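(* Let $0<q<1$, $r<0$, $0<c\le q^2$, $d\in\mathbb{R}$ with $|d|<1$ and $|c/d|<1$. Let $$c(y)=\frac{(c/dy,\,d/y,\,dry,\,q/dry;q)_\infty}{(y^{-2},\,c,\,r,\,q/r;q)_\infty},$$ and assume that the zeroes of $y\mapsto c(y)$ are simple and that $c(y)=0$ implies $c(y^{-1})\ne0$. Let $L$ be the doubly infinite Jacobi operator on $\ell^2(\mathbb{Z})$ defined on finite linear combinations of the standard orthonormal basis $\{e_k\}_{k\in\mathbb{Z}}$ by $$Le_k=a_ke_{k+1}+b_ke_k+a_{k-1}e_{k-1},\qquad a_k=\tfrac12\sqrt{\Bigl(1-\frac{q^{-k}}{r}\Bigr)\Bigl(1-\frac{cq^{-k}}{d^2r}\Bigr)},\qquad b_k=\frac{q^{-k}(c+q)}{2dr},$$ which is essentially self-adjoint. Then the spectral measure $E$ of (the self-adjoint closure of) $L$ is given, for $A\subset\mathbb{R}$ a Borel set and $u,v$ finite linear combinations of the $e_k$, by $$\langle E(A)u,v\rangle=\frac1{2\pi}\int_{\chi\in[0,\pi],\ \cos\chi\in A}(\mathcal{F}u)(\cos\chi)\overline{(\mathcal{F}v)(\cos\chi)}\,\frac{d\chi}{|c(e^{i\chi})|^2}$$ $$\qquad+\sum_{\substack{p\in\mathbb{Z},\ |q^p/dr|>1\\ \mu(q^p/dr)\in A}}\Bigl(\operatorname*{Res}_{y=q^p/dr}\frac{1}{c(y^{-1})c(y)y}\Bigr)(\mathcal{F}u)(\mu(q^p/dr))\,\overline{(\mathcal{F}v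)(\mu(q^p/dr))}.$$
   Context: Here $c$ without argument is the real parameter, $c(y)$ the function; $c/dy=c/(dy)$, $q/dry=q/(dry)$, $q^p/dr=q^p/(dr)$. $(x;q)_\infty=\prod_{k\ge0}(1-xq^k)$, $(x_1,\dots,x_m;q)_\infty=\prod_j(x_j;q)_\infty$; $\mu(y)=\frac12(y+y^{-1})$. For $k\in\mathbb{Z}$ let $$f_k(\mu(y))={}_2\varphi_1(dy,d/y;c;q,rq^k),\qquad w_k=d^k\left(\frac{(cq^{1-k}/d^2r;q)_\infty}{(q^{1-k}/r;q)_\infty}\right)^{1/2},$$ where ${}_2\varphi_1(\alpha,\beta;\gamma;q,z)=\sum_{n\ge0}\frac{(\alpha;q)_n(\beta;q)_n}{(q;q)_n(\gamma;q)_n}z^n$ for $|z|<1$, $(x;q)_n=\prod_{k=0}^{n-1}(1-xq^k)$, and its analytic continuation to $\mathbb{C}\setminus[1,\infty)$ otherwise. For a finitely supported $u=\sum_lu_le_l$, $$(\mathcal{F}u)(x)=\sum_{l\in\mathbb{Z}}w_lf_l(x)u_l.$$ The spectral measure $E$ of a self-adjoint operator $T$ is the projection-valued measure with $T=\int_{\mathbb{R}}t\,dE(t)$.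
   Formalization: "c(y)=0 implies c(1/y)≠0" is read as: c(1/y) is defined by the quotient (nonvanishing denominator) and nonzero; this excludes dr=±q^{j/2}, j an integer, where c(1/y) is 0/0 and the stated residues are twice the true masses. *)

theory Defs
  imports "HOL-Complex_Analysis.Complex_Analysis"
begin

section \<open>Basic hypergeometric functions\<close>

definition qpoch :: "'a::comm_ring_1 \<Rightarrow> 'a \<Rightarrow> nat \<Rightarrow> 'a" where
  "qpoch x q n = (\<Prod>k<n. 1 - x * q ^ k)"

definition qpoch_inf :: "'a::real_normed_field \<Rightarrow> 'a \<Rightarrow> 'a" where
  "qpoch_inf x q = (\<Prod>k. 1 - x * q ^ k)"

definition qpochs_inf :: "'a::real_normed_field list \<Rightarrow> 'a \<Rightarrow> 'a" where
  "qpochs_inf xs q = (\<Prod>x\<leftarrow>xs. qpoch_inf x q)"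

definition phi21_series :: "complex \<Rightarrow> complex \<Rightarrow> complex \<Rightarrow> complex \<Rightarrow> complex \<Rightarrow> complex" where
  "phi21_series \<alpha> \<beta> \<gamma> q z =
     (\<Sum>n. qpoch \<alpha> q n * qpoch \<beta> q n / (qpoch q q n * qpoch \<gamma> q n) * z ^ n)"

text \<open>Outside the unit disc this is the analytic continuation to the plane cut along
  \<open>[1, \<infinity>)\<close>; by the identity theorem the choice is unique off the cut.  On the cut the value
  is unspecified.\<close>

definition phi21 :: "complex \<Rightarrow> complex \<Rightarrow> complex \<Rightarrow> complex \<Rightarrow> complex \<Rightarrow> complex" where
  "phi21 \<alpha> \<beta> \<gamma> q z =
     (if norm z < 1 then phi21_series \<alpha> \<beta> \<gamma> q z
      else (SOME g. g holomorphic_on (- complex_of_real ` {1..}) \<and>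
                    (\<forall>w. norm w < 1 \<longrightarrow> g w = phi21_series \<alpha> \<beta> \<gamma> q w)) z)"

definition mu :: "'a::field \<Rightarrow> 'a" where
  "mu y = (y + inverse y) / 2"


section \<open>The functions attached to the Jacobi operator\<close>

text \<open>\<open>f\<^sub>k\<close> is a function of \<open>x = mu y\<close>.  The choice of \<open>y\<close> is immaterial: \<open>mu y = mu z\<close> only for
  \<open>z = y\<close> or \<open>z = 1/y\<close>, and swapping \<open>y\<close> and \<open>1/y\<close> swaps the two numerator parameters;
  see \<open>f_fun_mu\<close>.\<close>

definition f_fun :: "real \<Rightarrow> real \<Rightarrow> real \<Rightarrow> real \<Rightarrow> int \<Rightarrow> complex \<Rightarrow> complex" where
  "f_fun q r c d k x =
     (let y = (SOME y. y \<noteq> 0 \<and> mu y = x)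
      in phi21 (of_real d * y) (of_real d / y) (of_real c) (of_real q) (of_real (r * q powi k)))"

definition w_fun :: "real \<Rightarrow> real \<Rightarrow> real \<Rightarrow> real \<Rightarrow> int \<Rightarrow> real" where
  "w_fun q r c d k =
     d powi k * sqrt (qpoch_inf (c * q powi (1 - k) / (d\<^sup>2 * r)) q / qpoch_inf (q powi (1 - k) / r) q)"

text \<open>As a total function this takes the value \<open>0\<close> wherever the denominator
  vanishes, i.e. wherever \<open>y\<^sup>2 = q ^ k\<close> for some natural number \<open>k\<close>.  Hence its zeroes as a
  meromorphic function are described by \<open>isolated_zero\<close>, whereas \<open>c_fun q r c d y \<noteq> 0\<close> says that the
  quotient is defined at \<open>y\<close> and nonzero.\<close>

definition c_fun :: "real \<Rightarrow> real \<Rightarrow> real \<Rightarrow> real \<Rightarrow> complex \<Rightarrow> complex" where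
  "c_fun q r c d y =
     qpochs_inf [of_real c / (of_real d * y), of_real d / y,
                 of_real d * of_real r * y, of_real q / (of_real d * of_real r * y)] (of_real q) /
     qpochs_inf [y powi (-2), of_real c, of_real r, of_real q / of_real r] (of_real q)"

definition a_coeff :: "real \<Rightarrow> real \<Rightarrow> real \<Rightarrow> real \<Rightarrow> int \<Rightarrow> real" where
  "a_coeff q r c d k =
     1 / 2 * sqrt ((1 - q powi (-k) / r) * (1 - c * q powi (-k) / (d\<^sup>2 * r)))"

definition b_coeff :: "real \<Rightarrow> real \<Rightarrow> real \<Rightarrow> real \<Rightarrow> int \<Rightarrow> real" where
  "b_coeff q r c d k = q powi (-k) * (c + q) / (2 * d * r)"

lemma mu_eq_iff:
  fixes y z :: complex
  assumes "y \<noteq> 0" "z \<noteq> 0"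
  shows "mu y = mu z \<longleftrightarrow> y = z \<or> y = inverse z"
proof -
  have "mu y - mu z = (y - z) * (y * z - 1) / (2 * y * z)"
    using assms by (simp add: mu_def field_simps)
  then have "mu y = mu z \<longleftrightarrow> (y - z) * (y * z - 1) = 0"
    using assms by (metis (no_types, lifting) divide_eq_0_iff eq_iff_diff_eq_0 mult_eq_0_iff zero_neq_numeral)
  also have "\<dots> \<longleftrightarrow> y = z \<or> y = inverse z"
    using assms by (simp add: eq_iff_diff_eq_0[symmetric] divide_simps)
  finally show ?thesis .
qed

lemma f_fun_mu:
  assumes "y \<noteq> 0"
  shows "f_fun q r c d k (mu y) =
         phi21 (of_real d * y) (of_real d / y) (of_real c) (of_real q) (of_real (r * q powi k))"
proof -
  define z where "z = (SOME z. z \<noteq> 0 \<and> mu z = mu y)"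
  have z: "z \<noteq> 0 \<and> mu z = mu y"
    unfolding z_def by (rule someI[of _ y]) (use assms in auto)
  have sym: "phi21 u v g p s = phi21 v u g p s" for u v g p s
    by (simp add: phi21_def phi21_series_def mult.commute)
  from z assms mu_eq_iff[of z y] have "z = y \<or> z = inverse y" by auto
  then show ?thesis
  proof
    assume "z = inverse y"
    then show ?thesis
      using sym by (simp add: f_fun_def z_def[symmetric] Let_def field_simps)
  qed (simp add: f_fun_def z_def[symmetric] Let_def)
qed


section \<open>The Hilbert space of square-summable sequences on the integers\<close>

type_synonym zseq = "int \<Rightarrow> complex"

definition ell2 :: "zseq set" where
  "ell2 = {u. (\<lambda>k. (cmod (u k))\<^sup>2) summable_on UNIV}"

definition ip :: "zseq \<Rightarrow> zseq \<Rightarrow> complex" where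
  "ip u v = (\<Sum>\<^sub>\<infinity>k. u k * cnj (v k))"

definition ell2_norm :: "zseq \<Rightarrow> real" where
  "ell2_norm u = sqrt (\<Sum>\<^sub>\<infinity>k. (cmod (u k))\<^sup>2)"

definition basis_vec :: "int \<Rightarrow> zseq" where
  "basis_vec k = (\<lambda>j. if j = k then 1 else 0)"

definition finseq :: "zseq set" where
  "finseq = {u. finite {k. u k \<noteq> 0}}"


section \<open>Unbounded operators\<close>

text \<open>An unbounded operator is represented by its graph.\<close>

type_synonym op_graph = "(zseq \<times> zseq) set"

definition op_closure :: "op_graph \<Rightarrow> op_graph" where
  "op_closure T = {(u, v). u \<in> ell2 \<and> v \<in> ell2 \<and>
     (\<exists>s t. (\<forall>n::nat. (s n, t n) \<in> T) \<and>
            (\<lambda>n. ell2_norm (\<lambda>k. s n k - u k)) \<longlonglongrightarrow> 0 \<and>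
            (\<lambda>n. ell2_norm (\<lambda>k. t n k - v k)) \<longlonglongrightarrow> 0)}"

definition op_adjoint :: "op_graph \<Rightarrow> op_graph" where
  "op_adjoint T = {(v, w). v \<in> ell2 \<and> w \<in> ell2 \<and> (\<forall>(u, u') \<in> T. ip u' v = ip u w)}"

text \<open>Linearity of \<open>T\<close> follows from \<open>op_adjoint T = T\<close>, and density of the domain then follows
  from single-valuedness, since the vectors \<open>w\<close> with \<open>(0, w) \<in> op_adjoint T\<close> are exactly those
  orthogonal to the domain of \<open>T\<close>.\<close>

definition self_adjoint :: "op_graph \<Rightarrow> bool" where
  "self_adjoint T \<longleftrightarrow> single_valued T \<and> op_adjoint T = T"

definition essentially_self_adjoint :: "op_graph \<Rightarrow> bool" where
  "essentially_self_adjoint T \<longleftrightarrow> self_adjoint (op_closure T)"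


section \<open>Spectral measures\<close>

definition orth_projection :: "(zseq \<Rightarrow> zseq) \<Rightarrow> bool" where
  "orth_projection P \<longleftrightarrow>
     (\<forall>u\<in>ell2. P u \<in> ell2) \<and>
     (\<forall>u\<in>ell2. \<forall>v\<in>ell2. \<forall>\<alpha> \<beta>. P (\<lambda>k. \<alpha> * u k + \<beta> * v k) = (\<lambda>k. \<alpha> * P u k + \<beta> * P v k)) \<and>
     (\<forall>u\<in>ell2. P (P u) = P u) \<and>
     (\<forall>u\<in>ell2. \<forall>v\<in>ell2. ip (P u) v = ip u (P v))"

definition projection_valued_measure :: "(real set \<Rightarrow> zseq \<Rightarrow> zseq) \<Rightarrow> bool" where
  "projection_valued_measure E \<longleftrightarrow>
     (\<forall>A\<in>sets borel. orth_projection (E A)) \<and>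
     (\<forall>u\<in>ell2. E {} u = (\<lambda>k. 0)) \<and>
     (\<forall>u\<in>ell2. E UNIV u = u) \<and>
     (\<forall>A\<in>sets borel. \<forall>B\<in>sets borel. \<forall>u\<in>ell2. E (A \<inter> B) u = E A (E B u)) \<and>
     (\<forall>F :: nat \<Rightarrow> real set. range F \<subseteq> sets borel \<longrightarrow> disjoint_family F \<longrightarrow>
        (\<forall>u\<in>ell2. (\<lambda>n. ell2_norm (\<lambda>k. (\<Sum>i<n. E (F i) u k) - E (\<Union>i. F i) u k)) \<longlonglongrightarrow> 0))"

definition scalar_measure :: "(real set \<Rightarrow> zseq \<Rightarrow> zseq) \<Rightarrow> zseq \<Rightarrow> real measure" where
  "scalar_measure E u = measure_of UNIV (sets borel) (\<lambda>A. ennreal (Re (ip (E A u) u)))"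

text \<open>\<open>T = \<integral> t dE(t)\<close>: the domain of \<open>T\<close> consists of the vectors \<open>u\<close> with
  \<open>\<integral> t\<^sup>2 d\<langle>E(t)u, u\<rangle> < \<infinity>\<close>, and \<open>\<langle>Tu, u\<rangle> = \<integral> t d\<langle>E(t)u, u\<rangle>\<close> on this domain, which determines
  \<open>T\<close> by polarisation.\<close>

definition is_spectral_measure :: "(real set \<Rightarrow> zseq \<Rightarrow> zseq) \<Rightarrow> op_graph \<Rightarrow> bool" where
  "is_spectral_measure E T \<longleftrightarrow>
     projection_valued_measure E \<and>
     Domain T = {u \<in> ell2. (\<integral>\<^sup>+ t. ennreal (t\<^sup>2) \<partial>scalar_measure E u) < \<infinity>} \<and>
     (\<forall>(u, u') \<in> T. ip u' u = complex_of_real (\<integral>t. t \<partial>scalar_measure E u))"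


section \<open>The Jacobi operator and its transform\<close>

text \<open>The linear extension of \<open>e\<^sub>k \<mapsto> a\<^sub>k e\<^sub>k\<^sub>+\<^sub>1 + b\<^sub>k e\<^sub>k + a\<^sub>k\<^sub>-\<^sub>1 e\<^sub>k\<^sub>-\<^sub>1\<close> to finite linear
  combinations.\<close>

definition jacobi_op :: "(int \<Rightarrow> real) \<Rightarrow> (int \<Rightarrow> real) \<Rightarrow> zseq \<Rightarrow> zseq" where
  "jacobi_op a b u = (\<lambda>j. \<Sum>k | u k \<noteq> 0. u k *
     (of_real (a k) * basis_vec (k + 1) j + of_real (b k) * basis_vec k j
        + of_real (a (k - 1)) * basis_vec (k - 1) j))"

definition L_graph :: "real \<Rightarrow> real \<Rightarrow> real \<Rightarrow> real \<Rightarrow> op_graph" where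
  "L_graph q r c d = {(u, jacobi_op (a_coeff q r c d) (b_coeff q r c d) u) | u. u \<in> finseq}"

definition F_transform :: "real \<Rightarrow> real \<Rightarrow> real \<Rightarrow> real \<Rightarrow> zseq \<Rightarrow> complex \<Rightarrow> complex" where
  "F_transform q r c d u x =
     (\<Sum>l | u l \<noteq> 0. of_real (w_fun q r c d l) * f_fun q r c d l x * u l)"

end

theory Submission
  imports Defs
begin

text \<open>The functions \<open>\<Phi>\<^sub>k(x) = w\<^sub>k f\<^sub>k(x)\<close> solve the recurrence of \<open>L\<close> and decay geometrically as \<open>k \<rightarrow> \<infinity>\<close>.
  As \<open>k \<rightarrow> -\<infinity>\<close> the coefficients tend to those of the free Jacobi operator, and there is a Jost solution
  \<open>\<Psi>\<^sub>k(y) \<sim> y\<^sup>k\<close> with eigenvalue \<open>\<mu>(y)\<close>.  Ramanujan's \<open>\<^sub>1\<psi>\<^sub>1\<close> sum gives the asymptotics of \<open>\<Phi>\<close>, hence the Wronskian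
  \<open>D(y) = c(y) (y\<^sup>-\<^sup>1 - y) / 2\<close> of \<open>\<Phi>\<close> and \<open>\<Psi>\<close> and the connection formula
  \<open>\<Phi>\<^sub>k(\<mu>(y)) = c(y\<^sup>-\<^sup>1) \<Psi>\<^sub>k(y) + c(y) \<Psi>\<^sub>k(y\<^sup>-\<^sup>1)\<close>.

  Let \<open>E\<close> be the spectral measure.  On a short interval around \<open>l\<close> every vector \<open>E(G)e\<^sub>k\<close> is nearly an eigenvector
  with eigenvalue \<open>l\<close>, hence nearly proportional to \<open>\<Phi>\<^sub>k(l)\<close>; therefore \<open>d\<langle>E u, u\<rangle> = |\<F>u|\<^sup>2 d\<sigma>\<close> with one measure \<open>\<sigma>\<close>.
  Outside \<open>[-1, 1]\<close> the functions \<open>\<Phi>\<^sub>k\<close> grow exponentially as \<open>k \<rightarrow> -\<infinity>\<close> unless \<open>D\<close> vanishes, although all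
  \<open>|\<Phi>\<^sub>k|\<^sup>2 \<sigma>\<close> have mass one, so \<open>\<sigma>\<close> lives on the zeros of \<open>D\<close>; the mass there is \<open>1 / \<parallel>\<Phi>\<parallel>\<^sup>2\<close>, which
  differentiating the Wronskian turns into the residue.  At \<open>\<plusminus>1\<close> there is no eigenvector.  Inside \<open>(-1, 1)\<close>, the
  form \<open>\<Phi>\<^sub>k\<^sup>2 + \<Phi>\<^sub>k\<^sub>-\<^sub>1\<^sup>2 - 2x\<Phi>\<^sub>k\<Phi>\<^sub>k\<^sub>-\<^sub>1\<close> tends to \<open>4 (1 - x\<^sup>2) |c(y)|\<^sup>2\<close> at \<open>x = \<mu>(y)\<close>, while its moments against \<open>\<sigma>\<close> tend to
  those of the free operator; this determines \<open>\<sigma>\<close> there.\<close>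

section \<open>Basic hypergeometric series\<close>

text \<open>No resolvent is inverted. Of \<open>E\<close> only the domain condition and the
  quadratic form are known, so it has to be shown first that \<open>J\<close> commutes with the
  projections \<open>E G\<close> and is close to a scalar on their ranges over short intervals. From
  then on every limit is a limit of measures on the line.

  The balance at +infinity comes from \<open>c \<le> q\<^sup>2\<close>: successive weights have
  ratio tending to \<open>sqrt c\<close> in modulus, so \<open>Phi k\<close> is of order
  \<open>q ^ k\<close> at most, while \<open>a k\<close> grows like \<open>q powi (- k)\<close>. The
  products remain bounded but need not tend to zero. This suffices for Green's formula against
  square-summable sequences, and no more.

  Two definitions cannot be used directly. Beyond the unit disc \<open>phi21\<close> is a choice
  among continuations; Heine's transformation gives an explicit one on the slit plane, which
  contains every argument \<open>r * q powi k\<close> because \<open>r < 0\<close>. And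
  \<open>f_fun\<close> chooses a preimage \<open>y\<close> of \<open>x\<close>; coefficients that
  are polynomials in \<open>x\<close> show that \<open>Phi k\<close> is entire.

  The Jost solution is a convergent series only for indices up to some \<open>K0 \<le> 0\<close>.
  What is proved with it far to the left is carried to the other indices by the recurrence.\<close>

lemma holomorphic_suminf:
 fixes f :: "nat \<Rightarrow> complex \<Rightarrow> complex"
 assumes S: "open S" and hol: "\<And>n. f n holomorphic_on S"
  and bound: "\<And>x. x \<in> S \<Longrightarrow>
   \<exists>d M. 0 < d \<and> cball x d \<subseteq> S \<and> summable M \<and> (\<forall>y\<in>cball x d. \<forall>n. norm (f n y) \<le> M n)"
 shows "(\<lambda>y. \<Sum>n. f n y) holomorphic_on S"
proof (rule holomorphic_uniform_sequence[OF S])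
 show "(\<lambda>y. \<Sum>i<n. f i y) holomorphic_on S" for n by (intro holomorphic_intros hol)
 fix x assume "x \<in> S"
 then obtain d M where "0 < d" "cball x d \<subseteq> S" and M: "summable M"
  "\<And>y n. y \<in> cball x d \<Longrightarrow> norm (f n y) \<le> M n" using bound by meson
 moreover have "uniform_limit (cball x d) (\<lambda>n y. \<Sum>i<n. f i y) (\<lambda>y. \<Sum>n. f n y) sequentially"
  by (rule Weierstrass_m_test) (use M in auto)
 ultimately show "\<exists>d>0. cball x d \<subseteq> S \<and>
   uniform_limit (cball x d) (\<lambda>n y. \<Sum>i<n. f i y) (\<lambda>y. \<Sum>n. f n y) sequentially" by blast
qed

section \<open>q-shifted factorials and infinite products\<close>

lemma qpoch_0 [simp]: "qpoch x q 0 = 1" by (simp add: qpoch_def)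

lemma qpoch_Suc: "qpoch x q (Suc n) = qpoch x q n * (1 - x * q ^ n)" by (simp add: qpoch_def)

lemma qpoch_Suc': "qpoch x q (Suc n) = (1 - x) * qpoch (x * q) q n"
 unfolding qpoch_def by (subst prod.lessThan_Suc_shift) (simp add: mult_ac)

lemma sums_drop_first:
 fixes f :: "nat \<Rightarrow> 'a::real_normed_vector"
 shows "f sums s \<Longrightarrow> (\<lambda>n. f (Suc n)) sums (s - f 0)" by (simp add: sums_Suc_iff)

locale q_base =
 fixes q :: complex
 assumes norm_q: "norm q < 1"
begin

lemma norm_qpow_le: "norm (q ^ n) \<le> 1" using norm_q by (simp add: norm_power power_le_one)

lemma abs_convergent_qpoch: "abs_convergent_prod (\<lambda>k. 1 - x * q ^ k)"
 using norm_q by (simp add: abs_convergent_prod_conv_summable norm_mult norm_power summable_mult)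

lemma qpoch_LIMSEQ: "(\<lambda>n. qpoch x q n) \<longlonglongrightarrow> qpoch_inf x q"
proof -
 have "(\<lambda>n. \<Prod>i\<le>n. 1 - x * q ^ i) \<longlonglongrightarrow> qpoch_inf x q" unfolding qpoch_inf_def
  by (intro convergent_prod_LIMSEQ abs_convergent_prod_imp_convergent_prod abs_convergent_qpoch)
 then have "(\<lambda>n. qpoch x q (Suc n)) \<longlonglongrightarrow> qpoch_inf x q" by (simp add: qpoch_def lessThan_Suc_atMost)
 then show ?thesis by (rule LIMSEQ_imp_Suc)
qed

lemma qpoch_inf_rec: "qpoch_inf x q = (1 - x) * qpoch_inf (x * q) q"
proof (rule LIMSEQ_unique)
 show "(\<lambda>n. qpoch x q (Suc n)) \<longlonglongrightarrow> qpoch_inf x q" by (rule LIMSEQ_Suc[OF qpoch_LIMSEQ])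
 show "(\<lambda>n. qpoch x q (Suc n)) \<longlonglongrightarrow> (1 - x) * qpoch_inf (x * q) q"
  unfolding qpoch_Suc' by (intro tendsto_intros qpoch_LIMSEQ)
qed

lemma qpoch_inf_split: "qpoch_inf x q = qpoch x q n * qpoch_inf (x * q ^ n) q"
proof (induction n)
 case (Suc n)
 then show ?case using qpoch_inf_rec[of "x * q ^ n"] by (simp add: qpoch_Suc mult_ac)
qed simp

lemma qpoch_inf_zero [simp]: "qpoch_inf 0 q = 1" by (simp add: qpoch_inf_def)

text \<open>The zeros can be located exactly because an absolutely convergent product vanishes only
  through one of its factors.\<close>

lemma qpoch_inf_eq_0_iff: "qpoch_inf x q = 0 \<longleftrightarrow> (\<exists>n. x * q ^ n = 1)"
proof
 assume 0: "qpoch_inf x q = 0"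
 have "(\<lambda>k. 1 - x * q ^ k) has_prod qpoch_inf x q" unfolding qpoch_inf_def
  by (intro convergent_prod_has_prod abs_convergent_prod_imp_convergent_prod abs_convergent_qpoch)
 then have "(\<lambda>k. 1 - x * q ^ k) has_prod 0" by (simp only: 0)
 then obtain n where "1 - x * q ^ n = 0" using has_prod_0_iff[THEN iffD1] by blast
 then show "\<exists>n. x * q ^ n = 1" by (intro exI[of _ n]) simp
next
 assume "\<exists>n. x * q ^ n = 1"
 then obtain n where "x * q ^ n = 1" by blast
 then have "qpoch x q (Suc n) = 0" by (simp add: qpoch_Suc)
 then show "qpoch_inf x q = 0" using qpoch_inf_split[of x "Suc n"] by simp
qed

lemma qpoch_inf_nonzero: "norm x < 1 \<Longrightarrow> qpoch_inf x q \<noteq> 0"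
proof
 assume x: "norm x < 1" and "qpoch_inf x q = 0"
 then obtain n where "x * q ^ n = 1" by (auto simp: qpoch_inf_eq_0_iff)
 then have "norm x * norm (q ^ n) = 1" by (metis norm_mult norm_one)
 moreover have "norm x * norm (q ^ n) \<le> norm x * 1" by (intro mult_left_mono norm_qpow_le) auto
 ultimately show False using x by simp
qed

lemma qpoch_nonzero: "qpoch_inf x q \<noteq> 0 \<Longrightarrow> qpoch x q n \<noteq> 0" using qpoch_inf_split[of x n] by auto

text \<open>From \<open>1 + t \<le> exp t\<close> and the geometric series. The bound is independent
  of \<open>n\<close>, so it passes to the infinite product and feeds the majorants below.\<close>

lemma norm_qpoch_le: "norm (qpoch x q n) \<le> exp (norm x / (1 - norm q))"
proof -
 have "norm (qpoch x q n) = (\<Prod>k<n. norm (1 - x * q ^ k))" by (simp add: qpoch_def prod_norm)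
 also have "\<dots> \<le> (\<Prod>k<n. 1 + norm x * norm q ^ k)"
  by (intro prod_mono conjI) (auto intro: order_trans[OF norm_triangle_ineq4] simp: norm_mult norm_power)
 also have "\<dots> \<le> exp (\<Sum>k<n. norm x * norm q ^ k)" by (rule prod_le_exp_sum) auto
 also have "(\<Sum>k<n. norm x * norm q ^ k) \<le> norm x / (1 - norm q)"
 proof -
  have "(\<Sum>k<n. norm q ^ k) \<le> (\<Sum>k. norm q ^ k)" by (rule sum_le_suminf) (use norm_q in auto)
  also have "\<dots> = 1 / (1 - norm q)" using norm_q by (simp add: suminf_geometric)
  finally have "norm x * (\<Sum>k<n. norm q ^ k) \<le> norm x * (1 / (1 - norm q))" by (intro mult_left_mono) auto
  then show ?thesis by (simp add: sum_distrib_left)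
 qed
 finally show ?thesis by simp
qed

lemma norm_qpoch_inf_le: "norm (qpoch_inf x q) \<le> exp (norm x / (1 - norm q))"
 by (rule LIMSEQ_le_const2[OF tendsto_norm[OF qpoch_LIMSEQ]]) (use norm_qpoch_le in auto)

text \<open>The partial products are rewritten as a telescoping series whose terms decay
  geometrically on discs; this brings the infinite product under
  \<open>holomorphic_suminf\<close>.\<close>

lemma holomorphic_qpoch_inf: "(\<lambda>x. qpoch_inf x q) holomorphic_on A"
proof -
 have "(\<lambda>x. \<Sum>n. - qpoch x q n * (x * q ^ n)) holomorphic_on UNIV"
 proof (rule holomorphic_suminf)
  show "(\<lambda>x. - qpoch x q n * (x * q ^ n)) holomorphic_on UNIV" for n unfolding qpoch_def by (intro holomorphic_intros)
  fix x :: complex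
  define R where "R = norm x + 1"
  have bd: "norm (- qpoch y q n * (y * q ^ n)) \<le> exp (R / (1 - norm q)) * (R * norm q ^ n)"
   if "y \<in> cball x 1" for y n
  proof -
   have y: "norm y \<le> R" using that norm_triangle_ineq2[of y x] by (simp add: R_def dist_norm norm_minus_commute)
   have "norm (qpoch y q n) \<le> exp (R / (1 - norm q))"
    by (rule order_trans[OF norm_qpoch_le]) (use y norm_q in \<open>simp add: divide_right_mono\<close>)
   then show ?thesis unfolding norm_mult norm_minus_cancel norm_power
    by (intro mult_mono) (use y in \<open>auto intro: order_trans[OF norm_ge_zero]\<close>)
  qed
  have "summable (\<lambda>n. exp (R / (1 - norm q)) * (R * norm q ^ n))" using norm_q by (intro summable_mult summable_geometric) auto
  then show "\<exists>d M. 0 < d \<and> cball x d \<subseteq> UNIV \<and> summable M \<and>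
    (\<forall>y\<in>cball x d. \<forall>n. norm (- qpoch y q n * (y * q ^ n)) \<le> M n)"
   using bd by (intro exI[of _ 1] exI[of _ "\<lambda>n. exp (R / (1 - norm q)) * (R * norm q ^ n)"]) auto
 qed auto
 moreover have "qpoch_inf x q = 1 + (\<Sum>n. - qpoch x q n * (x * q ^ n))" for x
 proof -
  have "(\<lambda>n. qpoch x q (Suc n) - qpoch x q n) sums (qpoch_inf x q - qpoch x q 0)" by (rule telescope_sums[OF qpoch_LIMSEQ])
  then have "(\<lambda>n. - qpoch x q n * (x * q ^ n)) sums (qpoch_inf x q - 1)" by (simp add: qpoch_Suc algebra_simps)
  then show ?thesis by (simp add: sums_iff)
 qed
 ultimately have "(\<lambda>x. qpoch_inf x q) holomorphic_on UNIV" by (simp add: holomorphic_on_add)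
 then show ?thesis by (rule holomorphic_on_subset) auto
qed

lemma holomorphic_qpoch_inf' [holomorphic_intros]:
 "f holomorphic_on A \<Longrightarrow> (\<lambda>x. qpoch_inf (f x) q) holomorphic_on A"
 using holomorphic_on_compose[OF _ holomorphic_qpoch_inf] by (simp add: o_def)

lemma continuous_qpoch_inf [continuous_intros]:
 "continuous_on A f \<Longrightarrow> continuous_on A (\<lambda>x. qpoch_inf (f x) q)"
 using continuous_on_compose2[OF holomorphic_on_imp_continuous_on[OF holomorphic_qpoch_inf[of UNIV]]] by blast

lemma tendsto_qpoch_inf [tendsto_intros]:
 "(f \<longlongrightarrow> x) F \<Longrightarrow> ((\<lambda>z. qpoch_inf (f z) q) \<longlongrightarrow> qpoch_inf x q) F"
 using continuous_qpoch_inf[of UNIV "\<lambda>x. x"] continuous_on_tendsto_compose by fastforce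

section \<open>Coefficients of the series and its q-difference equation\<close>

definition phi_coeff :: "complex \<Rightarrow> complex \<Rightarrow> complex \<Rightarrow> nat \<Rightarrow> complex" where
 "phi_coeff a b c n = qpoch a q n * qpoch b q n / (qpoch q q n * qpoch c q n)"

text \<open>The two numerator factors give exponentials directly. Each reciprocal denominator is a
  tail of the infinite product divided by the whole product, which gives the other two exponentials
  and the quotient. The expression is continuous in the parameters where it is defined, hence
  bounded on compact sets.\<close>

definition phi_bound :: "complex \<Rightarrow> complex \<Rightarrow> complex \<Rightarrow> real" where
 "phi_bound a b c = exp ((norm a + norm b + norm c + norm q) / (1 - norm q))
   / (norm (qpoch_inf q q) * norm (qpoch_inf c q))"

lemma qpoch_q_nonzero: "qpoch_inf q q \<noteq> 0" using norm_q by (rule qpoch_inf_nonzero)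

lemma inverse_qpoch_bound:
 assumes "qpoch_inf c q \<noteq> 0"
 shows "norm (inverse (qpoch c q n)) \<le> exp (norm c / (1 - norm q)) / norm (qpoch_inf c q)"
proof -
 have "inverse (qpoch c q n) = qpoch_inf (c * q ^ n) q / qpoch_inf c q"
  using qpoch_inf_split[of c n] assms qpoch_nonzero[OF assms] by (simp add: field_simps)
 moreover have "norm (qpoch_inf (c * q ^ n) q) \<le> exp (norm c / (1 - norm q))"
 proof (rule order_trans[OF norm_qpoch_inf_le])
  have "norm (c * q ^ n) \<le> norm c" using mult_left_mono[OF norm_qpow_le, of "norm c" n] by (simp add: norm_mult)
  then show "exp (norm (c * q ^ n) / (1 - norm q)) \<le> exp (norm c / (1 - norm q))" using norm_q by (simp add: divide_right_mono)
 qed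
 ultimately show ?thesis by (simp add: norm_divide divide_right_mono)
qed

lemma norm_phi_coeff_le:
 assumes "qpoch_inf c q \<noteq> 0"
 shows "norm (phi_coeff a b c n) \<le> phi_bound a b c"
proof -
 have "phi_coeff a b c n = qpoch a q n * qpoch b q n * (inverse (qpoch q q n) * inverse (qpoch c q n))"
  by (simp add: phi_coeff_def field_simps)
 then have "norm (phi_coeff a b c n) =
   norm (qpoch a q n) * norm (qpoch b q n) * (norm (inverse (qpoch q q n)) * norm (inverse (qpoch c q n)))" by (simp only: norm_mult)
 also have "\<dots> \<le> exp (norm a / (1 - norm q)) * exp (norm b / (1 - norm q)) *
   (exp (norm q / (1 - norm q)) / norm (qpoch_inf q q) * (exp (norm c / (1 - norm q)) / norm (qpoch_inf c q)))"
  by (intro mult_mono norm_qpoch_le inverse_qpoch_bound assms qpoch_q_nonzero)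
   (auto intro!: mult_nonneg_nonneg)
 also have "\<dots> = phi_bound a b c" by (simp add: phi_bound_def exp_add add_divide_distrib)
 finally show ?thesis .
qed

lemma phi_bound_nonneg: "0 \<le> phi_bound a b c" by (simp add: phi_bound_def)

lemma phi_coeff_0 [simp]: "phi_coeff a b c 0 = 1" by (simp add: phi_coeff_def)

lemma phi_coeff_Suc:
 assumes "qpoch_inf c q \<noteq> 0"
 shows "phi_coeff a b c (Suc n) * ((1 - q * q ^ n) * (1 - c * q ^ n))
  = phi_coeff a b c n * ((1 - a * q ^ n) * (1 - b * q ^ n))"
proof -
 have "qpoch c q (Suc n) \<noteq> 0" "qpoch q q (Suc n) \<noteq> 0" using qpoch_nonzero assms qpoch_q_nonzero by blast+
 then have "1 - q * q ^ n \<noteq> 0" "1 - c * q ^ n \<noteq> 0" by (auto simp: qpoch_Suc)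
 moreover have "phi_coeff a b c (Suc n) = phi_coeff a b c n * ((1 - a * q ^ n) * (1 - b * q ^ n))
   / ((1 - q * q ^ n) * (1 - c * q ^ n))" by (simp add: phi_coeff_def qpoch_Suc mult_ac)
 ultimately show ?thesis by simp
qed

lemma phi21_series_sums:
 assumes "qpoch_inf c q \<noteq> 0" "norm z < 1"
 shows "(\<lambda>n. phi_coeff a b c n * z ^ n) sums phi21_series a b c q z"
  and "summable (\<lambda>n. norm (phi_coeff a b c n * z ^ n))"
proof -
 show "summable (\<lambda>n. norm (phi_coeff a b c n * z ^ n))"
 proof (rule summable_comparison_test')
  show "summable (\<lambda>n. phi_bound a b c * norm z ^ n)" using assms by (intro summable_mult summable_geometric) auto
  show "norm (norm (phi_coeff a b c n * z ^ n)) \<le> phi_bound a b c * norm z ^ n" for n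
   using norm_phi_coeff_le[OF assms(1)] by (simp add: norm_mult norm_power mult_right_mono)
 qed
 then show "(\<lambda>n. phi_coeff a b c n * z ^ n) sums phi21_series a b c q z"
  using summable_sums[OF summable_norm_cancel] by (simp add: phi21_series_def phi_coeff_def)
qed

lemma phi21_series_near_1:
 assumes "qpoch_inf c q \<noteq> 0" "norm z < 1"
 shows "norm (phi21_series a b c q z - 1) \<le> phi_bound a b c * norm z / (1 - norm z)"
proof -
 have s: "(\<lambda>n. phi_coeff a b c (Suc n) * z ^ Suc n) sums (phi21_series a b c q z - 1)"
  using sums_drop_first[OF phi21_series_sums(1)[OF assms]] by simp
 have g: "(\<lambda>n. phi_bound a b c * norm z * norm z ^ n) sums (phi_bound a b c * norm z * (1 / (1 - norm z)))"
  using assms by (intro sums_mult geometric_sums) auto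
 have b: "norm (phi_coeff a b c (Suc n) * z ^ Suc n) \<le> phi_bound a b c * norm z * norm z ^ n" for n
  using mult_right_mono[OF norm_phi_coeff_le[OF assms(1)], of "norm z * norm z ^ n"] by (simp add: norm_mult norm_power mult.assoc)
 have "norm (\<Sum>n. phi_coeff a b c (Suc n) * z ^ Suc n) \<le> (\<Sum>n. phi_bound a b c * norm z * norm z ^ n)"
  using b g by (intro norm_suminf_le) (auto simp: sums_iff)
 then show ?thesis using s g by (simp add: sums_iff)
qed

text \<open>This is the recursion \<open>phi_coeff_Suc\<close> for the coefficients: every factor
  \<open>q ^ n\<close> in it becomes a dilation of \<open>z\<close> by \<open>q\<close>, and the
  products of two such factors produce the argument \<open>q^2 * z\<close>.\<close>

lemma phi21_series_q_difference:
 assumes c: "qpoch_inf c q \<noteq> 0" and z: "norm z < 1"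
 shows "(1 - z) * phi21_series a b c q z * q - (q + c - q * z * (a + b)) * phi21_series a b c q (q * z)
  + (c - q * a * b * z) * phi21_series a b c q (q^2 * z) = 0"
proof -
 define u where "u = phi_coeff a b c"
 have "norm (q * w) < 1" if "norm w < 1" for w using mult_left_le_one_le[of "norm w" "norm q"] norm_q that by (simp add: norm_mult)
 from this[OF z] this[OF this[OF z]]
 have qz: "norm (q * z) < 1" "norm (q^2 * z) < 1" by (simp_all add: power2_eq_square mult.assoc)
 have s: "(\<lambda>n. u n * z ^ n) sums phi21_series a b c q z"
  "(\<lambda>n. u n * (q * z) ^ n) sums phi21_series a b c q (q * z)"
  "(\<lambda>n. u n * (q^2 * z) ^ n) sums phi21_series a b c q (q^2 * z)" unfolding u_def by (intro phi21_series_sums c z qz)+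
 have "(\<lambda>n. q * (u n * z ^ n) - (q + c) * (u n * (q * z) ^ n) + c * (u n * (q^2 * z) ^ n)) sums
   (q * phi21_series a b c q z - (q + c) * phi21_series a b c q (q * z) + c * phi21_series a b c q (q^2 * z))"
  by (intro sums_add sums_diff sums_mult s)
 then have l: "(\<lambda>n. q * (u (Suc n) * z ^ Suc n) - (q + c) * (u (Suc n) * (q * z) ^ Suc n) + c * (u (Suc n) * (q^2 * z) ^ Suc n)) sums
   (q * phi21_series a b c q z - (q + c) * phi21_series a b c q (q * z) + c * phi21_series a b c q (q^2 * z))"
  by (drule_tac sums_drop_first) (simp add: u_def)
 have r: "(\<lambda>n. q * z * (u n * z ^ n - (a + b) * (u n * (q * z) ^ n) + a * b * (u n * (q^2 * z) ^ n))) sums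
   (q * z * (phi21_series a b c q z - (a + b) * phi21_series a b c q (q * z) + a * b * phi21_series a b c q (q^2 * z)))"
  by (intro sums_add sums_diff sums_mult s)
 have "q * (u (Suc n) * z ^ Suc n) - (q + c) * (u (Suc n) * (q * z) ^ Suc n) + c * (u (Suc n) * (q^2 * z) ^ Suc n)
   = q * z * (u n * z ^ n - (a + b) * (u n * (q * z) ^ n) + a * b * (u n * (q^2 * z) ^ n))" for n
 proof -
  have "q * (u (Suc n) * z ^ Suc n) - (q + c) * (u (Suc n) * (q * z) ^ Suc n) + c * (u (Suc n) * (q^2 * z) ^ Suc n)
    = q * z ^ Suc n * (u (Suc n) * ((1 - q * q ^ n) * (1 - c * q ^ n)))" by (simp add: power_mult_distrib power2_eq_square algebra_simps)
  also have "\<dots> = q * z ^ Suc n * (u n * ((1 - a * q ^ n) * (1 - b * q ^ n)))" unfolding u_def by (subst phi_coeff_Suc[OF c]) simp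
  also have "\<dots> = q * z * (u n * z ^ n - (a + b) * (u n * (q * z) ^ n) + a * b * (u n * (q^2 * z) ^ n))"
   by (simp add: power_mult_distrib power2_eq_square algebra_simps)
  finally show ?thesis .
 qed
 then have "q * phi21_series a b c q z - (q + c) * phi21_series a b c q (q * z) + c * phi21_series a b c q (q^2 * z)
   = q * z * (phi21_series a b c q z - (a + b) * phi21_series a b c q (q * z) + a * b * phi21_series a b c q (q^2 * z))"
  using l r sums_unique2 by (simp only:)
 then show ?thesis by (simp add: algebra_simps)
qed

lemma holomorphic_phi21_series_params:
 assumes S: "open S" and hol: "a holomorphic_on S" "b holomorphic_on S" "c holomorphic_on S"
  and c: "\<And>y. y \<in> S \<Longrightarrow> qpoch_inf (c y) q \<noteq> 0" and z: "norm z < 1"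
 shows "(\<lambda>y. phi21_series (a y) (b y) (c y) q z) holomorphic_on S"
proof -
 have "(\<lambda>y. \<Sum>n. phi_coeff (a y) (b y) (c y) n * z ^ n) holomorphic_on S"
 proof (rule holomorphic_suminf[OF S])
  show "(\<lambda>y. phi_coeff (a y) (b y) (c y) n * z ^ n) holomorphic_on S" for n unfolding phi_coeff_def qpoch_def
   using qpoch_nonzero[OF c, of _ n] qpoch_nonzero[OF qpoch_q_nonzero, of n] by (intro holomorphic_intros hol) (auto simp: qpoch_def)
  fix x assume "x \<in> S"
  then obtain d where d: "d > 0" "cball x d \<subseteq> S" using S open_contains_cball by blast
  have cont: "continuous_on (cball x d) a" "continuous_on (cball x d) b" "continuous_on (cball x d) c"
   using hol d holomorphic_on_imp_continuous_on continuous_on_subset by blast+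
  have "continuous_on (cball x d) (\<lambda>y. phi_bound (a y) (b y) (c y))" unfolding phi_bound_def using norm_q c d(2) qpoch_q_nonzero
   by (intro continuous_intros cont) auto
  then have "bounded ((\<lambda>y. phi_bound (a y) (b y) (c y)) ` cball x d)" by (intro compact_imp_bounded compact_continuous_image) auto
  then obtain B where "\<forall>t\<in>(\<lambda>y. phi_bound (a y) (b y) (c y)) ` cball x d. norm t \<le> B"
   unfolding bounded_iff by blast
  then have B: "phi_bound (a y) (b y) (c y) \<le> B" if "y \<in> cball x d" for y using that by (auto intro: order_trans[OF abs_ge_self])
  have "norm (phi_coeff (a y) (b y) (c y) n * z ^ n) \<le> B * norm z ^ n" if "y \<in> cball x d" for y n
   using order_trans[OF norm_phi_coeff_le B[OF that]] c d(2) that by (auto simp: norm_mult norm_power intro!: mult_right_mono)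
  moreover have "summable (\<lambda>n. B * norm z ^ n)" using z by (intro summable_mult summable_geometric) auto
  ultimately show "\<exists>d M. 0 < d \<and> cball x d \<subseteq> S \<and> summable M \<and>
    (\<forall>y\<in>cball x d. \<forall>n. norm (phi_coeff (a y) (b y) (c y) n * z ^ n) \<le> M n)" using d by blast
 qed
 then show ?thesis by (simp add: phi21_series_def phi_coeff_def)
qed

text \<open>The sum \<open>h\<close> satisfies
  \<open>(1 - w) * h w = (1 - a * w) * h (w * q)\<close>. Iterating this towards the origin, where
  \<open>h\<close> has the value 1, builds up the quotient of products.\<close>

lemma q_binomial:
 assumes z: "norm z < 1"
 shows "(\<lambda>n. qpoch a q n / qpoch q q n * z ^ n) sums (qpoch_inf (a * z) q / qpoch_inf z q)"
proof -
 define u where "u n = qpoch a q n / qpoch q q n" for n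
 define h where "h z = phi21_series a 0 0 q z" for z
 have u: "u n = phi_coeff a 0 0 n" for n by (simp add: u_def phi_coeff_def qpoch_def)
 have s: "(\<lambda>n. u n * w ^ n) sums h w" if "norm w < 1" for w unfolding u h_def using phi21_series_sums(1)[of 0] that by simp
 have nq: "norm (q * w) < 1" if "norm w < 1" for w using mult_mono[of "norm q" 1 "norm w" "norm w"] norm_q that by (simp add: norm_mult)
 have rec: "(1 - w) * h w = (1 - a * w) * h (w * q)" if w: "norm w < 1" for w
 proof -
  have "(\<lambda>n. u n * w ^ n - u n * (q * w) ^ n) sums (h w - h (q * w))" by (intro sums_diff s w nq)
  then have l: "(\<lambda>n. u (Suc n) * w ^ Suc n - u (Suc n) * (q * w) ^ Suc n) sums (h w - h (q * w))"
   by (drule_tac sums_drop_first) simp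
  have r: "(\<lambda>n. w * (u n * w ^ n - a * (u n * (q * w) ^ n))) sums (w * (h w - a * h (q * w)))"
   by (intro sums_diff sums_mult s w nq)
  have "u (Suc n) * w ^ Suc n - u (Suc n) * (q * w) ^ Suc n = w * (u n * w ^ n - a * (u n * (q * w) ^ n))" for n
  proof -
   have "qpoch q q (Suc n) \<noteq> 0" using qpoch_nonzero[OF qpoch_q_nonzero] .
   then have "u (Suc n) * (1 - q * q ^ n) = u n * (1 - a * q ^ n)" by (simp add: u_def qpoch_Suc)
   then have "w ^ Suc n * (u (Suc n) * (1 - q * q ^ n)) = w ^ Suc n * (u n * (1 - a * q ^ n))" by simp
   then show ?thesis by (simp add: power_mult_distrib algebra_simps)
  qed
  then have "h w - h (q * w) = w * (h w - a * h (q * w))" using l r sums_unique2 by (simp only:)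
  then show ?thesis by (simp add: algebra_simps)
 qed
 have nz: "norm (z * q ^ n) < 1" for n using mult_left_mono[OF norm_qpow_le, of "norm z" n] z by (simp add: norm_mult)
 have iter: "qpoch z q n * h z = qpoch (a * z) q n * h (z * q ^ n)" for n
 proof (induction n)
  case (Suc n)
  have "qpoch z q (Suc n) * h z = (1 - z * q ^ n) * (qpoch (a * z) q n * h (z * q ^ n))" using Suc by (simp add: qpoch_Suc algebra_simps)
  also have "\<dots> = qpoch (a * z) q n * ((1 - a * (z * q ^ n)) * h (z * q ^ n * q))" by (subst rec[OF nz[of n], symmetric]) simp
  finally show ?case by (simp add: qpoch_Suc mult_ac)
 qed simp
 have "(\<lambda>n. h (z * q ^ n)) \<longlonglongrightarrow> 1"
 proof -
  have "norm (h w - 1) \<le> phi_bound a 0 0 * norm w / (1 - norm z)" if "norm w \<le> norm z" for w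
  proof -
   have "norm (h w - 1) \<le> phi_bound a 0 0 * norm w / (1 - norm w)" unfolding h_def using phi21_series_near_1[of 0 w] that z by simp
   also have "\<dots> \<le> phi_bound a 0 0 * norm w / (1 - norm z)" using that z phi_bound_nonneg by (intro divide_left_mono) auto
   finally show ?thesis .
  qed
  moreover have "norm (z * q ^ n) \<le> norm z" for n using mult_left_mono[OF norm_qpow_le, of "norm z" n] by (simp add: norm_mult)
  ultimately have b: "norm (h (z * q ^ n) - 1) \<le> phi_bound a 0 0 * norm (z * q ^ n) / (1 - norm z)" for n by blast
  have "(\<lambda>n. phi_bound a 0 0 * norm (z * q ^ n) / (1 - norm z)) \<longlonglongrightarrow> phi_bound a 0 0 * norm (z * 0) / (1 - norm z)"
   using z norm_q by (intro tendsto_intros LIMSEQ_power_zero) auto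
  then have "(\<lambda>n. phi_bound a 0 0 * norm (z * q ^ n) / (1 - norm z)) \<longlonglongrightarrow> 0" by simp
  then have "(\<lambda>n. h (z * q ^ n) - 1) \<longlonglongrightarrow> 0"
   by (rule Lim_null_comparison[OF always_eventually[OF allI[OF b]]])
  then show ?thesis using LIM_zero_iff by blast
 qed
 then have "(\<lambda>n. qpoch (a * z) q n * h (z * q ^ n)) \<longlonglongrightarrow> qpoch_inf (a * z) q * 1"
  by (intro tendsto_intros qpoch_LIMSEQ)
 moreover have "(\<lambda>n. qpoch z q n * h z) \<longlonglongrightarrow> qpoch_inf z q * h z" by (intro tendsto_intros qpoch_LIMSEQ)
 ultimately have "qpoch_inf z q * h z = qpoch_inf (a * z) q" unfolding iter by (metis LIMSEQ_unique mult.right_neutral)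
 then have "h z = qpoch_inf (a * z) q / qpoch_inf z q" using qpoch_inf_nonzero[OF z] by (simp add: field_simps)
 then show ?thesis using s[OF z] by (simp add: u_def)
qed

end

section \<open>Heine's transformation and the continuation to the slit plane\<close>

lemma suminf_swap:
 fixes f :: "nat \<Rightarrow> nat \<Rightarrow> complex"
 assumes bound: "\<And>n m. norm (f n m) \<le> A n * B m" and A: "summable A" and B: "summable B"
  and nonneg: "\<And>n. 0 \<le> A n" "\<And>n. 0 \<le> B n"
 shows "(\<Sum>n. \<Sum>m. f n m) = (\<Sum>m. \<Sum>n. f n m)"
proof -
 have conv: "infsum g UNIV = suminf g" if "summable (\<lambda>n. norm (g n))" for g :: "nat \<Rightarrow> complex"
  using norm_summable_imp_has_sum[OF that summable_sums[OF summable_norm_cancel[OF that]]] by (rule infsumI)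
 have sA: "A summable_on UNIV" and sB: "B summable_on UNIV" using A B nonneg by (auto intro!: norm_summable_imp_summable_on)
 \<comment> \<open>Absolute summability over pairs permits the exchange for \<open>infsum\<close>.
   To return to \<open>suminf\<close>, the rows, the columns and both outer sums must be absolutely
   summable as well.\<close>
 have "(\<lambda>(n, m). A n * B m) summable_on UNIV \<times> UNIV"
  by (rule summable_on_SigmaI[where g = "\<lambda>n. A n * infsum B UNIV"])
   (auto intro!: has_sum_cmult_right has_sum_infsum sB summable_on_cmult_left sA mult_nonneg_nonneg nonneg)
 then have "(\<lambda>p. norm (case p of (n, m) \<Rightarrow> f n m)) summable_on UNIV \<times> UNIV"
  by (rule Infinite_Sum.abs_summable_on_comparison_test') (use bound in auto)
 then have "(\<lambda>(n, m). f n m) summable_on UNIV \<times> UNIV" by (rule abs_summable_summable)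
 from infsum_swap_banach[OF this]
 have eq: "(\<Sum>\<^sub>\<infinity>n. \<Sum>\<^sub>\<infinity>m. f n m) = (\<Sum>\<^sub>\<infinity>m. \<Sum>\<^sub>\<infinity>n. f n m)" .
 have s1: "summable (\<lambda>m. norm (f n m))" for n
  by (rule summable_comparison_test'[OF summable_mult[OF B, of "A n"]]) (use bound in auto)
 have s2: "summable (\<lambda>n. norm (f n m))" for m
  by (rule summable_comparison_test'[OF summable_mult2[OF A, of "B m"]]) (use bound in auto)
 have n1: "norm (\<Sum>m. f n m) \<le> A n * (\<Sum>m. B m)" for n
  using norm_suminf_le[OF bound summable_mult[OF B, of "A n"]] suminf_mult[OF B, of "A n"] by simp
 have n2: "norm (\<Sum>n. f n m) \<le> (\<Sum>n. A n) * B m" for m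
  using norm_suminf_le[OF bound summable_mult2[OF A, of "B m"]] suminf_mult2[OF A, of "B m"] by simp
 have t1: "summable (\<lambda>n. norm (\<Sum>m. f n m))"
  by (rule summable_comparison_test'[OF summable_mult2[OF A, of "\<Sum>m. B m"]]) (use n1 in auto)
 have t2: "summable (\<lambda>m. norm (\<Sum>n. f n m))"
  by (rule summable_comparison_test'[OF summable_mult[OF B, of "\<Sum>m. A m"]]) (use n2 in auto)
 show ?thesis using eq by (simp add: conv s1 s2 t1 t2)
qed

definition slit_plane :: "complex set" where
 "slit_plane = - complex_of_real ` {1..}"

lemma open_slit_plane: "open slit_plane"
proof -
 have "complex_of_real ` {1..} = \<real> \<inter> {z. 1 \<le> Re z}" by (auto simp: complex_is_Real_iff complex_eq_iff image_iff)
 then show ?thesis unfolding slit_plane_def by (auto intro!: closed_Int closed_complex_Reals closed_halfspace_Re_ge simp only: open_Compl)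
qed

text \<open>Used for two purposes: the slit plane is star-shaped about 0, hence connected, and with
  \<open>z\<close> it contains all points \<open>z * q ^ n\<close>.\<close>

lemma slit_plane_mult:
 assumes "z \<in> slit_plane" "0 \<le> t" "t \<le> 1"
 shows "of_real t * z \<in> slit_plane"
proof (rule ccontr)
 assume "of_real t * z \<notin> slit_plane"
 then obtain s where s: "of_real t * z = of_real s" "1 \<le> s" by (auto simp: slit_plane_def)
 then have "t > 0" using assms(2) by (cases "t = 0") auto
 with s have "z = of_real (s / t)" by (simp add: field_simps)
 moreover have "1 \<le> s / t" using s assms \<open>t > 0\<close> by (simp add: field_simps)
 ultimately show False using assms(1) by (auto simp: slit_plane_def simp del: of_real_divide)
qed

lemma starlike_slit_plane: "starlike slit_plane" unfolding starlike_def
proof (intro bexI ballI subsetI)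
 show "0 \<in> slit_plane" by (auto simp: slit_plane_def)
 fix x y assume "x \<in> slit_plane" "y \<in> closed_segment 0 x"
 then show "y \<in> slit_plane" by (auto simp: closed_segment_def scaleR_conv_of_real intro: slit_plane_mult)
qed

lemma connected_slit_plane: "connected slit_plane" by (rule starlike_imp_connected[OF starlike_slit_plane])

lemma ball_subset_slit_plane: "ball 0 1 \<subseteq> slit_plane" by (auto simp: slit_plane_def)

context q_base
begin

definition heine_coeff :: "complex \<Rightarrow> complex \<Rightarrow> nat \<Rightarrow> complex" where
 "heine_coeff b c m = qpoch (c / b) q m / qpoch q q m * b ^ m"

text \<open>The right-hand side of Heine's transformation, with the quotient of the products at
  \<open>a * z\<close> and \<open>z\<close> moved into each term. In this form it is a series in
  powers of \<open>b\<close>: it needs \<open>norm b < 1\<close>, but \<open>z\<close> only has to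
  avoid the points where some \<open>z * q ^ n\<close> equals 1.\<close>

definition heine :: "complex \<Rightarrow> complex \<Rightarrow> complex \<Rightarrow> complex \<Rightarrow> complex" where
 "heine a b c z = qpoch_inf b q / qpoch_inf c q *
   (\<Sum>m. heine_coeff b c m * (qpoch_inf (a * z * q ^ m) q / qpoch_inf (z * q ^ m) q))"

lemma norm_ratio_le:
 "norm (qpoch a q n / qpoch q q n) \<le> phi_bound a 0 0" using norm_phi_coeff_le[of 0 a 0 n] by (simp add: phi_coeff_def qpoch_def)

lemma norm_heine_coeff_le: "norm (heine_coeff b c m) \<le> phi_bound (c / b) 0 0 * norm b ^ m"
 unfolding heine_coeff_def norm_mult norm_power by (rule mult_right_mono[OF norm_ratio_le]) simp

text \<open>The quotient of the products at \<open>c * q ^ n\<close> and \<open>b * q ^ n\<close> is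
  expanded by the q-binomial theorem, the double series is exchanged, and the inner sum over
  \<open>n\<close> is evaluated by the q-binomial theorem once more.\<close>

lemma heine_eq_series:
 assumes b: "norm b < 1" "b \<noteq> 0" and c: "qpoch_inf c q \<noteq> 0" and z: "norm z < 1"
 shows "heine a b c z = phi21_series a b c q z"
proof -
 define u where "u n = qpoch a q n / qpoch q q n * z ^ n" for n
 have bn: "norm (b * q ^ n) < 1" for n using mult_left_mono[OF norm_qpow_le, of "norm b" n] b(1) by (simp add: norm_mult)
 have zn: "norm (z * q ^ n) < 1" for n using mult_left_mono[OF norm_qpow_le, of "norm z" n] z by (simp add: norm_mult)
 have row: "(\<Sum>m. u n * (heine_coeff b c m * (q ^ n) ^ m)) =
   qpoch_inf c q / qpoch_inf b q * (phi_coeff a b c n * z ^ n)" for n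
 proof -
  have "(\<lambda>m. qpoch (c / b) q m / qpoch q q m * (b * q ^ n) ^ m) sums
    (qpoch_inf (c / b * (b * q ^ n)) q / qpoch_inf (b * q ^ n) q)" by (rule q_binomial[OF bn])
  then have "(\<lambda>m. u n * (heine_coeff b c m * (q ^ n) ^ m)) sums
    (u n * (qpoch_inf (c * q ^ n) q / qpoch_inf (b * q ^ n) q))"
   using b by (intro sums_mult) (simp add: heine_coeff_def power_mult_distrib mult_ac)
  moreover have "qpoch_inf (c * q ^ n) q = qpoch_inf c q / qpoch c q n"
   "qpoch_inf (b * q ^ n) q = qpoch_inf b q / qpoch b q n"
   using qpoch_inf_split[of c n] qpoch_inf_split[of b n] qpoch_nonzero[OF c, of n]
    qpoch_nonzero[OF qpoch_inf_nonzero[OF b(1)], of n] by (simp_all add: field_simps)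
  ultimately show ?thesis by (simp add: sums_iff u_def phi_coeff_def mult_ac)
 qed
 have col: "(\<Sum>n. u n * (heine_coeff b c m * (q ^ n) ^ m)) =
   heine_coeff b c m * (qpoch_inf (a * z * q ^ m) q / qpoch_inf (z * q ^ m) q)" for m
 proof -
  have "(\<lambda>n. qpoch a q n / qpoch q q n * (z * q ^ m) ^ n) sums
    (qpoch_inf (a * (z * q ^ m)) q / qpoch_inf (z * q ^ m) q)" by (rule q_binomial[OF zn])
  from sums_mult[OF this, of "heine_coeff b c m"]
  have "(\<lambda>n. u n * (heine_coeff b c m * (q ^ n) ^ m)) sums
    (heine_coeff b c m * (qpoch_inf (a * z * q ^ m) q / qpoch_inf (z * q ^ m) q))"
   by (simp add: u_def power_mult_distrib mult_ac flip: power_mult)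
  then show ?thesis by (simp add: sums_iff)
 qed
 have "(\<Sum>n. \<Sum>m. u n * (heine_coeff b c m * (q ^ n) ^ m)) = (\<Sum>m. \<Sum>n. u n * (heine_coeff b c m * (q ^ n) ^ m))"
 proof (rule suminf_swap)
  fix n m
  have u: "norm (u n) \<le> phi_bound a 0 0 * norm z ^ n"
   unfolding u_def norm_mult norm_power by (rule mult_right_mono[OF norm_ratio_le]) simp
  have "norm (heine_coeff b c m * (q ^ n) ^ m) \<le> phi_bound (c / b) 0 0 * norm b ^ m * 1"
   unfolding norm_mult using norm_heine_coeff_le norm_qpow_le[of "n * m"] by (intro mult_mono) (auto simp: power_mult phi_bound_nonneg)
  with u show "norm (u n * (heine_coeff b c m * (q ^ n) ^ m)) \<le>
    (phi_bound a 0 0 * norm z ^ n) * (phi_bound (c / b) 0 0 * norm b ^ m)"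
   unfolding norm_mult[of "u n"] by (intro mult_mono) (auto simp: phi_bound_nonneg)
 qed (use b z in \<open>auto simp: phi_bound_nonneg intro!: summable_mult\<close>)
 then have "qpoch_inf c q / qpoch_inf b q * phi21_series a b c q z =
   (\<Sum>m. heine_coeff b c m * (qpoch_inf (a * z * q ^ m) q / qpoch_inf (z * q ^ m) q))" unfolding row col
  using sums_mult[OF phi21_series_sums(1)[OF c z, of a b], of "qpoch_inf c q / qpoch_inf b q"] by (simp only: sums_iff)
 then show ?thesis unfolding heine_def using c qpoch_inf_nonzero[OF b(1)] by (simp add: field_simps)
qed

end

locale q_real = fixes q :: real assumes q01: "0 < q" "q < 1"
begin

sublocale q_base "of_real q" by unfold_locales (use q01 in simp)

lemma slit_plane_qpow: "z \<in> slit_plane \<Longrightarrow> z * of_real q ^ n \<in> slit_plane"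
 using slit_plane_mult[of z "q ^ n"] q01 by (simp add: power_le_one mult.commute)

lemma slit_plane_qpoch_nonzero:
 assumes "z \<in> slit_plane" shows "qpoch_inf z (of_real q) \<noteq> 0"
proof
 assume "qpoch_inf z (of_real q) = 0"
 then obtain n where "z * of_real q ^ n = 1" by (auto simp: qpoch_inf_eq_0_iff)
 with slit_plane_qpow[OF assms, of n] show False by (auto simp: slit_plane_def image_iff)
qed

lemma holomorphic_heine:
 assumes b: "norm b < 1"
 shows "heine a b c holomorphic_on slit_plane"
proof -
 let ?q = "complex_of_real q"
 have "(\<lambda>z. \<Sum>m. heine_coeff b c m * (qpoch_inf (a * z * ?q ^ m) ?q / qpoch_inf (z * ?q ^ m) ?q))
   holomorphic_on slit_plane"
 proof (rule holomorphic_suminf[OF open_slit_plane])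
  show "(\<lambda>z. heine_coeff b c m * (qpoch_inf (a * z * ?q ^ m) ?q / qpoch_inf (z * ?q ^ m) ?q))
    holomorphic_on slit_plane" for m by (intro holomorphic_intros) (use slit_plane_qpoch_nonzero slit_plane_qpow in auto)
  fix x assume "x \<in> slit_plane"
  then obtain d where d: "d > 0" "cball x d \<subseteq> slit_plane" using open_slit_plane open_contains_cball by blast
  \<comment> \<open>The cone over the disc is compact, lies in the slit plane and contains
    \<open>z * q ^ m\<close> for every \<open>m\<close>, so a single bound \<open>B\<close> serves
    all terms.\<close>
  define K where "K = (\<lambda>(t, z). of_real t * z) ` ({0..1::real} \<times> cball x d)"
  have "compact K" unfolding K_def
   by (intro compact_continuous_image compact_Times) (auto simp: case_prod_unfold intro!: continuous_intros)
  moreover have K: "K \<subseteq> slit_plane" using d slit_plane_mult by (fastforce simp: K_def)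
  ultimately have "compact ((\<lambda>z. qpoch_inf (a * z) ?q / qpoch_inf z ?q) ` K)"
   using slit_plane_qpoch_nonzero by (intro compact_continuous_image continuous_intros) auto
  from compact_imp_bounded[OF this] obtain B
   where B: "\<And>z. z \<in> K \<Longrightarrow> norm (qpoch_inf (a * z) ?q / qpoch_inf z ?q) \<le> B" unfolding bounded_iff by blast
  have "norm (heine_coeff b c m * (qpoch_inf (a * z * ?q ^ m) ?q / qpoch_inf (z * ?q ^ m) ?q))
    \<le> phi_bound (c / b) 0 0 * norm b ^ m * B" if "z \<in> cball x d" for z m
  proof -
   have "z * ?q ^ m \<in> K" unfolding K_def using that q01 by (intro image_eqI[of _ _ "(q ^ m, z)"]) (auto simp: power_le_one)
   from B[OF this] show ?thesis unfolding norm_mult[of "heine_coeff b c m"]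
    by (intro mult_mono norm_heine_coeff_le) (auto simp: phi_bound_nonneg mult_ac)
  qed
  moreover have "summable (\<lambda>m. phi_bound (c / b) 0 0 * norm b ^ m * B)"
   using b by (intro summable_mult summable_mult2 summable_geometric) auto
  ultimately show "\<exists>d M. 0 < d \<and> cball x d \<subseteq> slit_plane \<and> summable M \<and>
   (\<forall>y\<in>cball x d. \<forall>n. norm (heine_coeff b c n * (qpoch_inf (a * y * ?q ^ n) ?q / qpoch_inf (y * ?q ^ n) ?q)) \<le> M n)"
   using d by blast
 qed
 then show ?thesis unfolding heine_def by (intro holomorphic_intros)
qed

text \<open>\<open>heine\<close> witnesses that a continuation exists, so the chosen function has
  the required properties; it then agrees with \<open>heine\<close> on the connected slit plane by
  the identity theorem.\<close>

lemma phi21_eq_heine: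
 assumes b: "norm b < 1" "b \<noteq> 0" and c: "qpoch_inf c (of_real q) \<noteq> 0" and z: "z \<in> slit_plane"
 shows "phi21 a b c (of_real q) z = heine a b c z"
proof (cases "norm z < 1")
 case True
 then show ?thesis using heine_eq_series[OF b c] by (simp add: phi21_def)
next
 case False
 let ?P = "\<lambda>g. g holomorphic_on (- complex_of_real ` {1..}) \<and>
   (\<forall>w. norm w < 1 \<longrightarrow> g w = phi21_series a b c (of_real q) w)"
 define g where "g = (SOME g. ?P g)"
 have "?P (heine a b c)" using heine_eq_series[OF b c] holomorphic_heine[OF b(1)] by (simp add: slit_plane_def)
 then have "?P g" unfolding g_def by (rule someI[of ?P])
 then have g: "g holomorphic_on slit_plane" "\<And>w. norm w < 1 \<Longrightarrow> g w = heine a b c w"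
  using heine_eq_series[OF b c] by (auto simp: slit_plane_def)
 have "g z = heine a b c z" by (rule analytic_continuation_open[where s = "ball 0 1" and s' = slit_plane and z = z])
   (use g z holomorphic_heine[OF b(1)] open_slit_plane connected_slit_plane
    ball_subset_slit_plane in auto)
 then show ?thesis using False by (simp add: phi21_def g_def)
qed

text \<open>The equation holds for the power series on the unit disc and persists under
  continuation.\<close>

lemma heine_q_difference:
 fixes a b c z :: complex
 assumes b: "norm b < 1" "b \<noteq> 0" and c: "qpoch_inf c (of_real q) \<noteq> 0" and z: "z \<in> slit_plane"
 shows "(1 - z) * heine a b c z * q - (q + c - q * z * (a + b)) * heine a b c (q * z)
  + (c - q * a * b * z) * heine a b c (q^2 * z) = 0"
proof -
 let ?G = "\<lambda>z::complex. (1 - z) * heine a b c z * q - (q + c - q * z * (a + b)) * heine a b c (q * z)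
  + (c - q * a * b * z) * heine a b c (q^2 * z)"
 have q1: "of_real q * z \<in> slit_plane" "(of_real q)^2 * z \<in> slit_plane" if "z \<in> slit_plane" for z
  using slit_plane_qpow[OF that, of 1] slit_plane_qpow[OF that, of 2] by (auto simp: mult.commute)
 have h: "heine a b c holomorphic_on slit_plane" using holomorphic_heine[OF b(1)] .
 have "(heine a b c \<circ> (\<lambda>z. of_real q * z)) holomorphic_on slit_plane"
  "(heine a b c \<circ> (\<lambda>z. of_real (q^2) * z)) holomorphic_on slit_plane"
  by (rule holomorphic_on_compose_gen[OF _ h]; use q1 in \<open>auto intro!: holomorphic_intros\<close>)+
 then have "?G holomorphic_on slit_plane" unfolding o_def by (intro holomorphic_intros h)
 moreover have "?G w = 0" if "w \<in> ball 0 1" for w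
 proof -
  have w: "norm w < 1" using that by simp
  moreover have "norm (of_real q * v) < 1" if "norm v < 1" for v :: complex
   using mult_left_le_one_le[of "norm v" q] q01 that by (simp add: norm_mult)
  from this[OF w] this[OF this[OF w]] have "norm (of_real q * w) < 1" "norm ((of_real q)^2 * w) < 1"
   by (simp_all add: power2_eq_square mult.assoc)
  ultimately show ?thesis using phi21_series_q_difference[OF c w, of a b] by (simp add: heine_eq_series[OF b c])
 qed
 ultimately show ?thesis by (intro analytic_continuation_open[where s = "ball 0 1" and s' = slit_plane and z = z
     and f = ?G and g = "\<lambda>_. 0"])
   (use z open_slit_plane connected_slit_plane ball_subset_slit_plane in auto)
qed

section \<open>Ramanujan's bilateral sum and the asymptotics of Heine's series\<close>

lemma q_nonzero [simp]: "q \<noteq> 0" using q01 by simp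

definition theta :: "complex \<Rightarrow> complex" where
 "theta x = qpoch_inf x (of_real q) * qpoch_inf (of_real q / x) (of_real q)"

lemma theta_shift:
 assumes "x \<noteq> 0"
 shows "theta (x / of_real q) = - (x / of_real q) * theta x"
proof -
 let ?q = "complex_of_real q"
 have q: "?q \<noteq> 0" using q01 by simp
 have "qpoch_inf (x / ?q) ?q = (1 - x / ?q) * qpoch_inf x ?q" using qpoch_inf_rec[of "x / ?q"] q by simp
 moreover have "qpoch_inf (?q / x) ?q = (1 - ?q / x) * qpoch_inf (?q / x * ?q) ?q" by (rule qpoch_inf_rec)
 moreover have "?q / (x / ?q) = ?q / x * ?q" by simp
 moreover have "1 - x / ?q = - (x / ?q) * (1 - ?q / x)" using q assms by (simp add: field_simps)
 ultimately show ?thesis unfolding theta_def by (simp add: mult_ac)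
qed

text \<open>Each shift by \<open>q\<close> multiplies a theta function by minus its argument.
  Between the arguments \<open>r * b\<close> and \<open>r\<close> these factors differ only by
  \<open>b\<close>, so the powers of \<open>r\<close> and \<open>q\<close> cancel and just
  \<open>b ^ N\<close> survives.\<close>

lemma theta_quasi_periodic:
 assumes "r \<noteq> 0" "b \<noteq> 0"
 shows "theta (r * b / of_real q ^ N) * theta r = b ^ N * theta (r / of_real q ^ N) * theta (r * b)"
proof (induction N)
 case (Suc N)
 let ?q = "complex_of_real q"
 have q: "?q \<noteq> 0" using q01 by simp
 have "theta (r * b / ?q ^ N / ?q) = - (r * b / ?q ^ N / ?q) * theta (r * b / ?q ^ N)"
  "theta (r / ?q ^ N / ?q) = - (r / ?q ^ N / ?q) * theta (r / ?q ^ N)" by (rule theta_shift; use assms q in simp)+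
 then have eqs: "theta (r * b / ?q ^ Suc N) = - (r * b / ?q ^ Suc N) * theta (r * b / ?q ^ N)"
  "theta (r / ?q ^ Suc N) = - (r / ?q ^ Suc N) * theta (r / ?q ^ N)" by (simp_all add: mult_ac)
 have "theta (r * b / ?q ^ Suc N) * theta r = - (r * b / ?q ^ Suc N) * (theta (r * b / ?q ^ N) * theta r)" by (simp only: eqs mult.assoc)
 also have "\<dots> = - (r * b / ?q ^ Suc N) * (b ^ N * theta (r / ?q ^ N) * theta (r * b))" by (simp only: Suc)
 also have "\<dots> = b ^ Suc N * theta (r / ?q ^ Suc N) * theta (r * b)" unfolding eqs(2) by (simp add: mult_ac)
 finally show ?case .
qed simp

end

section \<open>Ramanujan's summation of the bilateral series\<close>

locale psi_sum = q_real +
 fixes r :: real and b :: complex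
 assumes r: "r < 0" and b: "b \<noteq> 0" "norm b < 1"
begin

abbreviation "cq \<equiv> complex_of_real q"
abbreviation "cr \<equiv> complex_of_real r"
abbreviation "Q x \<equiv> qpoch_inf x (complex_of_real q)"

text \<open>\<open>up a m\<close> and \<open>dn a j\<close> are the terms of index \<open>m\<close> and \<open>-j\<close> of a bilateral series.\<close>

definition up :: "complex \<Rightarrow> nat \<Rightarrow> complex" where
 "up a m = b ^ m * (Q (a * cr * cq ^ m) / Q (cr * cq ^ m))"

definition dn :: "complex \<Rightarrow> nat \<Rightarrow> complex" where
 "dn a j = (Q (a * cr / cq ^ j) / Q (cr / cq ^ j)) / b ^ j"

lemma neg_slit_plane: "x \<le> 0 \<Longrightarrow> complex_of_real x \<in> slit_plane" by (auto simp: slit_plane_def)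

lemma Q_up_nonzero: "Q (cr * cq ^ m) \<noteq> 0" using slit_plane_qpoch_nonzero[OF neg_slit_plane[of "r * q ^ m"]] r q01
 by (simp add: mult_nonpos_nonneg)

lemma Q_dn_nonzero: "Q (cr / cq ^ m) \<noteq> 0" using slit_plane_qpoch_nonzero[OF neg_slit_plane[of "r / q ^ m"]] r q01
 by (simp add: divide_nonpos_pos)

lemma Q_cr_nonzero: "Q cr \<noteq> 0" using Q_up_nonzero[of 0] by simp

definition up_bound :: real where
 "up_bound = exp (\<bar>r\<bar> / (1 - q)) * (exp (\<bar>r\<bar> / (1 - q)) / norm (Q cr))"

lemma norm_Q_le:
 assumes "norm a \<le> 1" "0 \<le> s" "s \<le> \<bar>r\<bar>" shows "norm (Q (a * of_real s)) \<le> exp (\<bar>r\<bar> / (1 - q))"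
  "norm (Q (- a * of_real s)) \<le> exp (\<bar>r\<bar> / (1 - q))"
proof -
 have "norm a * s \<le> 1 * \<bar>r\<bar>" using assms by (intro mult_mono) auto
 then have "exp (norm a * s / (1 - q)) \<le> exp (\<bar>r\<bar> / (1 - q))" using q01 by (simp add: divide_right_mono)
 then show "norm (Q (a * of_real s)) \<le> exp (\<bar>r\<bar> / (1 - q))"
  "norm (Q (- a * of_real s)) \<le> exp (\<bar>r\<bar> / (1 - q))"
  using norm_qpoch_inf_le[of "a * of_real s"] norm_qpoch_inf_le[of "- a * of_real s"] assms q01
  by (auto simp: norm_mult intro: order_trans)
qed

lemma norm_up_le:
 assumes "norm a \<le> 1"
 shows "norm (up a m) \<le> up_bound * norm b ^ m"
proof -
 have s: "\<bar>r\<bar> * q ^ m \<le> \<bar>r\<bar>" using q01 by (simp add: mult_left_le power_le_one)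
 have e: "a * cr * cq ^ m = - a * of_real (\<bar>r\<bar> * q ^ m)" using r by simp
 have 1: "norm (Q (a * cr * cq ^ m)) \<le> exp (\<bar>r\<bar> / (1 - q))" unfolding e by (rule norm_Q_le(2)) (use assms s q01 in auto)
 have "inverse (Q (cr * cq ^ m)) = qpoch cr cq m / Q cr"
  using qpoch_inf_split[of cr m] Q_up_nonzero[of m] Q_cr_nonzero by (simp add: field_simps)
 moreover have "norm (qpoch cr cq m) \<le> exp (\<bar>r\<bar> / (1 - q))" using norm_qpoch_le[of cr m] q01 by simp
 ultimately have 2: "norm (inverse (Q (cr * cq ^ m))) \<le> exp (\<bar>r\<bar> / (1 - q)) / norm (Q cr)"
  by (simp add: norm_divide divide_right_mono)
 have "norm (up a m) = norm b ^ m * (norm (Q (a * cr * cq ^ m)) * norm (inverse (Q (cr * cq ^ m))))"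
  by (simp add: up_def norm_mult norm_power norm_divide norm_inverse field_simps)
 also have "\<dots> \<le> norm b ^ m * up_bound" unfolding up_bound_def by (intro mult_left_mono mult_mono 1 2) auto
 finally show ?thesis by (simp add: mult.commute)
qed

text \<open>A product of bounds for the ratios of successive terms of negative index: with
  \<open>s = \<bar>r\<bar> / q ^ Suc i\<close> one has
  \<open>norm (1 + a * s) / (1 + s) \<le> \<rho> + 1 / s\<close> whenever
  \<open>norm a \<le> \<rho>\<close>.\<close>

definition dn_ratio :: "real \<Rightarrow> nat \<Rightarrow> real" where
 "dn_ratio \<rho> j = (\<Prod>i<j. (\<rho> + q ^ Suc i / \<bar>r\<bar>) / norm b)"

lemma summable_dn_ratio:
 assumes \<rho>: "0 \<le> \<rho>" "\<rho> < norm b"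
 shows "summable (dn_ratio \<rho>)"
proof -
 \<comment> \<open>The ratios tend to \<open>\<rho> / norm b\<close>; any \<open>s\<close> strictly
   between \<open>\<rho>\<close> and \<open>norm b\<close> leaves room for the ratio test.\<close>
 obtain s where s: "\<rho> < s" "s < norm b" using \<rho>(2) dense by blast
 have "(\<lambda>i. q ^ Suc i / \<bar>r\<bar>) \<longlonglongrightarrow> 0 / \<bar>r\<bar>"
  using q01 r by (intro tendsto_intros LIMSEQ_Suc[OF LIMSEQ_power_zero]) auto
 then have "\<forall>\<^sub>F i in sequentially. q ^ Suc i / \<bar>r\<bar> < s - \<rho>" using s by (intro order_tendstoD(2)) auto
 then obtain N where N: "\<And>i. i \<ge> N \<Longrightarrow> q ^ Suc i / \<bar>r\<bar> < s - \<rho>"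
  by (auto simp: eventually_sequentially)
 have nn: "0 \<le> dn_ratio \<rho> j" for j unfolding dn_ratio_def using \<rho> q01 by (intro prod_nonneg) auto
 show ?thesis
 proof (rule summable_ratio_test[of "s / norm b"])
  show "s / norm b < 1" using s b by (simp add: field_simps)
  fix n assume n: "n \<ge> N"
  have "norm (dn_ratio \<rho> (Suc n)) = dn_ratio \<rho> n * ((\<rho> + q ^ Suc n / \<bar>r\<bar>) / norm b)"
   using nn[of "Suc n"] by (simp only: real_norm_def abs_of_nonneg) (simp add: dn_ratio_def)
  also have "\<dots> \<le> dn_ratio \<rho> n * (s / norm b)" using N[OF n] nn[of n] by (intro mult_left_mono divide_right_mono) auto
  finally show "norm (dn_ratio \<rho> (Suc n)) \<le> s / norm b * norm (dn_ratio \<rho> n)" using nn[of n] by (simp add: mult.commute)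
 qed
qed

lemma Q_div_cq: "Q (x / cq ^ Suc j) = (1 - x / cq ^ Suc j) * Q (x / cq ^ j)" using qpoch_inf_rec[of "x / cq ^ Suc j"] by simp

lemma norm_dn_le:
 assumes a: "norm a \<le> \<rho>"
 shows "norm (dn a j) \<le> norm (Q (a * cr) / Q cr) * dn_ratio \<rho> j"
proof (induction j)
 case 0
 then show ?case by (simp add: dn_def dn_ratio_def)
next
 case (Suc j)
 have \<rho>: "0 \<le> \<rho>" using a norm_ge_zero order_trans by blast
 define s where "s = \<bar>r\<bar> / q ^ Suc j"
 have s: "s > 0" unfolding s_def using r q01 by (intro divide_pos_pos zero_less_power) auto
 have crs: "cr / cq ^ Suc j = - of_real s" using r by (simp add: s_def abs_of_neg)
 have "dn a (Suc j) = dn a j * ((1 - a * cr / cq ^ Suc j) / (1 - cr / cq ^ Suc j) / b)"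
  unfolding dn_def by (simp only: Q_div_cq) (simp add: mult_ac)
 also have "a * cr / cq ^ Suc j = a * (cr / cq ^ Suc j)" by simp
 finally have "norm (dn a (Suc j)) = norm (dn a j) * (norm (1 + a * of_real s) / norm (1 + complex_of_real s) / norm b)"
  unfolding crs by (simp add: norm_mult norm_divide)
 also have "norm (1 + complex_of_real s) = 1 + s"
  using s by (metis abs_of_pos norm_of_real of_real_1 of_real_add add_pos_pos zero_less_one)
 finally have eq: "norm (dn a (Suc j)) = norm (dn a j) * (norm (1 + a * of_real s) / (1 + s) / norm b)" .
 have "norm (1 + a * of_real s) / (1 + s) \<le> \<rho> + 1 / s"
 proof -
  have "norm (1 + a * of_real s) \<le> 1 + norm a * s"
   by (rule order_trans[OF norm_triangle_ineq]) (use s in \<open>simp add: norm_mult\<close>)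
  also have "\<dots> \<le> 1 + \<rho> * s" using a s by simp
  also have "\<dots> \<le> (\<rho> + 1 / s) * (1 + s)" using s \<rho> by (simp add: field_simps)
  finally show ?thesis using s by (simp add: field_simps)
 qed
 also have "1 / s = q ^ Suc j / \<bar>r\<bar>" by (simp add: s_def)
 finally have "norm (dn a (Suc j)) \<le> norm (dn a j) * ((\<rho> + q ^ Suc j / \<bar>r\<bar>) / norm b)"
  unfolding eq by (intro mult_left_mono divide_right_mono) auto
 also have "\<dots> \<le> norm (Q (a * cr) / Q cr) * dn_ratio \<rho> j * ((\<rho> + q ^ Suc j / \<bar>r\<bar>) / norm b)"
  using \<rho> q01 by (intro mult_right_mono Suc) auto
 also have "\<dots> = norm (Q (a * cr) / Q cr) * dn_ratio \<rho> (Suc j)" by (simp add: dn_ratio_def)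
 finally show ?case .
qed

lemma norm_dn_le':
 assumes "norm a \<le> \<rho>" "\<rho> < norm b"
 shows "norm (dn a j) \<le> up_bound * dn_ratio \<rho> j"
proof -
 have \<rho>: "0 \<le> \<rho>" using assms norm_ge_zero order_trans by blast
 have nn: "0 \<le> dn_ratio \<rho> j" unfolding dn_ratio_def using \<rho> q01 by (intro prod_nonneg) auto
 have "norm (up a 0) \<le> up_bound" using norm_up_le[of a 0] assms b by simp
 then have "norm (Q (a * cr) / Q cr) \<le> up_bound" by (simp add: up_def)
 then show ?thesis using norm_dn_le[OF assms(1), of j] mult_right_mono[OF _ nn] order_trans by blast
qed

lemma summable_up: "norm a \<le> 1 \<Longrightarrow> summable (\<lambda>m. norm (up a m))"
 by (rule summable_comparison_test'[where g = "\<lambda>m. up_bound * norm b ^ m"])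
  (use b norm_up_le in \<open>auto intro!: summable_mult summable_geometric\<close>)

lemma summable_dn: "norm a < norm b \<Longrightarrow> summable (\<lambda>j. norm (dn a j))"
 by (rule summable_comparison_test'[where g = "\<lambda>m. up_bound * dn_ratio (norm a) m"])
  (use norm_dn_le'[of a "norm a"] in \<open>auto intro!: summable_mult summable_dn_ratio\<close>)

text \<open>Up to the factor \<open>Q (a * cr) / Q cr\<close> this is the bilateral series 1psi1
  with upper parameter \<open>r\<close>, lower parameter \<open>a * r\<close> and argument
  \<open>b\<close>, whose annulus of convergence is \<open>norm a < norm b < 1\<close>. The shift in
  the second sum prevents index 0 from being counted twice.\<close>

definition psi :: "complex \<Rightarrow> complex" where
 "psi a = (\<Sum>m. up a m) + (\<Sum>j. dn a (Suc j))"

lemma holomorphic_psi: "psi holomorphic_on ball 0 (norm b)"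
proof -
 have "(\<lambda>a. \<Sum>m. up a m) holomorphic_on ball 0 (norm b)"
 proof (rule holomorphic_suminf)
  show "(\<lambda>a. up a n) holomorphic_on ball 0 (norm b)" for n
   unfolding up_def by (intro holomorphic_intros) (use Q_up_nonzero in auto)
  fix x :: complex assume "x \<in> ball 0 (norm b)"
  then obtain d where d: "d > 0" "cball x d \<subseteq> ball 0 (norm b)" using open_contains_cball open_ball by blast
  have "norm (up y n) \<le> up_bound * norm b ^ n" if "y \<in> cball x d" for y :: complex and n
   using d(2) that b by (intro norm_up_le) (auto simp: subset_iff)
  moreover have "summable (\<lambda>n. up_bound * norm b ^ n)" using b by (intro summable_mult summable_geometric) auto
  ultimately show "\<exists>d M. 0 < d \<and> cball x d \<subseteq> ball 0 (norm b) \<and> summable M \<and> (\<forall>y\<in>cball x d. \<forall>n. norm (up y n) \<le> M n)"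
   using d by blast
 qed auto
 moreover have "(\<lambda>a. \<Sum>j. dn a (Suc j)) holomorphic_on ball 0 (norm b)"
 proof (rule holomorphic_suminf)
  show "(\<lambda>a. dn a (Suc n)) holomorphic_on ball 0 (norm b)" for n
   unfolding dn_def using Q_dn_nonzero[of "Suc n"] b by (intro holomorphic_intros) auto
  fix x :: complex assume x: "x \<in> ball 0 (norm b)"
  \<comment> \<open>The midpoint leaves a whole disc around \<open>x\<close> on which one convergent
    majorant \<open>dn_ratio \<rho>\<close> applies.\<close>
  define \<rho> where "\<rho> = (norm x + norm b) / 2"
  have \<rho>: "norm x < \<rho>" "\<rho> < norm b" "0 \<le> \<rho>" using x by (auto simp: \<rho>_def)
  have y: "norm y \<le> \<rho>" if "y \<in> cball x (\<rho> - norm x)" for y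
   using that norm_triangle_ineq2[of y x] by (simp add: dist_norm norm_minus_commute)
  have "norm (dn y (Suc n)) \<le> up_bound * dn_ratio \<rho> (Suc n)" if "y \<in> cball x (\<rho> - norm x)" for y :: complex and n
   using y[OF that] \<rho> by (intro norm_dn_le')
  moreover have "summable (\<lambda>n. up_bound * dn_ratio \<rho> (Suc n))"
   using summable_dn_ratio[OF \<rho>(3,2)] by (intro summable_mult) (simp add: summable_Suc_iff)
  moreover have "cball x (\<rho> - norm x) \<subseteq> ball 0 (norm b)" using y \<rho>(2) by force
  ultimately show "\<exists>d M. 0 < d \<and> cball x d \<subseteq> ball 0 (norm b) \<and> summable M \<and> (\<forall>y\<in>cball x d. \<forall>n. norm (dn y (Suc n)) \<le> M n)"
   using \<rho>(1) by (intro exI[of _ "\<rho> - norm x"] exI[of _ "\<lambda>n. up_bound * dn_ratio \<rho> (Suc n)"]) auto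
 qed auto
 ultimately show ?thesis unfolding psi_def by (intro holomorphic_intros)
qed

text \<open>At these values of \<open>a\<close> the terms of index below \<open>-N\<close> contain a
  zero factor. The series is therefore one-sided, and after a shift by \<open>N\<close> it is a
  q-binomial series with parameter \<open>cr / cq ^ N\<close>.\<close>

lemma psi_special:
 assumes N: "norm (cq ^ Suc N / cr) < norm b"
 defines "a \<equiv> cq ^ Suc N / cr"
 shows "psi a * Q (a / b) * (theta cr * Q b) = Q cq * Q a * theta (cr * b)"
proof -
 have cr: "cr \<noteq> 0" using r by simp
 define G where "G n = b ^ n * (Q (cq * cq ^ n) / Q (cr / cq ^ N * cq ^ n))" for n
 define x where "x = cr / cq ^ N"
 have x0: "Q x \<noteq> 0" unfolding x_def by (rule Q_dn_nonzero)
 have xn: "Q (x * cq ^ n) \<noteq> 0" for n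
 proof -
  have "x * cq ^ n = of_real (r / q ^ N * q ^ n)" by (simp add: x_def)
  moreover have "r / q ^ N * q ^ n \<le> 0" using r q01 by (simp add: mult_nonpos_nonneg divide_nonpos_pos)
  ultimately show ?thesis using slit_plane_qpoch_nonzero neg_slit_plane by metis
 qed
 have "(\<lambda>n. qpoch x cq n / qpoch cq cq n * b ^ n) sums (Q (x * b) / Q b)" by (rule q_binomial[OF b(2)])
 moreover
 have "G n = Q cq / Q x * (qpoch x cq n / qpoch cq cq n * b ^ n)" for n
 proof -
  have "Q (cq * cq ^ n) = Q cq / qpoch cq cq n"
   using qpoch_inf_split[of cq n] qpoch_nonzero[OF qpoch_q_nonzero, of n] by (simp add: field_simps)
  moreover have "qpoch x cq n \<noteq> 0" using qpoch_nonzero[OF x0] .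
  moreover have "Q (x * cq ^ n) = Q x / qpoch x cq n"
   using qpoch_inf_split[of x n] \<open>qpoch x cq n \<noteq> 0\<close> by (simp add: field_simps)
  ultimately show ?thesis using x0 by (simp add: G_def x_def[symmetric] mult_ac)
 qed
 then have "G = (\<lambda>n. Q cq / Q x * (qpoch x cq n / qpoch cq cq n * b ^ n))" by blast
 ultimately have Gs: "G sums (Q cq / Q x * (Q (x * b) / Q b))" by (simp only: sums_mult)
 have ar: "a * cr = cq ^ Suc N" using cr by (simp add: a_def)
 have up: "up a m = G (m + N) / b ^ N" for m
 proof -
  have e: "cr / cq ^ N * cq ^ (m + N) = cr * cq ^ m" "cq * cq ^ (m + N) = a * cr * cq ^ m" by (simp_all add: ar power_add mult_ac)
  show ?thesis unfolding up_def G_def e using b by (simp add: power_add)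
 qed
 have dn: "dn a (Suc j) = (if j < N then G (N - Suc j) / b ^ N else 0)" for j
 proof (cases "j < N")
  case True
  then obtain k where k: "N = Suc j + k" using less_imp_Suc_add by fastforce
  have "cr / cq ^ N * cq ^ (N - Suc j) = cr / cq ^ Suc j" by (simp add: k power_add)
  moreover have "cq * cq ^ (N - Suc j) = a * cr / cq ^ Suc j" by (simp add: ar k power_add)
  ultimately show ?thesis using True b by (simp add: dn_def G_def k power_add)
 next
  case False
  then obtain k where k: "j = N + k" using le_Suc_ex not_less by blast
  have "a * cr / cq ^ Suc j * cq ^ k = 1" by (simp add: ar k power_add)
  then have "Q (a * cr / cq ^ Suc j) = 0" using qpoch_inf_eq_0_iff by blast
  then show ?thesis using False by (simp add: dn_def)
 qed
 have "(\<lambda>m. up a m) sums ((Q cq / Q x * (Q (x * b) / Q b) - (\<Sum>n<N. G n)) / b ^ N)"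
  unfolding up by (intro sums_divide sums_split_initial_segment Gs)
 moreover have "(\<lambda>j. dn a (Suc j)) sums ((\<Sum>n<N. G n) / b ^ N)"
 proof -
  have "(\<lambda>j. dn a (Suc j)) sums (\<Sum>j<N. dn a (Suc j))" by (rule sums_finite) (auto simp: dn)
  also have "(\<Sum>j<N. dn a (Suc j)) = (\<Sum>j<N. G (N - Suc j) / b ^ N)" by (intro sum.cong) (auto simp: dn)
  also have "\<dots> = (\<Sum>n<N. G n / b ^ N)" by (rule sum.nat_diff_reindex)
  finally show ?thesis by (simp add: sum_divide_distrib)
 qed
 ultimately have "psi a = Q cq / Q x * (Q (x * b) / Q b) / b ^ N" unfolding psi_def by (simp add: sums_iff diff_divide_distrib)
 moreover have "cq / (x * b) = a / b" "cq / x = a" by (simp_all add: x_def a_def)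
 then have th: "theta (x * b) = Q (x * b) * Q (a / b)" "theta x = Q x * Q a" by (simp_all add: theta_def)
 have "theta (x * b) * theta cr = b ^ N * theta x * theta (cr * b)" using theta_quasi_periodic[OF cr b(1), of N] by (simp add: x_def)
 then have "Q (x * b) * Q (a / b) * theta cr = b ^ N * (Q x * Q a) * theta (cr * b)" by (simp add: th)
 then have "Q cq * (Q (x * b) * Q (a / b) * theta cr) / (Q x * b ^ N) = Q cq * Q a * theta (cr * b)" using x0 b by (simp add: field_simps)
 ultimately show ?thesis using qpoch_inf_nonzero[OF b(2)] by (simp add: field_simps)
qed

text \<open>Both sides are holomorphic in \<open>a\<close> on the disc of radius
  \<open>norm b\<close>, and the special values \<open>cq ^ Suc N / cr\<close> accumulate at 0, an
  interior point of it; the identity theorem gives the rest.\<close>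

theorem ramanujan_psi:
 assumes a: "norm a < norm b"
 shows "psi a * Q (a / b) * (theta cr * Q b) = Q cq * Q a * theta (cr * b)"
proof -
 let ?F = "\<lambda>a. psi a * Q (a / b) * (theta cr * Q b) - Q cq * Q a * theta (cr * b)"
 define s where "s N = cq ^ Suc N / cr" for N
 have lim: "s \<longlonglongrightarrow> 0" using tendsto_divide[OF LIMSEQ_Suc[OF LIMSEQ_power_zero[of cq]] tendsto_const[of cr]] q01 r
  by (simp add: s_def[abs_def])
 define U where "U = s ` {N. norm (s N) < norm b}"
 have "?F a = 0"
 proof (rule analytic_continuation[of ?F "ball 0 (norm b)" U 0])
  show "?F holomorphic_on ball 0 (norm b)" using b by (intro holomorphic_intros holomorphic_psi) auto
  show "U \<subseteq> ball 0 (norm b)" by (auto simp: U_def)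
  show "(0::complex) \<in> ball 0 (norm b)" using b by simp
  show "0 islimpt U" unfolding islimpt_approachable
  proof (intro allI impI)
   fix e :: real assume "e > 0"
   then have "\<forall>\<^sub>F N in sequentially. dist (s N) 0 < min e (norm b)" using b by (intro tendstoD[OF lim]) auto
   then obtain N where N: "norm (s N) < min e (norm b)" by (auto simp: eventually_sequentially)
   then show "\<exists>x'\<in>U. x' \<noteq> 0 \<and> dist x' 0 < e" using r by (intro bexI[of _ "s N"]) (auto simp: U_def s_def)
  qed
  show "?F z = 0" if "z \<in> U" for z using that psi_special by (auto simp: U_def s_def)
 qed (use a in auto)
 then show ?thesis by simp
qed

text \<open>Counting the terms of Heine's series at \<open>cr / cq ^ N\<close> from index
  \<open>N\<close> and dividing by \<open>b ^ N\<close> gives the terms of \<open>psi\<close> with a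
  weight \<open>v\<close> that tends to a constant. Tannery's theorem applies to the two halves
  separately.\<close>

lemma heine_asymptotics:
 assumes a: "norm a < norm b"
 shows "(\<lambda>N. heine a b c (cr / cq ^ N) / b ^ N) \<longlonglongrightarrow>
  Q (c / b) * Q a * theta (cr * b) / (Q c * theta cr * Q (a / b))"
proof -
 define v where "v n = qpoch (c / b) cq n / qpoch cq cq n" for n
 define vl where "vl = Q (c / b) / Q cq"
 have vlim: "v \<longlonglongrightarrow> vl" unfolding v_def vl_def by (intro tendsto_intros qpoch_LIMSEQ qpoch_q_nonzero)
 have vb: "norm (v n) \<le> phi_bound (c / b) 0 0" for n unfolding v_def by (rule norm_ratio_le)
 have a1: "norm a \<le> 1" using a b by simp
 define G where "G N n = heine_coeff b c n * (Q (a * (cr / cq ^ N) * cq ^ n) / Q (cr / cq ^ N * cq ^ n)) / b ^ N" for N n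
 have Gup: "G N (m + N) = v (m + N) * up a m" for N m using b by (simp add: G_def heine_coeff_def v_def up_def power_add mult_ac)
 have Gdn: "G N (N - Suc j) = v (N - Suc j) * dn a (Suc j)" if jN: "j < N" for N j
 proof -
  obtain k where k: "N = Suc j + k" using less_imp_Suc_add[OF jN] by auto
  have e: "cr / cq ^ N * cq ^ (N - Suc j) = cr / cq ^ Suc j"
   "a * (cr / cq ^ N) * cq ^ (N - Suc j) = a * cr / cq ^ Suc j" by (simp_all add: k power_add)
  have p: "b ^ (N - Suc j) / b ^ N = 1 / b ^ Suc j" using b by (simp add: k power_add)
  have "u * b ^ (N - Suc j) * X / b ^ N = u * (X / b ^ Suc j)" for u X
  proof -
   have "u * b ^ (N - Suc j) * X / b ^ N = u * X * (b ^ (N - Suc j) / b ^ N)" by simp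
   then show ?thesis by (simp only: p) simp
  qed
  then show ?thesis unfolding G_def heine_coeff_def v_def[symmetric] dn_def e .
 qed
 have up: "(\<lambda>N. \<Sum>m. v (m + N) * up a m) \<longlonglongrightarrow> (\<Sum>m. vl * up a m)"
 proof (rule tannerys_theorem[where M = "\<lambda>m. phi_bound (c / b) 0 0 * norm (up a m)", THEN conjunct2, THEN conjunct2])
  show "(\<lambda>N. v (m + N) * up a m) \<longlonglongrightarrow> vl * up a m" for m
   using tendsto_mult_right[OF LIMSEQ_ignore_initial_segment[OF vlim, of m], of "up a m"] by (simp only: add.commute)
  have "norm (v (m + N) * up a m) \<le> phi_bound (c / b) 0 0 * norm (up a m)" for m N
   unfolding norm_mult by (rule mult_right_mono[OF vb]) simp
  then show "\<forall>\<^sub>F (m, N) in at_top \<times>\<^sub>F sequentially. norm (v (m + N) * up a m) \<le> phi_bound (c / b) 0 0 * norm (up a m)"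
   by (intro always_eventually) auto
 qed (auto intro!: summable_mult summable_up a1)
 \<comment> \<open>For fixed \<open>N\<close> only finitely many terms lie to the left; padding with
   zeros makes them a series, so that a limit in \<open>N\<close> can be taken termwise.\<close>
 have dn: "(\<lambda>N. \<Sum>j. if j < N then v (N - Suc j) * dn a (Suc j) else 0) \<longlonglongrightarrow> (\<Sum>j. vl * dn a (Suc j))"
 proof (rule tannerys_theorem[where M = "\<lambda>j. phi_bound (c / b) 0 0 * norm (dn a (Suc j))", THEN conjunct2, THEN conjunct2])
  show "(\<lambda>N. if j < N then v (N - Suc j) * dn a (Suc j) else 0) \<longlonglongrightarrow> vl * dn a (Suc j)" for j
  proof -
   have "(\<lambda>N. v (N - Suc j)) \<longlonglongrightarrow> vl" by (rule LIMSEQ_offset[where k = "Suc j"]) (simp add: vlim)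
   then have "(\<lambda>N. v (N - Suc j) * dn a (Suc j)) \<longlonglongrightarrow> vl * dn a (Suc j)" by (intro tendsto_intros)
   then show ?thesis by (rule Lim_transform_eventually) (use eventually_gt_at_top[of j] in eventually_elim, simp)
  qed
  show "\<forall>\<^sub>F (j, N) in at_top \<times>\<^sub>F sequentially.
    norm (if j < N then v (N - Suc j) * dn a (Suc j) else 0) \<le> phi_bound (c / b) 0 0 * norm (dn a (Suc j))"
   by (rule always_eventually)
    (auto simp: norm_mult intro!: mult_right_mono mult_nonneg_nonneg vb phi_bound_nonneg)
  show "summable (\<lambda>j. phi_bound (c / b) 0 0 * norm (dn a (Suc j)))"
   using summable_dn[OF a] by (intro summable_mult) (subst summable_Suc_iff)
 qed auto
 have eq: "heine a b c (cr / cq ^ N) / b ^ N = Q b / Q c *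
   ((\<Sum>m. v (m + N) * up a m) + (\<Sum>j. if j < N then v (N - Suc j) * dn a (Suc j) else 0))" for N
 proof -
  have s: "summable (\<lambda>m. G N (m + N))" unfolding Gup
  proof (rule summable_norm_cancel, rule summable_comparison_test')
   show "summable (\<lambda>m. phi_bound (c / b) 0 0 * norm (up a m))" by (intro summable_mult summable_up a1)
   show "norm (norm (v (n + N) * up a n)) \<le> phi_bound (c / b) 0 0 * norm (up a n)" for n
    by (auto simp: norm_mult intro!: mult_right_mono vb)
  qed
  then have sG: "summable (G N)" by (simp add: summable_iff_shift)
  have "(\<Sum>n. G N n) = (\<Sum>m. G N (m + N)) + (\<Sum>n<N. G N n)" by (rule suminf_split_initial_segment[OF sG])
  also have "(\<Sum>n<N. G N n) = (\<Sum>j<N. G N (N - Suc j))" by (rule sum.nat_diff_reindex[symmetric])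
  also have "\<dots> = (\<Sum>j<N. if j < N then v (N - Suc j) * dn a (Suc j) else 0)" by (intro sum.cong) (auto simp: Gdn)
  also have "\<dots> = (\<Sum>j. if j < N then v (N - Suc j) * dn a (Suc j) else 0)" by (rule suminf_finite[symmetric]) auto
  finally have "(\<Sum>n. G N n) = (\<Sum>m. v (m + N) * up a m) + (\<Sum>j. if j < N then v (N - Suc j) * dn a (Suc j) else 0)"
   by (simp add: Gup)
  moreover have "(\<Sum>n. G N n) = (\<Sum>n. G N n * b ^ N) / b ^ N"
   using b sG by (subst suminf_divide[symmetric]) (auto intro!: summable_mult2)
  moreover have "(\<Sum>n. G N n * b ^ N) =
    (\<Sum>m. heine_coeff b c m * (Q (a * (cr / cq ^ N) * cq ^ m) / Q (cr / cq ^ N * cq ^ m)))" using b by (simp add: G_def)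
  ultimately have "(\<Sum>m. heine_coeff b c m * (Q (a * (cr / cq ^ N) * cq ^ m) / Q (cr / cq ^ N * cq ^ m))) / b ^ N
   = (\<Sum>m. v (m + N) * up a m) + (\<Sum>j. if j < N then v (N - Suc j) * dn a (Suc j) else 0)" by (simp only:)
  then show ?thesis unfolding heine_def by (simp only: times_divide_eq_right[symmetric])
 qed
 have "(\<lambda>N. heine a b c (cr / cq ^ N) / b ^ N) \<longlonglongrightarrow>
   Q b / Q c * ((\<Sum>m. vl * up a m) + (\<Sum>j. vl * dn a (Suc j)))" unfolding eq by (intro tendsto_intros up dn)
 also have "(\<Sum>m. vl * up a m) + (\<Sum>j. vl * dn a (Suc j)) = vl * psi a"
  using summable_norm_cancel[OF summable_up[OF a1]] summable_norm_cancel[OF summable_dn[OF a]]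
  by (simp add: psi_def suminf_mult summable_Suc_iff distrib_left)
 also have "Q b / Q c * (vl * psi a) = Q (c / b) * Q a * theta (cr * b) / (Q c * theta cr * Q (a / b))"
 proof -
  have "Q (a / b) \<noteq> 0" using a b by (intro qpoch_inf_nonzero) (simp add: norm_divide)
  moreover have "theta cr \<noteq> 0"
  proof -
   have "cq / cr = of_real (q / r)" by simp
   then have "Q (cq / cr) \<noteq> 0" using slit_plane_qpoch_nonzero[OF neg_slit_plane[of "q / r"]] r q01
    by (simp add: divide_nonneg_neg)
   then show ?thesis using Q_cr_nonzero by (simp add: theta_def)
  qed
  \<comment> \<open>For \<open>Q c = 0\<close> both sides are zero by division by zero.\<close>
  ultimately show ?thesis using ramanujan_psi[OF a] qpoch_q_nonzero unfolding vl_def by (cases "Q c = 0") (simp_all add: field_simps)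
 qed
 finally show ?thesis .
qed

end

section \<open>The solution in \<open>\<ell>\<^sup>2\<close> at \<open>\<infinity>\<close>\<close>

lemma mu_inverse: "mu (inverse y) = mu (y :: 'a :: field)" by (simp add: mu_def add.commute)

lemma mu_of_real: "mu (complex_of_real x) = of_real (mu x)" by (simp add: mu_def)

text \<open>The two preimages of \<open>x\<close> are inverse to each other, so one of them is not
  inside the unit disc. The upper bound on its modulus makes estimates in \<open>y\<close> uniform
  for bounded \<open>x\<close>.\<close>

lemma mu_surj: "\<exists>y. 1 \<le> norm y \<and> norm y \<le> 2 * norm x + 1 \<and> mu y = (x::complex)"
proof -
 define s where "s = csqrt (x^2 - 1)"
 have s: "(x + s) * (x - s) = 1" by (simp add: s_def algebra_simps flip: power2_eq_square)
 then have n: "norm (x + s) * norm (x - s) = 1" by (metis norm_mult norm_one)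
 have inv: "inverse (x + s) = x - s" using s inverse_unique by blast
 have m: "mu (x + s) = x" by (simp add: mu_def inv)
 define y where "y = (if 1 \<le> norm (x + s) then x + s else inverse (x + s))"
 have y: "1 \<le> norm y" "mu y = x"
 proof -
  show "mu y = x" using m by (simp add: y_def mu_inverse)
  show "1 \<le> norm y"
  proof (cases "1 \<le> norm (x + s)")
   case False
   have "0 < norm (x + s)" using n by (metis mult_zero_left norm_ge_zero order_le_less zero_neq_one)
   then have "1 \<le> norm (inverse (x + s))" using False unfolding norm_inverse by (intro one_le_inverse) auto
   then show ?thesis using False by (simp add: y_def)
  qed (simp add: y_def)
 qed
 have "y = 2 * x - inverse y" using y(2) by (simp add: mu_def field_simps)
 then have "norm y \<le> norm (2 * x) + norm (inverse y)" by (metis norm_triangle_ineq4)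
 also have "norm (inverse y) \<le> 1" using y(1) by (simp add: norm_inverse inverse_le_1_iff)
 finally show ?thesis using y by (intro exI[of _ y]) (simp add: norm_mult)
qed

text \<open>The induction that fits a three-term recurrence solved downwards from large
  indices.\<close>

lemma int_down_induct:
 fixes P :: "int \<Rightarrow> bool"
 assumes base: "\<And>k. K \<le> k \<Longrightarrow> P k" and step: "\<And>k. P k \<Longrightarrow> P (k + 1) \<Longrightarrow> P (k - 1)"
 shows "P k"
proof -
 have "P k \<and> P (k + 1)" for k
 proof (cases "K \<le> k")
  case True
  then show ?thesis using base by simp
 next
  case False
  then have "k \<le> K" by simp
  then show ?thesis
  proof (induction k rule: int_le_induct)
   case base
   then show ?case using assms(1) by simp
  next
   case (step i)
   then show ?case using assms(2)[of i] by simp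
  qed
 qed
 then show ?thesis by simp
qed

section \<open>Weights and the three-term recurrence\<close>

locale jacobi_fun = q_real +
 fixes r c d :: real
 assumes r: "r < 0" and c: "0 < c" "c \<le> q^2" and d: "d \<noteq> 0" "\<bar>d\<bar> < 1" and cd: "\<bar>c / d\<bar> < 1"
begin

abbreviation "Q x \<equiv> qpoch_inf x (complex_of_real q)"
abbreviation "a \<equiv> a_coeff q r c d"
abbreviation "b \<equiv> b_coeff q r c d"
abbreviation "w \<equiv> w_fun q r c d"
abbreviation "f \<equiv> f_fun q r c d"

lemma c_less_1: "c < 1" using c q01 by (simp add: power2_eq_square) (smt (verit) mult_le_one mult_less_cancel_left2)

lemma Q_c_nonzero: "Q (of_real c) \<noteq> 0" using c c_less_1 by (intro qpoch_inf_nonzero) auto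

lemma qpoch_inf_of_real: "Q (of_real x) = of_real (qpoch_inf x q)"
proof -
 have "(\<lambda>k. 1 - of_real x * complex_of_real q ^ k) has_prod Q (of_real x)" unfolding qpoch_inf_def
  by (intro convergent_prod_has_prod abs_convergent_prod_imp_convergent_prod abs_convergent_qpoch)
 then have h: "(\<lambda>k. complex_of_real (1 - x * q ^ k)) has_prod Q (of_real x)" by simp
 have "abs_convergent_prod (\<lambda>k. 1 - x * q ^ k)"
  using q01 by (simp add: abs_convergent_prod_conv_summable abs_mult power_abs summable_mult)
 then have "(\<lambda>k. 1 - x * q ^ k) has_prod qpoch_inf x q"
  unfolding qpoch_inf_def by (intro convergent_prod_has_prod abs_convergent_prod_imp_convergent_prod)
 then have "(\<lambda>k. complex_of_real (1 - x * q ^ k)) has_prod of_real (qpoch_inf x q)" by (simp only: has_prod_of_real_iff)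
 with h show ?thesis by (rule has_prod_unique2)
qed

lemma real_qpoch_inf_rec: "qpoch_inf x q = (1 - x) * qpoch_inf (x * q) q"
proof -
 have "complex_of_real (qpoch_inf x q) = of_real ((1 - x) * qpoch_inf (x * q) q)"
  unfolding of_real_mult of_real_diff qpoch_inf_of_real[symmetric] of_real_1 by (rule qpoch_inf_rec)
 then show ?thesis by (simp only: of_real_eq_iff)
qed

lemma real_qpoch_inf_pos:
 assumes "x \<le> 0"
 shows "0 < qpoch_inf x q"
proof -
 have "(\<lambda>n. complex_of_real (qpoch x q n)) \<longlonglongrightarrow> complex_of_real (qpoch_inf x q)"
  using qpoch_LIMSEQ[of "of_real x"] by (simp add: qpoch_inf_of_real qpoch_def)
 then have lim: "(\<lambda>n. qpoch x q n) \<longlonglongrightarrow> qpoch_inf x q" by (simp only: tendsto_of_real_iff)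
 have "1 \<le> qpoch x q n" for n unfolding qpoch_def using assms q01 by (intro prod_ge_1) (auto simp: mult_nonpos_nonneg)
 then show ?thesis using LIMSEQ_le_const[OF lim, of 1] by force
qed

text \<open>The weight without its power of \<open>d\<close>. It tends to 1 at -infinity and
  normalises the Jost solution as well as \<open>Phi\<close>.\<close>

definition om :: "int \<Rightarrow> real" where
 "om k = sqrt (qpoch_inf (c * q powi (1 - k) / (d^2 * r)) q / qpoch_inf (q powi (1 - k) / r) q)"

lemma w_om: "w k = d powi k * om k" by (simp add: w_fun_def om_def)

definition A :: "int \<Rightarrow> real" where "A k = 1 - q powi (-k) / r"
definition B :: "int \<Rightarrow> real" where "B k = 1 - c * q powi (-k) / (d^2 * r)"

lemma A_ge: "1 < A k" and B_ge: "1 < B k" using r q01 c d by (auto simp: A_def B_def divide_pos_neg mult_pos_neg)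

lemma a_AB: "a k = 1 / 2 * sqrt (A k * B k)" by (simp add: a_coeff_def A_def B_def)

lemma a_pos: "0 < a k" using A_ge[of k] B_ge[of k] by (simp add: a_AB)

lemma om_args: "c * q powi i / (d^2 * r) \<le> 0" "q powi i / r \<le> 0"
 using r q01 c d by (auto intro!: divide_nonneg_nonpos mult_nonneg_nonpos)

lemma om_pos: "0 < om k" unfolding om_def using om_args real_qpoch_inf_pos by simp

lemma om_Suc: "om (k + 1) = sqrt (B k / A k) * om k"
proof -
 have "q powi (- k) * q = q powi (1 - k)" using power_int_add_1[of q "-k"] by (simp add: add.commute)
 then have "qpoch_inf (c * q powi (1 - (k + 1)) / (d^2 * r)) q = B k * qpoch_inf (c * q powi (1 - k) / (d^2 * r)) q"
  "qpoch_inf (q powi (1 - (k + 1)) / r) q = A k * qpoch_inf (q powi (1 - k) / r) q"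
  using real_qpoch_inf_rec[of "c * q powi (- k) / (d^2 * r)"] real_qpoch_inf_rec[of "q powi (- k) / r"]
  by (simp_all add: A_def B_def mult_ac)
 then show ?thesis by (simp add: om_def flip: real_sqrt_mult)
qed

lemma w_Suc: "w (k + 1) = d * sqrt (B k / A k) * w k" using d by (simp add: w_om om_Suc power_int_add_1)

lemma w_nonzero: "w k \<noteq> 0" using om_pos[of k] d by (simp add: w_om)

text \<open>Together with \<open>a_w_down\<close> this removes the square roots: after conjugation
  by \<open>w\<close> the recurrence has the coefficients \<open>A\<close> and \<open>B\<close>,
  which are affine in \<open>q powi (- k)\<close> and can be compared with the q-difference
  equation.\<close>

lemma a_w_up: "a k * w (k + 1) = d / 2 * B k * w k"
proof -
 have "sqrt (A k * B k) * sqrt (B k / A k) = sqrt ((B k)^2)" using A_ge[of k] by (simp add: power2_eq_square flip: real_sqrt_mult)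
 also have "\<dots> = B k" using B_ge[of k] by simp
 finally have "sqrt (A k * B k) * sqrt (B k / A k) = B k" .
 then show ?thesis unfolding w_Suc a_AB
  by (metis (no_types, opaque_lifting) mult.assoc mult.commute mult.left_commute times_divide_eq_left mult_1)
qed

lemma a_w_down: "a (k - 1) * w (k - 1) = A (k - 1) / (2 * d) * w k"
proof -
 have AB: "0 < A (k - 1)" "0 < B (k - 1)" using A_ge[of "k - 1"] B_ge[of "k - 1"] by auto
 have "A (k - 1) * sqrt (B (k - 1) / A (k - 1)) = sqrt ((A (k - 1))^2 * (B (k - 1) / A (k - 1)))"
  using AB by (subst real_sqrt_mult) simp
 also have "(A (k - 1))^2 * (B (k - 1) / A (k - 1)) = A (k - 1) * B (k - 1)" using AB by (simp add: power2_eq_square)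
 finally show ?thesis using w_Suc[of "k - 1"] d by (simp add: a_AB field_simps)
qed

definition Phi :: "int \<Rightarrow> complex \<Rightarrow> complex" where
 "Phi k x = of_real (w k) * f k x"

definition zk :: "int \<Rightarrow> complex" where "zk k = of_real (r * q powi k)"

lemma zk_slit: "zk k \<in> slit_plane"
proof -
 have "0 \<le> q powi k" using q01 by simp
 then have "r * q powi k \<le> 0" using r by (simp add: mult_nonpos_nonneg)
 then show ?thesis by (auto simp: zk_def slit_plane_def simp del: of_real_mult)
qed

lemma zk_add: "zk (k + 1) = of_real q * zk k" "zk (k + 2) = (of_real q)^2 * zk k" by (simp_all add: zk_def power_int_add mult_ac)

lemma f_heine:
 assumes "y \<noteq> 0" "norm (of_real d / y) < 1"
 shows "f k (mu y) = heine (of_real d * y) (of_real d / y) (of_real c) (zk k)" unfolding f_fun_mu[OF assms(1)] zk_def[symmetric]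
 by (rule phi21_eq_heine) (use assms d Q_c_nonzero zk_slit in auto)

text \<open>Heine's series needs a second numerator parameter of modulus below 1. The form
  \<open>f_heine\<close> serves for \<open>norm y \<ge> 1\<close>; this one exchanges the
  parameters, so that the geometric factor of the asymptotics becomes a power of
  \<open>d * y\<close>.\<close>

lemma f_heine':
 assumes "y \<noteq> 0" "norm (of_real d * y) < 1"
 shows "f k (mu y) = heine (of_real d / y) (of_real d * y) (of_real c) (zk k)"
 using f_heine[of "inverse y" k] assms by (simp add: mu_inverse divide_inverse)

text \<open>The q-difference equation at the argument with index \<open>k - 1\<close>, so that
  multiplication by \<open>q\<close> and \<open>q^2\<close> reaches the indices \<open>k\<close> and
  \<open>k + 1\<close>. The parameters enter only through their sum \<open>2 * d * x\<close> and
  product \<open>d^2\<close>, which is why \<open>y\<close> disappears.\<close>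

lemma f_recurrence:
 "of_real (A (k - 1)) / (2 * of_real d) * f (k - 1) x + of_real d / 2 * of_real (B k) * f (k + 1) x
   + of_real (b k) * f k x = x * f k x"
proof -
 obtain y where y: "1 \<le> norm y" "mu y = x" using mu_surj by blast
 then have y0: "y \<noteq> 0" by auto
 have yd: "norm (of_real d / y) < 1" using y(1) d by (simp add: norm_divide divide_less_eq)
 define z where "z = zk (k - 1)"
 have z: "zk k = of_real q * z" "zk (k + 1) = (of_real q)^2 * z" using zk_add[of "k - 1"] by (simp_all add: z_def add.commute)
 have dd: "of_real d / y \<noteq> 0" using d y0 by simp
 have ab: "of_real d * y + of_real d / y = 2 * of_real d * x" "of_real d * y * (of_real d / y) = (of_real d)^2"
  unfolding y(2)[symmetric] mu_def using y0 by (auto simp: field_simps power2_eq_square)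
 have h0: "(1 - z) * f (k - 1) x * q - (q + c - q * z * (of_real d * y + of_real d / y)) * f k x
   + (c - q * (of_real d * y) * (of_real d / y) * z) * f (k + 1) x = 0"
  using heine_q_difference[OF yd dd Q_c_nonzero, of z "of_real d * y"] zk_slit[of "k - 1"]
  by (simp add: f_heine[OF y0 yd, unfolded y(2)] z z_def[symmetric])
 have ab3: "of_real q * (of_real d * y) * (of_real d / y) * z = of_real q * (of_real d)^2 * z" using ab(2) by (metis mult.assoc)
 have main: "(1 - z) * f (k - 1) x * q - (q + c - q * z * (2 * of_real d * x)) * f k x
   + (c - of_real q * (of_real d)^2 * z) * f (k + 1) x = 0" using h0 by (simp only: ab(1) ab3)
 have z0: "z \<noteq> 0" using r by (simp add: z_def zk_def)
 have inv: "complex_of_real (q powi (- k)) = of_real r / (of_real q * z)"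
  "complex_of_real (q powi (- (k - 1))) = of_real r / z"
  using r by (simp_all add: z_def zk_def power_int_minus power_int_diff field_simps)
 have r0: "complex_of_real r \<noteq> 0" using r by simp
 have A: "of_real (A (k - 1)) = 1 - 1 / z" unfolding A_def of_real_diff of_real_divide inv using r0 by simp
 have B: "of_real (B k) = 1 - of_real c / ((of_real d)^2 * (of_real q * z))"
  unfolding B_def of_real_diff of_real_divide of_real_mult inv using r0 z0 d by (simp add: field_simps)
 have bb: "of_real (b k) = of_real (c + q) / (2 * of_real d * (of_real q * z))"
  unfolding b_coeff_def of_real_diff of_real_divide of_real_mult inv using r0 z0 d by (simp add: field_simps)
 have nz: "2 * of_real d * (of_real q * z) \<noteq> 0" using z0 d by simp
 have "(2 * of_real d * (of_real q * z)) * (of_real (A (k - 1)) / (2 * of_real d) * f (k - 1) x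
   + of_real d / 2 * of_real (B k) * f (k + 1) x + of_real (b k) * f k x - x * f k x) = 0"
 proof -
  define D where "D = complex_of_real d"
  have D: "D \<noteq> 0" using d by (simp add: D_def)
  have 1: "2 * D * (of_real q * z) * ((1 - 1 / z) / (2 * D) * X) = of_real q * (z - 1) * X" for X using z0 D by (simp add: field_simps)
  have 2: "2 * D * (of_real q * z) * (D / 2 * (1 - of_real c / (D^2 * (of_real q * z))) * X)
    = (D^2 * of_real q * z - of_real c) * X" for X using z0 D by (simp add: field_simps power2_eq_square)
  have 3: "2 * D * (of_real q * z) * (of_real (c + q) / (2 * D * (of_real q * z)) * X) = of_real (c + q) * X" for X using z0 D by simp
  show ?thesis unfolding A B bb D_def[symmetric] right_diff_distrib[of "2 * D * (of_real q * z)"]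
    distrib_left[of "2 * D * (of_real q * z)"] 1 2 3 using main unfolding D_def[symmetric] by (simp add: algebra_simps)
 qed
 then show ?thesis using nz by (metis (no_types, lifting) eq_iff_diff_eq_0 mult_eq_0_iff)
qed

lemma Phi_recurrence: "of_real (a k) * Phi (k + 1) x + of_real (b k) * Phi k x + of_real (a (k - 1)) * Phi (k - 1) x = x * Phi k x"
proof -
 have "of_real (a k) * Phi (k + 1) x = of_real (a k * w (k + 1)) * f (k + 1) x"
  "of_real (a (k - 1)) * Phi (k - 1) x = of_real (a (k - 1) * w (k - 1)) * f (k - 1) x" by (simp_all add: Phi_def)
 then have "of_real (a k) * Phi (k + 1) x + of_real (b k) * Phi k x + of_real (a (k - 1)) * Phi (k - 1) x
  = of_real (w k) * (of_real (A (k - 1)) / (2 * of_real d) * f (k - 1) x + of_real d / 2 * of_real (B k) * f (k + 1) x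
   + of_real (b k) * f k x)" unfolding a_w_up a_w_down by (simp add: Phi_def algebra_simps)
 then show ?thesis unfolding f_recurrence by (simp add: Phi_def)
qed

lemma Phi_down: "Phi (k - 1) x = ((x - of_real (b k)) * Phi k x - of_real (a k) * Phi (k + 1) x) / of_real (a (k - 1))"
 using Phi_recurrence[of k x] a_pos[of "k - 1"] by (simp add: field_simps)

section \<open>Entire dependence on the spectral parameter and decay at +infinity\<close>

definition fc :: "nat \<Rightarrow> complex \<Rightarrow> complex" where
 "fc n x = (\<Prod>j<n. 1 - 2 * of_real d * x * of_real q ^ j + (of_real d)^2 * (of_real q ^ j)^2)
   / (qpoch (of_real q) (of_real q) n * qpoch (of_real c) (of_real q) n)"

text \<open>Pairing the factors with \<open>d * y\<close> and \<open>d / y\<close> leaves a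
  polynomial in \<open>mu y\<close>; the coefficients therefore do not depend on the preimage chosen
  in \<open>f_fun\<close>.\<close>

lemma fc_mu:
 assumes y: "y \<noteq> 0"
 shows "fc n (mu y) = phi_coeff (of_real d * y) (of_real d / y) (of_real c) n"
proof -
 have "qpoch (of_real d * y) (of_real q) n * qpoch (of_real d / y) (of_real q) n =
  (\<Prod>j<n. 1 - 2 * of_real d * mu y * of_real q ^ j + (of_real d)^2 * (of_real q ^ j)^2)"
  unfolding qpoch_def prod.distrib[symmetric] using y by (intro prod.cong) (simp_all add: mu_def field_simps power2_eq_square)
 then show ?thesis by (simp add: fc_def phi_coeff_def)
qed

text \<open>This is \<open>phi_bound\<close> at its worst for
  \<open>1 \<le> norm y \<le> 2 * R + 1\<close>, the range that \<open>mu_surj\<close> provides for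
  \<open>norm x \<le> R\<close>.\<close>

definition fbound :: "real \<Rightarrow> real" where
 "fbound R = exp ((\<bar>d\<bar> * (2 * R + 1) + \<bar>d\<bar> + c + q) / (1 - q)) / (norm (Q (of_real q)) * norm (Q (of_real c)))"

lemma fbound_nonneg: "0 \<le> fbound R" by (simp add: fbound_def)

lemma phi_bound_le_fbound:
 assumes "1 \<le> norm y" "norm y \<le> 2 * R + 1"
 shows "phi_bound (of_real d * y) (of_real d / y) (of_real c) \<le> fbound R"
proof -
 have "\<bar>d\<bar> * norm y \<le> \<bar>d\<bar> * (2 * R + 1)" using assms by (intro mult_left_mono) auto
 moreover have "\<bar>d\<bar> / norm y \<le> \<bar>d\<bar>" using assms mult_left_mono[of 1 "norm y" "\<bar>d\<bar>"] by (subst pos_divide_le_eq) auto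
 ultimately show ?thesis unfolding phi_bound_def fbound_def using c q01
  by (intro divide_right_mono) (auto simp: norm_mult norm_divide intro!: divide_right_mono)
qed

lemma norm_fc_le:
 assumes "norm x \<le> R"
 shows "norm (fc n x) \<le> fbound R"
proof -
 obtain y where y: "1 \<le> norm y" "norm y \<le> 2 * norm x + 1" "mu y = x" using mu_surj by blast
 then have "norm (fc n x) \<le> phi_bound (of_real d * y) (of_real d / y) (of_real c)"
  using fc_mu[of y n] norm_phi_coeff_le[OF Q_c_nonzero, of "of_real d * y" "of_real d / y" n] by force
 also have "\<dots> \<le> fbound R" using y assms by (intro phi_bound_le_fbound) auto
 finally show ?thesis .
qed

lemma f_series:
 assumes k: "norm (zk k) < 1"
 shows "f k x = (\<Sum>n. fc n x * zk k ^ n)"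
  and "norm x \<le> R \<Longrightarrow> norm (f k x - 1) \<le> fbound R * norm (zk k) / (1 - norm (zk k))"
proof -
 obtain y where y: "1 \<le> norm y" "norm y \<le> 2 * norm x + 1" "mu y = x" using mu_surj by blast
 then have y0: "y \<noteq> 0" by auto
 have eq: "f k x = phi21_series (of_real d * y) (of_real d / y) (of_real c) (of_real q) (zk k)"
  using f_fun_mu[OF y0, of q r c d k] k by (simp add: y(3) zk_def phi21_def)
 then show "f k x = (\<Sum>n. fc n x * zk k ^ n)" using phi21_series_sums(1)[OF Q_c_nonzero k] fc_mu[OF y0] y(3) by (simp add: sums_iff)
 assume x: "norm x \<le> R"
 have "norm (f k x - 1) \<le> phi_bound (of_real d * y) (of_real d / y) (of_real c) * norm (zk k) / (1 - norm (zk k))"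
  unfolding eq by (rule phi21_series_near_1[OF Q_c_nonzero k])
 also have "\<dots> \<le> fbound R * norm (zk k) / (1 - norm (zk k))"
  using k y x by (intro divide_right_mono mult_right_mono phi_bound_le_fbound) auto
 finally show "norm (f k x - 1) \<le> fbound R * norm (zk k) / (1 - norm (zk k))" .
qed

lemma norm_zk: "norm (zk k) = \<bar>r\<bar> * q powi k" using q01 by (simp add: zk_def abs_mult del: of_real_mult)

lemma zk_mono: "K \<le> k \<Longrightarrow> norm (zk k) \<le> norm (zk K)"
 using q01 unfolding norm_zk by (intro mult_left_mono power_int_decreasing) auto

lemma ex_zk_small: "e > 0 \<Longrightarrow> \<exists>K\<ge>0. \<forall>k\<ge>K. norm (zk k) < e"
proof -
 assume e: "e > 0"
 have "(\<lambda>n. \<bar>r\<bar> * q ^ n) \<longlonglongrightarrow> \<bar>r\<bar> * 0"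
  using q01 by (intro tendsto_intros LIMSEQ_power_zero) auto
 then have "\<forall>\<^sub>F n in sequentially. \<bar>r\<bar> * q ^ n < e"
  using e by (intro order_tendstoD(2)[of _ "\<bar>r\<bar> * 0"]) auto
 then obtain n where "\<bar>r\<bar> * q ^ n < e" by (auto simp: eventually_sequentially)
 then have "norm (zk (int n)) < e" by (simp add: norm_zk)
 then show ?thesis using zk_mono[of "int n"] by (intro exI[of _ "int n"]) fastforce
qed

text \<open>For large \<open>k\<close> the argument \<open>zk k\<close> is inside the unit disc and
  the power series with polynomial coefficients converges locally uniformly in \<open>x\<close>;
  smaller \<open>k\<close> follow from the recurrence, since \<open>a (k - 1) > 0\<close>.\<close>

lemma holomorphic_Phi: "Phi k holomorphic_on S"
proof -
 obtain K where K: "\<And>k. k \<ge> K \<Longrightarrow> norm (zk k) < 1" using ex_zk_small[of 1] by auto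
 have "Phi k holomorphic_on UNIV"
 proof (induction k rule: int_down_induct[where K = K])
  case (1 k)
  have "(\<lambda>x. \<Sum>n. fc n x * zk k ^ n) holomorphic_on UNIV"
  proof (rule holomorphic_suminf)
   show "(\<lambda>x. fc n x * zk k ^ n) holomorphic_on UNIV" for n
    unfolding fc_def using qpoch_nonzero[OF Q_c_nonzero] qpoch_nonzero[OF qpoch_q_nonzero] by (intro holomorphic_intros) auto
   fix x :: complex
   have "norm (fc n y * zk k ^ n) \<le> fbound (norm x + 1) * norm (zk k) ^ n" if "y \<in> cball x 1" for y n
   proof -
    have "norm y \<le> norm x + 1" using that norm_triangle_ineq2[of y x] by (simp add: dist_norm norm_minus_commute)
    then show ?thesis by (simp add: norm_mult norm_power mult_right_mono norm_fc_le)
   qed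
   moreover have "summable (\<lambda>n. fbound (norm x + 1) * norm (zk k) ^ n)"
    using K[OF 1] by (intro summable_mult summable_geometric) auto
   ultimately show "\<exists>d M. 0 < d \<and> cball x d \<subseteq> UNIV \<and> summable M \<and> (\<forall>y\<in>cball x d. \<forall>n. norm (fc n y * zk k ^ n) \<le> M n)"
    by (intro exI[of _ 1] exI[of _ "\<lambda>n. fbound (norm x + 1) * norm (zk k) ^ n"]) auto
  qed auto
  then show ?case unfolding Phi_def f_series(1)[OF K[OF 1], abs_def] by (intro holomorphic_intros)
 next
  case (2 k)
  then show ?case unfolding Phi_down[of k, abs_def] using a_pos[of "k - 1"] by (intro holomorphic_intros) auto
 qed
 then show ?thesis by (rule holomorphic_on_subset) auto
qed

lemma holomorphic_Phi' [holomorphic_intros]: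
 "g holomorphic_on S \<Longrightarrow> (\<lambda>x. Phi k (g x)) holomorphic_on S"
 using holomorphic_on_compose[OF _ holomorphic_Phi] by (simp add: o_def)

lemma continuous_Phi [continuous_intros]:
 "continuous_on S g \<Longrightarrow> continuous_on S (\<lambda>x. Phi k (g x))"
 using continuous_on_compose2[OF holomorphic_on_imp_continuous_on[OF holomorphic_Phi[of k UNIV]]] by blast

lemma cnj_Phi: "cnj (Phi k x) = Phi k (cnj x)"
proof -
 obtain K where K: "\<And>k. k \<ge> K \<Longrightarrow> norm (zk k) < 1" using ex_zk_small[of 1] by auto
 show ?thesis
 proof (induction k rule: int_down_induct[where K = K])
  case (1 k)
  have "cnj (fc n x * zk k ^ n) = fc n (cnj x) * zk k ^ n" for n by (simp add: fc_def zk_def qpoch_def)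
  moreover have "summable (\<lambda>n. fc n x * zk k ^ n)"
  proof (rule summable_comparison_test')
   show "summable (\<lambda>n. fbound (norm x) * norm (zk k) ^ n)" using K[OF 1] by (intro summable_mult summable_geometric) auto
   show "norm (fc n x * zk k ^ n) \<le> fbound (norm x) * norm (zk k) ^ n" for n
    by (simp add: norm_mult norm_power mult_right_mono norm_fc_le)
  qed
  from sums_cnj[THEN iffD2, OF summable_sums[OF this]]
  have "cnj (\<Sum>n. fc n x * zk k ^ n) = (\<Sum>n. cnj (fc n x * zk k ^ n))" by (simp add: sums_iff)
  ultimately show ?case by (simp add: Phi_def f_series(1)[OF K[OF 1]])
 next
  case (2 k)
  then show ?case unfolding Phi_down[of k] by simp
 qed
qed

text \<open>The square of the ratio \<open>w (k + 1) / w k\<close> is \<open>(c + d^2 *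
  \<bar>r\<bar> * q ^ k) / (1 + \<bar>r\<bar> * q ^ k)\<close>, which tends to
  \<open>c \<le> q^2\<close>. Hence \<open>w k / q ^ k\<close> is controlled by a convergent
  product.\<close>

lemma w_bound: "\<exists>C>0. \<forall>k\<ge>0. \<bar>w k\<bar> \<le> C * q powi k"
proof -
 define u where "u n = (\<bar>w (int n)\<bar> / q ^ n)^2" for n
 \<comment> \<open>Chosen so that
   \<open>c + d^2 * \<bar>r\<bar> * q ^ n \<le> q^2 * (1 + s * q ^ n)\<close>.\<close>
 define s where "s = d^2 * \<bar>r\<bar> / q^2"
 have s: "0 \<le> s" by (simp add: s_def)
 have step: "u (Suc n) \<le> u n * (1 + s * q ^ n)" for n
 proof -
  have AB: "0 < A (int n)" "0 < B (int n)" using A_ge[of "int n"] B_ge[of "int n"] by auto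
  have "(w (int (Suc n)))^2 = d^2 * (B (int n) / A (int n)) * (w (int n))^2"
   using w_Suc[of "int n"] AB by (simp add: power_mult_distrib add.commute)
  moreover have "d^2 * (B (int n) / A (int n)) = (c + d^2 * \<bar>r\<bar> * q ^ n) / (1 + \<bar>r\<bar> * q ^ n)"
  proof -
   have p: "0 < q ^ n" using q01 by simp
   have e: "A (int n) = (1 + \<bar>r\<bar> * q ^ n) / (\<bar>r\<bar> * q ^ n)" "B (int n) = (c + d^2 * \<bar>r\<bar> * q ^ n) / (d^2 * \<bar>r\<bar> * q ^ n)"
    using r p d by (simp_all add: A_def B_def power_int_minus field_simps)
   have n0: "1 + \<bar>r\<bar> * q ^ n > 0" using p by (simp add: add_pos_nonneg)
   show ?thesis unfolding e using r p d n0 by (simp add: field_simps)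
  qed
  moreover have "(c + d^2 * \<bar>r\<bar> * q ^ n) / (1 + \<bar>r\<bar> * q ^ n) \<le> c + d^2 * \<bar>r\<bar> * q ^ n"
   using c q01 by (simp add: divide_le_eq mult_le_cancel_left1 add_nonneg_nonneg)
    (smt (verit) mult_nonneg_nonneg zero_le_power zero_le_power2)
  moreover have "c + d^2 * \<bar>r\<bar> * q ^ n \<le> q^2 * (1 + s * q ^ n)" using c q01 by (simp add: s_def distrib_left)
  ultimately have le: "(c + d^2 * \<bar>r\<bar> * q ^ n) / (1 + \<bar>r\<bar> * q ^ n) \<le> q^2 * (1 + s * q ^ n)"
   and e: "(w (int (Suc n)))^2 = (c + d^2 * \<bar>r\<bar> * q ^ n) / (1 + \<bar>r\<bar> * q ^ n) * (w (int n))^2"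
   by (linarith, simp only:)
  have "(w (int (Suc n)))^2 \<le> q^2 * (1 + s * q ^ n) * (w (int n))^2"
   unfolding e by (rule mult_right_mono[OF le]) simp
  then show ?thesis using q01 by (simp add: u_def power_divide field_simps power_mult_distrib del: of_nat_Suc)
 qed
 have u_le: "u n \<le> u 0 * exp (\<Sum>i<n. s * q ^ i)" for n
 proof (induction n)
  case (Suc n)
  have "u (Suc n) \<le> u n * (1 + s * q ^ n)" by (rule step)
  also have "\<dots> \<le> (u 0 * exp (\<Sum>i<n. s * q ^ i)) * exp (s * q ^ n)"
   using Suc s q01 by (intro mult_mono exp_ge_add_one_self) (auto simp: u_def)
  finally show ?case by (simp add: exp_add mult.assoc)
 qed simp
 define C where "C = sqrt (u 0 * exp (s / (1 - q)))"
 have "u n \<le> u 0 * exp (s / (1 - q))" for n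
 proof -
  have "(\<Sum>i<n. q ^ i) \<le> 1 / (1 - q)" using sum_le_suminf[of "\<lambda>i. q ^ i" "{..<n}"] q01 by (simp add: suminf_geometric)
  then have "(\<Sum>i<n. s * q ^ i) \<le> s / (1 - q)" using mult_left_mono[OF _ s] by (fastforce simp: sum_distrib_left)
  then have "u 0 * exp (\<Sum>i<n. s * q ^ i) \<le> u 0 * exp (s / (1 - q))" by (intro mult_left_mono) (auto simp: u_def)
  then show ?thesis using u_le order_trans by blast
 qed
 then have "\<bar>w (int n)\<bar> / q ^ n \<le> C" for n unfolding C_def using q01 by (intro real_le_rsqrt) (simp add: u_def)
 then have "\<bar>w (int n)\<bar> \<le> C * q ^ n" for n using q01 by (simp add: divide_le_eq)
 moreover have "C > 0" using w_nonzero[of 0] by (simp add: C_def u_def)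
 ultimately show ?thesis by (intro exI[of _ C]) (auto simp: zero_le_imp_eq_int dest!: zero_le_imp_eq_int)
qed

lemma a_bound: "\<exists>C>0. \<forall>k\<ge>0. a k \<le> C * q powi (- k)"
proof -
 define C where "C = (1 + 1 / \<bar>r\<bar>) * (1 + c / (d^2 * \<bar>r\<bar>))"
 have C: "C \<ge> 1" unfolding C_def using r c d by (intro mult_ge1_I) (auto simp: divide_nonneg_nonpos mult_nonneg_nonpos)
 have "a k \<le> C * q powi (- k)" if k: "k \<ge> 0" for k
 proof -
  define p where "p = q powi (- k)"
  have p: "1 \<le> p" using q01 k by (simp add: p_def power_int_minus one_le_inverse power_int_le_one)
  have AB: "A k \<le> (1 + 1 / \<bar>r\<bar>) * p" "B k \<le> (1 + c / (d^2 * \<bar>r\<bar>)) * p"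
  proof -
   have "A k = 1 + 1 / \<bar>r\<bar> * p" "B k = 1 + c / (d^2 * \<bar>r\<bar>) * p"
    using r by (simp_all add: A_def B_def p_def[symmetric])
   then show "A k \<le> (1 + 1 / \<bar>r\<bar>) * p" "B k \<le> (1 + c / (d^2 * \<bar>r\<bar>)) * p"
    using p by (simp_all add: distrib_right)
  qed
  have "A k * B k \<le> ((1 + 1 / \<bar>r\<bar>) * p) * ((1 + c / (d^2 * \<bar>r\<bar>)) * p)"
   using A_ge[of k] B_ge[of k] AB by (intro mult_mono) auto
  also have "\<dots> = C * p^2" by (simp add: C_def power2_eq_square)
  also have "\<dots> \<le> C^2 * p^2" using C by (intro mult_right_mono) (auto simp: power2_eq_square)
  finally have "sqrt (A k * B k) \<le> sqrt ((C * p)^2)" by (simp add: power_mult_distrib)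
  then have "sqrt (A k * B k) \<le> C * p" using C p by simp
  moreover have "0 \<le> sqrt (A k * B k)" using A_ge[of k] B_ge[of k] by simp
  ultimately show ?thesis unfolding a_AB p_def[symmetric] by linarith
 qed
 then show ?thesis using C by (intro exI[of _ C]) auto
qed

lemma Phi_bound: "\<exists>C>0. \<forall>x k. norm x \<le> R \<longrightarrow> 0 \<le> k \<longrightarrow> norm (Phi k x) \<le> C * q powi k"
proof -
 obtain C where C: "C > 0" "\<And>k. k \<ge> 0 \<Longrightarrow> \<bar>w k\<bar> \<le> C * q powi k" using w_bound by blast
 obtain K where K: "K \<ge> 0" "\<And>k. k \<ge> K \<Longrightarrow> norm (zk k) < 1 / 2" using ex_zk_small[of "1/2"] by auto
 have big: "norm (Phi k x) \<le> C * (1 + fbound R) * q powi k" if "norm x \<le> R" "K \<le> k" for k x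
 proof -
  have z: "norm (zk k) < 1 / 2" using K that by auto
  have "norm (f k x) \<le> 1 + norm (f k x - 1)" using norm_triangle_ineq[of 1 "f k x - 1"] by simp
  also have "norm (f k x - 1) \<le> fbound R * norm (zk k) / (1 - norm (zk k))" by (rule f_series(2)) (use z that in auto)
  also have "\<dots> \<le> fbound R" using z mult_left_mono[of "norm (zk k)" "1 - norm (zk k)" "fbound R"] fbound_nonneg[of R]
   by (simp add: divide_le_eq)
  finally have "norm (f k x) \<le> 1 + fbound R" by simp
  then have "\<bar>w k\<bar> * norm (f k x) \<le> (C * q powi k) * (1 + fbound R)" using C K that q01 by (intro mult_mono) auto
  then show ?thesis by (simp add: Phi_def norm_mult mult_ac)
 qed
 have "\<exists>M. \<forall>x\<in>cball 0 R. norm (Phi k x) \<le> M" for k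
 proof -
  have "bounded (Phi k ` cball 0 R)"
   by (intro compact_imp_bounded compact_continuous_image holomorphic_on_imp_continuous_on holomorphic_Phi) auto
  then show ?thesis by (auto simp: bounded_iff)
 qed
 then obtain M where M: "\<And>k x. norm x \<le> R \<Longrightarrow> norm (Phi k x) \<le> M k" by (metis mem_cball_0)
 \<comment> \<open>The first summand covers the indices from \<open>K\<close> on, where the series
   is used; the sum covers the finitely many indices below \<open>K\<close>, where only compactness
   is available.\<close>
 define C' where "C' = C * (1 + fbound R) + (\<Sum>k\<in>{0..<K}. \<bar>M k\<bar> / q powi k)"
 have nn: "0 \<le> C * (1 + fbound R)" "0 \<le> (\<Sum>k\<in>{0..<K}. \<bar>M k\<bar> / q powi k)"
  using C fbound_nonneg[of R] q01 by (auto intro!: sum_nonneg)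
 have "norm (Phi k x) \<le> C' * q powi k" if x: "norm x \<le> R" and k: "0 \<le> k" for k x
 proof (cases "K \<le> k")
  case True
  have "C * (1 + fbound R) * q powi k \<le> C' * q powi k" unfolding C'_def using nn q01 by (intro mult_right_mono) auto
  then show ?thesis using big[OF x True] by linarith
 next
  case False
  have "norm (Phi k x) \<le> \<bar>M k\<bar>" using M[OF x, of k] by linarith
  also have "\<dots> = \<bar>M k\<bar> / q powi k * q powi k" using q01 by simp
  also have "\<dots> \<le> C' * q powi k"
  proof (rule mult_right_mono)
   have "\<bar>M k\<bar> / q powi k \<le> (\<Sum>k\<in>{0..<K}. \<bar>M k\<bar> / q powi k)"
    using False k q01 by (intro member_le_sum) auto
   then show "\<bar>M k\<bar> / q powi k \<le> C'" using nn by (simp add: C'_def)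
  qed (use q01 in auto)
  finally show ?thesis .
 qed
 moreover have "C' > 0"
 proof -
  have "0 < C * (1 + fbound R)" using C fbound_nonneg[of R] by (intro mult_pos_pos) auto
  then show ?thesis using nn by (simp add: C'_def)
 qed
 ultimately show ?thesis by blast
qed

text \<open>Since \<open>f k x\<close> tends to 1, \<open>Phi\<close> is never the zero solution;
  \<open>e\<close> is taken small enough to force \<open>norm (f k x - 1) < 1\<close>.\<close>

lemma Phi_eventually_nonzero: "\<exists>K. \<forall>k\<ge>K. Phi k x \<noteq> 0"
proof -
 define e where "e = min (1/2) (1 / (2 * fbound (norm x) + 1) / 2)"
 have fb: "0 \<le> fbound (norm x)" by (rule fbound_nonneg)
 have e: "e > 0" using fb by (auto simp: e_def)
 obtain K where K: "\<And>k. k \<ge> K \<Longrightarrow> norm (zk k) < e" using ex_zk_small[OF e] by auto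
 have "Phi k x \<noteq> 0" if "k \<ge> K" for k
 proof -
  have z: "norm (zk k) < 1/2" "norm (zk k) < 1 / (2 * fbound (norm x) + 1) / 2" using K[OF that] by (auto simp: e_def)
  have "norm (f k x - 1) \<le> fbound (norm x) * norm (zk k) / (1 - norm (zk k))" by (rule f_series(2)) (use z in auto)
  also have "\<dots> < 1"
  proof -
   have "(2 * fbound (norm x) + 1) * norm (zk k) < 1 / 2" using z(2) fb by (simp add: field_simps)
   then have "fbound (norm x) * norm (zk k) < 1 - norm (zk k)"
    using fb by (simp add: distrib_right) (smt (verit) mult_nonneg_nonneg norm_ge_zero z(1))
   then show ?thesis using z by (simp add: divide_less_eq)
  qed
  finally have "f k x \<noteq> 0" by auto
  then show ?thesis using w_nonzero by (simp add: Phi_def)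
 qed
 then show ?thesis by blast
qed

section \<open>The Jost solution at \<open>-\<infinity>\<close> and the connection formula\<close>

definition solves :: "complex \<Rightarrow> (int \<Rightarrow> complex) \<Rightarrow> int \<Rightarrow> bool" where
 "solves x X k \<longleftrightarrow> of_real (a k) * X (k + 1) + of_real (b k) * X k + of_real (a (k - 1)) * X (k - 1) = x * X k"

definition wr :: "int \<Rightarrow> (int \<Rightarrow> complex) \<Rightarrow> (int \<Rightarrow> complex) \<Rightarrow> complex" where
 "wr m X Y = of_real (a m) * (X (m + 1) * Y m - X m * Y (m + 1))"

lemma solves_Phi: "solves x (\<lambda>k. Phi k x) k" unfolding solves_def by (rule Phi_recurrence)

text \<open>Green's formula in differential form: for equal eigenvalues the Wronskian is constant,
  for different ones the products \<open>X k * Y k\<close> telescope.\<close>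

lemma wr_step: "solves s X k \<Longrightarrow> solves t Y k \<Longrightarrow> wr k X Y - wr (k - 1) X Y = (s - t) * (X k * Y k)"
proof -
 assume "solves s X k" "solves t Y k"
 then have "(s * X k) * Y k - X k * (t * Y k) =
   (of_real (a k) * X (k + 1) + of_real (b k) * X k + of_real (a (k - 1)) * X (k - 1)) * Y k
   - X k * (of_real (a k) * Y (k + 1) + of_real (b k) * Y k + of_real (a (k - 1)) * Y (k - 1))" by (simp add: solves_def)
 then show ?thesis by (simp add: wr_def algebra_simps)
qed

lemma wr_const:
 assumes "\<And>k. k \<le> M \<Longrightarrow> solves s X k" "\<And>k. k \<le> M \<Longrightarrow> solves s Y k" "m \<le> M"
 shows "wr m X Y = wr M X Y" using assms(3)
proof (induction m rule: int_le_induct)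
 case (step i)
 then show ?case using wr_step[of s X i s Y] assms(1,2)[of i] by simp
qed simp

text \<open>The linear dependence of three vectors in a plane. With the Wronskians known it becomes
  the connection formula, and later a factorisation of \<open>D\<close>.\<close>

lemma wr_cyclic: "X k * wr k Y Z + Y k * wr k Z X + Z k * wr k X Y = 0" by (simp add: wr_def algebra_simps)

lemma real_qpoch_inf_tendsto:
 fixes g :: "nat \<Rightarrow> real"
 assumes "g \<longlonglongrightarrow> 0" shows "(\<lambda>n. qpoch_inf (g n) q) \<longlonglongrightarrow> 1"
proof -
 have "(\<lambda>n. Q (of_real (g n))) \<longlonglongrightarrow> Q (of_real 0)" by (intro tendsto_intros assms)
 then have "(\<lambda>n. complex_of_real (qpoch_inf (g n) q)) \<longlonglongrightarrow> of_real 1" by (simp add: qpoch_inf_of_real)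
 then show ?thesis by (simp only: tendsto_of_real_iff)
qed

lemma qpow_lim: "(\<lambda>n. q ^ n) \<longlonglongrightarrow> 0" using q01 by (intro LIMSEQ_power_zero) auto

lemma om_lim: "(\<lambda>n. om (- int n)) \<longlonglongrightarrow> 1"
proof -
 have e: "q powi (1 - (- int n)) = q * q ^ n" for n by (simp add: power_int_add)
 have "(\<lambda>n. om (- int n)) \<longlonglongrightarrow> sqrt (1 / 1)" unfolding om_def e
  using tendsto_mult[OF tendsto_const[of "c * q / (d^2 * r)"] qpow_lim]
   tendsto_mult[OF tendsto_const[of "q / r"] qpow_lim] by (intro tendsto_intros real_qpoch_inf_tendsto) (simp_all add: mult_ac)
 then show ?thesis by simp
qed

lemma a_lim: "(\<lambda>n. a (- int n)) \<longlonglongrightarrow> 1 / 2"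
proof -
 have "(\<lambda>n. a (- int n)) \<longlonglongrightarrow> 1 / 2 * sqrt ((1 - 0 / r) * (1 - c * 0 / (d^2 * r)))"
  unfolding a_coeff_def using r d by (intro tendsto_intros) (simp_all add: qpow_lim)
 then show ?thesis by simp
qed

lemma b_lim: "(\<lambda>n. b (- int n)) \<longlonglongrightarrow> 0"
proof -
 have "(\<lambda>n. b (- int n)) \<longlonglongrightarrow> 0 * (c + q) / (2 * d * r)"
  unfolding b_coeff_def using r d by (intro tendsto_intros) (simp_all add: qpow_lim)
 then show ?thesis by simp
qed

text \<open>The geometric growth rates of the two sequences are reciprocal, so the powers cancel in
  the Wronskian; the factor \<open>1 / 2\<close> is the limit of \<open>a\<close>.\<close>

lemma wr_limit:
 assumes X: "(\<lambda>n. X (- int n) * u ^ n) \<longlonglongrightarrow> \<alpha>" and Y: "(\<lambda>n. Y (- int n) * v ^ n) \<longlonglongrightarrow> \<beta>"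
  and uv: "u * v = 1"
 shows "(\<lambda>n. wr (- int (Suc n)) X Y) \<longlonglongrightarrow> \<alpha> * \<beta> * (u - v) / 2"
proof -
 have uvn: "u ^ n * v ^ n = 1" for n using uv by (metis power_mult_distrib power_one)
 have "wr (- int (Suc n)) X Y = of_real (a (- int (Suc n))) *
   ((X (- int n) * u ^ n) * (Y (- int (Suc n)) * v ^ Suc n) * u
   - (X (- int (Suc n)) * u ^ Suc n) * (Y (- int n) * v ^ n) * v)" for n
 proof -
  have e: "- int (Suc n) + 1 = - int n" by simp
  have "(X (- int n) * u ^ n) * (Y (- int (Suc n)) * v ^ Suc n) * u = X (- int n) * Y (- int (Suc n)) * ((u ^ n * v ^ n) * (u * v))"
   "(X (- int (Suc n)) * u ^ Suc n) * (Y (- int n) * v ^ n) * v = X (- int (Suc n)) * Y (- int n) * ((u ^ n * v ^ n) * (u * v))"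
   by (simp_all add: mult_ac)
  then have "(X (- int n) * u ^ n) * (Y (- int (Suc n)) * v ^ Suc n) * u = X (- int n) * Y (- int (Suc n))"
   "(X (- int (Suc n)) * u ^ Suc n) * (Y (- int n) * v ^ n) * v = X (- int (Suc n)) * Y (- int n)" unfolding uv uvn by simp_all
  then show ?thesis unfolding wr_def e by (simp only:)
 qed
 moreover have "(\<lambda>n. of_real (a (- int (Suc n))) *
   ((X (- int n) * u ^ n) * (Y (- int (Suc n)) * v ^ Suc n) * u
   - (X (- int (Suc n)) * u ^ Suc n) * (Y (- int n) * v ^ n) * v)) \<longlonglongrightarrow> of_real (1 / 2) * (\<alpha> * \<beta> * u - \<alpha> * \<beta> * v)"
  by (intro tendsto_intros X Y LIMSEQ_Suc[OF a_lim] LIMSEQ_Suc[OF X] LIMSEQ_Suc[OF Y])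
 ultimately have "(\<lambda>n. wr (- int (Suc n)) X Y) \<longlonglongrightarrow> of_real (1 / 2) * (\<alpha> * \<beta> * u - \<alpha> * \<beta> * v)"
  by (simp only:)
 moreover have "of_real (1 / 2) * (\<alpha> * \<beta> * u - \<alpha> * \<beta> * v) = \<alpha> * \<beta> * (u - v) / 2"
  by (simp add: algebra_simps)
 ultimately show ?thesis by (simp only:)
qed

lemma wr_swap: "wr k Y X = - wr k X Y" by (simp add: wr_def algebra_simps)

section \<open>The Jost solution\<close>

definition zeta :: "int \<Rightarrow> complex" where
 "zeta k = of_real (c * q powi (1 - k) / (d^2 * r))"

lemma norm_zeta: "norm (zeta k) = c * q powi (1 - k) / (d^2 * \<bar>r\<bar>)"
 unfolding zeta_def norm_of_real using q01 c by (simp add: abs_mult)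

lemma zeta_mono: "k \<le> K \<Longrightarrow> norm (zeta k) \<le> norm (zeta K)"
 using q01 c d unfolding norm_zeta by (intro divide_right_mono mult_left_mono power_int_decreasing) auto

lemma zeta_lim: "(\<lambda>n. zeta (- int n)) \<longlonglongrightarrow> 0"
proof -
 have e: "zeta (- int n) = of_real (c * q / (d^2 * r) * q ^ n)" for n by (simp add: zeta_def power_int_add)
 have "(\<lambda>n. complex_of_real (c * q / (d^2 * r) * q ^ n)) \<longlonglongrightarrow> of_real (c * q / (d^2 * r) * 0)"
  by (intro tendsto_intros qpow_lim)
 then show ?thesis by (simp add: e)
qed

text \<open>Convergence alone would need the bound 1; with \<open>1 / 2\<close> the denominator
  \<open>1 - norm (zeta k)\<close> of the remainder estimate is at least
  \<open>1 / 2\<close>.\<close>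

definition K0 :: int where
 "K0 = (SOME K. K \<le> 0 \<and> norm (zeta K) < 1 / 2)"

lemma K0: "K0 \<le> 0" "k \<le> K0 \<Longrightarrow> norm (zeta k) < 1 / 2"
proof -
 have "\<forall>\<^sub>F n in sequentially. norm (zeta (- int n)) < 1 / 2"
  using tendsto_norm[OF zeta_lim] by (intro order_tendstoD(2)) auto
 then obtain n where "norm (zeta (- int n)) < 1 / 2" by (auto simp: eventually_sequentially)
 then have "- int n \<le> 0 \<and> norm (zeta (- int n)) < 1 / 2" by simp
 from someI[of "\<lambda>K. K \<le> 0 \<and> norm (zeta K) < 1 / 2", OF this]
 have *: "K0 \<le> 0 \<and> norm (zeta K0) < 1 / 2" unfolding K0_def by simp
 then show "K0 \<le> 0" by simp
 show "norm (zeta k) < 1 / 2" if "k \<le> K0" using * zeta_mono[OF that] by linarith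
qed

text \<open>The points at which no denominator of the Jost series vanishes. It contains everything
  with \<open>norm y \<ge> 1\<close>, and its complement is countable, whence its
  connectedness.\<close>

definition S :: "complex set" where
 "S = {y. y \<noteq> 0 \<and> Q (of_real q / y^2) \<noteq> 0}"

lemma S_eq: "S = UNIV - ({0} \<union> (\<Union>n. {y. y^2 = of_real q ^ Suc n}))"
proof -
 have "Q (of_real q / y^2) = 0 \<longleftrightarrow> (\<exists>n. y^2 = of_real q ^ Suc n)" if "y \<noteq> 0" for y
  using that by (simp add: qpoch_inf_eq_0_iff field_simps) metis
 then show ?thesis by (auto simp: S_def)
qed

lemma connected_S: "connected S"
proof -
 have "countable {y::complex. y^2 = z}" for z
 proof -
  have "{y::complex. y^2 = z} \<subseteq> {csqrt z, - csqrt z}"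
   by (auto simp: power2_eq_iff dest: arg_cong[where f = csqrt]) (metis power2_csqrt power2_eq_iff)
  then show ?thesis by (rule countable_subset) auto
 qed
 then show ?thesis unfolding S_eq by (intro connected_open_diff_countable) auto
qed

lemma open_S: "open S"
proof -
 have "open ((- {0}) \<inter> (\<lambda>y. Q (of_real q / y^2)) -` (- {0}))"
  by (intro continuous_open_preimage continuous_intros) auto
 moreover have "S = (- {0}) \<inter> (\<lambda>y. Q (of_real q / y^2)) -` (- {0})" by (auto simp: S_def)
 ultimately show ?thesis by simp
qed

lemma S_I: "norm y \<ge> 1 \<Longrightarrow> y \<in> S"
proof -
 assume y: "norm y \<ge> 1"
 have "norm (of_real q / y^2) < 1"
 proof -
  have "1 \<le> (norm y)^2" using one_le_power[OF y] .
  then have "q < (norm y)^2" using q01 by linarith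
  then show ?thesis using y q01 by (simp add: norm_divide norm_power divide_less_eq)
 qed
 then show ?thesis using y qpoch_inf_nonzero by (auto simp: S_def)
qed

text \<open>The solution of the q-difference equation at infinity. With \<alpha> =
  \<open>d * y\<close>, \<beta> = \<open>d / y\<close> and argument z = \<open>zk k\<close> it is
  the series with numerator parameters \<beta> and q \<beta> / c, denominator parameter q \<beta> /
  \<alpha>, and argument q c / (\<alpha> \<beta> z), which is \<open>zeta k\<close>.\<close>

definition th :: "int \<Rightarrow> complex \<Rightarrow> complex" where
 "th k y = phi21_series (of_real d / y) (of_real (q * d / c) / y) (of_real q / y^2) (of_real q) (zeta k)"

text \<open>The Jost solution \<open>Psi k y \<sim> y ^ k\<close> at \<open>-\<infinity>\<close>.  The series \<open>th k\<close> converges for \<open>k \<le> K0\<close>; the points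
 outside \<open>S\<close> are its poles in \<open>y\<close>.\<close>

definition Psi :: "int \<Rightarrow> complex \<Rightarrow> complex" where
 "Psi k y = of_real (om k) * y powi k * th k y"

text \<open>Again the q-difference equation, read in the opposite direction: the argument
  \<open>zeta\<close> is multiplied by \<open>q\<close> when the index decreases by one.\<close>

lemma th_recurrence:
 assumes y: "y \<in> S" and k: "k + 1 \<le> K0"
 shows "(1 - zeta (k + 1)) * y / 2 * th (k + 1) y + of_real (b k) * th k y
  + of_real (A (k - 1)) / (2 * y) * th (k - 1) y = mu y * th k y"
proof -
 let ?q = "complex_of_real q"
 define z where "z = zeta (k + 1)"
 have y0: "y \<noteq> 0" and Qy: "Q (?q / y^2) \<noteq> 0" using y by (auto simp: S_def)
 have z1: "norm z < 1" using K0(2)[OF k] by (simp add: z_def)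
 have zk: "zeta k = ?q * z" "zeta (k - 1) = ?q\<^sup>2 * z"
  by (simp_all add: z_def zeta_def power_int_diff power_int_minus power2_eq_square field_simps)
 define D where "D = complex_of_real d"
 define e where "e = complex_of_real (q * d / c)"
 have main: "(1 - z) * th (k + 1) y * ?q - (?q + ?q / y^2 - ?q * z * (D / y + e / y)) * th k y
   + (?q / y^2 - ?q * (D / y) * (e / y) * z) * th (k - 1) y = 0"
  using phi21_series_q_difference[OF Qy z1, of "D / y" "e / y"] unfolding th_def zk z_def D_def e_def by simp
 have bk: "of_real (b k) = z * (D + e) / 2" using c d r unfolding z_def D_def e_def
  by (simp add: b_coeff_def zeta_def power_int_diff field_simps power2_eq_square)
 have Ak: "of_real (A (k - 1)) = 1 - D * e * z"
 proof -
  have "A (k - 1) = 1 - d * (q * d / c) * (c * q powi (1 - (k + 1)) / (d^2 * r))"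
   using c d by (simp add: A_def power_int_diff power_int_minus field_simps power2_eq_square)
  then show ?thesis by (simp add: z_def zeta_def D_def e_def)
 qed
 have "(1 - z) * y / 2 * th (k + 1) y + of_real (b k) * th k y + of_real (A (k - 1)) / (2 * y) * th (k - 1) y - mu y * th k y
  = y / (2 * ?q) * ((1 - z) * th (k + 1) y * ?q - (?q + ?q / y^2 - ?q * z * (D / y + e / y)) * th k y
   + (?q / y^2 - ?q * (D / y) * (e / y) * z) * th (k - 1) y)"
  unfolding bk Ak mu_def using y0 by (simp add: field_simps power2_eq_square)
 then have "(1 - z) * y / 2 * th (k + 1) y + of_real (b k) * th k y + of_real (A (k - 1)) / (2 * y) * th (k - 1) y - mu y * th k y
  = y / (2 * ?q) * 0" by (simp only: main)
 then show ?thesis by (simp add: z_def)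
qed

lemma Psi_recurrence:
 assumes y: "y \<in> S" and k: "k + 1 \<le> K0"
 shows "solves (mu y) (\<lambda>k. Psi k y) k"
proof -
 have y0: "y \<noteq> 0" using y by (simp add: S_def)
 have dk: "d powi k \<noteq> 0" for k using d by simp
 have up: "a k * om (k + 1) = B k / 2 * om k"
 proof -
  have "d powi (k + 1) * (a k * om (k + 1)) = d powi (k + 1) * (B k / 2 * om k)"
   using a_w_up[of k] d by (simp add: w_om power_int_add_1 mult_ac)
  then show ?thesis using dk by (simp only: mult_left_cancel[OF dk])
 qed
 have dn: "a (k - 1) * om (k - 1) = A (k - 1) / 2 * om k"
 proof -
  have "d powi (k - 1) * (a (k - 1) * om (k - 1)) = d powi (k - 1) * (A (k - 1) / 2 * om k)"
   using a_w_down[of k] d by (simp add: w_om power_int_diff field_simps)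
  then show ?thesis using dk by (simp only: mult_left_cancel[OF dk])
 qed
 have Bk: "of_real (B k) = 1 - zeta (k + 1)" by (simp add: B_def zeta_def)
 have "of_real (a k) * Psi (k + 1) y = of_real (om k) * y powi k * ((1 - zeta (k + 1)) * y / 2 * th (k + 1) y)"
 proof -
  have "of_real (a k) * Psi (k + 1) y = of_real (a k * om (k + 1)) * y powi (k + 1) * th (k + 1) y" by (simp add: Psi_def mult_ac)
  then show ?thesis unfolding up using y0 by (simp add: Bk power_int_add_1 mult_ac)
 qed
 moreover have "of_real (a (k - 1)) * Psi (k - 1) y = of_real (om k) * y powi k * (of_real (A (k - 1)) / (2 * y) * th (k - 1) y)"
 proof -
  have "of_real (a (k - 1)) * Psi (k - 1) y = of_real (a (k - 1) * om (k - 1)) * y powi (k - 1) * th (k - 1) y"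
   by (simp add: Psi_def mult_ac)
  then show ?thesis unfolding dn using y0 by (simp add: power_int_diff mult_ac)
 qed
 ultimately have "of_real (a k) * Psi (k + 1) y + of_real (b k) * Psi k y + of_real (a (k - 1)) * Psi (k - 1) y
  = of_real (om k) * y powi k * ((1 - zeta (k + 1)) * y / 2 * th (k + 1) y + of_real (b k) * th k y
  + of_real (A (k - 1)) / (2 * y) * th (k - 1) y)" by (simp add: Psi_def algebra_simps)
 then show ?thesis unfolding th_recurrence[OF y k] by (simp add: solves_def Psi_def)
qed

lemma holomorphic_Psi: "k \<le> K0 \<Longrightarrow> Psi k holomorphic_on S"
proof -
 assume k: "k \<le> K0"
 have z: "norm (zeta k) < 1" using K0(2)[OF k] by simp
 have S0: "y \<noteq> 0" "Q (of_real q / y^2) \<noteq> 0" if "y \<in> S" for y using that by (auto simp: S_def)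
 have "th k holomorphic_on S" unfolding th_def
  by (rule holomorphic_phi21_series_params[OF open_S _ _ _ _ z]) (use S0 in \<open>auto intro!: holomorphic_intros\<close>)
 then show ?thesis unfolding Psi_def by (intro holomorphic_intros) (use S0 in auto)
qed

lemma th_near_1:
 assumes "y \<in> S" "k \<le> K0"
 shows "norm (th k y - 1) \<le> phi_bound (of_real d / y) (of_real (q * d / c) / y) (of_real q / y^2) * norm (zeta k) * 2"
proof -
 let ?P = "phi_bound (of_real d / y) (of_real (q * d / c) / y) (of_real q / y^2)"
 have z: "norm (zeta k) < 1/2" using K0(2) assms by auto
 have "norm (th k y - 1) \<le> ?P * norm (zeta k) / (1 - norm (zeta k))"
  unfolding th_def by (rule phi21_series_near_1) (use assms z in \<open>auto simp: S_def\<close>)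
 also have "\<dots> \<le> ?P * norm (zeta k) / (1 / 2)" using z by (intro divide_left_mono) (auto simp: phi_bound_nonneg)
 finally show ?thesis by simp
qed

lemma om_bound: "\<exists>C>0. \<forall>k\<le>0. om k \<le> C"
proof -
 have "Bseq (\<lambda>n. om (- int n))" using om_lim convergent_def convergent_imp_Bseq by blast
 then obtain C where C: "C > 0" "\<And>n. norm (om (- int n)) \<le> C" by (auto simp: Bseq_def)
 have "om k \<le> C" if "k \<le> 0" for k using C(2)[of "nat (-k)"] that by simp
 then show ?thesis using C by blast
qed

lemma Psi_bound:
 assumes "compact Y" "Y \<subseteq> S"
 shows "\<exists>C>0. \<forall>y\<in>Y. \<forall>k\<le>K0. norm (Psi k y) \<le> C * norm y powi k"
proof -
 let ?P = "\<lambda>y. phi_bound (of_real d / y) (of_real (q * d / c) / y) (of_real q / y^2)"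
 have "continuous_on Y ?P" unfolding phi_bound_def using assms(2) q01 qpoch_q_nonzero
  by (intro continuous_intros) (auto simp: S_def subset_iff)
 then have "bounded (?P ` Y)" using assms(1) by (intro compact_imp_bounded compact_continuous_image)
 then obtain M where "\<forall>x\<in>?P ` Y. norm x \<le> M" by (auto simp: bounded_iff)
 then have M: "?P y \<le> M" if "y \<in> Y" for y using that by (auto intro: order_trans[OF abs_ge_self])
 obtain C where C: "C > 0" "\<And>k. k \<le> 0 \<Longrightarrow> om k \<le> C" using om_bound by blast
 have "norm (Psi k y) \<le> C * (1 + \<bar>M\<bar>) * norm y powi k" if "y \<in> Y" "k \<le> K0" for y k
 proof -
  have z: "norm (zeta k) * 2 \<le> 1" using K0(2)[OF that(2)] by simp
  have "norm (th k y) \<le> 1 + norm (th k y - 1)" using norm_triangle_ineq[of 1 "th k y - 1"] by simp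
  also have "norm (th k y - 1) \<le> ?P y * (norm (zeta k) * 2)" using th_near_1[of y k] that assms(2) by (auto simp: mult.assoc)
  also have "\<dots> \<le> \<bar>M\<bar> * 1" using M[OF that(1)] z by (intro mult_mono) auto
  finally have "norm (th k y) \<le> 1 + \<bar>M\<bar>" by simp
  moreover have "0 \<le> om k" "om k \<le> C" using C(2)[of k] om_pos[of k] K0(1) that by auto
  ultimately have "om k * norm (th k y) \<le> C * (1 + \<bar>M\<bar>)" using C by (intro mult_mono) auto
  then have "om k * norm (th k y) * norm y powi k \<le> C * (1 + \<bar>M\<bar>) * norm y powi k" by (intro mult_right_mono) auto
  then show ?thesis using om_pos[of k] by (simp add: Psi_def norm_mult norm_power_int mult_ac)
 qed
 moreover have "C * (1 + \<bar>M\<bar>) > 0" using C by (intro mult_pos_pos) auto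
 ultimately show ?thesis by blast
qed

lemma th_lim: "y \<in> S \<Longrightarrow> (\<lambda>n. th (- int n) y) \<longlonglongrightarrow> 1"
proof -
 assume y: "y \<in> S"
 let ?P = "phi_bound (of_real d / y) (of_real (q * d / c) / y) (of_real q / y^2)"
 have "(\<lambda>n. ?P * norm (zeta (- int n)) * 2) \<longlonglongrightarrow> ?P * norm (0::complex) * 2"
  by (intro tendsto_intros zeta_lim)
 then have "(\<lambda>n. ?P * norm (zeta (- int n)) * 2) \<longlonglongrightarrow> 0" by simp
 moreover have "\<forall>\<^sub>F n in sequentially. norm (th (- int n) y - 1) \<le> ?P * norm (zeta (- int n)) * 2"
  using eventually_ge_at_top[of "nat (- K0)"] by eventually_elim (intro th_near_1[OF y], simp)
 ultimately have "(\<lambda>n. th (- int n) y - 1) \<longlonglongrightarrow> 0" by (rule Lim_null_comparison[rotated])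
 then show ?thesis using LIM_zero_iff by blast
qed

lemma Psi_lim:
 assumes "y \<in> S" shows "(\<lambda>n. Psi (- int n) y * y ^ n) \<longlonglongrightarrow> 1"
proof -
 have y0: "y \<noteq> 0" using assms by (simp add: S_def)
 have "(\<lambda>n. of_real (om (- int n)) * th (- int n) y) \<longlonglongrightarrow> of_real 1 * 1"
  by (intro tendsto_intros om_lim th_lim assms)
 moreover have "Psi (- int n) y * y ^ n = of_real (om (- int n)) * th (- int n) y" for n using y0 by (simp add: Psi_def power_int_minus)
 ultimately show ?thesis by simp
qed

text \<open>The Wronskian does not depend on \<open>m\<close>, and at -infinity both leading terms
  are known.\<close>

lemma wr_Psi_Psi:
 assumes y: "y \<in> S" "inverse y \<in> S" and m: "m + 1 \<le> K0"
 shows "wr m (\<lambda>k. Psi k y) (\<lambda>k. Psi k (inverse y)) = (y - inverse y) / 2"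
proof -
 have y0: "y \<noteq> 0" using y by (simp add: S_def)
 let ?W = "\<lambda>m. wr m (\<lambda>k. Psi k y) (\<lambda>k. Psi k (inverse y))"
 have const: "?W m = ?W (K0 - 1)" if "m + 1 \<le> K0" for m by (rule wr_const[where s = "mu y"])
   (use Psi_recurrence[OF y(1)] Psi_recurrence[OF y(2)] that in \<open>auto simp: mu_inverse\<close>)
 have "(\<lambda>n. ?W (- int (Suc n))) \<longlonglongrightarrow> 1 * 1 * (y - inverse y) / 2"
  by (rule wr_limit) (use Psi_lim y y0 in auto)
 moreover have "\<forall>\<^sub>F n in sequentially. ?W (- int (Suc n)) = ?W (K0 - 1)"
  using eventually_ge_at_top[of "nat (- K0)"] by eventually_elim (intro const, simp)
 ultimately have "(\<lambda>n. ?W (K0 - 1)) \<longlonglongrightarrow> (y - inverse y) / 2" by (subst (asm) tendsto_cong) auto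
 then show ?thesis using const[OF m] by (simp add: LIMSEQ_const_iff)
qed

text \<open>The index \<open>K0 - 1\<close> is the last at which both entries of \<open>Psi\<close>
  in the Wronskian lie in the range of convergence; by \<open>wr_Phi_Psi\<close> every smaller index
  gives the same value.\<close>

definition D :: "complex \<Rightarrow> complex" where
 "D y = wr (K0 - 1) (\<lambda>k. Phi k (mu y)) (\<lambda>k. Psi k y)"

lemma wr_Phi_Psi: "y \<in> S \<Longrightarrow> m + 1 \<le> K0 \<Longrightarrow> wr m (\<lambda>k. Phi k (mu y)) (\<lambda>k. Psi k y) = D y"
 unfolding D_def by (rule wr_const[where s = "mu y"]) (auto intro: solves_Phi Psi_recurrence)

lemma holomorphic_mu [holomorphic_intros]: "(\<And>z. z \<in> X \<Longrightarrow> z \<noteq> 0) \<Longrightarrow> (\<lambda>y. mu y :: complex) holomorphic_on X"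
 unfolding mu_def by (intro holomorphic_intros) auto

lemma holomorphic_D: "D holomorphic_on S" unfolding D_def wr_def by (intro holomorphic_intros holomorphic_Psi) (auto simp: S_def)

text \<open>The function \<open>c(y)\<close> freed of the factor \<open>1 - 1 / y^2\<close> in its
  denominator. It is holomorphic on all of \<open>S\<close>, including the points 1 and -1, where
  \<open>c_fun\<close> is 0 by division by zero.\<close>

definition N :: "complex \<Rightarrow> complex" where
 "N y = Q (of_real (c / d) / y) * Q (of_real d / y) * theta (of_real (d * r) * y)
   / (Q (of_real c) * theta (of_real r) * Q (of_real q / y^2))"

abbreviation "cc \<equiv> c_fun q r c d"

lemma theta_r_nonzero: "theta (of_real r) \<noteq> 0"
proof -
 have "Q (of_real r) \<noteq> 0" "Q (of_real (q / r)) \<noteq> 0" using r q01 real_qpoch_inf_pos[of r] real_qpoch_inf_pos[of "q / r"]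
  unfolding qpoch_inf_of_real by (auto simp: divide_nonneg_neg)
 then show ?thesis by (simp add: theta_def)
qed

lemma cc_N: "y \<noteq> 0 \<Longrightarrow> cc y = N y / (1 - 1 / y^2)"
proof -
 assume y: "y \<noteq> 0"
 have p: "y powi (-2) = 1 / y^2" by (simp add: power_int_minus field_simps)
 have "Q (1 / y^2) = (1 - 1 / y^2) * Q (of_real q / y^2)" using qpoch_inf_rec[of "1 / y^2"] by simp
 then show ?thesis by (simp add: c_fun_def qpochs_inf_def N_def theta_def p mult_ac)
qed

text \<open>The upper bound on \<open>norm y\<close> is the condition for Heine's series with
  \<open>b = d * y\<close>; the lower bound is the condition \<open>norm a < norm b\<close> of
  Ramanujan's sum, with \<open>a = d / y\<close>.\<close>

lemma Phi_asymptotics: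
 assumes y: "1 < norm y" "norm y < 1 / \<bar>d\<bar>"
 shows "(\<lambda>n. Phi (- int n) (mu y) * inverse y ^ n) \<longlonglongrightarrow> cc y"
proof -
 have y0: "y \<noteq> 0" using y by auto
 have bd: "norm (of_real d * y) < 1" using y d by (simp add: norm_mult field_simps)
 interpret ps: psi_sum q r "of_real d * y" by unfold_locales (use r d y0 bd in auto)
 have ab: "norm (of_real d / y) < norm (of_real d * y)"
 proof -
  have "1 < norm y * norm y" using y(1) by (simp add: less_1_mult)
  then show ?thesis using d y0 by (simp add: norm_divide norm_mult field_simps)
 qed
 have z: "zk (- int n) = of_real r / of_real q ^ n" for n by (simp add: zk_def power_int_minus field_simps)
 have lim: "(\<lambda>n. heine (of_real d / y) (of_real d * y) (of_real c) (zk (- int n)) / (of_real d * y) ^ n) \<longlonglongrightarrow>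
   Q (of_real c / (of_real d * y)) * Q (of_real d / y) * theta (of_real r * (of_real d * y)) /
    (Q (of_real c) * theta (of_real r) * Q (of_real d / y / (of_real d * y)))" unfolding z by (rule ps.heine_asymptotics[OF ab])
 have "Phi (- int n) (mu y) * inverse y ^ n =
   of_real (om (- int n)) * (heine (of_real d / y) (of_real d * y) (of_real c) (zk (- int n)) / (of_real d * y) ^ n)" for n
  using d y0 by (simp add: Phi_def w_om f_heine'[OF y0 bd] power_int_minus power_mult_distrib field_simps)
 then have "(\<lambda>n. Phi (- int n) (mu y) * inverse y ^ n) \<longlonglongrightarrow> of_real 1 *
   (Q (of_real c / (of_real d * y)) * Q (of_real d / y) * theta (of_real r * (of_real d * y)) /
    (Q (of_real c) * theta (of_real r) * Q (of_real d / y / (of_real d * y))))" by (simp only:) (intro tendsto_intros om_lim lim)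
 moreover have "of_real d / y / (of_real d * y) = y powi (-2)" using d y0 by (simp add: power_int_minus power2_eq_square field_simps)
 ultimately show ?thesis by (simp add: c_fun_def qpochs_inf_def theta_def mult_ac)
qed

lemma D_eq_annulus:
 assumes y: "1 < norm y" "norm y < 1 / \<bar>d\<bar>"
 shows "D y = - y / 2 * N y"
proof -
 have y0: "y \<noteq> 0" and yS: "y \<in> S" using y S_I[of y] by auto
 let ?W = "\<lambda>m. wr m (\<lambda>k. Phi k (mu y)) (\<lambda>k. Psi k y)"
 have "(\<lambda>n. ?W (- int (Suc n))) \<longlonglongrightarrow> cc y * 1 * (inverse y - y) / 2"
  by (rule wr_limit) (use Phi_asymptotics[OF y] Psi_lim[OF yS] y0 in auto)
 moreover have "\<forall>\<^sub>F n in sequentially. ?W (- int (Suc n)) = D y"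
  using eventually_ge_at_top[of "nat (- K0)"] by eventually_elim (intro wr_Phi_Psi yS, simp)
 ultimately have "(\<lambda>n::nat. D y) \<longlonglongrightarrow> cc y * 1 * (inverse y - y) / 2" by (subst (asm) tendsto_cong) auto
 then have "D y = cc y * (inverse y - y) / 2" by (simp add: LIMSEQ_const_iff)
 moreover have "1 - 1 / y^2 \<noteq> 0"
 proof
  assume "1 - 1 / y^2 = 0"
  then have "y^2 = 1" using y0 by (simp add: field_simps)
  then have "norm y ^ 2 = 1" by (metis norm_one norm_power)
  then show False using y(1) by (simp add: power2_eq_1_iff)
 qed
 moreover have "inverse y - y = - y * (1 - 1 / y^2)" using y0 by (simp add: field_simps power2_eq_square)
 ultimately show ?thesis using y0 by (simp add: cc_N)
qed

lemma holomorphic_N: "N holomorphic_on S"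
proof -
 have "theta (of_real r) \<noteq> 0" by (rule theta_r_nonzero)
 then show ?thesis unfolding N_def theta_def using Q_c_nonzero r d by (intro holomorphic_intros) (auto simp: S_def theta_def)
qed

text \<open>The annulus in which the asymptotics is known is a nonempty open part of the connected
  set \<open>S\<close>, and both sides are holomorphic there.\<close>

theorem D_eq: "y \<in> S \<Longrightarrow> D y = - y / 2 * N y"
proof (rule analytic_continuation_open[where s = "ball 0 (1 / \<bar>d\<bar>) - cball 0 1" and s' = S and z = y])
 have "1 < 1 / \<bar>d\<bar>" using d by simp
 then obtain m where "1 < m" "m < 1 / \<bar>d\<bar>" using dense by blast
 then have "of_real m \<in> ball 0 (1 / \<bar>d\<bar>) - cball (0::complex) 1" by simp
 then show "ball 0 (1 / \<bar>d\<bar>) - cball (0::complex) 1 \<noteq> {}" by blast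
 show "ball 0 (1 / \<bar>d\<bar>) - cball 0 1 \<subseteq> S" using S_I by auto
 show "(\<lambda>y. - y / 2 * N y) holomorphic_on S" by (intro holomorphic_intros holomorphic_N) simp
qed (auto simp: D_eq_annulus open_S connected_S holomorphic_D)

lemma D_cc:
 assumes "y \<in> S" "y^2 \<noteq> 1" shows "D y = cc y * (inverse y - y) / 2"
proof -
 have y0: "y \<noteq> 0" using assms by (simp add: S_def)
 then have "1 - 1 / y^2 \<noteq> 0" using assms(2) by (simp add: field_simps)
 then show ?thesis using y0 by (simp add: D_eq[OF assms(1)] cc_N field_simps power2_eq_square)
qed

text \<open>The solutions at \<open>y\<close> and \<open>inverse y\<close> span all solutions for
  the same eigenvalue; the coefficients are ratios of Wronskians, which \<open>wr_cyclic\<close>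
  extracts without inverting a matrix.\<close>

theorem connection:
 assumes y: "y \<in> S" "inverse y \<in> S" "y^2 \<noteq> 1" and k: "k + 1 \<le> K0"
 shows "Phi k (mu y) = cc (inverse y) * Psi k y + cc y * Psi k (inverse y)"
proof -
 have y0: "y \<noteq> 0" using y by (simp add: S_def)
 have yy: "y - inverse y \<noteq> 0" using y(3) y0 by (simp add: field_simps power2_eq_square)
 have W1: "wr k (\<lambda>k. Psi k y) (\<lambda>k. Psi k (inverse y)) = (y - inverse y) / 2" by (rule wr_Psi_Psi[OF y(1,2) k])
 have W2: "wr k (\<lambda>k. Phi k (mu y)) (\<lambda>k. Psi k y) = cc y * (inverse y - y) / 2"
  using wr_Phi_Psi[OF y(1) k] D_cc[OF y(1,3)] by simp
 have W3: "wr k (\<lambda>k. Phi k (mu y)) (\<lambda>k. Psi k (inverse y)) = cc (inverse y) * (y - inverse y) / 2"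
 proof -
  have "(inverse y)^2 \<noteq> 1" using y(3) by (simp add: power_inverse)
  then show ?thesis using wr_Phi_Psi[OF y(2) k, unfolded mu_inverse] D_cc[OF y(2)] by simp
 qed
 have W3': "wr k (\<lambda>k. Psi k (inverse y)) (\<lambda>k. Phi k (mu y)) = - (cc (inverse y) * (y - inverse y) / 2)"
  using W3 by (simp add: wr_swap[of k "\<lambda>k. Psi k (inverse y)"])
 define t where "t = y - inverse y"
 have t: "inverse y - y = - t" by (simp add: t_def)
 have "Phi k (mu y) * (t / 2) + Psi k y * - (cc (inverse y) * t / 2)
   + Psi k (inverse y) * (cc y * (- t) / 2) = 0"
  using wr_cyclic[of "\<lambda>k. Phi k (mu y)" k "\<lambda>k. Psi k y" "\<lambda>k. Psi k (inverse y)"]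
  unfolding W1 W2 W3' t t_def[symmetric] .
 moreover have "Phi k (mu y) * (t / 2) + Psi k y * - (cc (inverse y) * t / 2) + Psi k (inverse y) * (cc y * (- t) / 2)
  = t / 2 * (Phi k (mu y) - (cc (inverse y) * Psi k y + cc y * Psi k (inverse y)))"
  by (simp add: algebra_simps diff_divide_distrib add_divide_distrib)
 ultimately show ?thesis using yy by (simp add: t_def)
qed

text \<open>The form factors into \<open>X (Suc n) - X n * inverse y\<close> and
  \<open>X (Suc n) - X n * y\<close>. Each factor asymptotically annihilates one of the two
  oscillating parts of \<open>Phi\<close>, so that it converges after multiplication by a power of
  \<open>y\<close>.\<close>

lemma quad_lim:
 assumes y: "norm y = 1" "y^2 \<noteq> 1"
 shows "(\<lambda>n. (Phi (- int n) (mu y))^2 + (Phi (- int (Suc n)) (mu y))^2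
   - 2 * mu y * Phi (- int n) (mu y) * Phi (- int (Suc n)) (mu y)) \<longlonglongrightarrow> - cc y * cc (inverse y) * (y - inverse y)^2"
proof -
 have y0: "y \<noteq> 0" using y by auto
 have yS: "y \<in> S" "inverse y \<in> S" using y S_I by (auto simp: norm_inverse)
 define g h where "g = cc y" and "h = cc (inverse y)"
 define X where "X n = Phi (- int n) (mu y)" for n
 define P where "P n = Psi (- int n) y * y ^ n" for n
 define P' where "P' n = Psi (- int n) (inverse y) * inverse y ^ n" for n
 have P: "P \<longlonglongrightarrow> 1" and P': "P' \<longlonglongrightarrow> 1" unfolding P_def P'_def by (intro Psi_lim yS)+
 have yn: "inverse y ^ n * y ^ n = 1" for n using y0 by (simp add: power_inverse)
 have X: "X n = h * (P n * inverse y ^ n) + g * (P' n * y ^ n)" if "nat (1 - K0) \<le> n" for n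
 proof -
  have "Psi (- int n) y = P n * inverse y ^ n" "Psi (- int n) (inverse y) = P' n * y ^ n"
   using yn[of n] by (simp_all add: P_def P'_def mult.assoc mult.commute[of "y ^ n"])
  moreover have "- int n + 1 \<le> K0" using that by simp
  ultimately show ?thesis using connection[OF yS y(2), of "- int n"] by (simp add: X_def g_def h_def)
 qed
 have 0: "(\<lambda>n. P (Suc n) - P n) \<longlonglongrightarrow> 0" "(\<lambda>n. P' (Suc n) - P' n) \<longlonglongrightarrow> 0"
  using tendsto_diff[OF LIMSEQ_Suc[OF P] P] tendsto_diff[OF LIMSEQ_Suc[OF P'] P'] by simp_all
 \<comment> \<open>The part that the factor should annihilate still oscillates, but with the
   vanishing increments of \<open>P\<close> or \<open>P'\<close> as amplitude.\<close>
 have z: "(\<lambda>n. (inverse y ^ n)^2 * (P (Suc n) - P n)) \<longlonglongrightarrow> 0" "(\<lambda>n. (y ^ n)^2 * (P' (Suc n) - P' n)) \<longlonglongrightarrow> 0"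
  by (rule lim_null_mult_left_bounded[where B = 1]; use y 0 in \<open>simp add: norm_power norm_inverse\<close>)+
 have L1: "(\<lambda>n. (X (Suc n) - X n * inverse y) * inverse y ^ n) \<longlonglongrightarrow> g * (y - inverse y)"
 proof -
  have "(\<lambda>n. h * inverse y * ((inverse y ^ n)^2 * (P (Suc n) - P n)) + g * (y * P' (Suc n) - inverse y * P' n)) \<longlonglongrightarrow>
    h * inverse y * 0 + g * (y * 1 - inverse y * 1)" by (intro tendsto_intros LIMSEQ_Suc[OF P'] P' z)
  moreover have "\<forall>\<^sub>F n in sequentially. h * inverse y * ((inverse y ^ n)^2 * (P (Suc n) - P n)) + g * (y * P' (Suc n) - inverse y * P' n)
    = (X (Suc n) - X n * inverse y) * inverse y ^ n" using eventually_ge_at_top[of "nat (1 - K0)"]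
  proof eventually_elim
   case (elim n)
   have "(X (Suc n) - X n * inverse y) * inverse y ^ n = h * inverse y * ((inverse y ^ n)^2 * (P (Suc n) - P n))
    + g * (y * P' (Suc n) - inverse y * P' n) * (inverse y ^ n * y ^ n)" using elim by (simp add: X power2_eq_square algebra_simps)
   then show ?case unfolding yn by simp
  qed
  ultimately show ?thesis by (simp add: tendsto_cong)
 qed
 have L2: "(\<lambda>n. (X (Suc n) - X n * y) * y ^ n) \<longlonglongrightarrow> h * (inverse y - y)"
 proof -
  have "(\<lambda>n. g * y * ((y ^ n)^2 * (P' (Suc n) - P' n)) + h * (inverse y * P (Suc n) - y * P n)) \<longlonglongrightarrow>
    g * y * 0 + h * (inverse y * 1 - y * 1)" by (intro tendsto_intros LIMSEQ_Suc[OF P] P z)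
  moreover have "\<forall>\<^sub>F n in sequentially. g * y * ((y ^ n)^2 * (P' (Suc n) - P' n)) + h * (inverse y * P (Suc n) - y * P n)
    = (X (Suc n) - X n * y) * y ^ n" using eventually_ge_at_top[of "nat (1 - K0)"]
  proof eventually_elim
   case (elim n)
   have "(X (Suc n) - X n * y) * y ^ n = g * y * ((y ^ n)^2 * (P' (Suc n) - P' n))
    + h * (inverse y * P (Suc n) - y * P n) * (inverse y ^ n * y ^ n)" using elim by (simp add: X power2_eq_square algebra_simps)
   then show ?case unfolding yn by simp
  qed
  ultimately show ?thesis by (simp add: tendsto_cong)
 qed
 have "(X n)^2 + (X (Suc n))^2 - 2 * mu y * X n * X (Suc n) =
   ((X (Suc n) - X n * inverse y) * inverse y ^ n) * ((X (Suc n) - X n * y) * y ^ n)" for n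
 proof -
  have "((X (Suc n) - X n * inverse y) * inverse y ^ n) * ((X (Suc n) - X n * y) * y ^ n)
   = (X (Suc n) - X n * inverse y) * (X (Suc n) - X n * y) * (inverse y ^ n * y ^ n)" by (simp add: mult_ac)
  also have "\<dots> = (X n)^2 + (X (Suc n))^2 - 2 * mu y * X n * X (Suc n)"
   unfolding yn mu_def using y0 by (simp add: power2_eq_square field_simps)
  finally show ?thesis by simp
 qed
 moreover have "(\<lambda>n. ((X (Suc n) - X n * inverse y) * inverse y ^ n) * ((X (Suc n) - X n * y) * y ^ n)) \<longlonglongrightarrow>
   (g * (y - inverse y)) * (h * (inverse y - y))" by (intro tendsto_mult L1 L2)
 moreover have "(g * (y - inverse y)) * (h * (inverse y - y)) = - g * h * (y - inverse y)^2"
  by (simp add: power2_eq_square algebra_simps)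
 ultimately show ?thesis by (simp add: X_def g_def h_def)
qed

text \<open>Outside the unit disc the factors with \<open>c / d\<close> and \<open>d\<close> cannot
  vanish, because both numbers have modulus below 1; only the theta function remains, and it
  vanishes exactly at the integer powers of \<open>q\<close>.\<close>

lemma D_zero_iff:
 assumes y: "norm y > 1"
 shows "D y = 0 \<longleftrightarrow> (\<exists>p::int. y = of_real (q powi p / (d * r)))"
proof -
 have y0: "y \<noteq> 0" and yS: "y \<in> S" using y S_I[of y] by auto
 have "\<bar>c / d\<bar> < norm y" "\<bar>d\<bar> < norm y" using cd d y by linarith+
 then have "norm (of_real (c / d) / y) < 1" "norm (of_real d / y) < 1"
 proof -
  have ny: "0 < norm y" using y by linarith
  assume *: "\<bar>c / d\<bar> < norm y" "\<bar>d\<bar> < norm y"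
  show "norm (of_real (c / d) / y) < 1" "norm (of_real d / y) < 1"
   unfolding norm_divide[of _ y] norm_of_real pos_divide_less_eq[OF ny] mult_1 by fact+
 qed
 then have "Q (of_real (c / d) / y) \<noteq> 0" "Q (of_real d / y) \<noteq> 0" using qpoch_inf_nonzero by blast+
 moreover have "Q (of_real q / y^2) \<noteq> 0" using yS by (simp add: S_def)
 ultimately have "D y = 0 \<longleftrightarrow> theta (of_real (d * r) * y) = 0"
  using y0 Q_c_nonzero theta_r_nonzero by (simp add: D_eq[OF yS] N_def)
 also have "\<dots> \<longleftrightarrow> (\<exists>n. of_real (d * r) * y * of_real q ^ n = 1) \<or> (\<exists>n. of_real q / (of_real (d * r) * y) * of_real q ^ n = 1)"
  by (simp add: theta_def qpoch_inf_eq_0_iff)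
 also have "\<dots> \<longleftrightarrow> (\<exists>p::int. of_real (d * r) * y = of_real q powi p)"
 proof
  assume "(\<exists>n. of_real (d * r) * y * of_real q ^ n = 1) \<or> (\<exists>n. of_real q / (of_real (d * r) * y) * of_real q ^ n = 1)"
  then show "\<exists>p::int. of_real (d * r) * y = of_real q powi p"
  proof (elim disjE exE)
   fix n assume "of_real (d * r) * y * of_real q ^ n = 1"
   then show ?thesis by (intro exI[of _ "- int n"]) (simp add: power_int_minus field_simps)
  next
   fix n assume "of_real q / (of_real (d * r) * y) * of_real q ^ n = 1"
   then show ?thesis using y0 r d by (intro exI[of _ "int (Suc n)"]) (simp add: power_int_add field_simps)
  qed
 next
  assume "\<exists>p::int. of_real (d * r) * y = of_real q powi p"
  then obtain p :: int where p: "of_real (d * r) * y = of_real q powi p" by blast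
  show "(\<exists>n. of_real (d * r) * y * of_real q ^ n = 1) \<or> (\<exists>n. of_real q / (of_real (d * r) * y) * of_real q ^ n = 1)"
  proof (cases "p \<le> 0")
   case True
   then have "of_real (d * r) * y * of_real q ^ nat (- p) = 1"
    unfolding p by (metis (no_types, opaque_lifting) power_int_of_nat nat_0_le neg_0_le_iff_le power_int_add add.right_inverse power_int_0_right of_real_eq_0_iff q_nonzero)
   then show ?thesis by blast
  next
   case False
   then obtain n where n: "p = int (Suc n)" by (metis Suc_pred' linorder_not_le pos_int_cases)
   have "of_real q / (of_real (d * r) * y) * complex_of_real q ^ n = 1" unfolding p n by (simp add: power_int_add)
   then show ?thesis by blast
  qed
 qed
 also have "\<dots> \<longleftrightarrow> (\<exists>p::int. y = of_real (q powi p / (d * r)))"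
  using r d by (intro ex_cong1) (auto simp: field_simps)
 finally show ?thesis .
qed

end

section \<open>Essential self-adjointness of Jacobi operators\<close>

lemma ell2_lin [intro]:
 assumes "u \<in> ell2" "v \<in> ell2"
 shows "(\<lambda>k. \<alpha> * u k + \<beta> * v k) \<in> ell2"
proof -
 have "(\<lambda>k. 2 * (cmod \<alpha>)^2 * (cmod (u k))^2 + 2 * (cmod \<beta>)^2 * (cmod (v k))^2) summable_on UNIV"
  using assms by (intro summable_on_add summable_on_cmult_right) (auto simp: ell2_def)
 moreover have "(cmod (\<alpha> * u k + \<beta> * v k))^2 \<le> 2 * (cmod \<alpha>)^2 * (cmod (u k))^2 + 2 * (cmod \<beta>)^2 * (cmod (v k))^2" for k
 proof -
  have "(cmod (\<alpha> * u k + \<beta> * v k))^2 \<le> (cmod (\<alpha> * u k) + cmod (\<beta> * v k))^2"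
   by (intro power_mono norm_triangle_ineq) auto
  also have "\<dots> \<le> 2 * (cmod (\<alpha> * u k))^2 + 2 * (cmod (\<beta> * v k))^2"
   using sum_squares_bound[of "cmod (\<alpha> * u k)" "cmod (\<beta> * v k)"] by (simp add: power2_sum)
  finally show ?thesis by (simp add: norm_mult power_mult_distrib)
 qed
 ultimately show ?thesis unfolding ell2_def by (auto intro: summable_on_comparison_test)
qed

lemma ell2_zero [simp, intro]: "(\<lambda>k. 0) \<in> ell2" by (simp add: ell2_def)

lemma ell2_add [intro]: "u \<in> ell2 \<Longrightarrow> v \<in> ell2 \<Longrightarrow> (\<lambda>k. u k + v k) \<in> ell2"
 using ell2_lin[of u v 1 1] by simp

lemma ell2_diff [intro]: "u \<in> ell2 \<Longrightarrow> v \<in> ell2 \<Longrightarrow> (\<lambda>k. u k - v k) \<in> ell2"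
 using ell2_lin[of u v 1 "-1"] by simp

lemma ell2_cmult [intro]: "u \<in> ell2 \<Longrightarrow> (\<lambda>k. \<alpha> * u k) \<in> ell2" using ell2_lin[of u u \<alpha> 0] by simp

lemma finseq_ell2: "u \<in> finseq \<Longrightarrow> u \<in> ell2"
proof -
 assume "u \<in> finseq"
 then have "(\<lambda>k. (cmod (u k))^2) summable_on {k. u k \<noteq> 0}" by (simp add: finseq_def)
 then have "(\<lambda>k. (cmod (u k))^2) summable_on UNIV" by (rule summable_on_cong_neutral[THEN iffD1, rotated -1]) auto
 then show ?thesis by (simp add: ell2_def)
qed

lemma finseq_lin [intro]: "u \<in> finseq \<Longrightarrow> v \<in> finseq \<Longrightarrow> (\<lambda>k. \<alpha> * u k + \<beta> * v k) \<in> finseq"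
 unfolding finseq_def by (auto intro: finite_subset[of _ "{k. u k \<noteq> 0} \<union> {k. v k \<noteq> 0}"])

lemma finseq_zero [simp, intro]: "(\<lambda>k. 0) \<in> finseq" by (simp add: finseq_def)

lemma basis_vec_finseq [simp, intro]: "basis_vec k \<in> finseq" by (simp add: finseq_def basis_vec_def)

lemma basis_vec_ell2 [simp, intro]: "basis_vec k \<in> ell2" by (intro finseq_ell2 basis_vec_finseq)

lemma finseq_induct [consumes 1, case_names zero add]:
 assumes "u \<in> finseq" and 0: "P (\<lambda>k. 0)"
  and add: "\<And>u k \<alpha>. u \<in> finseq \<Longrightarrow> P u \<Longrightarrow> P (\<lambda>j. u j + \<alpha> * basis_vec k j)"
 shows "P u"
proof -
 have "\<forall>u. {k. u k \<noteq> 0} \<subseteq> F \<longrightarrow> P u" if "finite F" for F using that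
 proof (induction F)
  case empty
  show ?case
  proof (intro allI impI)
   fix u :: zseq assume "{k. u k \<noteq> 0} \<subseteq> {}"
   then have "u = (\<lambda>k. 0)" by auto
   then show "P u" using 0 by simp
  qed
 next
  case (insert k F)
  show ?case
  proof (intro allI impI)
   fix u :: zseq assume u: "{j. u j \<noteq> 0} \<subseteq> insert k F"
   define v where "v = u(k := 0)"
   have v: "{j. v j \<noteq> 0} \<subseteq> F" using u by (auto simp: v_def)
   moreover have "v \<in> finseq" using v insert(1) finite_subset by (auto simp: finseq_def)
   ultimately have "P (\<lambda>j. v j + u k * basis_vec k j)" using insert add by blast
   moreover have "(\<lambda>j. v j + u k * basis_vec k j) = u" by (auto simp: v_def basis_vec_def)
   ultimately show "P u" by simp
  qed
 qed
 then show ?thesis using assms(1) by (auto simp: finseq_def)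
qed

lemma ip_summable:
 assumes "u \<in> ell2" "v \<in> ell2"
 shows "(\<lambda>k. u k * cnj (v k)) summable_on UNIV"
proof (rule abs_summable_summable, rule Infinite_Sum.abs_summable_on_comparison_test')
 show "(\<lambda>k. (cmod (u k))^2 + (cmod (v k))^2) summable_on UNIV"
  using assms by (intro summable_on_add) (auto simp: ell2_def)
 show "cmod (u k * cnj (v k)) \<le> (cmod (u k))^2 + (cmod (v k))^2" for k
 proof -
  have "0 \<le> cmod (u k) * cmod (v k)" by simp
  moreover have "2 * (cmod (u k) * cmod (v k)) \<le> (cmod (u k))^2 + (cmod (v k))^2"
   using sum_squares_bound[of "cmod (u k)" "cmod (v k)"] by (simp add: mult.assoc)
  ultimately show ?thesis unfolding norm_mult complex_mod_cnj by linarith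
 qed
qed

lemma ip_lin_left:
 assumes "u \<in> ell2" "v \<in> ell2" "x \<in> ell2"
 shows "ip (\<lambda>k. \<alpha> * u k + \<beta> * v k) x = \<alpha> * ip u x + \<beta> * ip v x"
proof -
 have "ip (\<lambda>k. \<alpha> * u k + \<beta> * v k) x = (\<Sum>\<^sub>\<infinity>k. \<alpha> * (u k * cnj (x k)) + \<beta> * (v k * cnj (x k)))"
  unfolding ip_def by (intro infsum_cong) (simp add: algebra_simps)
 also have "\<dots> = (\<Sum>\<^sub>\<infinity>k. \<alpha> * (u k * cnj (x k))) + (\<Sum>\<^sub>\<infinity>k. \<beta> * (v k * cnj (x k)))"
  by (intro infsum_add summable_on_cmult_right ip_summable assms)
 finally show ?thesis unfolding ip_def by (simp add: infsum_cmult_right ip_summable assms)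
qed

lemma ip_commute: "ip v u = cnj (ip u v)" unfolding ip_def by (simp flip: infsum_cnj add: mult.commute)

lemma ip_lin_right:
 assumes "u \<in> ell2" "v \<in> ell2" "x \<in> ell2"
 shows "ip x (\<lambda>k. \<alpha> * u k + \<beta> * v k) = cnj \<alpha> * ip x u + cnj \<beta> * ip x v"
 using ip_lin_left[OF assms, of \<alpha> \<beta>] by (simp add: ip_commute[of x])

lemma ip_add_left: "u \<in> ell2 \<Longrightarrow> v \<in> ell2 \<Longrightarrow> x \<in> ell2 \<Longrightarrow> ip (\<lambda>k. u k + v k) x = ip u x + ip v x"
 and ip_diff_left: "u \<in> ell2 \<Longrightarrow> v \<in> ell2 \<Longrightarrow> x \<in> ell2 \<Longrightarrow> ip (\<lambda>k. u k - v k) x = ip u x - ip v x"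
 and ip_cmult_left: "u \<in> ell2 \<Longrightarrow> x \<in> ell2 \<Longrightarrow> ip (\<lambda>k. \<alpha> * u k) x = \<alpha> * ip u x"
 and ip_add_right: "u \<in> ell2 \<Longrightarrow> v \<in> ell2 \<Longrightarrow> x \<in> ell2 \<Longrightarrow> ip x (\<lambda>k. u k + v k) = ip x u + ip x v"
 and ip_diff_right: "u \<in> ell2 \<Longrightarrow> v \<in> ell2 \<Longrightarrow> x \<in> ell2 \<Longrightarrow> ip x (\<lambda>k. u k - v k) = ip x u - ip x v"
 and ip_cmult_right: "u \<in> ell2 \<Longrightarrow> x \<in> ell2 \<Longrightarrow> ip x (\<lambda>k. \<alpha> * u k) = cnj \<alpha> * ip x u"
 using ip_lin_left[of u v x 1 1] ip_lin_left[of u v x 1 "-1"] ip_lin_left[of u u x \<alpha> 0]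
  ip_lin_right[of u v x 1 1] ip_lin_right[of u v x 1 "-1"] ip_lin_right[of u u x \<alpha> 0] by simp_all

lemma ip_self:
 assumes "u \<in> ell2" shows "ip u u = of_real ((ell2_norm u)^2)"
proof -
 have "(ell2_norm u)^2 = (\<Sum>\<^sub>\<infinity>k. (cmod (u k))^2)" unfolding ell2_norm_def by (simp add: infsum_nonneg)
 moreover have "((\<lambda>k. complex_of_real ((cmod (u k))^2)) has_sum of_real (\<Sum>\<^sub>\<infinity>k. (cmod (u k))^2)) UNIV"
  using assms by (intro has_sum_of_real has_sum_infsum) (simp add: ell2_def)
 ultimately show ?thesis unfolding ip_def complex_norm_square[symmetric] by (simp add: infsumI)
qed

lemma ell2_norm_nonneg [simp]: "0 \<le> ell2_norm u" unfolding ell2_norm_def by (simp add: infsum_nonneg)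

lemma ell2_norm_sq: "u \<in> ell2 \<Longrightarrow> (ell2_norm u)^2 = Re (ip u u)" by (simp add: ip_self)

lemma ip_zero [simp]: "ip (\<lambda>k. 0) u = 0" "ip u (\<lambda>k. 0) = 0" by (simp_all add: ip_def)

lemma ell2_norm_zero [simp]: "ell2_norm (\<lambda>k. 0) = 0" by (simp add: ell2_norm_def)

text \<open>The norm of \<open>u - s * ip u v * v\<close> is nonnegative for every real
  \<open>s\<close>. For \<open>p \<noteq> 0\<close> take \<open>s = 1 / p\<close>; for
  \<open>p = 0\<close> a large \<open>s\<close> forces \<open>ip u v = 0\<close>.\<close>

lemma cauchy_schwarz:
 assumes u: "u \<in> ell2" and v: "v \<in> ell2"
 shows "cmod (ip u v) \<le> ell2_norm u * ell2_norm v"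
proof -
 define p where "p = (ell2_norm v)^2"
 have main: "2 * s * (cmod (ip u v))^2 \<le> (ell2_norm u)^2 + s^2 * (cmod (ip u v))^2 * p" for s :: real
 proof -
  define \<alpha> where "\<alpha> = of_real s * ip u v"
  have x: "(\<lambda>k. u k - \<alpha> * v k) \<in> ell2" by (intro ell2_diff ell2_cmult u v)
  have "ip (\<lambda>k. u k - \<alpha> * v k) (\<lambda>k. u k - \<alpha> * v k)
   = of_real ((ell2_norm u)^2) - cnj \<alpha> * ip u v - \<alpha> * ip v u + \<alpha> * cnj \<alpha> * of_real p"
   using u v x ell2_cmult[OF v, of \<alpha>]
   by (simp add: ip_diff_left ip_diff_right ip_cmult_left ip_cmult_right ip_self p_def algebra_simps)
  also have "cnj \<alpha> * ip u v = of_real (s * (cmod (ip u v))^2)"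
   unfolding of_real_mult complex_norm_square \<alpha>_def by (simp add: mult_ac)
  also have "\<alpha> * ip v u = of_real (s * (cmod (ip u v))^2)"
   unfolding of_real_mult complex_norm_square \<alpha>_def ip_commute[of v u] by (simp add: mult.assoc)
  also have "\<alpha> * cnj \<alpha> = of_real (s^2 * (cmod (ip u v))^2)"
   unfolding of_real_mult complex_norm_square \<alpha>_def by (simp add: power2_eq_square mult_ac)
  finally have "ip (\<lambda>k. u k - \<alpha> * v k) (\<lambda>k. u k - \<alpha> * v k)
   = of_real ((ell2_norm u)^2 - 2 * s * (cmod (ip u v))^2 + s^2 * (cmod (ip u v))^2 * p)" by simp
  then have "(ell2_norm u)^2 - 2 * s * (cmod (ip u v))^2 + s^2 * (cmod (ip u v))^2 * p
   = (ell2_norm (\<lambda>k. u k - \<alpha> * v k))^2" unfolding ip_self[OF x] of_real_eq_iff by simp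
  then show ?thesis using zero_le_power2[of "ell2_norm (\<lambda>k. u k - \<alpha> * v k)"] by linarith
 qed
 have "(cmod (ip u v))^2 \<le> (ell2_norm u)^2 * p"
 proof (cases "p = 0")
  case True
  have "(cmod (ip u v))^2 = 0"
  proof (rule ccontr)
   assume "(cmod (ip u v))^2 \<noteq> 0"
   then have "2 * ((ell2_norm u)^2 / (cmod (ip u v))^2 + 1) * (cmod (ip u v))^2 \<le> (ell2_norm u)^2"
    using main[of "(ell2_norm u)^2 / (cmod (ip u v))^2 + 1"] True by simp
   then have "2 * (ell2_norm u)^2 + 2 * (cmod (ip u v))^2 \<le> (ell2_norm u)^2"
    using \<open>(cmod (ip u v))\<^sup>2 \<noteq> 0\<close> by (simp add: distrib_right)
   then show False using \<open>(cmod (ip u v))\<^sup>2 \<noteq> 0\<close> zero_le_power2[of "ell2_norm u"] zero_le_power2[of "cmod (ip u v)"] by linarith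
  qed
  then show ?thesis using True by simp
 next
  case False
  then have "p > 0" by (simp add: p_def)
  then show ?thesis using main[of "1 / p"] by (simp add: field_simps power2_eq_square)
 qed
 also have "\<dots> = (ell2_norm u * ell2_norm v)^2" by (simp add: p_def power_mult_distrib)
 finally show ?thesis by (rule power2_le_imp_le) simp
qed

lemma ell2_norm_triangle:
 assumes u: "u \<in> ell2" and v: "v \<in> ell2"
 shows "ell2_norm (\<lambda>k. u k + v k) \<le> ell2_norm u + ell2_norm v"
proof (rule power2_le_imp_le)
 have "(ell2_norm (\<lambda>k. u k + v k))^2 = (ell2_norm u)^2 + (ell2_norm v)^2 + 2 * Re (ip u v)"
  using u v ip_commute[of v u] by (simp add: ell2_norm_sq ell2_add ip_add_left ip_add_right)
 also have "Re (ip u v) \<le> ell2_norm u * ell2_norm v" using cauchy_schwarz[OF u v] complex_Re_le_cmod order_trans by blast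
 finally show "(ell2_norm (\<lambda>k. u k + v k))^2 \<le> (ell2_norm u + ell2_norm v)^2" by (simp add: power2_sum)
qed simp

lemma ell2_norm_cmult: "ell2_norm (\<lambda>k. \<alpha> * u k) = cmod \<alpha> * ell2_norm u"
 by (simp add: ell2_norm_def norm_mult power_mult_distrib infsum_cmult_right' real_sqrt_mult)

lemma ell2_norm_minus: "ell2_norm (\<lambda>k. u k - v k) = ell2_norm (\<lambda>k. v k - u k)"
 by (simp add: ell2_norm_def norm_minus_commute)

lemma ell2_norm_triangle_diff:
 assumes "u \<in> ell2" "v \<in> ell2" "x \<in> ell2"
 shows "ell2_norm (\<lambda>k. u k - x k) \<le> ell2_norm (\<lambda>k. u k - v k) + ell2_norm (\<lambda>k. v k - x k)"
 using ell2_norm_triangle[of "\<lambda>k. u k - v k" "\<lambda>k. v k - x k"] assms by (auto simp: ell2_diff)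

lemma ip_basis_right: "ip u (basis_vec k) = u k"
proof -
 have "ip u (basis_vec k) = (\<Sum>\<^sub>\<infinity>j\<in>{k}. u j * cnj (basis_vec k j))"
  unfolding ip_def by (rule infsum_cong_neutral) (auto simp: basis_vec_def)
 then show ?thesis by (simp add: basis_vec_def)
qed

lemma ip_basis_left: "ip (basis_vec k) u = cnj (u k)" using ip_basis_right ip_commute by metis

lemma ell2_norm_basis [simp]: "ell2_norm (basis_vec k) = 1"
proof -
 have "(ell2_norm (basis_vec k))^2 = 1" by (simp add: ell2_norm_sq ip_basis_right) (simp add: basis_vec_def)
 then show ?thesis by (metis abs_of_nonneg ell2_norm_nonneg power2_eq_1_iff abs_1 abs_minus)
qed

lemma norm_component_le: "u \<in> ell2 \<Longrightarrow> cmod (u k) \<le> ell2_norm u"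
 using cauchy_schwarz[of u "basis_vec k"] by (simp add: ip_basis_right)

lemma ell2_norm_eq_0: "u \<in> ell2 \<Longrightarrow> ell2_norm u = 0 \<Longrightarrow> u = (\<lambda>k. 0)"
 using norm_component_le[of u] by fastforce

definition trunc :: "nat \<Rightarrow> zseq \<Rightarrow> zseq" where
 "trunc n u = (\<lambda>k. if \<bar>k\<bar> \<le> int n then u k else 0)"

lemma trunc_finseq [simp, intro]: "trunc n u \<in> finseq"
proof -
 have "{k. trunc n u k \<noteq> 0} \<subseteq> {- int n..int n}" by (auto simp: trunc_def abs_le_iff)
 then show ?thesis unfolding finseq_def using finite_subset by blast
qed

lemma trunc_tendsto:
 assumes u: "u \<in> ell2"
 shows "(\<lambda>n. ell2_norm (\<lambda>k. trunc n u k - u k)) \<longlonglongrightarrow> 0"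
proof -
 define g where "g k = (cmod (u k))^2" for k
 have s: "g summable_on UNIV" using u by (simp add: ell2_def g_def[abs_def])
 have "filterlim (\<lambda>n. {- int n..int n}) (finite_subsets_at_top UNIV) sequentially" unfolding filterlim_finite_subsets_at_top
 proof (intro allI impI)
  fix X :: "int set" assume "finite X \<and> X \<subseteq> UNIV"
  then obtain M where M: "\<And>x. x \<in> X \<Longrightarrow> nat \<bar>x\<bar> \<le> M"
   by (metis finite_nat_set_iff_bounded_le finite_imageI imageI)
  show "\<forall>\<^sub>F n in sequentially. finite {- int n..int n} \<and> X \<subseteq> {- int n..int n} \<and> {- int n..int n} \<subseteq> UNIV"
   using eventually_ge_at_top[of M] by eventually_elim (use M in fastforce)
 qed
 then have "(\<lambda>n. sum g {- int n..int n}) \<longlonglongrightarrow> infsum g UNIV"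
  using infsum_tendsto[OF s] filterlim_compose by blast
 then have "(\<lambda>n. sqrt (infsum g UNIV - sum g {- int n..int n})) \<longlonglongrightarrow> sqrt (infsum g UNIV - infsum g UNIV)"
  by (intro tendsto_intros)
 moreover have "ell2_norm (\<lambda>k. trunc n u k - u k) = sqrt (infsum g UNIV - sum g {- int n..int n})" for n
 proof -
  have "(\<Sum>\<^sub>\<infinity>k. (cmod (trunc n u k - u k))^2) = infsum g (UNIV - {- int n..int n})"
   by (rule infsum_cong_neutral) (auto simp: trunc_def g_def abs_le_iff)
  also have "\<dots> = infsum g UNIV - infsum g {- int n..int n}" by (rule infsum_Diff) (use s in auto)
  finally show ?thesis by (simp add: ell2_norm_def)
 qed
 ultimately show ?thesis by simp
qed

lemma ip_tendsto_left:
 assumes "\<And>n. s n \<in> ell2" "u \<in> ell2" "v \<in> ell2" "(\<lambda>n. ell2_norm (\<lambda>k. s n k - u k)) \<longlonglongrightarrow> 0"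
 shows "(\<lambda>n. ip (s n) v) \<longlonglongrightarrow> ip u v"
proof -
 have "cmod (ip (s n) v - ip u v) \<le> ell2_norm (\<lambda>k. s n k - u k) * ell2_norm v" for n
  using cauchy_schwarz[of "\<lambda>k. s n k - u k" v] assms by (auto simp: ip_diff_left)
 moreover have "(\<lambda>n. ell2_norm (\<lambda>k. s n k - u k) * ell2_norm v) \<longlonglongrightarrow> 0"
  using tendsto_mult_right[OF assms(4), of "ell2_norm v"] by simp
 ultimately have "(\<lambda>n. ip (s n) v - ip u v) \<longlonglongrightarrow> 0"
  using Lim_null_comparison[OF always_eventually[OF allI]] by fast
 then show ?thesis using LIM_zero_iff by blast
qed

lemma ell2_norm_tendsto:
 assumes "\<And>n. s n \<in> ell2" "u \<in> ell2" "(\<lambda>n. ell2_norm (\<lambda>k. s n k - u k)) \<longlonglongrightarrow> 0"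
 shows "(\<lambda>n. ell2_norm (s n)) \<longlonglongrightarrow> ell2_norm u"
proof -
 have "norm (ell2_norm (s n) - ell2_norm u) \<le> ell2_norm (\<lambda>k. s n k - u k)" for n
  using ell2_norm_triangle[of "\<lambda>k. s n k - u k" u] ell2_norm_triangle[of "\<lambda>k. u k - s n k" "s n"]
   assms(1,2) ell2_norm_minus[of "s n" u] by (auto simp: ell2_diff abs_le_iff)
 then have "(\<lambda>n. ell2_norm (s n) - ell2_norm u) \<longlonglongrightarrow> 0"
  using Lim_null_comparison[OF always_eventually[OF allI] assms(3)] by fast
 then show ?thesis using LIM_zero_iff by blast
qed

section \<open>Jacobi matrices, the adjoint and the deficiency argument\<close>

definition jac :: "(int \<Rightarrow> real) \<Rightarrow> (int \<Rightarrow> real) \<Rightarrow> zseq \<Rightarrow> zseq" where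
 "jac a b v = (\<lambda>j. of_real (a j) * v (j + 1) + of_real (b j) * v j + of_real (a (j - 1)) * v (j - 1))"

lemma jac_lin: "jac a b (\<lambda>k. \<alpha> * u k + \<beta> * v k) = (\<lambda>k. \<alpha> * jac a b u k + \<beta> * jac a b v k)"
 by (auto simp: jac_def algebra_simps)

text \<open>\<open>jacobi_op\<close> sums over the support and is meaningful for finite support
  only. The difference expression \<open>jac\<close> is defined on all sequences, so that it can
  also describe the adjoint.\<close>

lemma jacobi_op_eq_jac:
 assumes "u \<in> finseq"
 shows "jacobi_op a b u = jac a b u"
proof
 fix j
 let ?t = "\<lambda>k. u k * (of_real (a k) * basis_vec (k + 1) j + of_real (b k) * basis_vec k j
    + of_real (a (k - 1)) * basis_vec (k - 1) j)"
 have fin: "finite {k. u k \<noteq> 0}" using assms by (simp add: finseq_def)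
 have "jacobi_op a b u j = (\<Sum>k | u k \<noteq> 0. ?t k)" by (simp add: jacobi_op_def)
 also have "\<dots> = (\<Sum>k\<in>{k. u k \<noteq> 0} \<union> {j - 1, j, j + 1}. ?t k)" using fin by (intro sum.mono_neutral_left) auto
 also have "\<dots> = (\<Sum>k\<in>{j - 1, j, j + 1}. ?t k)" using fin by (intro sum.mono_neutral_right) (auto simp: basis_vec_def)
 also have "\<dots> = jac a b u j" by (simp add: jac_def basis_vec_def)
 finally show "jacobi_op a b u j = jac a b u j" .
qed

lemma jac_finseq:
 assumes "u \<in> finseq" shows "jac a b u \<in> finseq"
proof -
 have "{k. jac a b u k \<noteq> 0} \<subseteq> {k. u k \<noteq> 0} \<union> (\<lambda>k. k - 1) ` {k. u k \<noteq> 0} \<union> (\<lambda>k. k + 1) ` {k. u k \<noteq> 0}"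
 proof
  fix k assume "k \<in> {k. jac a b u k \<noteq> 0}"
  then have "u (k + 1) \<noteq> 0 \<or> u k \<noteq> 0 \<or> u (k - 1) \<noteq> 0" by (auto simp: jac_def)
  then show "k \<in> {k. u k \<noteq> 0} \<union> (\<lambda>k. k - 1) ` {k. u k \<noteq> 0} \<union> (\<lambda>k. k + 1) ` {k. u k \<noteq> 0}"
   by (auto intro: image_eqI[of k _ "k + 1"] image_eqI[of k _ "k - 1"])
 qed
 then show ?thesis using assms unfolding finseq_def by (auto intro: finite_subset)
qed

lemma jac_basis:
 "jac a b (basis_vec k) = (\<lambda>j. of_real (a k) * basis_vec (k + 1) j + of_real (b k) * basis_vec k j
    + of_real (a (k - 1)) * basis_vec (k - 1) j)" by (auto simp: jac_def basis_vec_def)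

lemma ip_jac:
 assumes u: "u \<in> finseq" and v: "v \<in> ell2" and Jv: "jac a b v \<in> ell2"
 shows "ip (jac a b u) v = ip u (jac a b v)" using u
proof (induction u rule: finseq_induct)
 case zero
 have "jac a b (\<lambda>k. 0) = (\<lambda>k. 0)" by (simp add: jac_def)
 then show ?case by simp
next
 case (add u k \<alpha>)
 have e: "jac a b (\<lambda>j. u j + \<alpha> * basis_vec k j) = (\<lambda>j. 1 * jac a b u j + \<alpha> * jac a b (basis_vec k) j)"
  using jac_lin[of a b 1 u \<alpha> "basis_vec k"] by simp
 have s: "u \<in> ell2" "jac a b u \<in> ell2" "jac a b (basis_vec k) \<in> ell2" using add(1) by (auto intro!: finseq_ell2 jac_finseq)
 have "ip (jac a b (basis_vec k)) v = ip (basis_vec k) (jac a b v)"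
 proof -
  have "ip (jac a b (basis_vec k)) v = ip (\<lambda>j. 1 * (of_real (a k) * basis_vec (k + 1) j + of_real (b k) * basis_vec k j)
    + of_real (a (k - 1)) * basis_vec (k - 1) j) v" unfolding jac_basis by simp
  also have "\<dots> = of_real (a k) * cnj (v (k + 1)) + of_real (b k) * cnj (v k) + of_real (a (k - 1)) * cnj (v (k - 1))"
   using v by (simp only: ip_lin_left ell2_lin basis_vec_ell2) (simp add: ip_basis_left)
  finally show ?thesis by (simp add: ip_basis_left jac_def)
 qed
 then show ?case unfolding e using add s v Jv ip_lin_left[of u "basis_vec k" "jac a b v" 1 \<alpha>]
   ip_lin_left[of "jac a b u" "jac a b (basis_vec k)" v 1 \<alpha>] by simp
qed

definition jac_graph :: "(int \<Rightarrow> real) \<Rightarrow> (int \<Rightarrow> real) \<Rightarrow> op_graph" where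
 "jac_graph a b = {(u, jac a b u) | u. u \<in> finseq}"

lemma L_graph_eq: "L_graph q r c d = jac_graph (a_coeff q r c d) (b_coeff q r c d)"
 unfolding L_graph_def jac_graph_def using jacobi_op_eq_jac by fastforce

text \<open>Testing against basis vectors identifies the adjoint as the maximal operator; conversely
  a finite test vector leaves no boundary terms.\<close>

lemma op_adjoint_jac:
 "op_adjoint (jac_graph a b) = {(v, w). v \<in> ell2 \<and> w \<in> ell2 \<and> w = jac a b v}"
proof (intro set_eqI iffI; clarify)
 fix v w assume "(v, w) \<in> op_adjoint (jac_graph a b)"
 then have vw: "v \<in> ell2" "w \<in> ell2" "\<And>u. u \<in> finseq \<Longrightarrow> ip (jac a b u) v = ip u w"
  by (auto simp: op_adjoint_def jac_graph_def)
 have "w k = jac a b v k" for k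
 proof -
  have "ip (jac a b (basis_vec k)) v = ip (\<lambda>j. 1 * (of_real (a k) * basis_vec (k + 1) j + of_real (b k) * basis_vec k j)
    + of_real (a (k - 1)) * basis_vec (k - 1) j) v" unfolding jac_basis by simp
  also have "\<dots> = of_real (a k) * cnj (v (k + 1)) + of_real (b k) * cnj (v k) + of_real (a (k - 1)) * cnj (v (k - 1))"
   using vw by (simp only: ip_lin_left ell2_lin basis_vec_ell2) (simp add: ip_basis_left)
  also have "\<dots> = cnj (jac a b v k)" by (simp add: jac_def)
  finally show ?thesis using vw(3)[of "basis_vec k"] by (simp add: ip_basis_left)
 qed
 then show "v \<in> ell2 \<and> w \<in> ell2 \<and> w = jac a b v" using vw by auto
next
 fix v assume "v \<in> ell2" "jac a b v \<in> ell2"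
 then show "(v, jac a b v) \<in> op_adjoint (jac_graph a b)" by (auto simp: op_adjoint_def jac_graph_def ip_jac)
qed

lemma op_adjoint_closure:
 assumes T: "T \<subseteq> ell2 \<times> ell2"
 shows "op_adjoint (op_closure T) = op_adjoint T"
proof (intro set_eqI iffI; clarify)
 fix v w assume vw: "(v, w) \<in> op_adjoint (op_closure T)"
 have "T \<subseteq> op_closure T"
 proof clarify
  fix u u' assume "(u, u') \<in> T"
  then show "(u, u') \<in> op_closure T" unfolding op_closure_def mem_Collect_eq case_prod_conv using T
   by (intro conjI exI[of _ "\<lambda>n. u"] exI[of _ "\<lambda>n. u'"]) auto
 qed
 then show "(v, w) \<in> op_adjoint T" using vw by (auto simp: op_adjoint_def)
next
 fix v w assume vw: "(v, w) \<in> op_adjoint T"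
 then have v: "v \<in> ell2" "w \<in> ell2" by (auto simp: op_adjoint_def)
 have "ip u' v = ip u w" if "(u, u') \<in> op_closure T" for u u'
 proof -
  obtain s t where st: "u \<in> ell2" "u' \<in> ell2" "\<And>n::nat. (s n, t n) \<in> T"
   "(\<lambda>n. ell2_norm (\<lambda>k. s n k - u k)) \<longlonglongrightarrow> 0" "(\<lambda>n. ell2_norm (\<lambda>k. t n k - u' k)) \<longlonglongrightarrow> 0"
   using \<open>(u, u') \<in> op_closure T\<close> unfolding op_closure_def by blast
  have s: "s n \<in> ell2" "t n \<in> ell2" for n using st(3) T by auto
  have "(\<lambda>n. ip (t n) v) \<longlonglongrightarrow> ip u' v" by (rule ip_tendsto_left) (use s st v in auto)
  moreover have "(\<lambda>n. ip (s n) w) \<longlonglongrightarrow> ip u w" by (rule ip_tendsto_left) (use s st v in auto)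
  moreover have "ip (t n) v = ip (s n) w" for n using vw st(3) by (auto simp: op_adjoint_def)
  ultimately show ?thesis using LIMSEQ_unique by simp
 qed
 then show "(v, w) \<in> op_adjoint (op_closure T)" using v by (auto simp: op_adjoint_def)
qed

text \<open>Says that \<open>u\<close> lies in the closure of the range of \<open>L - z\<close> on
  finite sequences.\<close>

definition approx_range :: "(int \<Rightarrow> real) \<Rightarrow> (int \<Rightarrow> real) \<Rightarrow> complex \<Rightarrow> zseq \<Rightarrow> bool" where
 "approx_range a b z u \<longleftrightarrow> (\<forall>e>0. \<exists>h\<in>finseq. ell2_norm (\<lambda>k. jac a b h k - z * h k - u k) < e)"

lemma approx_range_lin:
 assumes uv: "u \<in> ell2" "v \<in> ell2" and "approx_range a b z u" "approx_range a b z v"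
 shows "approx_range a b z (\<lambda>k. \<alpha> * u k + \<beta> * v k)" unfolding approx_range_def
proof (intro allI impI)
 fix e :: real assume e: "e > 0"
 define e' where "e' = e / (cmod \<alpha> + cmod \<beta> + 1)"
 have pos: "cmod \<alpha> + cmod \<beta> + 1 > 0" by (simp add: add_nonneg_pos)
 then have e': "e' > 0" using e by (simp add: e'_def)
 obtain h g where h: "h \<in> finseq" "ell2_norm (\<lambda>k. jac a b h k - z * h k - u k) < e'"
  and g: "g \<in> finseq" "ell2_norm (\<lambda>k. jac a b g k - z * g k - v k) < e'"
  using assms(3,4) e' unfolding approx_range_def by meson
 define f where "f = (\<lambda>k. \<alpha> * h k + \<beta> * g k)"
 have m: "(\<lambda>k. jac a b h k - z * h k - u k) \<in> ell2" "(\<lambda>k. jac a b g k - z * g k - v k) \<in> ell2"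
  using h(1) g(1) by (intro ell2_diff ell2_cmult uv; simp add: finseq_ell2 jac_finseq)+
 have eq: "(\<lambda>k. jac a b f k - z * f k - (\<alpha> * u k + \<beta> * v k)) =
   (\<lambda>k. \<alpha> * (jac a b h k - z * h k - u k) + \<beta> * (jac a b g k - z * g k - v k))"
  unfolding f_def jac_lin by (auto simp: algebra_simps)
 have "ell2_norm (\<lambda>k. jac a b f k - z * f k - (\<alpha> * u k + \<beta> * v k)) \<le> cmod \<alpha> * ell2_norm (\<lambda>k. jac a b h k - z * h k - u k) + cmod \<beta> * ell2_norm (\<lambda>k. jac a b g k - z * g k - v k)"
  unfolding eq ell2_norm_cmult[symmetric] by (intro ell2_norm_triangle ell2_cmult m)
 also have "\<dots> \<le> cmod \<alpha> * e' + cmod \<beta> * e'" using h g by (intro add_mono mult_left_mono) auto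
 also have "\<dots> < (cmod \<alpha> + cmod \<beta> + 1) * e'" using e' by (simp add: distrib_right)
 also have "\<dots> = e" using pos by (simp add: e'_def)
 finally show "\<exists>h\<in>finseq. ell2_norm (\<lambda>k. jac a b h k - z * h k - (\<alpha> * u k + \<beta> * v k)) < e"
  using h g by (intro bexI[of _ f]) (auto simp: f_def)
qed

text \<open>The quadratic form of a real Jacobi matrix is real, so the imaginary part of
  \<open>ip ((J - z) h) h\<close> comes from \<open>z\<close> alone.\<close>

lemma jac_im_bound:
 assumes h: "h \<in> finseq"
 shows "\<bar>Im z\<bar> * ell2_norm h \<le> ell2_norm (\<lambda>k. jac a b h k - z * h k)"
proof (cases "ell2_norm h = 0")
 case False
 have m: "h \<in> ell2" "jac a b h \<in> ell2" using h by (auto intro!: finseq_ell2 jac_finseq)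
 have "ip (jac a b h) h = cnj (ip (jac a b h) h)" using ip_jac[OF h m] ip_commute[of h "jac a b h"] by simp
 then have re: "Im (ip (jac a b h) h) = 0" by (metis complex_cnj_cancel_iff complex_In_mult_cnj_zero cnj.simps(2) equal_neg_zero)
 have "Im (ip (\<lambda>k. jac a b h k - z * h k) h) = - Im z * (ell2_norm h)^2"
  using m re by (simp add: ip_diff_left ip_cmult_left ell2_cmult ip_self)
 then have "\<bar>Im z\<bar> * (ell2_norm h)^2 \<le> cmod (ip (\<lambda>k. jac a b h k - z * h k) h)"
  using abs_Im_le_cmod[of "ip (\<lambda>k. jac a b h k - z * h k) h"] by (simp add: abs_mult)
 also have "\<dots> \<le> ell2_norm (\<lambda>k. jac a b h k - z * h k) * ell2_norm h" using m by (intro cauchy_schwarz) auto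
 finally have "\<bar>Im z\<bar> * ell2_norm h * ell2_norm h \<le> ell2_norm (\<lambda>k. jac a b h k - z * h k) * ell2_norm h"
  by (simp add: power2_eq_square mult.assoc)
 then show ?thesis using False by (simp add: mult_le_cancel_right order.strict_iff_order)
qed simp

text \<open>The deficiency argument without orthogonal projections: approximate solvability of
 \<open>(L - z) h = u\<close> at \<open>z\<close> and at \<open>cnj z\<close> shows directly that every element of the adjoint graph is a
 limit of elements of the graph.\<close>

theorem jac_essentially_self_adjoint:
 assumes z: "Im z \<noteq> 0"
  and r1: "\<And>u. u \<in> finseq \<Longrightarrow> approx_range a b z u"
  and r2: "\<And>u. u \<in> finseq \<Longrightarrow> approx_range a b (cnj z) u"
 shows "op_closure (jac_graph a b) = {(v, w). v \<in> ell2 \<and> w \<in> ell2 \<and> w = jac a b v}"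
  and "self_adjoint (op_closure (jac_graph a b))"
proof -
 let ?L = "jac_graph a b" and ?M = "{(v, w). v \<in> ell2 \<and> w \<in> ell2 \<and> w = jac a b v}"
 have L: "?L \<subseteq> ell2 \<times> ell2" by (auto simp: jac_graph_def intro!: finseq_ell2 jac_finseq)
 have adj: "op_adjoint (op_closure ?L) = ?M" unfolding op_adjoint_closure[OF L] by (rule op_adjoint_jac)
 have "op_closure ?L \<subseteq> ?M"
 proof clarify
  fix u u' assume uu: "(u, u') \<in> op_closure ?L"
  then obtain s t where st: "u \<in> ell2" "u' \<in> ell2" "\<And>n::nat. (s n, t n) \<in> ?L"
   "(\<lambda>n. ell2_norm (\<lambda>k. s n k - u k)) \<longlonglongrightarrow> 0" "(\<lambda>n. ell2_norm (\<lambda>k. t n k - u' k)) \<longlonglongrightarrow> 0"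
   unfolding op_closure_def by blast
  have s: "s n \<in> ell2" "t n \<in> ell2" "t n = jac a b (s n)" for n using st(3)[of n] L by (auto simp: jac_graph_def)
  have cs: "(\<lambda>n. s n k) \<longlonglongrightarrow> u k" for k
   using ip_tendsto_left[of s u "basis_vec k"] s st by (simp add: ip_basis_right)
  have ct: "(\<lambda>n. t n k) \<longlonglongrightarrow> u' k" for k
   using ip_tendsto_left[of t u' "basis_vec k"] s st by (simp add: ip_basis_right)
  have "u' k = jac a b u k" for k
  proof (rule LIMSEQ_unique[OF ct])
   show "(\<lambda>n. t n k) \<longlonglongrightarrow> jac a b u k" unfolding s(3) jac_def by (intro tendsto_intros cs)
  qed
  then show "u \<in> ell2 \<and> u' \<in> ell2 \<and> u' = jac a b u" using st by auto
 qed
 moreover have "?M \<subseteq> op_closure ?L"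
 proof clarify
  fix v assume v: "v \<in> ell2" and w: "jac a b v \<in> ell2"
  \<comment> \<open>Approximate solutions \<open>h n\<close> of \<open>(J - z) h = g\<close> should
    approximate \<open>v\<close> itself, in spite of \<open>v\<close> lying only in the domain of
    the adjoint.\<close>
  define g where "g = (\<lambda>k. jac a b v k - z * v k)"
  have g: "g \<in> ell2" unfolding g_def by (intro ell2_diff ell2_cmult v w)
  have "\<exists>h\<in>finseq. ell2_norm (\<lambda>k. jac a b h k - z * h k - trunc n g k) < 1 / real (Suc n)" for n
   using r1[of "trunc n g"] unfolding approx_range_def by simp
  then obtain h where h: "\<And>n. h n \<in> finseq"
   "\<And>n. ell2_norm (\<lambda>k. jac a b (h n) k - z * h n k - trunc n g k) < 1 / real (Suc n)" by metis
  have he: "h n \<in> ell2" "jac a b (h n) \<in> ell2" for n using h by (auto intro!: finseq_ell2 jac_finseq)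
  define \<delta> where "\<delta> n = ell2_norm (\<lambda>k. jac a b (h n) k - z * h n k - g k)" for n
  have \<delta>0: "\<delta> \<longlonglongrightarrow> 0"
  proof (rule Lim_null_comparison)
   have "\<delta> n \<le> 1 / real (Suc n) + ell2_norm (\<lambda>k. trunc n g k - g k)" for n
   proof -
    have "(\<lambda>k. jac a b (h n) k - z * h n k) \<in> ell2" by (intro ell2_diff ell2_cmult he)
    from ell2_norm_triangle_diff[OF this finseq_ell2[OF trunc_finseq] g]
    show ?thesis using h(2)[of n] unfolding \<delta>_def by (meson add_mono order_less_imp_le order_refl order_trans)
   qed
   then show "\<forall>\<^sub>F n in sequentially. norm (\<delta> n) \<le> 1 / real (Suc n) + ell2_norm (\<lambda>k. trunc n g k - g k)"
    by (simp add: \<delta>_def)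
   show "(\<lambda>n. 1 / real (Suc n) + ell2_norm (\<lambda>k. trunc n g k - g k)) \<longlonglongrightarrow> 0"
    using tendsto_add[OF LIMSEQ_Suc[OF lim_1_over_n] trunc_tendsto[OF g]] by simp
  qed
  have key: "ell2_norm (\<lambda>k. v k - h n k) \<le> \<delta> n / \<bar>Im z\<bar>" for n
  proof -
   define x where "x = (\<lambda>k. v k - h n k)"
   have x: "x \<in> ell2" unfolding x_def by (intro ell2_diff v he)
   define y where "y = (\<lambda>k. jac a b (h n) k - z * h n k - g k)"
   have y: "y \<in> ell2" "ell2_norm y = \<delta> n" unfolding y_def \<delta>_def by (intro ell2_diff ell2_cmult he g refl)+
   \<comment> \<open>Duality: \<open>u\<close> is approximated by \<open>p = (J - cnj z) f\<close>,
     and \<open>ip x p\<close> equals \<open>- ip y f\<close> by symmetry, where \<open>y\<close> is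
     the small residual and \<open>f\<close> is controlled by \<open>jac_im_bound\<close>.\<close>
   have bound: "cmod (ip x u) \<le> \<delta> n / \<bar>Im z\<bar> * ell2_norm u" if u: "u \<in> finseq" for u
   proof (rule field_le_epsilon)
    fix e :: real assume e: "e > 0"
    \<comment> \<open>Approximating \<open>u\<close> within \<open>e / M\<close> changes the
      estimate by at most \<open>(\<delta> n / \<bar>Im z\<bar> + ell2_norm x) * (e / M)\<close>,
      which is below \<open>e\<close>.\<close>
    define M where "M = \<delta> n / \<bar>Im z\<bar> + ell2_norm x + 1"
    have dn: "0 \<le> \<delta> n / \<bar>Im z\<bar>" by (simp add: \<delta>_def)
    then have M: "M > 0" unfolding M_def using ell2_norm_nonneg[of x] by linarith
    then have eM: "e / M > 0" using e by simp
    obtain f where f: "f \<in> finseq" "ell2_norm (\<lambda>k. jac a b f k - cnj z * f k - u k) < e / M"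
     using r2[OF u] eM unfolding approx_range_def by blast
    have fe: "f \<in> ell2" "jac a b f \<in> ell2" "u \<in> ell2" using f u by (auto intro!: finseq_ell2 jac_finseq)
    define p where "p = (\<lambda>k. jac a b f k - cnj z * f k)"
    have p: "p \<in> ell2" unfolding p_def by (intro ell2_diff ell2_cmult fe)
    have pu: "ell2_norm (\<lambda>k. p k - u k) < e / M" using f by (simp add: p_def)
    have sym: "ip v (jac a b f) = ip (jac a b v) f" "ip (h n) (jac a b f) = ip (jac a b (h n)) f"
     using ip_jac[OF f(1) v w] ip_jac[OF h(1) fe(1,2)] ip_commute[of v "jac a b f"] ip_commute[of f "jac a b v"] by simp_all
    have yf: "ip y f = ip (jac a b (h n)) f - z * ip (h n) f - (ip (jac a b v) f - z * ip v f)" unfolding y_def g_def using v w he fe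
     by (simp add: ip_diff_left ip_cmult_left ell2_diff ell2_cmult)
    have xp: "ip x p = (ip v (jac a b f) - ip (h n) (jac a b f)) - z * (ip v f - ip (h n) f)" unfolding x_def p_def using v w he fe
     by (simp add: ip_diff_left ip_diff_right ip_cmult_right ell2_diff ell2_cmult right_diff_distrib)
    have "ip x p = - ip y f" unfolding xp yf sym by (simp add: algebra_simps)
    then have "cmod (ip x p) \<le> \<delta> n * ell2_norm f" using cauchy_schwarz[OF y(1) fe(1)] y(2) by simp
    also have "ell2_norm f \<le> ell2_norm p / \<bar>Im z\<bar>"
     using jac_im_bound[OF f(1), of "cnj z" a b] z by (simp add: p_def pos_le_divide_eq mult.commute)
    also have "ell2_norm p \<le> ell2_norm u + e / M"
     using ell2_norm_triangle[of "\<lambda>k. p k - u k" u] p fe pu by (auto simp: ell2_diff)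
    finally have 1: "cmod (ip x p) \<le> \<delta> n * ((ell2_norm u + e / M) / \<bar>Im z\<bar>)"
     using z by (auto simp: \<delta>_def divide_right_mono mult_left_mono)
    have "cmod (ip x p - ip x u) \<le> ell2_norm x * (e / M)"
    proof -
     have "cmod (ip x (\<lambda>k. p k - u k)) \<le> ell2_norm x * ell2_norm (\<lambda>k. p k - u k)"
      by (rule cauchy_schwarz) (use x p fe in auto)
     also have "\<dots> \<le> ell2_norm x * (e / M)" using pu by (intro mult_left_mono) auto
     finally show ?thesis using x p fe by (simp add: ip_diff_right)
    qed
    then have "cmod (ip x u) \<le> \<delta> n * ((ell2_norm u + e / M) / \<bar>Im z\<bar>) + ell2_norm x * (e / M)"
     using 1 norm_triangle_ineq2[of "ip x u" "ip x p"] by (simp add: norm_minus_commute)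
    also have "\<dots> = \<delta> n / \<bar>Im z\<bar> * ell2_norm u + (\<delta> n / \<bar>Im z\<bar> + ell2_norm x) * (e / M)"
     by (simp add: algebra_simps add_divide_distrib)
    also have "(\<delta> n / \<bar>Im z\<bar> + ell2_norm x) * (e / M) \<le> M * (e / M)"
     using eM by (intro mult_right_mono) (auto simp: M_def)
    finally show "cmod (ip x u) \<le> \<delta> n / \<bar>Im z\<bar> * ell2_norm u + e" using M by simp
   qed
   have "ell2_norm (trunc m x) \<le> \<delta> n / \<bar>Im z\<bar>" for m
   proof (cases "ell2_norm (trunc m x) = 0")
    case False
    have "ip x (trunc m x) = ip (trunc m x) (trunc m x)" unfolding ip_def by (intro infsum_cong) (simp add: trunc_def)
    then have "(ell2_norm (trunc m x))^2 \<le> \<delta> n / \<bar>Im z\<bar> * ell2_norm (trunc m x)"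
     using bound[OF trunc_finseq, of m x] by (simp add: ip_self finseq_ell2 norm_power)
    moreover have "0 < ell2_norm (trunc m x)" using False by (simp add: order.strict_iff_order)
    ultimately show ?thesis unfolding power2_eq_square by (rule mult_right_le_imp_le)
   qed (simp add: \<delta>_def)
   moreover have "(\<lambda>m. ell2_norm (trunc m x)) \<longlonglongrightarrow> ell2_norm x"
    by (rule ell2_norm_tendsto) (use x trunc_tendsto[OF x] finseq_ell2 in auto)
   ultimately show ?thesis unfolding x_def[symmetric] by (intro LIMSEQ_le_const2) auto
  qed
  have lim1: "(\<lambda>n. ell2_norm (\<lambda>k. h n k - v k)) \<longlonglongrightarrow> 0"
  proof (rule Lim_null_comparison)
   show "(\<lambda>n. \<delta> n / \<bar>Im z\<bar>) \<longlonglongrightarrow> 0" using tendsto_divide_zero[OF \<delta>0] .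
   show "\<forall>\<^sub>F n in sequentially. norm (ell2_norm (\<lambda>k. h n k - v k)) \<le> \<delta> n / \<bar>Im z\<bar>"
    using key by (simp add: ell2_norm_minus[of _ v])
  qed
  have lim2: "(\<lambda>n. ell2_norm (\<lambda>k. jac a b (h n) k - jac a b v k)) \<longlonglongrightarrow> 0"
  proof (rule Lim_null_comparison)
   show "(\<lambda>n. \<delta> n + cmod z * ell2_norm (\<lambda>k. h n k - v k)) \<longlonglongrightarrow> 0"
    using tendsto_add[OF \<delta>0 tendsto_mult_left[OF lim1, of "cmod z"]] by simp
   have "ell2_norm (\<lambda>k. jac a b (h n) k - jac a b v k) \<le> \<delta> n + cmod z * ell2_norm (\<lambda>k. h n k - v k)" for n
   proof -
    have eq: "(\<lambda>k. jac a b (h n) k - jac a b v k) = (\<lambda>k. (jac a b (h n) k - z * h n k - g k) + z * (h n k - v k))"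
     by (auto simp: g_def algebra_simps)
    show ?thesis unfolding eq \<delta>_def ell2_norm_cmult[symmetric] by (intro ell2_norm_triangle ell2_diff ell2_cmult he v g)
   qed
   then show "\<forall>\<^sub>F n in sequentially. norm (ell2_norm (\<lambda>k. jac a b (h n) k - jac a b v k)) \<le> \<delta> n + cmod z * ell2_norm (\<lambda>k. h n k - v k)"
    by simp
  qed
  have "\<forall>n. (h n, jac a b (h n)) \<in> ?L" using h by (auto simp: jac_graph_def)
  then show "(v, jac a b v) \<in> op_closure ?L" unfolding op_closure_def mem_Collect_eq case_prod_conv using v w lim1 lim2
   by (intro conjI exI[of _ h] exI[of _ "\<lambda>n. jac a b (h n)"])
 qed
 ultimately show eq: "op_closure ?L = ?M" by blast
 show "self_adjoint (op_closure ?L)" unfolding self_adjoint_def adj unfolding eq by (auto simp: single_valued_def)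
qed

lemma ell2_norm_finite_bound:
 assumes F: "finite F" "\<And>k. k \<notin> F \<Longrightarrow> u k = 0" and B: "\<And>k. cmod (u k) \<le> B"
 shows "(ell2_norm u)^2 \<le> real (card F) * B^2"
proof -
 have "(ell2_norm u)^2 = (\<Sum>\<^sub>\<infinity>k. (cmod (u k))^2)" unfolding ell2_norm_def by (simp add: infsum_nonneg)
 also have "\<dots> = (\<Sum>\<^sub>\<infinity>k\<in>F. (cmod (u k))^2)" by (rule infsum_cong_neutral) (use F in auto)
 also have "\<dots> = (\<Sum>k\<in>F. (cmod (u k))^2)" using F by simp
 also have "\<dots> \<le> (\<Sum>k\<in>F. B^2)" by (intro sum_mono power_mono B) auto
 finally show ?thesis by simp
qed

text \<open>A linear cut-off is needed: the coefficients grow like \<open>1 / \<bar>v\<bar>\<close>, so a sharp cut-off would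
 leave an error of order one.\<close>

lemma approx_range_cutoff:
 assumes a: "\<And>j. 0 \<le> a j" and C: "\<And>j. a j * cmod (v j) \<le> C" "\<And>j. a j * cmod (v (j + 1)) \<le> C"
  and u: "u \<in> finseq" "\<And>k. jac a b v k - z * v k = u k"
 shows "approx_range a b z u" unfolding approx_range_def
proof (intro allI impI)
 fix e :: real assume e: "e > 0"
 have C0: "0 \<le> C" using C(1)[of 0] a[of 0] by (meson mult_nonneg_nonneg norm_ge_zero order_trans)
 have "finite {k. u k \<noteq> 0}" using u by (simp add: finseq_def)
 then have "finite ((\<lambda>k. nat \<bar>k\<bar>) ` {k. u k \<noteq> 0})" by simp
 then obtain M where M: "\<And>k. u k \<noteq> 0 \<Longrightarrow> nat \<bar>k\<bar> \<le> M"
  unfolding finite_nat_set_iff_bounded_le by blast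
 \<comment> \<open>The error has at most \<open>5 * N\<close> nonzero entries, each of size at most
   \<open>2 * C / N\<close>, so its squared norm is at most \<open>20 * C^2 / N\<close>.\<close>
 obtain N0 :: nat where N0: "20 * C^2 / e^2 < real N0" using reals_Archimedean2 by blast
 define N where "N = max (max M N0) 1"
 have N: "N \<ge> 1" "M \<le> N" "20 * C^2 / e^2 < real N" using N0 by (auto simp: N_def)
 define \<xi> where "\<xi> k = max 0 (min 1 (2 - real_of_int \<bar>k\<bar> / real N))" for k :: int
 have \<xi>1: "\<xi> k = 1" if "\<bar>k\<bar> \<le> int N" for k
 proof -
  have "real_of_int \<bar>k\<bar> \<le> real N" using that by linarith
  then have "real_of_int \<bar>k\<bar> / real N \<le> 1" using N by (simp add: divide_le_eq)
  then show ?thesis by (simp add: \<xi>_def)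
 qed
 have \<xi>0: "\<xi> k = 0" if "\<bar>k\<bar> \<ge> 2 * int N" for k
 proof -
  have "2 * real N \<le> real_of_int \<bar>k\<bar>" using that by linarith
  then have "2 \<le> real_of_int \<bar>k\<bar> / real N" using N by (simp add: le_divide_eq)
  then show ?thesis by (simp add: \<xi>_def)
 qed
 have \<xi>d: "\<bar>\<xi> (k + 1) - \<xi> k\<bar> \<le> 1 / real N" for k
 proof -
  have "\<bar>real_of_int \<bar>k + 1\<bar> - real_of_int \<bar>k\<bar>\<bar> \<le> 1" by linarith
  then have "\<bar>real_of_int \<bar>k + 1\<bar> / real N - real_of_int \<bar>k\<bar> / real N\<bar> \<le> 1 / real N"
   using N by (simp add: diff_divide_distrib[symmetric] abs_divide divide_right_mono)
  then show ?thesis unfolding \<xi>_def by linarith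
 qed
 define h where "h = (\<lambda>k. of_real (\<xi> k) * v k)"
 define E where "E = (\<lambda>k. jac a b h k - z * h k - u k)"
 have hfin: "h \<in> finseq"
 proof -
  have "{k. h k \<noteq> 0} \<subseteq> {- 2 * int N..2 * int N}"
  proof
   fix k assume "k \<in> {k. h k \<noteq> 0}"
   then have "\<xi> k \<noteq> 0" by (auto simp: h_def)
   then have "\<bar>k\<bar> < 2 * int N" using \<xi>0 not_le by blast
   then show "k \<in> {- 2 * int N..2 * int N}" by auto
  qed
  then show ?thesis unfolding finseq_def using finite_subset by blast
 qed
 have Ek: "E k = of_real (a k * (\<xi> (k + 1) - \<xi> k)) * v (k + 1) + of_real (a (k - 1) * (\<xi> (k - 1) - \<xi> k)) * v (k - 1)" for k
 proof -
  have "of_real (\<xi> k) * u k = u k"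
  proof (cases "u k = 0")
   case False
   then have "nat \<bar>k\<bar> \<le> M" using M by blast
   then have "\<xi> k = 1" using N by (intro \<xi>1) linarith
   then show ?thesis by simp
  qed simp
  moreover have "E k = of_real (\<xi> k) * (jac a b v k - z * v k) - u k
   + of_real (a k * (\<xi> (k + 1) - \<xi> k)) * v (k + 1) + of_real (a (k - 1) * (\<xi> (k - 1) - \<xi> k)) * v (k - 1)"
   by (simp add: E_def h_def jac_def algebra_simps)
  ultimately show ?thesis using u(2) by simp
 qed
 have "cmod (E k) \<le> 2 * C / real N" for k
 proof -
  have 1: "cmod (of_real (a k * (\<xi> (k + 1) - \<xi> k)) * v (k + 1)) \<le> C * (1 / real N)"
  proof -
   have "cmod (of_real (a k * (\<xi> (k + 1) - \<xi> k)) * v (k + 1)) = (a k * cmod (v (k + 1))) * \<bar>\<xi> (k + 1) - \<xi> k\<bar>"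
    using a[of k] by (simp add: norm_mult abs_mult mult_ac del: of_real_mult of_real_diff)
   also have "\<dots> \<le> C * (1 / real N)" using C0 a[of k] by (intro mult_mono C \<xi>d) auto
   finally show ?thesis .
  qed
  have 2: "cmod (of_real (a (k - 1) * (\<xi> (k - 1) - \<xi> k)) * v (k - 1)) \<le> C * (1 / real N)"
  proof -
   have "cmod (of_real (a (k - 1) * (\<xi> (k - 1) - \<xi> k)) * v (k - 1)) = (a (k - 1) * cmod (v (k - 1))) * \<bar>\<xi> (k - 1) - \<xi> k\<bar>"
    using a[of "k - 1"] by (simp add: norm_mult abs_mult mult_ac del: of_real_mult of_real_diff)
   also have "\<dots> \<le> C * (1 / real N)"
    using C0 a[of "k - 1"] \<xi>d[of "k - 1"] by (intro mult_mono C) (auto simp: abs_minus_commute)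
   finally show ?thesis .
  qed
  show ?thesis unfolding Ek using norm_triangle_le[OF add_mono[OF 1 2]] by simp
 qed
 moreover have "E k = 0" if "k \<notin> {- 2 * int N..2 * int N}" for k
 proof -
  have "\<xi> k = 0" "\<xi> (k + 1) = 0" "\<xi> (k - 1) = 0" using that by (auto intro!: \<xi>0)
  then show ?thesis by (simp add: Ek)
 qed
 ultimately have "(ell2_norm E)^2 \<le> real (card {- 2 * int N..2 * int N}) * (2 * C / real N)^2"
  by (intro ell2_norm_finite_bound) auto
 also have "real (card {- 2 * int N..2 * int N}) \<le> 5 * real N" using N by simp
 also have "5 * real N * (2 * C / real N)^2 = 20 * C^2 / real N" using N by (simp add: power2_eq_square field_simps)
 also have "\<dots> < e^2" using N e by (simp add: divide_less_eq mult.commute)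
 finally have "(ell2_norm E)^2 < e^2" by (simp add: mult_right_mono)
 then have "ell2_norm E < e" using e by (simp add: power2_less_imp_less)
 then show "\<exists>h\<in>finseq. ell2_norm (\<lambda>k. jac a b h k - z * h k - u k) < e" using hfin by (auto simp: E_def)
qed

section \<open>The Green function and the self-adjoint closure\<close>

context jacobi_fun
begin

abbreviation "L \<equiv> L_graph q r c d"
abbreviation "T \<equiv> op_closure L"

lemma a_bound_neg: "\<exists>C>0. \<forall>k\<le>0. a k \<le> C"
proof -
 have "Bseq (\<lambda>n. a (- int n))" using a_lim convergent_def convergent_imp_Bseq by blast
 then obtain C where C: "C > 0" "\<And>n. norm (a (- int n)) \<le> C" by (auto simp: Bseq_def)
 have "a k \<le> C" if "k \<le> 0" for k using C(2)[of "nat (-k)"] that by simp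
 then show ?thesis using C by blast
qed

lemma a_Phi_bound: "\<exists>C>0. \<forall>x k. norm x \<le> R \<longrightarrow> 0 \<le> k \<longrightarrow> a k * norm (Phi k x) \<le> C \<and> a k * norm (Phi (k + 1) x) \<le> C"
proof -
 obtain A where A: "A > 0" "\<And>k. k \<ge> 0 \<Longrightarrow> a k \<le> A * q powi (- k)" using a_bound by blast
 obtain C where C: "C > 0" "\<And>x k. norm x \<le> R \<Longrightarrow> 0 \<le> k \<Longrightarrow> norm (Phi k x) \<le> C * q powi k"
  using Phi_bound by meson
 have "a k * norm (Phi k x) \<le> A * C \<and> a k * norm (Phi (k + 1) x) \<le> A * C" if x: "norm x \<le> R" and k: "0 \<le> k" for x k
 proof -
  have qq: "q powi (- k) * q powi k = 1" using q01 by (simp add: power_int_minus)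
  have bound: "a k * t \<le> A * C" if t: "0 \<le> t" "t \<le> C * q powi k" for t
  proof -
   have "a k * t \<le> (A * q powi (- k)) * (C * q powi k)" using A(1) A(2)[OF k] t a_pos[of k] q01 by (intro mult_mono) auto
   also have "\<dots> = A * C * (q powi (- k) * q powi k)" by (simp only: mult_ac)
   finally show ?thesis unfolding qq by simp
  qed
  have "q powi (k + 1) \<le> q powi k" using q01 by (intro power_int_decreasing) auto
  then have "norm (Phi (k + 1) x) \<le> C * q powi k"
   using C(2)[OF x, of "k + 1"] k C(1) by (meson mult_left_mono order_less_imp_le order_trans add_nonneg_nonneg zero_le_one)
  then show ?thesis using C(2)[OF x k] bound by simp
 qed
 then show ?thesis using A C by (intro exI[of _ "A * C"]) auto
qed

text \<open>\<open>G\<close> is the Green function with source \<open>l\<close>, built from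
  \<open>Phi\<close> on the right and \<open>Psi\<close> on the left, where
  \<open>norm y > 1\<close> makes \<open>Psi\<close> decay. The jump at \<open>l\<close> is the
  Wronskian, so \<open>(J - z) G = D y * basis_vec l\<close>, and \<open>a * G\<close> is bounded as
  the cut-off lemma requires.\<close>

lemma approx_range_basis:
 assumes y: "norm y > 1" "D y \<noteq> 0" and l: "l + 1 \<le> K0"
 shows "approx_range a b (mu y) (basis_vec l)"
proof -
 have yS: "y \<in> S" using y S_I by simp
 define z where "z = mu y"
 define G where "G k = (if l \<le> k then Psi l y * Phi k z else Phi l z * Psi k y)" for k
 have eqn: "jac a b G k - z * G k = (if k = l then D y else 0)" for k
 proof -
  have Phi_rec: "of_real (a k) * Phi (k + 1) z + of_real (b k) * Phi k z + of_real (a (k - 1)) * Phi (k - 1) z = z * Phi k z"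
   by (rule Phi_recurrence)
  have Psi_rec: "of_real (a k) * Psi (k + 1) y + of_real (b k) * Psi k y + of_real (a (k - 1)) * Psi (k - 1) y = z * Psi k y"
   if "k + 1 \<le> K0" using Psi_recurrence[OF yS that] by (simp add: solves_def z_def)
  consider "k > l" | "k = l" | "k < l" by linarith
  then show ?thesis
  proof cases
   case 1
   then have "jac a b G k = Psi l y * (of_real (a k) * Phi (k + 1) z + of_real (b k) * Phi k z + of_real (a (k - 1)) * Phi (k - 1) z)"
    by (simp add: jac_def G_def algebra_simps)
   then show ?thesis using 1 by (simp add: Phi_rec G_def)
  next
   case 2
   have "wr l (\<lambda>k. Phi k z) (\<lambda>k. Psi k y) = D y" unfolding z_def by (rule wr_Phi_Psi[OF yS l])
   moreover have "jac a b G l - z * G l = wr l (\<lambda>k. Phi k z) (\<lambda>k. Psi k y)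
     + Phi l z * (of_real (a l) * Psi (l + 1) y + of_real (b l) * Psi l y + of_real (a (l - 1)) * Psi (l - 1) y - z * Psi l y)"
    by (simp add: jac_def G_def wr_def algebra_simps)
   ultimately show ?thesis using 2 Psi_rec l by simp
  next
   case 3
   then have G: "G (k + 1) = Phi l z * Psi (k + 1) y" by (cases "k + 1 = l") (auto simp: G_def)
   have "jac a b G k = Phi l z * (of_real (a k) * Psi (k + 1) y + of_real (b k) * Psi k y + of_real (a (k - 1)) * Psi (k - 1) y)"
    unfolding jac_def G using 3 by (simp add: G_def algebra_simps)
   then show ?thesis using 3 Psi_rec l by (simp add: G_def)
  qed
 qed
 have "\<exists>C. \<forall>j. a j * cmod (G j) \<le> C \<and> a j * cmod (G (j + 1)) \<le> C"
 proof -
  obtain C1 where C1: "C1 > 0" "\<And>k. 0 \<le> k \<Longrightarrow> a k * norm (Phi k z) \<le> C1 \<and> a k * norm (Phi (k + 1) z) \<le> C1"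
   using a_Phi_bound[of "norm z"] by auto
  obtain A where A: "A > 0" "\<And>k. k \<le> 0 \<Longrightarrow> a k \<le> A" using a_bound_neg by blast
  obtain C2 where C2: "C2 > 0" "\<And>k. k \<le> K0 \<Longrightarrow> norm (Psi k y) \<le> C2 * norm y powi k"
   using Psi_bound[of "{y}"] yS by auto
  define C where "C = cmod (Psi l y) * C1 + cmod (Phi l z) * (A * C2)
    + (\<Sum>j\<in>{l - 1..0}. a j * cmod (G j) + a j * cmod (G (j + 1)))"
  have nn: "0 \<le> cmod (Psi l y) * C1" "0 \<le> cmod (Phi l z) * (A * C2)"
   "0 \<le> (\<Sum>j\<in>{l - 1..0}. a j * cmod (G j) + a j * cmod (G (j + 1)))"
   using C1 A C2 a_pos by (auto intro!: sum_nonneg mult_nonneg_nonneg add_nonneg_nonneg simp: less_imp_le)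
  have "a j * cmod (G j) \<le> C \<and> a j * cmod (G (j + 1)) \<le> C" for j
  proof -
   consider "j \<ge> 0" | "j \<in> {l - 1..0}" | "j < l - 1" by force
   then show ?thesis
   proof cases
    case 1
    then have "l \<le> j" using l K0(1) by linarith
    then have "a j * cmod (G j) = cmod (Psi l y) * (a j * norm (Phi j z))" "a j * cmod (G (j + 1)) = cmod (Psi l y) * (a j * norm (Phi (j + 1) z))"
     by (simp_all add: G_def norm_mult)
    moreover have "cmod (Psi l y) * (a j * norm (Phi j z)) \<le> cmod (Psi l y) * C1" "cmod (Psi l y) * (a j * norm (Phi (j + 1) z)) \<le> cmod (Psi l y) * C1"
     using C1(2)[OF 1] by (auto intro: mult_left_mono)
    ultimately show ?thesis using nn unfolding C_def by linarith
   next
    case 2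
    have "a j * cmod (G j) + a j * cmod (G (j + 1)) \<le> (\<Sum>j\<in>{l - 1..0}. a j * cmod (G j) + a j * cmod (G (j + 1)))"
     by (rule member_le_sum[OF 2]) (use a_pos in \<open>auto intro!: mult_nonneg_nonneg add_nonneg_nonneg simp: less_imp_le\<close>)
    moreover have "0 \<le> a j * cmod (G j)" "0 \<le> a j * cmod (G (j + 1))" using a_pos[of j] by simp_all
    ultimately show ?thesis using nn unfolding C_def by linarith
   next
    case 3
    have P: "norm (Psi k y) \<le> C2" if "k \<le> K0" "k \<le> 0" for k
    proof -
     have "norm y powi k \<le> 1" using power_int_increasing[of k 0 "norm y"] that y by simp
     then have "C2 * norm y powi k \<le> C2 * 1" using C2(1) by (intro mult_left_mono) auto
     then show ?thesis using C2(2)[OF that(1)] by simp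
    qed
    have j: "a j \<le> A" "0 \<le> a j" using A(2)[of j] a_pos[of j] 3 l K0(1) by auto
    have "a j * (cmod (Phi l z) * norm (Psi k y)) \<le> cmod (Phi l z) * (A * C2)" if "k \<le> K0" for k
    proof -
     have "a j * norm (Psi k y) \<le> A * C2" using j P[OF that] that K0(1) A(1) by (intro mult_mono) auto
     then have "cmod (Phi l z) * (a j * norm (Psi k y)) \<le> cmod (Phi l z) * (A * C2)" by (intro mult_left_mono) auto
     then show ?thesis by (simp add: mult_ac)
    qed
    from this[of j] this[of "j + 1"] show ?thesis using 3 l nn by (simp add: G_def norm_mult C_def)
   qed
  qed
  then show ?thesis by blast
 qed
 then obtain C where C: "\<And>j. a j * cmod (G j) \<le> C" "\<And>j. a j * cmod (G (j + 1)) \<le> C" by blast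
 have "approx_range a b z (\<lambda>k. D y * basis_vec l k)"
 proof (rule approx_range_cutoff[where a = a and v = G, OF _ C])
  show "0 \<le> a j" for j using a_pos[of j] by simp
  show "(\<lambda>k. D y * basis_vec l k) \<in> finseq" using finseq_lin[of "basis_vec l" "basis_vec l" "D y" 0] by simp
  show "jac a b G k - z * G k = D y * basis_vec l k" for k unfolding eqn by (simp add: basis_vec_def)
 qed
 from approx_range_lin[OF _ _ this this, of "1 / D y" 0]
 show ?thesis using y by (simp add: z_def ell2_cmult)
qed

text \<open>The Jost solution reaches only sources with \<open>l + 1 \<le> K0\<close>. Beyond that,
  \<open>(J - z)\<close> applied to a basis vector lies in the range anyway, and solving it for its
  top entry leads from two neighbouring basis vectors to the next.\<close>

lemma approx_range_all:
 assumes y: "norm y > 1" "D y \<noteq> 0" and u: "u \<in> finseq"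
 shows "approx_range a b (mu y) u"
proof -
 let ?P = "\<lambda>l. approx_range a b (mu y) (basis_vec l)"
 have self: "approx_range a b (mu y) (\<lambda>k. jac a b (basis_vec l) k - mu y * basis_vec l k)" for l
  unfolding approx_range_def by (auto intro!: bexI[of _ "basis_vec l"])
 have step: "?P (l + 1)" if "?P l" "?P (l - 1)" for l
 proof -
  define g1 where "g1 = (\<lambda>k. (of_real (b l) - mu y) * basis_vec l k + of_real (a (l - 1)) * basis_vec (l - 1) k)"
  have g1: "approx_range a b (mu y) g1" "g1 \<in> ell2" unfolding g1_def by (intro approx_range_lin that basis_vec_ell2 ell2_lin)+
  define g2 where "g2 = (\<lambda>k. jac a b (basis_vec l) k - mu y * basis_vec l k)"
  have g2: "approx_range a b (mu y) g2" "g2 \<in> ell2"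
   unfolding g2_def by (rule self) (intro ell2_diff ell2_cmult basis_vec_ell2 finseq_ell2 jac_finseq basis_vec_finseq)
  have "approx_range a b (mu y) (\<lambda>k. 1 / of_real (a l) * g2 k + (- 1 / of_real (a l)) * g1 k)" by (intro approx_range_lin g1 g2)
  moreover have "(\<lambda>k. 1 / of_real (a l) * g2 k + (- 1 / of_real (a l)) * g1 k) = basis_vec (l + 1)"
  proof
   fix k
   have "g2 k - g1 k = of_real (a l) * basis_vec (l + 1) k" unfolding g1_def g2_def jac_basis by (simp add: algebra_simps)
   moreover have "1 / of_real (a l) * g2 k + (- 1 / of_real (a l)) * g1 k = (g2 k - g1 k) / of_real (a l)"
    by (simp add: diff_divide_distrib)
   ultimately show "1 / of_real (a l) * g2 k + (- 1 / of_real (a l)) * g1 k = basis_vec (l + 1) k" using a_pos[of l] by simp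
  qed
  ultimately show ?thesis by simp
 qed
 have "?P l \<and> ?P (l - 1)" for l
 proof (cases "l \<le> K0 - 1")
  case True
  then show ?thesis using approx_range_basis[OF y] by simp
 next
  case False
  then have "K0 - 1 \<le> l" by simp
  then show ?thesis
  proof (induction l rule: int_ge_induct)
   case base
   show ?case using approx_range_basis[OF y] by simp
  next
   case (step i)
   then show ?case using \<open>\<And>l. ?P l \<Longrightarrow> ?P (l - 1) \<Longrightarrow> ?P (l + 1)\<close> by simp
  qed
 qed
 then have basis: "?P l" for l by blast
 show ?thesis using u
 proof (induction u rule: finseq_induct)
  case zero
  show ?case unfolding approx_range_def by (auto intro!: bexI[of _ "\<lambda>k. 0"] simp: jac_def)
 next
  case (add u k \<alpha>)
  then show ?case using approx_range_lin[OF finseq_ell2[OF add(1)] basis_vec_ell2 add(2) basis, of 1 \<alpha>] by simp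
 qed
qed

theorem closure_L: "T = {(v, w). v \<in> ell2 \<and> w \<in> ell2 \<and> w = jac a b v}"
 and self_adjoint_closure_L: "self_adjoint T"
proof -
 \<comment> \<open>All zeros of \<open>D\<close> outside the unit disc are real, so any non-real
   pair will do; the points \<open>2 * \<i>\<close> and \<open>- 2 * \<i>\<close> lead to the
   conjugate spectral parameters with imaginary part \<open>3 / 4\<close> and
   \<open>- 3 / 4\<close>.\<close>
 have D: "D (2 * \<i>) \<noteq> 0" "D (- 2 * \<i>) \<noteq> 0"
 proof -
  have "D y \<noteq> 0" if "norm y > 1" "Im y \<noteq> 0" for y using D_zero_iff[OF that(1)] that(2) Im_complex_of_real by metis
  then show "D (2 * \<i>) \<noteq> 0" "D (- 2 * \<i>) \<noteq> 0" by (simp_all add: norm_mult)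
 qed
 have m: "mu (2 * \<i>) = 3 / 4 * \<i>" "mu (- 2 * \<i>) = cnj (3 / 4 * \<i>)" by (simp_all add: mu_def complex_eq_iff)
 have z: "Im (3 / 4 * \<i>) \<noteq> 0" by simp
 have r: "approx_range a b (3 / 4 * \<i>) u" "approx_range a b (cnj (3 / 4 * \<i>)) u" if "u \<in> finseq" for u
  using approx_range_all[OF _ D(1) that] approx_range_all[OF _ D(2) that] unfolding m by (simp_all add: norm_mult)
 show "T = {(v, w). v \<in> ell2 \<and> w \<in> ell2 \<and> w = jac a b v}"
  unfolding L_graph_eq by (rule jac_essentially_self_adjoint(1)[OF z r])
 show "self_adjoint T" unfolding L_graph_eq by (rule jac_essentially_self_adjoint(2)[OF z r])
qed

end

section \<open>Scalar spectral measures\<close>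

locale jac_spectral =
 fixes a b :: "int \<Rightarrow> real" and E :: "real set \<Rightarrow> zseq \<Rightarrow> zseq" and Dom :: "zseq set"
 defines "Dom \<equiv> {u. u \<in> ell2 \<and> jac a b u \<in> ell2}"
 assumes sym: "u \<in> Dom \<Longrightarrow> v \<in> Dom \<Longrightarrow> ip (jac a b u) v = ip u (jac a b v)"
  and pvm: "projection_valued_measure E"
  and dom: "Dom = {u \<in> ell2. (\<integral>\<^sup>+ t. ennreal (t^2) \<partial>scalar_measure E u) < \<infinity>}"
  and quad: "u \<in> Dom \<Longrightarrow> ip (jac a b u) u = of_real (\<integral>t. t \<partial>scalar_measure E u)"
begin

abbreviation "J \<equiv> jac a b"
abbreviation "M \<equiv> scalar_measure E"

lemma E_ell2 [simp, intro]: "A \<in> sets borel \<Longrightarrow> u \<in> ell2 \<Longrightarrow> E A u \<in> ell2"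
 and E_lin: "A \<in> sets borel \<Longrightarrow> u \<in> ell2 \<Longrightarrow> v \<in> ell2 \<Longrightarrow> E A (\<lambda>k. \<alpha> * u k + \<beta> * v k) = (\<lambda>k. \<alpha> * E A u k + \<beta> * E A v k)"
 and E_idem: "A \<in> sets borel \<Longrightarrow> u \<in> ell2 \<Longrightarrow> E A (E A u) = E A u"
 and E_sym: "A \<in> sets borel \<Longrightarrow> u \<in> ell2 \<Longrightarrow> v \<in> ell2 \<Longrightarrow> ip (E A u) v = ip u (E A v)"
 and E_empty: "u \<in> ell2 \<Longrightarrow> E {} u = (\<lambda>k. 0)"
 and E_UNIV: "u \<in> ell2 \<Longrightarrow> E UNIV u = u"
 and E_Int: "A \<in> sets borel \<Longrightarrow> B \<in> sets borel \<Longrightarrow> u \<in> ell2 \<Longrightarrow> E (A \<inter> B) u = E A (E B u)"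
 and E_Union: "range F \<subseteq> sets borel \<Longrightarrow> disjoint_family F \<Longrightarrow> u \<in> ell2 \<Longrightarrow>
    (\<lambda>n. ell2_norm (\<lambda>k. (\<Sum>i<n. E (F i) u k) - E (\<Union>i. F i) u k)) \<longlonglongrightarrow> 0"
 using pvm unfolding projection_valued_measure_def orth_projection_def by simp_all

lemma Re_ip_E: "A \<in> sets borel \<Longrightarrow> u \<in> ell2 \<Longrightarrow> ip (E A u) u = of_real ((ell2_norm (E A u))^2)"
 using E_sym[of A "E A u" u] by (simp add: E_idem ip_self)

lemma sum_ell2: "(\<And>i. f i \<in> ell2) \<Longrightarrow> (\<lambda>k. \<Sum>i<(n::nat). f i k) \<in> ell2"
 by (induction n) (auto simp: ell2_add)

lemma ip_sum_left: "(\<And>i. f i \<in> ell2) \<Longrightarrow> v \<in> ell2 \<Longrightarrow> ip (\<lambda>k. \<Sum>i<(n::nat). f i k) v = (\<Sum>i<n. ip (f i) v)"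
 by (induction n) (auto simp: ip_add_left sum_ell2)

lemma E_sums:
 assumes F: "range F \<subseteq> sets borel" "disjoint_family F" and u: "u \<in> ell2" "v \<in> ell2"
 shows "(\<lambda>i. ip (E (F i) u) v) sums ip (E (\<Union>i. F i) u) v"
proof -
 have Fi: "F i \<in> sets borel" for i using F by auto
 then have U: "(\<Union>i. F i) \<in> sets borel" by auto
 have "(\<lambda>n. ip (\<lambda>k. \<Sum>i<n. E (F i) u k) v) \<longlonglongrightarrow> ip (E (\<Union>i. F i) u) v"
  by (rule ip_tendsto_left) (use E_Union[OF F u(1)] u Fi U in \<open>auto intro!: sum_ell2\<close>)
 then show ?thesis unfolding sums_def using ip_sum_left[where f = "\<lambda>i. E (F i) u" and v = v] Fi u by simp
qed

lemma sets_M [simp, measurable_cong]: "sets (M u) = sets borel"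
 and space_M [simp]: "space (M u) = UNIV"
proof -
 have "sigma_sets UNIV (sets borel) = sets (borel :: real measure)" using sets.sigma_sets_eq[of "borel :: real measure"] by simp
 then show "sets (M u) = sets borel" "space (M u) = UNIV" unfolding scalar_measure_def by (simp_all add: sets_measure_of space_measure_of)
qed

lemma emeasure_M:
 assumes A: "A \<in> sets borel" and u: "u \<in> ell2"
 shows "emeasure (M u) A = ennreal ((ell2_norm (E A u))^2)"
proof -
 let ?f = "\<lambda>A. ennreal (Re (ip (E A u) u))"
 have "emeasure (M u) A = ?f A" unfolding scalar_measure_def
 proof (rule emeasure_measure_of_sigma)
  show "sigma_algebra UNIV (sets (borel :: real measure))" using sets.sigma_algebra_axioms[of "borel :: real measure"] by simp
  show "positive (sets borel) ?f" using u by (simp add: positive_def E_empty)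
  show "countably_additive (sets borel) ?f"
  proof (rule countably_additiveI)
   fix F :: "nat \<Rightarrow> real set"
   assume F: "range F \<subseteq> sets borel" "disjoint_family F"
   have Fi: "F i \<in> sets borel" for i using F by auto
   have "(\<lambda>i. Re (ip (E (F i) u) u)) sums Re (ip (E (\<Union>i. F i) u) u)" by (rule sums_Re[OF E_sums[OF F u u]])
   then show "(\<Sum>i. ?f (F i)) = ?f (\<Union> (range F))" by (intro suminf_ennreal_eq) (simp_all add: Re_ip_E[OF Fi u])
  qed
 qed (use A in auto)
 then show ?thesis using A u by (simp add: Re_ip_E)
qed

lemma measure_M: "A \<in> sets borel \<Longrightarrow> u \<in> ell2 \<Longrightarrow> measure (M u) A = (ell2_norm (E A u))^2"
 by (simp add: measure_def emeasure_M)

lemma finite_M: "u \<in> ell2 \<Longrightarrow> finite_measure (M u)" by (rule finite_measureI) (simp add: emeasure_M)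

lemma measure_M_UNIV: "u \<in> ell2 \<Longrightarrow> measure (M u) UNIV = (ell2_norm u)^2" by (simp add: measure_M E_UNIV)

lemma M_E:
 assumes B: "B \<in> sets borel" and u: "u \<in> ell2"
 shows "M (E B u) = density (M u) (indicator B)"
proof (rule measure_eqI)
 fix A assume "A \<in> sets (M (E B u))"
 then have A: "A \<in> sets borel" by simp
 have "emeasure (density (M u) (indicator B)) A = (\<integral>\<^sup>+ x. indicator B x * indicator A x \<partial>M u)"
  using A B by (subst emeasure_density) auto
 also have "\<dots> = (\<integral>\<^sup>+ x. indicator (A \<inter> B) x \<partial>M u)"
  by (intro nn_integral_cong) (auto simp: indicator_def)
 also have "\<dots> = emeasure (M u) (A \<inter> B)" using A B by simp
 also have "\<dots> = emeasure (M (E B u)) A" using A B u by (simp add: emeasure_M E_Int)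
 finally show "emeasure (M (E B u)) A = emeasure (density (M u) (indicator B)) A" by simp
qed simp

lemma Dom_E:
 assumes B: "B \<in> sets borel" and u: "u \<in> Dom"
 shows "E B u \<in> Dom"
proof -
 have ue: "u \<in> ell2" and fin: "(\<integral>\<^sup>+ t. ennreal (t^2) \<partial>M u) < \<infinity>" using u dom by auto
 have "(\<integral>\<^sup>+ t. ennreal (t^2) \<partial>M (E B u)) = (\<integral>\<^sup>+ t. indicator B t * ennreal (t^2) \<partial>M u)"
  unfolding M_E[OF B ue] using B by (subst nn_integral_density) auto
 also have "\<dots> \<le> (\<integral>\<^sup>+ t. ennreal (t^2) \<partial>M u)"
  by (intro nn_integral_mono) (auto simp: indicator_def)
 finally show ?thesis using fin ue B dom by auto
qed

lemma Dom_E_bounded: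
 assumes B: "B \<in> sets borel" "B \<subseteq> {-R..R}" and u: "u \<in> ell2"
 shows "E B u \<in> Dom"
proof -
 have "(\<integral>\<^sup>+ t. ennreal (t^2) \<partial>M (E B u)) = (\<integral>\<^sup>+ t. indicator B t * ennreal (t^2) \<partial>M u)"
  unfolding M_E[OF B(1) u] using B by (subst nn_integral_density) auto
 also have "\<dots> \<le> (\<integral>\<^sup>+ t. ennreal (R^2) \<partial>M u)"
 proof (intro nn_integral_mono)
  fix t :: real
  have "t^2 \<le> R^2" if "t \<in> B" using that B(2) by (intro abs_le_square_iff[THEN iffD1]) (auto simp: abs_le_iff subset_iff)
  then show "indicator B t * ennreal (t^2) \<le> ennreal (R^2)" by (auto simp: indicator_def ennreal_leI)
 qed
 also have "\<dots> = ennreal (R^2) * emeasure (M u) UNIV" by simp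
 also have "\<dots> < \<infinity>" using u by (simp add: emeasure_M E_UNIV ennreal_mult_less_top)
 finally show ?thesis using u B dom by auto
qed

lemma Dom_ell2: "u \<in> Dom \<Longrightarrow> u \<in> ell2" "u \<in> Dom \<Longrightarrow> J u \<in> ell2" by (auto simp: Dom_def)

lemma Dom_lin: "u \<in> Dom \<Longrightarrow> v \<in> Dom \<Longrightarrow> (\<lambda>k. \<alpha> * u k + \<beta> * v k) \<in> Dom"
 unfolding Dom_def by (auto simp: jac_lin)

lemma finseq_Dom: "u \<in> finseq \<Longrightarrow> u \<in> Dom" unfolding Dom_def by (auto intro: finseq_ell2 jac_finseq)

lemma integrable_M_id:
 assumes u: "u \<in> Dom" shows "integrable (M u) (\<lambda>t. t)"
proof -
 interpret finite_measure "M u" using u by (intro finite_M Dom_ell2)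
 have "integrable (M u) (\<lambda>t. t^2)" using u dom by (intro integrableI_nonneg) auto
 then have "integrable (M u) (\<lambda>t. 1 + t^2)" by (intro Bochner_Integration.integrable_add) auto
 then show ?thesis
 proof (rule Bochner_Integration.integrable_bound)
  have "\<bar>t\<bar> \<le> 1 + t^2" for t :: real using sum_squares_bound[of 1 "\<bar>t\<bar>"] by simp
  then show "AE t in M u. norm t \<le> norm (1 + t^2)" by (simp add: abs_of_nonneg add_nonneg_nonneg)
 qed auto
qed

lemma E_Compl:
 assumes B: "B \<in> sets borel" and u: "u \<in> ell2"
 shows "E (- B) u = (\<lambda>k. u k - E B u k)"
proof -
 \<comment> \<open>Finite additivity is obtained from countable additivity by padding with empty
   sets.\<close>
 define F where "F = (\<lambda>n::nat. if n = 0 then B else if n = 1 then - B else {})"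
 have F: "range F \<subseteq> sets borel" "disjoint_family F" "(\<Union>i. F i) = UNIV"
  using B by (auto simp: F_def disjoint_family_on_def split: if_splits)
 have Bc: "- B \<in> sets borel" using B by (metis borel_comp)
 have "E (- B) u k = u k - E B u k" for k
 proof -
  have s: "(\<lambda>i. ip (E (F i) u) (basis_vec k)) sums ip (E (\<Union>i. F i) u) (basis_vec k)" by (rule E_sums[OF F(1,2) u]) simp
  have "(\<lambda>i. ip (E (F i) u) (basis_vec k)) sums (\<Sum>i\<in>{0,1}. ip (E (F i) u) (basis_vec k))"
   by (rule sums_finite) (auto simp: F_def E_empty u)
  with s have "(\<Sum>i\<in>{0,1}. ip (E (F i) u) (basis_vec k)) = ip (E (\<Union>i. F i) u) (basis_vec k)" by (metis sums_unique2)
  then have "E B u k + E (- B) u k = u k" unfolding F(3) using u by (simp add: E_UNIV ip_basis_right) (simp add: F_def ip_basis_right)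
  then show ?thesis by (simp add: eq_diff_eq add.commute)
 qed
 then show ?thesis by auto
qed

text \<open>The scalar measure of \<open>E B u\<close> is the restriction of that of
  \<open>u\<close> to \<open>B\<close>, so the integral of \<open>t\<close> splits over
  \<open>B\<close> and its complement. Hence the quadratic form has no cross terms.\<close>

lemma quad_split:
 assumes B: "B \<in> sets borel" and u: "u \<in> Dom"
 shows "ip (J u) u = ip (J (E B u)) (E B u) + ip (J (E (- B) u)) (E (- B) u)"
proof -
 have ue: "u \<in> ell2" using u by (rule Dom_ell2)
 have Bc: "- B \<in> sets borel" using B by (metis borel_comp)
 have i: "integrable (M u) (\<lambda>t. t)" by (rule integrable_M_id[OF u])
 have d: "(\<integral>t. t \<partial>M (E A u)) = (\<integral>t. indicator A t * t \<partial>M u)" if A: "A \<in> sets borel" for A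
 proof -
  have "M (E A u) = density (M u) (\<lambda>t. ennreal (indicator A t))" unfolding M_E[OF A ue] by (simp add: ennreal_indicator)
  then show ?thesis using A by (simp add: integral_density)
 qed
 have "integrable (M u) (\<lambda>t. indicator B t * t)" "integrable (M u) (\<lambda>t. indicator (- B) t * t)"
  using i B Bc by (auto intro!: integrable_mult_indicator[where 'b = real, simplified])
 then have "(\<integral>t. indicator B t * t \<partial>M u) + (\<integral>t. indicator (- B) t * t \<partial>M u) = (\<integral>t. indicator B t * t + indicator (- B) t * t \<partial>M u)"
  by (rule Bochner_Integration.integral_add[symmetric])
 also have "\<dots> = (\<integral>t. t \<partial>M u)" by (intro Bochner_Integration.integral_cong) (auto simp: indicator_def)
 finally show ?thesis using quad[OF u] quad[OF Dom_E[OF B u]] quad[OF Dom_E[OF Bc u]] by (simp add: d[OF B] d[OF Bc] flip: of_real_add)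
qed

text \<open>The absence of cross terms in \<open>quad_split\<close> is applied to
  \<open>w + \<alpha> * v\<close>; \<open>\<alpha> = 1\<close> and \<open>\<alpha> = \<i>\<close>
  annihilate the real and the imaginary part of the off-diagonal entry.\<close>

lemma J_orth:
 assumes B: "B \<in> sets borel" and w: "w \<in> Dom" "E B w = w" and v: "v \<in> Dom" "E B v = (\<lambda>k. 0)"
 shows "ip (J w) v = 0"
proof -
 have e: "w \<in> ell2" "v \<in> ell2" "J w \<in> ell2" "J v \<in> ell2" using w v Dom_ell2 by auto
 have Re: "Re (cnj \<alpha> * ip (J w) v) = 0" for \<alpha>
 proof -
  define x where "x = (\<lambda>k. 1 * w k + \<alpha> * v k)"
  have x: "x \<in> Dom" unfolding x_def by (intro Dom_lin w v)
  have EB: "E B x = w" unfolding x_def by (subst E_lin[OF B e(1,2)]) (simp add: w v)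
  have EBc: "E (- B) x = (\<lambda>k. \<alpha> * v k)" unfolding E_Compl[OF B Dom_ell2(1)[OF x]] EB by (simp add: x_def)
  have Jx: "J x = (\<lambda>k. 1 * J w k + \<alpha> * J v k)" unfolding x_def jac_lin ..
  have Jv: "J (\<lambda>k. \<alpha> * v k) = (\<lambda>k. \<alpha> * J v k)" using jac_lin[of a b \<alpha> v 0 v] by simp
  have "ip (J x) x = ip (J w) w + cnj \<alpha> * ip (J w) v + \<alpha> * ip (J v) w + \<alpha> * cnj \<alpha> * ip (J v) v"
   unfolding Jx unfolding x_def using e
   by (simp add: ip_add_left ip_add_right ip_cmult_left ip_cmult_right ell2_add ell2_cmult algebra_simps)
  moreover have "ip (J x) x = ip (J w) w + \<alpha> * cnj \<alpha> * ip (J v) v"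
   using quad_split[OF B x] e unfolding EB EBc Jv by (simp add: ip_cmult_left ip_cmult_right ell2_cmult)
  ultimately have "cnj \<alpha> * ip (J w) v + \<alpha> * ip (J v) w = 0" by simp
  moreover have "ip (J v) w = cnj (ip (J w) v)" using sym[OF v(1) w(1)] ip_commute by metis
  ultimately have "cnj \<alpha> * ip (J w) v + cnj (cnj \<alpha> * ip (J w) v) = 0" by simp
  then show ?thesis by (metis complex_add_cnj mult_eq_0_iff of_real_eq_0_iff zero_neq_numeral)
 qed
 from Re[of 1] Re[of \<i>] show ?thesis by (simp add: complex_eq_iff)
qed

lemma ell2_eqI: "u \<in> ell2 \<Longrightarrow> v \<in> ell2 \<Longrightarrow> (\<And>x. x \<in> finseq \<Longrightarrow> ip u x = ip v x) \<Longrightarrow> u = v"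
 by (metis basis_vec_finseq ip_basis_right ext)

text \<open>Split \<open>u\<close> along \<open>B\<close> and its complement. By
  \<open>J_orth\<close>, \<open>J\<close> keeps each part on its side: this is tested against finite
  sequences, whose projections still belong to the domain.\<close>

lemma J_E:
 assumes B: "B \<in> sets borel" and u: "u \<in> Dom"
 shows "J (E B u) = E B (J u)"
proof -
 have ue: "u \<in> ell2" "J u \<in> ell2" using u by (auto intro: Dom_ell2)
 have Bc: "- B \<in> sets borel" using B by (metis borel_comp)
 define w where "w = E B u" define v where "v = E (- B) u"
 have w: "w \<in> Dom" "E B w = w" unfolding w_def using Dom_E[OF B u] E_idem[OF B ue(1)] by auto
 have v: "v \<in> Dom" unfolding v_def by (rule Dom_E[OF Bc u])
 have zero: "E B (E (- B) x) = (\<lambda>k. 0)" if "x \<in> ell2" for x using E_Int[OF B Bc that] E_empty[OF that] by simp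
 have e: "w \<in> ell2" "J w \<in> ell2" "v \<in> ell2" "J v \<in> ell2" using w v Dom_ell2 by auto
 have "u = (\<lambda>k. 1 * w k + 1 * v k)" unfolding w_def v_def E_Compl[OF B ue(1)] by simp
 then have Ju: "J u = (\<lambda>k. 1 * J w k + 1 * J v k)" using jac_lin[of a b 1 w 1 v] by simp
 have 1: "E B (J w) = J w"
 proof (rule ell2_eqI)
  fix x assume x: "x \<in> finseq"
  have xe: "x \<in> ell2" "x \<in> Dom" using x finseq_ell2 finseq_Dom by auto
  have "ip (J w) (E (- B) x) = 0" by (rule J_orth[OF B w Dom_E[OF Bc xe(2)] zero[OF xe(1)]])
  then have "ip (J w) x - ip (J w) (E B x) = 0" unfolding E_Compl[OF B xe(1)] using e xe B by (simp add: ip_diff_right)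
  then show "ip (E B (J w)) x = ip (J w) x" using E_sym[OF B e(2) xe(1)] by simp
 qed (use e B in auto)
 have 2: "E B (J v) = (\<lambda>k. 0)"
 proof (rule ell2_eqI)
  fix x assume x: "x \<in> finseq"
  have xe: "x \<in> ell2" "x \<in> Dom" using x finseq_ell2 finseq_Dom by auto
  have "ip (J (E B x)) v = 0" by (rule J_orth[OF B Dom_E[OF B xe(2)] E_idem[OF B xe(1)] v]) (simp add: v_def zero ue)
  then have "ip (J v) (E B x) = 0" using sym[OF v Dom_E[OF B xe(2)]] ip_commute[of v "J (E B x)"] by simp
  then show "ip (E B (J v)) x = ip (\<lambda>k. 0) x" using E_sym[OF B e(4) xe(1)] by simp
 qed (use e B in auto)
 have "E B (J u) = (\<lambda>k. 1 * E B (J w) k + 1 * E B (J v) k)" unfolding Ju by (rule E_lin[OF B e(2,4)])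
 then show ?thesis unfolding 1 2 by (simp add: w_def)
qed

text \<open>On the range of \<open>E B\<close> the quadratic form of \<open>J - l\<close> is bounded
  by \<epsilon>. For a symmetric operator such a bound passes to the norm, as for the numerical
  radius, by polarising at \<open>w\<close> and \<open>z = (J - l) w\<close>.\<close>

lemma J_near_scalar:
 assumes B: "B \<in> sets borel" "B \<subseteq> {l - \<epsilon>..l + \<epsilon>}" and w: "w \<in> ell2" "E B w = w"
 shows "ell2_norm (\<lambda>k. J w k - of_real l * w k) \<le> \<epsilon> * ell2_norm w"
proof -
 define R where "R = \<bar>l\<bar> + \<bar>\<epsilon>\<bar>"
 have BR: "B \<subseteq> {-R..R}" using B(2) unfolding R_def by (force simp: subset_iff abs_if)
 have DomI: "x \<in> Dom" if "x \<in> ell2" "E B x = x" for x using Dom_E_bounded[OF B(1) BR that(1)] that by simp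
 have wD: "w \<in> Dom" by (rule DomI[OF w])
 define z where "z = (\<lambda>k. J w k - of_real l * w k)"
 have zl: "z = (\<lambda>k. 1 * J w k + (- of_real l) * w k)" by (simp add: z_def)
 have ze: "z \<in> ell2" unfolding zl using wD Dom_ell2 by blast
 have zB: "E B z = z" unfolding zl using E_lin[OF B(1) Dom_ell2(2)[OF wD] w(1), of 1 "- of_real l"] J_E[OF B(1) wD] w by simp
 have zD: "z \<in> Dom" by (rule DomI[OF ze zB])
 define Sq where "Sq x = Re (ip (\<lambda>k. J x k - of_real l * x k) x)" for x
 have q: "\<bar>Sq x\<bar> \<le> \<epsilon> * (ell2_norm x)^2" if x: "x \<in> ell2" "E B x = x" for x
 proof -
  have xD: "x \<in> Dom" by (rule DomI[OF x])
  interpret finite_measure "M x" by (rule finite_M[OF x(1)])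
  have i: "integrable (M x) (\<lambda>t. t)" by (rule integrable_M_id[OF xD])
  have "emeasure (M x) (- B) = 0"
  proof -
   have Bc: "- B \<in> sets borel" using B(1) by (metis borel_comp)
   have "E (- B) x = E (- B \<inter> B) x" using E_Int[OF Bc B(1) x(1)] x by simp
   then show ?thesis using Bc x E_empty by (simp add: emeasure_M)
  qed
  then have AE: "AE t in M x. t \<in> B" using B(1) by (intro AE_I[where N = "- B"]) (auto intro: borel_comp)
  have m: "measure (M x) UNIV = (ell2_norm x)^2" by (rule measure_M_UNIV[OF x(1)])
  have "Sq x = (\<integral>t. t \<partial>M x) - l * (ell2_norm x)^2"
   unfolding Sq_def using xD Dom_ell2[OF xD] quad[OF xD] by (simp add: ip_diff_left ip_cmult_left ell2_cmult ip_self)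
  also have "\<dots> = (\<integral>t. t - l \<partial>M x)" using i m by simp
  finally have "\<bar>Sq x\<bar> \<le> (\<integral>t. \<bar>t - l\<bar> \<partial>M x)" by simp
  also have "\<dots> \<le> (\<integral>t. \<epsilon> \<partial>M x)"
  proof (rule integral_mono_AE)
   show "integrable (M x) (\<lambda>t. \<bar>t - l\<bar>)" using i by simp
   show "AE t in M x. \<bar>t - l\<bar> \<le> \<epsilon>" by (rule AE_mp[OF AE], rule AE_I2) (use B(2) in \<open>auto simp: subset_iff abs_le_iff\<close>)
  qed simp
  also have "\<dots> = \<epsilon> * (ell2_norm x)^2" using m by simp
  finally show ?thesis .
 qed
 have Jl: "(\<lambda>k. J x k - of_real l * x k) \<in> ell2" if "x \<in> Dom" for x by (intro ell2_diff ell2_cmult Dom_ell2 that)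
 \<comment> \<open>The difference of the form at \<open>w + s * z\<close> and at
   \<open>w - s * z\<close> isolates \<open>ip z z\<close>; the parallelogram law evaluates the sum
   of the two bounds.\<close>
 have main: "4 * s * (ell2_norm z)^2 \<le> \<epsilon> * (2 * (ell2_norm w)^2 + 2 * s^2 * (ell2_norm z)^2)" for s :: real
 proof -
  define p where "p = (\<lambda>\<sigma> :: real. (\<lambda>k. 1 * w k + of_real (\<sigma> * s) * z k))"
  have p: "p \<sigma> \<in> ell2" "E B (p \<sigma>) = p \<sigma>" for \<sigma>
  proof -
   show "p \<sigma> \<in> ell2" unfolding p_def using w ze by blast
   show "E B (p \<sigma>) = p \<sigma>" unfolding p_def using E_lin[OF B(1) w(1) ze, of 1 "of_real (\<sigma> * s)"] w zB by simp
  qed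
  define zz where "zz = (\<lambda>k. J z k - of_real l * z k)"
  have zze: "zz \<in> ell2" unfolding zz_def by (rule Jl[OF zD])
  have symz: "Re (ip zz w) = (ell2_norm z)^2"
  proof -
   have "ip (J z) w = ip z (J w)" by (rule sym[OF zD wD])
   then have "ip zz w = ip z z" unfolding zz_def using Dom_ell2[OF zD] Dom_ell2[OF wD] sym[OF wD wD] unfolding zl
    by (simp add: ip_diff_left ip_cmult_left ip_lin_right ell2_cmult ell2_lin ip_add_right ip_cmult_right ell2_add ip_diff_right ell2_diff)
   then show ?thesis using ze by (simp add: ip_self)
  qed
  have Sq: "Sq (p \<sigma>) = Re (ip z w) + 2 * \<sigma> * s * (ell2_norm z)^2 + \<sigma>\<^sup>2 * s^2 * Re (ip zz z)" for \<sigma>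
  proof -
   have "(\<lambda>k. J (p \<sigma>) k - of_real l * p \<sigma> k) = (\<lambda>k. 1 * z k + of_real (\<sigma> * s) * zz k)"
    unfolding p_def jac_lin zz_def by (auto simp: z_def algebra_simps)
   then have "ip (\<lambda>k. J (p \<sigma>) k - of_real l * p \<sigma> k) (p \<sigma>)
    = ip z w + of_real (\<sigma> * s) * ip z z + of_real (\<sigma> * s) * ip zz w + of_real (\<sigma> * s) * of_real (\<sigma> * s) * ip zz z"
    unfolding p_def using ze zze w
    by (simp add: ip_add_left ip_add_right ip_cmult_left ip_cmult_right ell2_add ell2_cmult algebra_simps)
   then have "Sq (p \<sigma>) = Re (ip z w) + \<sigma> * s * Re (ip z z) + \<sigma> * s * Re (ip zz w) + (\<sigma> * s) * (\<sigma> * s) * Re (ip zz z)"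
    unfolding Sq_def by (simp flip: of_real_mult)
   then show ?thesis using ze by (simp add: symz ip_self power2_eq_square algebra_simps)
  qed
  have nrm: "(ell2_norm (p 1))^2 + (ell2_norm (p (-1)))^2 = 2 * (ell2_norm w)^2 + 2 * s^2 * (ell2_norm z)^2"
  proof -
   have "(ell2_norm (p \<sigma>))^2 = (ell2_norm w)^2 + \<sigma> * s * Re (ip w z) + \<sigma> * s * Re (ip z w) + (\<sigma> * s)^2 * (ell2_norm z)^2" for \<sigma>
   proof -
    have "ip (p \<sigma>) (p \<sigma>) = ip w w + of_real (\<sigma> * s) * ip w z + of_real (\<sigma> * s) * ip z w + of_real (\<sigma> * s) * of_real (\<sigma> * s) * ip z z"
     unfolding p_def using ze w by (simp add: ip_add_left ip_add_right ip_cmult_left ip_cmult_right ell2_add ell2_cmult algebra_simps)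
    then show ?thesis unfolding ell2_norm_sq[OF p(1)] ell2_norm_sq[OF w(1)] ell2_norm_sq[OF ze]
     by (simp add: power2_eq_square flip: of_real_mult)
   qed
   then show ?thesis by (simp add: power2_eq_square)
  qed
  have "4 * s * (ell2_norm z)^2 = Sq (p 1) - Sq (p (-1))" unfolding Sq by (simp add: algebra_simps)
  also have "\<dots> \<le> \<epsilon> * (ell2_norm (p 1))^2 + \<epsilon> * (ell2_norm (p (-1)))^2"
   using q[OF p, of 1] q[OF p, of "-1"] by linarith
  also have "\<dots> = \<epsilon> * (2 * (ell2_norm w)^2 + 2 * s^2 * (ell2_norm z)^2)"
   using nrm by (simp flip: distrib_left)
  finally show ?thesis .
 qed
 show ?thesis
 proof (cases "ell2_norm z = 0")
  case True
  have "0 \<le> \<epsilon> * (ell2_norm w)^2" using q[OF w] by linarith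
  then have "0 \<le> \<epsilon> * ell2_norm w" by (cases "ell2_norm w = 0") (auto simp: zero_le_mult_iff)
  then show ?thesis using True by (simp add: z_def)
 next
  case False
  then have z0: "0 < ell2_norm z" by (simp add: order.strict_iff_order)
  \<comment> \<open>This value makes the two terms on the right of \<open>main\<close>
    equal.\<close>
  define s where "s = ell2_norm w / ell2_norm z"
  have "s * (ell2_norm z)^2 = ell2_norm w * ell2_norm z" "s^2 * (ell2_norm z)^2 = (ell2_norm w)^2"
   using z0 by (simp_all add: s_def power2_eq_square power_divide)
  then have "ell2_norm w * ell2_norm z \<le> \<epsilon> * (ell2_norm w)^2" using main[of s] by (simp add: mult.assoc)
  moreover have "ell2_norm w \<noteq> 0"
  proof
   assume "ell2_norm w = 0"
   then have "w = (\<lambda>k. 0)" using ell2_norm_eq_0 w by blast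
   then have "z = (\<lambda>k. 0)" by (simp add: z_def jac_def)
   then show False using z0 by simp
  qed
  ultimately have "ell2_norm w * ell2_norm z \<le> ell2_norm w * (\<epsilon> * ell2_norm w)" "0 < ell2_norm w"
   by (simp_all add: power2_eq_square mult_ac order.strict_iff_order)
  then show ?thesis unfolding z_def[symmetric] by (simp add: mult_le_cancel_left)
 qed
qed

end

section \<open>Reduction to a single measure on the line\<close>

lemma ell2_dominated:
 assumes v: "v \<in> ell2" and le: "\<And>k. cmod (u k) \<le> C * cmod (v k)" and C: "0 \<le> C"
 shows "u \<in> ell2" and "ell2_norm u \<le> C * ell2_norm v"
proof -
 have le2: "(cmod (u k))^2 \<le> C^2 * (cmod (v k))^2" for k
  using power_mono[OF le[of k], of 2] by (simp add: power_mult_distrib)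
 have s: "(\<lambda>k. C^2 * (cmod (v k))^2) summable_on UNIV" using v by (intro summable_on_cmult_right) (simp add: ell2_def)
 then show u: "u \<in> ell2" unfolding ell2_def using le2 by (auto intro: summable_on_comparison_test)
 have "(\<Sum>\<^sub>\<infinity>k. (cmod (u k))^2) \<le> (\<Sum>\<^sub>\<infinity>k. C^2 * (cmod (v k))^2)"
  by (intro infsum_mono s le2) (use u in \<open>simp add: ell2_def\<close>)
 also have "\<dots> = C^2 * (\<Sum>\<^sub>\<infinity>k. (cmod (v k))^2)" by (rule infsum_cmult_right')
 finally show "ell2_norm u \<le> C * ell2_norm v"
  unfolding ell2_norm_def using C by (metis real_sqrt_le_iff real_sqrt_mult real_sqrt_abs abs_of_nonneg)
qed

lemma ell2_half_geometric:
 assumes q: "0 < (q::real)" "q < 1"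
 shows "(\<lambda>k::int. if m < k then complex_of_real (q powi k) else 0) \<in> ell2"
proof -
 have "summable (\<lambda>n. (q powi (m + 1))^2 * (q^2) ^ n)"
  using q by (intro summable_mult summable_geometric) (simp add: power_less_one_iff abs_square_less_1)
 then have "(\<lambda>n::nat. (q powi (m + 1))^2 * (q^2) ^ n) summable_on UNIV"
  using q by (intro norm_summable_imp_summable_on) simp
 moreover have "(q powi (m + 1))^2 * (q^2) ^ n = ((\<lambda>k. (q powi k)^2) \<circ> (\<lambda>n. m + 1 + int n)) n" for n
  using q by (simp add: power_int_add power_mult_distrib flip: power_mult) (simp add: mult.commute)
 ultimately have "((\<lambda>k. (q powi k)^2) \<circ> (\<lambda>n. m + 1 + int n)) summable_on (UNIV :: nat set)" by (simp add: o_def)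
 then have "(\<lambda>k. (q powi k)^2) summable_on range (\<lambda>n. m + 1 + int n)"
  by (subst summable_on_reindex) (auto simp: inj_on_def)
 also have "range (\<lambda>n. m + 1 + int n) = {m<..}" by (auto intro!: image_eqI[where x = "nat (_ - m - 1)"])
 finally have "(\<lambda>k. (q powi k)^2) summable_on {m<..}" .
 then have "(\<lambda>k. (cmod (if m < k then complex_of_real (q powi k) else 0))^2) summable_on UNIV"
  by (rule summable_on_cong_neutral[THEN iffD1, rotated -1]) (use q in \<open>auto simp: norm_power_int\<close>)
 then show ?thesis by (simp add: ell2_def)
qed

text \<open>A function whose derivative with respect to \<open>\<rho>\<close> vanishes uniformly is
  constant: refine the subdivision, telescope both sides, and let \<eta> tend to 0.\<close>

lemma eq_endpoints_if_small_increments: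
 fixes H \<rho> :: "real \<Rightarrow> real"
 assumes small: "\<And>\<eta>. \<eta> > 0 \<Longrightarrow> \<exists>\<delta>>0. \<forall>x y. \<alpha> \<le> x \<longrightarrow> x < y \<longrightarrow> y \<le> \<beta> \<longrightarrow> y - x < \<delta> \<longrightarrow> \<bar>H y - H x\<bar> \<le> \<eta> * (\<rho> y - \<rho> x)"
  and "\<alpha> < \<beta>"
 shows "H \<alpha> = H \<beta>"
proof -
 have bound: "\<bar>H \<beta> - H \<alpha>\<bar> \<le> \<eta> * (\<rho> \<beta> - \<rho> \<alpha>)" if \<eta>: "\<eta> > 0" for \<eta>
 proof -
  obtain \<delta> where \<delta>: "\<delta> > 0" "\<And>x y. \<alpha> \<le> x \<Longrightarrow> x < y \<Longrightarrow> y \<le> \<beta> \<Longrightarrow> y - x < \<delta> \<Longrightarrow> \<bar>H y - H x\<bar> \<le> \<eta> * (\<rho> y - \<rho> x)"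
   using small[OF \<eta>] by blast
  obtain n :: nat where n: "(\<beta> - \<alpha>) / \<delta> < real n" using reals_Archimedean2 by blast
  have n0: "0 < real n" using n \<delta>(1) assms(2) by (smt (verit) divide_pos_pos)
  define x where "x i = \<alpha> + real i * ((\<beta> - \<alpha>) / real n)" for i
  have st: "0 < (\<beta> - \<alpha>) / real n" "(\<beta> - \<alpha>) / real n < \<delta>"
   using n n0 \<delta>(1) assms(2) by (auto simp: field_simps)
  have xd: "x (Suc i) - x i = (\<beta> - \<alpha>) / real n" for i by (simp add: x_def distrib_right add_divide_distrib)
  have xn: "x n = \<beta>" "x 0 = \<alpha>" using n0 by (simp_all add: x_def)
  have "\<bar>H (x (Suc i)) - H (x i)\<bar> \<le> \<eta> * (\<rho> (x (Suc i)) - \<rho> (x i))" if "i < n" for i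
  proof (rule \<delta>(2))
   show "\<alpha> \<le> x i" using mult_nonneg_nonneg[of "real i" "(\<beta> - \<alpha>) / real n"] st by (simp add: x_def)
   show "x i < x (Suc i)" "x (Suc i) - x i < \<delta>" using xd[of i] st by linarith+
   have "real (Suc i) * ((\<beta> - \<alpha>) / real n) \<le> real n * ((\<beta> - \<alpha>) / real n)"
    using that st by (intro mult_right_mono) auto
   then show "x (Suc i) \<le> \<beta>" using n0 by (simp add: x_def)
  qed
  then have "(\<Sum>i<n. \<bar>H (x (Suc i)) - H (x i)\<bar>) \<le> (\<Sum>i<n. \<eta> * (\<rho> (x (Suc i)) - \<rho> (x i)))"
   by (intro sum_mono) auto
  also have "\<dots> = \<eta> * (\<rho> \<beta> - \<rho> \<alpha>)"
   using sum_lessThan_telescope[of "\<lambda>i. \<rho> (x i)" n] by (simp add: xn flip: sum_distrib_left)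
  finally have "(\<Sum>i<n. \<bar>H (x (Suc i)) - H (x i)\<bar>) \<le> \<eta> * (\<rho> \<beta> - \<rho> \<alpha>)" .
  moreover have "\<bar>H \<beta> - H \<alpha>\<bar> \<le> (\<Sum>i<n. \<bar>H (x (Suc i)) - H (x i)\<bar>)"
   using sum_abs[of "\<lambda>i. H (x (Suc i)) - H (x i)" "{..<n}"] sum_lessThan_telescope[of "\<lambda>i. H (x i)" n] by (simp add: xn)
  ultimately show ?thesis by linarith
 qed
 have "\<bar>H \<beta> - H \<alpha>\<bar> \<le> 0"
 proof (rule field_le_epsilon)
  fix e :: real assume e: "e > 0"
  define \<eta> where "\<eta> = e / (\<bar>\<rho> \<beta> - \<rho> \<alpha>\<bar> + 1)"
  have \<eta>: "\<eta> > 0" using e by (simp add: \<eta>_def add_nonneg_pos)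
  have "\<bar>H \<beta> - H \<alpha>\<bar> \<le> \<eta> * (\<rho> \<beta> - \<rho> \<alpha>)" by (rule bound[OF \<eta>])
  also have "\<dots> \<le> \<eta> * (\<bar>\<rho> \<beta> - \<rho> \<alpha>\<bar> + 1)" using \<eta> by (intro mult_left_mono) auto
  also have "\<dots> = e" unfolding \<eta>_def by simp
  finally show "\<bar>H \<beta> - H \<alpha>\<bar> \<le> 0 + e" by simp
 qed
 then show ?thesis by simp
qed

lemma measure_eqI_half_open:
 fixes M1 M2 :: "real measure"
 assumes s: "sets M1 = sets borel" "sets M2 = sets borel"
  and eq: "\<And>x y. x < y \<Longrightarrow> emeasure M1 {x..<y} = emeasure M2 {x..<y}"
  and fin: "\<And>x y. x < y \<Longrightarrow> emeasure M1 {x..<y} \<noteq> \<infinity>"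
 shows "M1 = M2"
proof (rule measure_eqI_generator_eq[where E = "range (\<lambda>(x, y). {x..<y::real})" and \<Omega> = UNIV and A = "\<lambda>n. {- real n - 1..<real n + 1}"])
 show "Int_stable (range (\<lambda>(x, y). {x..<y::real}))" by (auto simp: Int_stable_def intro!: image_eqI)
 have "sets (borel :: real measure) = sigma_sets UNIV (range (\<lambda>(x, y). {x..<y}))" by (simp add: borel_eq_atLeastLessThan)
 then show "sets M1 = sigma_sets UNIV (range (\<lambda>(x, y). {x..<y}))" "sets M2 = sigma_sets UNIV (range (\<lambda>(x, y). {x..<y}))"
  using s by simp_all
 show "(\<Union>n::nat. {- real n - 1..<real n + 1}) = UNIV"
 proof (intro set_eqI iffI UNIV_I)
  fix t :: real
  obtain n :: nat where "\<bar>t\<bar> < real n" using reals_Archimedean2 by blast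
  then show "t \<in> (\<Union>n::nat. {- real n - 1..<real n + 1})" by (intro UN_I[of n]) auto
 qed
 show "emeasure M1 X = emeasure M2 X" if X0: "X \<in> range (\<lambda>(x, y). {x..<y})" for X
 proof -
  obtain p where "X = (\<lambda>(x, y). {x..<y}) p" using X0 by (rule imageE)
  then obtain x y where X: "X = {x..<y}" by (cases p) simp
  show ?thesis by (cases "x < y") (use eq X in auto)
 qed
qed (use fin in auto)

section \<open>Approximate proportionality of the projected basis vectors to
  \<open>Phi\<close>\<close>

locale jacobi_spectral = jacobi_fun +
 fixes E :: "real set \<Rightarrow> zseq \<Rightarrow> zseq"
 assumes spec: "is_spectral_measure E T"
begin

sublocale jac_spectral "a_coeff q r c d" "b_coeff q r c d" E "{u. u \<in> ell2 \<and> jac (a_coeff q r c d) (b_coeff q r c d) u \<in> ell2}"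
proof unfold_locales
 let ?D = "{u. u \<in> ell2 \<and> jac (a_coeff q r c d) (b_coeff q r c d) u \<in> ell2}"
 have inT: "(u, jac a b u) \<in> T" if "u \<in> ?D" for u using that closure_L by auto
 fix u v assume u: "u \<in> ?D"
 { assume v: "v \<in> ?D"
  \<comment> \<open>Symmetry on the maximal domain is exactly the statement that \<open>T\<close>
    equals its adjoint.\<close>
  have "(v, jac a b v) \<in> op_adjoint T" using inT[OF v] self_adjoint_closure_L by (simp add: self_adjoint_def)
  then show "ip (jac a b u) v = ip u (jac a b v)" using inT[OF u] by (auto simp: op_adjoint_def) }
 show "ip (jac a b u) u = of_real (\<integral>t. t \<partial>scalar_measure E u)"
  using spec inT[OF u] by (auto simp: is_spectral_measure_def)
next
 show "projection_valued_measure E" using spec by (simp add: is_spectral_measure_def)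
 have "Domain T = {u. u \<in> ell2 \<and> jac a b u \<in> ell2}" unfolding closure_L by auto
 then show "{u. u \<in> ell2 \<and> jac a b u \<in> ell2} = {u \<in> ell2. (\<integral>\<^sup>+ t. ennreal (t^2) \<partial>scalar_measure E u) < \<infinity>}"
  using spec by (simp add: is_spectral_measure_def)
qed (rule reflexive)

lemma norm_E_le:
 assumes "G \<in> sets borel" "u \<in> ell2" shows "ell2_norm (E G u) \<le> ell2_norm u"
proof (cases "ell2_norm (E G u) = 0")
 case False
 have "(ell2_norm (E G u))^2 \<le> ell2_norm (E G u) * ell2_norm u"
  using cauchy_schwarz[of "E G u" u] assms by (simp add: Re_ip_E norm_power)
 moreover have "0 < ell2_norm (E G u)" using False by (simp add: order.strict_iff_order)
 ultimately show ?thesis by (simp add: power2_eq_square)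
qed simp

abbreviation "e \<equiv> basis_vec"

lemma E_J_basis: "G \<in> sets borel \<Longrightarrow> E G (J (e k)) = (\<lambda>j. of_real (a k) * E G (e (k + 1)) j + of_real (b k) * E G (e k) j + of_real (a (k - 1)) * E G (e (k - 1)) j)"
proof -
 assume G: "G \<in> sets borel"
 have "J (e k) = (\<lambda>j. 1 * (of_real (a k) * e (k + 1) j + of_real (b k) * e k j) + of_real (a (k - 1)) * e (k - 1) j)"
  unfolding jac_basis by simp
 then show ?thesis using G by (simp only: E_lin ell2_lin basis_vec_ell2) simp
qed

text \<open>The calculus of families of size O(\<epsilon>) on intervals of radius \<epsilon>,
  uniformly in the centre \<open>l\<close> on bounded sets. Uniformity is what permits summation
  over a subdivision later.\<close>

definition near :: "real \<Rightarrow> (real \<Rightarrow> real set \<Rightarrow> zseq) \<Rightarrow> bool" where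
 "near R V \<longleftrightarrow> (\<exists>C\<ge>0. \<forall>l \<epsilon> G. \<bar>l\<bar> \<le> R \<longrightarrow> 0 \<le> \<epsilon> \<longrightarrow> G \<in> sets borel \<longrightarrow> G \<subseteq> {l - \<epsilon>..l + \<epsilon>} \<longrightarrow> ell2_norm (V l G) \<le> C * \<epsilon>)"

lemma near_lin:
 assumes V: "near R V" "near R W" and ell: "\<And>l G. G \<in> sets borel \<Longrightarrow> V l G \<in> ell2" "\<And>l G. G \<in> sets borel \<Longrightarrow> W l G \<in> ell2"
  and K: "\<And>l. \<bar>l\<bar> \<le> R \<Longrightarrow> cmod (\<alpha> l) \<le> K" "\<And>l. \<bar>l\<bar> \<le> R \<Longrightarrow> cmod (\<beta> l) \<le> K"
 shows "near R (\<lambda>l G k. \<alpha> l * V l G k + \<beta> l * W l G k)"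
proof -
 obtain C1 where C1: "C1 \<ge> 0" "\<And>l \<epsilon> G. \<bar>l\<bar> \<le> R \<Longrightarrow> 0 \<le> \<epsilon> \<Longrightarrow> G \<in> sets borel \<Longrightarrow> G \<subseteq> {l - \<epsilon>..l + \<epsilon>} \<Longrightarrow> ell2_norm (V l G) \<le> C1 * \<epsilon>"
  using V(1) unfolding near_def by blast
 obtain C2 where C2: "C2 \<ge> 0" "\<And>l \<epsilon> G. \<bar>l\<bar> \<le> R \<Longrightarrow> 0 \<le> \<epsilon> \<Longrightarrow> G \<in> sets borel \<Longrightarrow> G \<subseteq> {l - \<epsilon>..l + \<epsilon>} \<Longrightarrow> ell2_norm (W l G) \<le> C2 * \<epsilon>"
  using V(2) unfolding near_def by blast
 have "ell2_norm (\<lambda>k. \<alpha> l * V l G k + \<beta> l * W l G k) \<le> (\<bar>K\<bar> * C1 + \<bar>K\<bar> * C2) * \<epsilon>"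
  if l: "\<bar>l\<bar> \<le> R" "0 \<le> \<epsilon>" "G \<in> sets borel" "G \<subseteq> {l - \<epsilon>..l + \<epsilon>}" for l \<epsilon> G
 proof -
  have "ell2_norm (\<lambda>k. \<alpha> l * V l G k + \<beta> l * W l G k) \<le> cmod (\<alpha> l) * ell2_norm (V l G) + cmod (\<beta> l) * ell2_norm (W l G)"
   unfolding ell2_norm_cmult[symmetric] by (intro ell2_norm_triangle ell2_cmult ell l)
  also have "\<dots> \<le> \<bar>K\<bar> * (C1 * \<epsilon>) + \<bar>K\<bar> * (C2 * \<epsilon>)"
   using K[OF l(1)] by (intro add_mono mult_mono C1(2) C2(2) l) auto
  finally show ?thesis by (simp add: algebra_simps)
 qed
 then show ?thesis unfolding near_def using C1 C2 by (intro exI[of _ "\<bar>K\<bar> * C1 + \<bar>K\<bar> * C2"]) auto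
qed

lemma near_cong: "(\<And>l G. G \<in> sets borel \<Longrightarrow> V l G = W l G) \<Longrightarrow> near R V \<longleftrightarrow> near R W"
 unfolding near_def by (metis (no_types, lifting))

definition res :: "int \<Rightarrow> real \<Rightarrow> real set \<Rightarrow> zseq" where
 "res k l G = (\<lambda>j. J (E G (e k)) j - of_real l * E G (e k) j)"

lemma res_eq:
 assumes G: "G \<in> sets borel"
 shows "res k l G = (\<lambda>j. of_real (a k) * E G (e (k + 1)) j + of_real (b k) * E G (e k) j
  + of_real (a (k - 1)) * E G (e (k - 1)) j - of_real l * E G (e k) j)"
proof -
 have "J (E G (e k)) = E G (J (e k))" by (rule J_E[OF G]) (simp add: jac_finseq finseq_ell2)
 then show ?thesis unfolding res_def E_J_basis[OF G] by simp
qed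

lemma res_ell2: "G \<in> sets borel \<Longrightarrow> res k l G \<in> ell2"
 unfolding res_eq by (intro ell2_diff ell2_add ell2_cmult E_ell2 basis_vec_ell2)

text \<open>\<open>J_near_scalar\<close> says that \<open>E G (e k)\<close> satisfies the eigenvalue
  equation at the centre up to \<epsilon>.\<close>

lemma near_res: "near R (res k)" unfolding near_def
proof (intro exI[of _ 1] conjI allI impI)
 fix l \<epsilon> :: real and G :: "real set" assume G: "G \<in> sets borel" "G \<subseteq> {l - \<epsilon>..l + \<epsilon>}" "0 \<le> \<epsilon>"
 have "ell2_norm (res k l G) \<le> \<epsilon> * ell2_norm (E G (e k))"
  unfolding res_def by (rule J_near_scalar) (use G in \<open>auto simp: E_idem\<close>)
 also have "\<dots> \<le> \<epsilon> * 1" using norm_E_le[OF G(1), of "e k"] G(3) by (intro mult_left_mono) auto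
 finally show "ell2_norm (res k l G) \<le> 1 * \<epsilon>" by simp
qed simp

lemma wr_general: "wr k X Y - wr (k - 1) X Y = J X k * Y k - X k * J Y k" by (simp add: wr_def jac_def algebra_simps)

lemma J_Phi: "J (\<lambda>k. Phi k x) k = x * Phi k x" using Phi_recurrence[of k x] by (simp add: jac_def)

definition Phi_tail :: "int \<Rightarrow> complex \<Rightarrow> zseq" where
 "Phi_tail m x = (\<lambda>k. if m < k then Phi k x else 0)"

lemma Phi_tail_bound:
 assumes m: "-1 \<le> m"
 shows "\<exists>C\<ge>0. \<forall>x. norm x \<le> R \<longrightarrow> Phi_tail m x \<in> ell2 \<and> ell2_norm (Phi_tail m x) \<le> C"
proof -
 obtain C where C: "C > 0" "\<And>x k. norm x \<le> R \<Longrightarrow> 0 \<le> k \<Longrightarrow> norm (Phi k x) \<le> C * q powi k"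
  using Phi_bound by meson
 let ?g = "\<lambda>k::int. if m < k then complex_of_real (q powi k) else 0"
 have g: "?g \<in> ell2" by (rule ell2_half_geometric[OF q01])
 have "cmod (Phi_tail m x k) \<le> C * cmod (?g k)" if "norm x \<le> R" for x k
  using C(2)[OF that, of k] m q01 by (auto simp: Phi_tail_def norm_power_int)
 from ell2_dominated[OF g this] C show ?thesis by (intro exI[of _ "C * ell2_norm ?g"]) auto
qed

lemma Phi_tail_ell2: "-1 \<le> m \<Longrightarrow> Phi_tail m x \<in> ell2" using Phi_tail_bound[of m "norm x"] by auto

text \<open>Green's formula summed from \<open>m + 1\<close> to infinity. The boundary term vanishes
  there because \<open>a * Phi\<close> is bounded while \<open>v\<close> tends to 0;
  \<open>-1 \<le> m\<close> keeps the summation among indices where the decay estimate for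
  \<open>Phi\<close> applies.\<close>

lemma wr_tail:
 assumes v: "v \<in> ell2" "J v \<in> ell2" and m: "-1 \<le> m"
 shows "wr m v (\<lambda>k. Phi k (of_real l)) = - ip (\<lambda>k. J v k - of_real l * v k) (Phi_tail m (of_real l))"
proof -
 define g where "g = (\<lambda>k. J v k - of_real l * v k)"
 have g: "g \<in> ell2" unfolding g_def by (intro ell2_diff ell2_cmult v)
 let ?P = "\<lambda>k. Phi k (of_real l)"
 have tele: "wr (m + int n) v ?P = wr m v ?P + (\<Sum>i<n. g (m + 1 + int i) * ?P (m + 1 + int i))" for n
 proof (induction n)
  case (Suc n)
  have "wr (m + 1 + int n) v ?P - wr (m + int n) v ?P = g (m + 1 + int n) * ?P (m + 1 + int n)"
   using wr_general[of "m + 1 + int n" v ?P] unfolding J_Phi by (simp add: g_def algebra_simps)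
  then show ?case using Suc by (simp add: algebra_simps)
 qed simp
 have sum: "(\<Sum>i<n. g (m + 1 + int i) * ?P (m + 1 + int i)) = ip g (trunc (nat (m + int n)) (Phi_tail m (of_real l)))" if n: "1 \<le> n" for n
 proof -
  have "ip g (trunc (nat (m + int n)) (Phi_tail m (of_real l))) = (\<Sum>\<^sub>\<infinity>k\<in>{m + 1..m + int n}. g k * ?P k)"
   unfolding ip_def using m n by (intro infsum_cong_neutral) (auto simp: trunc_def Phi_tail_def cnj_Phi)
  also have "\<dots> = (\<Sum>k\<in>{m + 1..m + int n}. g k * ?P k)" by simp
  also have "\<dots> = (\<Sum>i<n. g (m + 1 + int i) * ?P (m + 1 + int i))"
   by (rule sum.reindex_bij_witness[of _ "\<lambda>i. m + 1 + int i" "\<lambda>k. nat (k - m - 1)"]) auto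
  finally show ?thesis by simp
 qed
 have pt: "Phi_tail m (of_real l) \<in> ell2" by (rule Phi_tail_ell2[OF m])
 have "(\<lambda>n. ip (trunc n (Phi_tail m (of_real l))) g) \<longlonglongrightarrow> ip (Phi_tail m (of_real l)) g"
  by (rule ip_tendsto_left) (use pt g trunc_tendsto[OF pt] finseq_ell2 in auto)
 then have "(\<lambda>n. cnj (ip (trunc n (Phi_tail m (of_real l))) g)) \<longlonglongrightarrow> cnj (ip (Phi_tail m (of_real l)) g)"
  by (rule tendsto_cnj)
 then have lim1: "(\<lambda>n. ip g (trunc n (Phi_tail m (of_real l)))) \<longlonglongrightarrow> ip g (Phi_tail m (of_real l))"
  unfolding ip_commute[of g] .
 have "filterlim (\<lambda>n. nat (m + int n)) at_top sequentially" unfolding filterlim_at_top eventually_sequentially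
 proof
  fix Z
  show "\<exists>N. \<forall>n\<ge>N. Z \<le> nat (m + int n)" by (intro exI[of _ "nat (int Z - m)"]) (auto simp: nat_le_iff le_nat_iff)
 qed
 from filterlim_compose[OF lim1 this]
 have lim2: "(\<lambda>n. ip g (trunc (nat (m + int n)) (Phi_tail m (of_real l)))) \<longlonglongrightarrow> ip g (Phi_tail m (of_real l))" .
 have lim3: "(\<lambda>n. wr (m + int n) v ?P) \<longlonglongrightarrow> 0"
 proof -
  obtain C where C: "C > 0" "\<And>k. 0 \<le> k \<Longrightarrow> a k * norm (?P k) \<le> C \<and> a k * norm (?P (k + 1)) \<le> C"
   using a_Phi_bound[of "\<bar>l\<bar>"] by auto
  have w0: "(\<lambda>n. v (int n + k)) \<longlonglongrightarrow> 0" for k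
  proof -
   have "(\<lambda>k. (cmod (v k))^2) summable_on range (\<lambda>n::nat. int n + k)"
    using v(1) by (auto simp: ell2_def intro: summable_on_subset_banach)
   then have "((\<lambda>k. (cmod (v k))^2) \<circ> (\<lambda>n. int n + k)) summable_on (UNIV :: nat set)"
    by (subst (asm) summable_on_reindex) (auto simp: inj_on_def)
   then have "summable (\<lambda>n. (cmod (v (int n + k)))^2)" by (simp add: o_def summable_on_imp_summable)
   then have "(\<lambda>n. (cmod (v (int n + k)))^2) \<longlonglongrightarrow> 0" by (rule summable_LIMSEQ_zero)
   then have "(\<lambda>n. sqrt ((cmod (v (int n + k)))^2)) \<longlonglongrightarrow> sqrt 0" by (intro tendsto_intros)
   then show ?thesis by (simp add: tendsto_norm_zero_iff)
  qed
  have z: "(\<lambda>n. C * (norm (v (int n + (m + 1))) + norm (v (int n + m)))) \<longlonglongrightarrow> 0"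
   using tendsto_mult_left[OF tendsto_add[OF tendsto_norm_zero[OF w0[of "m + 1"]] tendsto_norm_zero[OF w0[of m]]], of C] by simp
  have "\<forall>\<^sub>F n in sequentially. norm (wr (m + int n) v ?P) \<le> C * (norm (v (int n + (m + 1))) + norm (v (int n + m)))"
   using eventually_ge_at_top[of 1]
  proof eventually_elim
   case (elim n)
   let ?k = "m + int n"
   have k: "0 \<le> ?k" using elim m by simp
   have ak: "0 < a ?k" by (rule a_pos)
   have "norm (wr ?k v ?P) \<le> a ?k * (norm (v (?k + 1)) * norm (?P ?k) + norm (v ?k) * norm (?P (?k + 1)))"
    unfolding wr_def norm_mult[of "of_real _"] using ak
    by (intro mult_mono) (auto intro!: order_trans[OF norm_triangle_ineq4] simp: norm_mult)
   also have "\<dots> = norm (v (?k + 1)) * (a ?k * norm (?P ?k)) + norm (v ?k) * (a ?k * norm (?P (?k + 1)))"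
    by (simp add: algebra_simps)
   also have "\<dots> \<le> norm (v (?k + 1)) * C + norm (v ?k) * C" using C(2)[OF k] by (intro add_mono mult_left_mono) auto
   finally show ?case by (simp add: algebra_simps)
  qed
  from Lim_null_comparison[OF this z] show ?thesis .
 qed
 have "(\<lambda>n. wr m v ?P + ip g (trunc (nat (m + int n)) (Phi_tail m (of_real l)))) \<longlonglongrightarrow> wr m v ?P + ip g (Phi_tail m (of_real l))"
  by (intro tendsto_intros lim2)
 moreover have "\<forall>\<^sub>F n in sequentially. wr m v ?P + ip g (trunc (nat (m + int n)) (Phi_tail m (of_real l))) = wr (m + int n) v ?P"
  using eventually_ge_at_top[of 1] by eventually_elim (simp add: tele sum)
 ultimately have "(\<lambda>n. wr (m + int n) v ?P) \<longlonglongrightarrow> wr m v ?P + ip g (Phi_tail m (of_real l))"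
  by (rule Lim_transform_eventually)
 from LIMSEQ_unique[OF this lim3] show ?thesis by (simp add: g_def eq_neg_iff_add_eq_0)
qed

definition Y :: "int \<Rightarrow> int \<Rightarrow> real \<Rightarrow> real set \<Rightarrow> zseq" where
 "Y k m l G = (\<lambda>j. Phi m (of_real l) * E G (e k) j - Phi k (of_real l) * E G (e m) j)"

lemma Y_ell2: "G \<in> sets borel \<Longrightarrow> Y k m l G \<in> ell2"
 unfolding Y_def by (intro ell2_diff ell2_cmult E_ell2 basis_vec_ell2)

text \<open>For \<open>x = Y 0 1 l G\<close> the square of the norm is, by self-adjointness of
  \<open>E G\<close>, a multiple of the Wronskian of \<open>x\<close> and \<open>Phi\<close> at 0.
  By \<open>wr_tail\<close> that Wronskian pairs the residual of \<open>x\<close>, of size at most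
  \<epsilon> times the norm of \<open>x\<close>, with a bounded tail of \<open>Phi\<close>.\<close>

lemma near_Y01: "near R (Y 0 1)"
proof -
 obtain C where C: "C \<ge> 0" "\<And>x. norm x \<le> R \<Longrightarrow> Phi_tail 0 x \<in> ell2 \<and> ell2_norm (Phi_tail 0 x) \<le> C"
  using Phi_tail_bound[of 0 R] by auto
 have a0: "0 < a 0" by (rule a_pos)
 have "ell2_norm (Y 0 1 l G) \<le> C / a 0 * \<epsilon>"
  if l: "\<bar>l\<bar> \<le> R" "0 \<le> \<epsilon>" "G \<in> sets borel" "G \<subseteq> {l - \<epsilon>..l + \<epsilon>}" for l \<epsilon> G
 proof -
  let ?P = "\<lambda>k. Phi k (of_real l)"
  define x where "x = Y 0 1 l G"
  have x: "x \<in> ell2" unfolding x_def by (rule Y_ell2[OF l(3)])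
  have Ex: "E G x = x" using E_lin[OF l(3) E_ell2[OF l(3)] E_ell2[OF l(3)], of "e 0" "e 1" "?P 1" "- ?P 0"] l(3)
   by (simp add: x_def Y_def E_idem)
  have AR: "G \<subseteq> {- (R + \<epsilon>)..R + \<epsilon>}" using l by (force simp: subset_iff)
  have Jx: "J x \<in> ell2" using Dom_E_bounded[OF l(3) AR x] Ex by simp
  have cP: "cnj (?P k) = ?P k" for k by (simp add: cnj_Phi)
  have "ip x x = ip x (\<lambda>j. ?P 1 * e 0 j - ?P 0 * e 1 j)"
  proof -
   have "E G (\<lambda>j. ?P 1 * e 0 j - ?P 0 * e 1 j) = x"
    using E_lin[OF l(3), of "e 0" "e 1" "?P 1" "- ?P 0"] by (simp add: x_def Y_def)
   moreover have "(\<lambda>j. ?P 1 * e 0 j - ?P 0 * e 1 j) \<in> ell2" by (intro ell2_diff ell2_cmult basis_vec_ell2)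
   ultimately show ?thesis using E_sym[OF l(3) x, of "\<lambda>j. ?P 1 * e 0 j - ?P 0 * e 1 j"] Ex by simp
  qed
  also have "\<dots> = ?P 1 * x 0 - ?P 0 * x 1" using x by (simp add: ip_diff_right ip_cmult_right ell2_cmult ip_basis_right cP)
  also have "\<dots> = - wr 0 x ?P / of_real (a 0)" 
  proof -
   have "wr 0 x ?P = of_real (a 0) * (x 1 * ?P 0 - x 0 * ?P 1)" by (simp add: wr_def)
   then show ?thesis using a0 by simp
  qed
  also have "\<dots> = ip (\<lambda>k. J x k - of_real l * x k) (Phi_tail 0 (of_real l)) / of_real (a 0)"
   using wr_tail[OF x Jx, of 0 l] by simp
  finally have "cmod (ip x x) = cmod (ip (\<lambda>k. J x k - of_real l * x k) (Phi_tail 0 (of_real l))) / a 0"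
   using a0 by (simp add: norm_divide)
  also have "\<dots> \<le> (\<epsilon> * ell2_norm x) * C / a 0"
  proof (intro divide_right_mono)
   have "cmod (ip (\<lambda>k. J x k - of_real l * x k) (Phi_tail 0 (of_real l)))
    \<le> ell2_norm (\<lambda>k. J x k - of_real l * x k) * ell2_norm (Phi_tail 0 (of_real l))"
    by (intro cauchy_schwarz ell2_diff ell2_cmult x Jx Phi_tail_ell2) simp
   also have "\<dots> \<le> (\<epsilon> * ell2_norm x) * C" using C l(1) l(2) by (intro mult_mono J_near_scalar[OF l(3,4) x Ex]) auto
   finally show "cmod (ip (\<lambda>k. J x k - of_real l * x k) (Phi_tail 0 (of_real l))) \<le> (\<epsilon> * ell2_norm x) * C" .
  qed (use a0 in simp)
  finally have "(ell2_norm x)^2 \<le> C / a 0 * \<epsilon> * ell2_norm x" using x by (simp add: ip_self norm_power mult_ac)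
  show ?thesis
  proof (cases "ell2_norm x = 0")
   case True
   then show ?thesis using C l a0 by (simp add: x_def)
  next
   case False
   then have "0 < ell2_norm x" by (simp add: order.strict_iff_order)
   then show ?thesis using \<open>(ell2_norm x)\<^sup>2 \<le> C / a 0 * \<epsilon> * ell2_norm x\<close> unfolding x_def[symmetric]
    by (simp add: power2_eq_square del: times_divide_eq_left)
  qed
 qed
 then show ?thesis unfolding near_def using C a0 by (intro exI[of _ "C / a 0"]) auto
qed

lemma Phi_bounded_on: "\<exists>K. \<forall>l. \<bar>l\<bar> \<le> R \<longrightarrow> cmod (Phi k (of_real l)) \<le> K"
proof -
 have "bounded (Phi k ` cball 0 R)"
  by (intro compact_imp_bounded compact_continuous_image holomorphic_on_imp_continuous_on holomorphic_Phi) auto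
 then obtain K where K: "\<forall>x\<in>cball 0 R. norm (Phi k x) \<le> K" by (auto simp: bounded_iff)
 show ?thesis
 proof (intro exI[of _ K] allI impI)
  fix l :: real assume "\<bar>l\<bar> \<le> R"
  then have "complex_of_real l \<in> cball 0 R" by simp
  then show "cmod (Phi k (of_real l)) \<le> K" using K by blast
 qed
qed

text \<open>As functions of \<open>k\<close> both \<open>Phi k\<close> and \<open>E G (e k)\<close>
  satisfy the recurrence at \<open>l\<close>, the latter up to \<open>res\<close>. So the estimate
  for two neighbouring indices spreads to all.\<close>

lemma Y_rec:
 assumes G: "G \<in> sets borel"
 shows "of_real (a k) * Y (k + 1) m l G j + of_real (a (k - 1)) * Y (k - 1) m l G j
  = (of_real l - of_real (b k)) * Y k m l G j + Phi m (of_real l) * res k l G j"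
proof -
 have "Phi m (of_real l) * res k l G j + (of_real l - of_real (b k)) * Y k m l G j
   - (of_real (a k) * Y (k + 1) m l G j + of_real (a (k - 1)) * Y (k - 1) m l G j)
   = E G (e m) j * (of_real (a k) * Phi (k + 1) (of_real l) + of_real (b k) * Phi k (of_real l)
    + of_real (a (k - 1)) * Phi (k - 1) (of_real l) - of_real l * Phi k (of_real l))"
  unfolding res_eq[OF G] Y_def by (simp add: algebra_simps)
 then show ?thesis unfolding Phi_recurrence by (simp add: algebra_simps)
qed

lemma near_third:
 assumes \<alpha>: "0 < \<alpha>" "0 < \<beta>" and near: "near R (Y k m)" "near R Z" and Z: "\<And>l G. G \<in> sets borel \<Longrightarrow> Z l G \<in> ell2"
  and eq: "\<And>G l j. G \<in> sets borel \<Longrightarrow> of_real \<alpha> * X l G j + of_real \<beta> * Z l G j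
   = (of_real l - of_real (b k)) * Y k m l G j + Phi m (of_real l) * res k l G j"
 shows "near R X"
proof -
 obtain K where K: "\<And>l. \<bar>l\<bar> \<le> R \<Longrightarrow> cmod (Phi m (of_real l)) \<le> K" using Phi_bounded_on by meson
 define V1 where "V1 = (\<lambda>l G j. ((of_real l - of_real (b k)) / of_real \<alpha>) * Y k m l G j + (- (of_real \<beta> / of_real \<alpha>)) * Z l G j)"
 have e1: "V1 l G \<in> ell2" if "G \<in> sets borel" for l G unfolding V1_def by (intro ell2_lin Y_ell2 Z that)
 have n1: "near R V1" unfolding V1_def
 proof (rule near_lin[OF near Y_ell2 Z, where K = "(R + \<bar>b k\<bar>) / \<alpha> + \<beta> / \<alpha>"])
  fix l :: real assume l: "\<bar>l\<bar> \<le> R"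
  have "cmod (of_real l - of_real (b k)) \<le> R + \<bar>b k\<bar>" using l by (simp flip: of_real_diff)
  then have "cmod ((of_real l - of_real (b k)) / of_real \<alpha>) \<le> (R + \<bar>b k\<bar>) / \<alpha>"
   using \<alpha> by (simp add: norm_divide divide_right_mono)
  moreover have "0 < \<beta> / \<alpha>" using \<alpha> by simp
  ultimately show "cmod ((of_real l - of_real (b k)) / of_real \<alpha>) \<le> (R + \<bar>b k\<bar>) / \<alpha> + \<beta> / \<alpha>" by linarith
  have "0 \<le> (R + \<bar>b k\<bar>) / \<alpha>" using l \<alpha> by (intro divide_nonneg_pos) auto
  then show "cmod (- (of_real \<beta> / complex_of_real \<alpha>)) \<le> (R + \<bar>b k\<bar>) / \<alpha> + \<beta> / \<alpha>"
   using \<alpha> by (simp add: norm_divide)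
 qed
 have "near R (\<lambda>l G j. 1 * V1 l G j + (Phi m (of_real l) / of_real \<alpha>) * res k l G j)"
 proof (rule near_lin[OF n1 near_res e1 res_ell2, where K = "1 + \<bar>K\<bar> / \<alpha>"])
  fix l :: real assume l: "\<bar>l\<bar> \<le> R"
  show "cmod 1 \<le> 1 + \<bar>K\<bar> / \<alpha>" using \<alpha> by simp
  have "cmod (Phi m (of_real l)) \<le> \<bar>K\<bar>" using K[OF l] by linarith
  then have "cmod (Phi m (of_real l)) / \<alpha> \<le> \<bar>K\<bar> / \<alpha>" using \<alpha> by (simp add: divide_right_mono)
  then show "cmod (Phi m (of_real l) / of_real \<alpha>) \<le> 1 + \<bar>K\<bar> / \<alpha>" using \<alpha> by (simp add: norm_divide)
 qed
 moreover have "(\<lambda>j. 1 * V1 l G j + (Phi m (of_real l) / of_real \<alpha>) * res k l G j) = X l G" if G: "G \<in> sets borel" for l G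
 proof
  fix j
  define t where "t = complex_of_real l - of_real (b k)"
  have "of_real \<alpha> * (1 * V1 l G j + (Phi m (of_real l) / of_real \<alpha>) * res k l G j)
    = t * Y k m l G j + Phi m (of_real l) * res k l G j - of_real \<beta> * Z l G j"
   using \<alpha> by (simp add: V1_def distrib_left right_diff_distrib flip: t_def)
  also have "\<dots> = of_real \<alpha> * X l G j" using eq[OF G, of l j] by (simp add: algebra_simps flip: t_def)
  finally have "of_real \<alpha> * (1 * V1 l G j + (Phi m (of_real l) / of_real \<alpha>) * res k l G j) = of_real \<alpha> * X l G j" .
  then show "1 * V1 l G j + (Phi m (of_real l) / of_real \<alpha>) * res k l G j = X l G j" using \<alpha> by simp
 qed
 ultimately show ?thesis
  using near_cong[of "\<lambda>l G j. 1 * V1 l G j + (Phi m (of_real l) / of_real \<alpha>) * res k l G j" X R] by blast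
qed

lemma near_Y_up: "near R (Y k m) \<Longrightarrow> near R (Y (k - 1) m) \<Longrightarrow> near R (Y (k + 1) m)"
 by (rule near_third[OF a_pos a_pos _ _ Y_ell2 Y_rec])

lemma near_Y_down: "near R (Y k m) \<Longrightarrow> near R (Y (k + 1) m) \<Longrightarrow> near R (Y (k - 1) m)"
 by (rule near_third[where k = k and m = m and \<alpha> = "a (k - 1)" and \<beta> = "a k" and Z = "Y (k + 1) m", OF a_pos a_pos _ _ Y_ell2])
  (auto simp: Y_rec[of _ k m, symmetric])

lemma near_Y_swap: "near R (Y k m) \<longleftrightarrow> near R (Y m k)"
proof -
 have "ell2_norm (Y k m l G) = ell2_norm (Y m k l G)" for l G unfolding Y_def by (rule ell2_norm_minus)
 then show ?thesis by (simp add: near_def)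
qed

lemma near_Y_diag: "near R (Y k k)" unfolding near_def Y_def by (intro exI[of _ 0]) simp

lemma near_Y_from_two:
 assumes "near R (Y 0 m)" "near R (Y 1 m)"
 shows "near R (Y k m)"
proof -
 have up: "near R (Y i m) \<and> near R (Y (i + 1) m)" if "0 \<le> i" for i using that
 proof (induction i rule: int_ge_induct)
  case (step i)
  then show ?case using near_Y_up[of R "i + 1" m] by simp
 qed (use assms in simp)
 have dn: "near R (Y i m) \<and> near R (Y (i + 1) m)" if "i \<le> 0" for i using that
 proof (induction i rule: int_le_induct)
  case (step i)
  then show ?case using near_Y_down[of R i m] by simp
 qed (use assms in simp)
 show ?thesis using up[of k] dn[of k] by linarith
qed

lemma near_Y: "near R (Y k m)"
proof -
 \<comment> \<open>The first index is moved while the second is fixed at 0 and then at 1;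
   antisymmetry exchanges the roles, after which the second index is moved too.\<close>
 have 0: "near R (Y k 0)" for k by (rule near_Y_from_two) (use near_Y_diag near_Y01 near_Y_swap[of R 1 0] in auto)
 have 1: "near R (Y k 1)" for k by (rule near_Y_from_two) (use near_Y_diag near_Y01 in auto)
 show ?thesis by (rule near_Y_from_two) (use 0 1 near_Y_swap[of R _ m] in auto)
qed

end

section \<open>The transform of finite sequences\<close>

context jacobi_fun
begin

abbreviation "FF \<equiv> F_transform q r c d"

lemma FF_sum: "finite X \<Longrightarrow> {l. u l \<noteq> 0} \<subseteq> X \<Longrightarrow> FF u x = (\<Sum>l\<in>X. Phi l x * u l)"
 unfolding F_transform_def Phi_def by (rule sum.mono_neutral_left) auto

lemma FF_zero [simp]: "FF (\<lambda>k. 0) x = 0" by (simp add: F_transform_def)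

lemma FF_lin:
 assumes "u \<in> finseq" "v \<in> finseq"
 shows "FF (\<lambda>k. \<alpha> * u k + \<beta> * v k) x = \<alpha> * FF u x + \<beta> * FF v x"
proof -
 let ?X = "{k. u k \<noteq> 0} \<union> {k. v k \<noteq> 0}"
 have X: "finite ?X" using assms by (simp add: finseq_def)
 have "FF (\<lambda>k. \<alpha> * u k + \<beta> * v k) x = (\<Sum>l\<in>?X. Phi l x * (\<alpha> * u l + \<beta> * v l))"
  by (rule FF_sum[OF X]) auto
 also have "\<dots> = \<alpha> * (\<Sum>l\<in>?X. Phi l x * u l) + \<beta> * (\<Sum>l\<in>?X. Phi l x * v l)"
  by (simp add: sum.distrib sum_distrib_left algebra_simps)
 also have "\<dots> = \<alpha> * FF u x + \<beta> * FF v x" using FF_sum[OF X, of u x] FF_sum[OF X, of v x] by simp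
 finally show ?thesis .
qed

lemma FF_basis [simp]: "FF (basis_vec k) x = Phi k x" using FF_sum[of "{k}" "basis_vec k" x] by (simp add: basis_vec_def)

lemma FF_add: "u \<in> finseq \<Longrightarrow> FF (\<lambda>j. u j + \<alpha> * basis_vec k j) x = FF u x + \<alpha> * Phi k x"
 using FF_lin[of u "basis_vec k" 1 \<alpha> x] by simp

lemma continuous_FF: "u \<in> finseq \<Longrightarrow> continuous_on X g \<Longrightarrow> continuous_on X (\<lambda>x. FF u (g x))"
 unfolding F_transform_def Phi_def[symmetric] mult.assoc[symmetric] by (simp add: Phi_def[symmetric] continuous_intros)

text \<open>The recurrence for \<open>Phi\<close> in the form that the transform turns
  \<open>J\<close> into multiplication by \<open>x\<close>.\<close>

lemma FF_jac:
 assumes "u \<in> finseq" shows "FF (jac a b u) x = x * FF u x" using assms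
proof (induction u rule: finseq_induct)
 case zero
 have "jac a b (\<lambda>k. 0) = (\<lambda>k. 0)" by (simp add: jac_def)
 then show ?case by simp
next
 case (add u k \<alpha>)
 have "FF (jac a b (basis_vec k)) x = x * Phi k x"
 proof -
  have "FF (jac a b (basis_vec k)) x = FF (\<lambda>j. 1 * (of_real (a k) * basis_vec (k + 1) j + of_real (b k) * basis_vec k j)
    + of_real (a (k - 1)) * basis_vec (k - 1) j) x" unfolding jac_basis by simp
  also have "\<dots> = of_real (a k) * Phi (k + 1) x + of_real (b k) * Phi k x + of_real (a (k - 1)) * Phi (k - 1) x"
   by (simp only: FF_lin finseq_lin basis_vec_finseq) simp
  finally show ?thesis unfolding Phi_recurrence .
 qed
 moreover have "jac a b (\<lambda>j. u j + \<alpha> * basis_vec k j) = (\<lambda>j. 1 * jac a b u j + \<alpha> * jac a b (basis_vec k) j)"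
  using jac_lin[of a b 1 u \<alpha> "basis_vec k"] by simp
 ultimately show ?case using add FF_lin[of "jac a b u" "jac a b (basis_vec k)" 1 \<alpha> x] by (simp add: FF_add jac_finseq algebra_simps)
qed

text \<open>Two neighbouring zeros would propagate upwards through the recurrence and contradict the
  behaviour of \<open>Phi\<close> at +infinity.\<close>

lemma Phi_0_1_nonzero: "Phi 0 x \<noteq> 0 \<or> Phi 1 x \<noteq> 0"
proof (rule ccontr)
 assume "\<not> (Phi 0 x \<noteq> 0 \<or> Phi 1 x \<noteq> 0)"
 then have 0: "Phi 0 x = 0" "Phi (0 + 1) x = 0" by auto
 have "Phi k x = 0 \<and> Phi (k + 1) x = 0" if "0 \<le> k" for k using that
 proof (induction k rule: int_ge_induct)
  case (step i)
  then have "of_real (a (i + 1)) * Phi (i + 1 + 1) x = 0" using Phi_recurrence[of "i + 1" x] by simp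
  then show ?case using step a_pos[of "i + 1"] by simp
 qed (use 0 in simp)
 moreover obtain K where "\<forall>k\<ge>K. Phi k x \<noteq> 0" using Phi_eventually_nonzero by blast
 ultimately show False by (metis linear max.cobounded1 max.cobounded2)
qed

lemma Phi_real: "Phi k (of_real t) = of_real (Re (Phi k (of_real t)))"
 using cnj_Phi[of k "of_real t"] by (metis Reals_cnj_iff complex_cnj_complex_of_real complex_is_Real_iff complex_eq_iff Im_complex_of_real Re_complex_of_real)

end

section \<open>The common measure on the line\<close>

context jacobi_spectral
begin

definition YF :: "zseq \<Rightarrow> zseq \<Rightarrow> real \<Rightarrow> real set \<Rightarrow> zseq" where
 "YF u v l G = (\<lambda>j. FF v (of_real l) * E G u j - FF u (of_real l) * E G v j)"

lemma YF_ell2: "u \<in> finseq \<Longrightarrow> v \<in> finseq \<Longrightarrow> G \<in> sets borel \<Longrightarrow> YF u v l G \<in> ell2"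
 unfolding YF_def by (intro ell2_diff ell2_cmult E_ell2 finseq_ell2)

lemma E_add: "G \<in> sets borel \<Longrightarrow> u \<in> finseq \<Longrightarrow> E G (\<lambda>j. u j + \<alpha> * e k j) = (\<lambda>j. E G u j + \<alpha> * E G (e k) j)"
 using E_lin[of G u "e k" 1 \<alpha>] by (simp add: finseq_ell2)

lemma near_add:
 assumes "near R V" "near R W" "\<And>l G. G \<in> sets borel \<Longrightarrow> V l G \<in> ell2" "\<And>l G. G \<in> sets borel \<Longrightarrow> W l G \<in> ell2"
 shows "near R (\<lambda>l G j. V l G j + \<alpha> * W l G j)"
proof -
 have "near R (\<lambda>l G j. 1 * V l G j + \<alpha> * W l G j)"
  by (rule near_lin[where K = "1 + cmod \<alpha>", OF assms(1,2)]) (use assms(3,4) in auto)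
 then show ?thesis by simp
qed

lemma near_YF_basis:
 assumes "u \<in> finseq" shows "near R (YF u (e m))" using assms
proof (induction u rule: finseq_induct)
 case zero
 have "YF (\<lambda>k. 0) (e m) l G = (\<lambda>j. 0)" if "G \<in> sets borel" for l G
  using E_lin[OF that, of "e 0" "e 0" 0 0] that by (simp add: YF_def)
 then show ?case unfolding near_def by (intro exI[of _ 0]) auto
next
 case (add u k \<alpha>)
 have "near R (\<lambda>l G j. YF u (e m) l G j + \<alpha> * Y k m l G j)" using add by (intro near_add near_Y YF_ell2 Y_ell2) auto
 moreover have "YF (\<lambda>j. u j + \<alpha> * e k j) (e m) l G = (\<lambda>j. YF u (e m) l G j + \<alpha> * Y k m l G j)" if "G \<in> sets borel" for l G
  using add(1) that by (auto simp: YF_def Y_def E_add FF_add algebra_simps)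
 ultimately show ?case using near_cong[of "YF (\<lambda>j. u j + \<alpha> * e k j) (e m)"] by auto
qed

lemma near_YF:
 assumes u: "u \<in> finseq" and v: "v \<in> finseq" shows "near R (YF u v)" using v
proof (induction v rule: finseq_induct)
 case zero
 have "YF u (\<lambda>k. 0) l G = (\<lambda>j. 0)" if "G \<in> sets borel" for l G
  using E_lin[OF that, of "e 0" "e 0" 0 0] that by (simp add: YF_def)
 then show ?case unfolding near_def by (intro exI[of _ 0]) auto
next
 case (add v k \<alpha>)
 have "near R (\<lambda>l G j. YF u v l G j + \<alpha> * YF u (e k) l G j)" using add u by (intro near_add near_YF_basis YF_ell2) auto
 moreover have "YF u (\<lambda>j. v j + \<alpha> * e k j) l G = (\<lambda>j. YF u v l G j + \<alpha> * YF u (e k) l G j)" if "G \<in> sets borel" for l G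
  using add(1) that by (auto simp: YF_def E_add FF_add algebra_simps)
 ultimately show ?case using near_cong[of "YF u (\<lambda>j. v j + \<alpha> * e k j)"] by auto
qed

definition sq :: "zseq \<Rightarrow> real \<Rightarrow> real" where
 "sq u t = (cmod (FF u (of_real t)))^2"

lemma sq_nonneg [simp]: "0 \<le> sq u t" by (simp add: sq_def)

lemma continuous_sq: "u \<in> finseq \<Longrightarrow> continuous_on X (sq u)" unfolding sq_def by (intro continuous_intros continuous_FF)

lemma measurable_sq [measurable]: "u \<in> finseq \<Longrightarrow> sq u \<in> borel_measurable borel"
 by (intro borel_measurable_continuous_onI continuous_sq)

lemma integrable_sq_ivl:
 assumes u: "u \<in> finseq" and v: "v \<in> ell2" and G: "G \<in> sets borel" "G \<subseteq> {x..y}"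
 shows "integrable (M v) (\<lambda>t. indicator G t * sq u t)"
proof -
 interpret finite_measure "M v" by (rule finite_M[OF v])
 have "bounded (sq u ` {x..y})" by (intro compact_imp_bounded compact_continuous_image continuous_sq u) auto
 then obtain K where "\<forall>t\<in>sq u ` {x..y}. norm t \<le> K" unfolding bounded_iff by blast
 then have K: "sq u t \<le> K" if "t \<in> G" for t using that G(2) by auto
 show ?thesis by (rule integrable_const_bound[where B = "\<bar>K\<bar>"])
   (use u G(1) K in \<open>auto simp: indicator_def intro!: AE_I2 order_trans[OF K abs_ge_self]\<close>)
qed

text \<open>On a short interval around \<open>l\<close> the vectors \<open>E G u\<close> and \<open>E G v\<close> are nearly proportional to each
 other with ratio \<open>FF u l : FF v l\<close>.\<close>

lemma sq_measure_ivl: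
 assumes u: "u \<in> finseq" and v: "v \<in> finseq" and xy: "\<alpha> < \<beta>"
 shows "(\<integral>t. indicator {\<alpha>..<\<beta>} t * sq v t \<partial>M u) = (\<integral>t. indicator {\<alpha>..<\<beta>} t * sq u t \<partial>M v)"
proof -
 have ue: "u \<in> ell2" and ve: "v \<in> ell2" using u v finseq_ell2 by auto
 interpret Mu: finite_measure "M u" by (rule finite_M[OF ue])
 interpret Mv: finite_measure "M v" by (rule finite_M[OF ve])
 define R where "R = max \<bar>\<alpha>\<bar> \<bar>\<beta>\<bar>"
 have R: "\<bar>l\<bar> \<le> R" if "\<alpha> \<le> l" "l \<le> \<beta>" for l using that by (auto simp: R_def)
 obtain C where C: "C \<ge> 0" "\<And>l \<epsilon> G. \<bar>l\<bar> \<le> R \<Longrightarrow> 0 \<le> \<epsilon> \<Longrightarrow> G \<in> sets borel \<Longrightarrow> G \<subseteq> {l - \<epsilon>..l + \<epsilon>} \<Longrightarrow> ell2_norm (YF u v l G) \<le> C * \<epsilon>"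
  using near_YF[OF u v, of R] unfolding near_def by blast
 have "\<exists>K. \<forall>l\<in>{\<alpha>..\<beta>}. cmod (FF x (of_real l)) \<le> K" if x: "x \<in> finseq" for x
 proof -
  have "bounded ((\<lambda>l. FF x (of_real l)) ` {\<alpha>..\<beta>})"
   by (intro compact_imp_bounded compact_continuous_image continuous_FF x continuous_intros) auto
  then show ?thesis by (auto simp: bounded_iff)
 qed
 then obtain K1 K2 where K: "\<And>l. \<alpha> \<le> l \<Longrightarrow> l \<le> \<beta> \<Longrightarrow> cmod (FF u (of_real l)) \<le> K1"
  "\<And>l. \<alpha> \<le> l \<Longrightarrow> l \<le> \<beta> \<Longrightarrow> cmod (FF v (of_real l)) \<le> K2"
  using u v by (meson atLeastAtMost_iff)
 define K where "K = \<bar>K1\<bar> + \<bar>K2\<bar>"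
 define H where "H x = (\<integral>t. indicator {\<alpha>..<x} t * sq v t \<partial>M u) - (\<integral>t. indicator {\<alpha>..<x} t * sq u t \<partial>M v)" for x
 \<comment> \<open>Besides the two masses the length is included, so that the radius \<epsilon> of
   an interval is itself controlled by an increment of \<open>\<rho>\<close>.\<close>
 define \<rho> where "\<rho> x = x + measure (M u) {\<alpha>..<x} + measure (M v) {\<alpha>..<x}" for x
 have "H \<alpha> = H \<beta>"
 proof (rule eq_endpoints_if_small_increments[of \<alpha> \<beta> H \<rho>])
  fix \<eta>' :: real assume \<eta>': "\<eta>' > 0"
  define \<eta> where "\<eta> = \<eta>' / (1 + C * K)"
  have CK: "0 \<le> C * K" using C by (simp add: K_def)
  then have \<eta>: "\<eta> > 0" using \<eta>' by (simp add: \<eta>_def add_pos_nonneg)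
  have uc: "uniformly_continuous_on {\<alpha>..\<beta>} (sq x)" if "x \<in> finseq" for x
   by (intro compact_uniformly_continuous continuous_sq that) auto
  obtain \<delta>1 where \<delta>1: "\<delta>1 > 0" "\<And>s t. s \<in> {\<alpha>..\<beta>} \<Longrightarrow> t \<in> {\<alpha>..\<beta>} \<Longrightarrow> dist t s < \<delta>1 \<Longrightarrow> dist (sq u t) (sq u s) < \<eta>"
   using uc[OF u] \<eta> unfolding uniformly_continuous_on_def by meson
  obtain \<delta>2 where \<delta>2: "\<delta>2 > 0" "\<And>s t. s \<in> {\<alpha>..\<beta>} \<Longrightarrow> t \<in> {\<alpha>..\<beta>} \<Longrightarrow> dist t s < \<delta>2 \<Longrightarrow> dist (sq v t) (sq v s) < \<eta>"
   using uc[OF v] \<eta> unfolding uniformly_continuous_on_def by meson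
  \<comment> \<open>Besides uniform continuity this secures
    \<open>\<epsilon> \<le> \<eta>\<^sup>2\<close>, which \<open>amgm\<close> needs.\<close>
  define \<delta> where "\<delta> = min (min \<delta>1 \<delta>2) (\<eta>\<^sup>2)"
  show "\<exists>\<delta>>0. \<forall>x y. \<alpha> \<le> x \<longrightarrow> x < y \<longrightarrow> y \<le> \<beta> \<longrightarrow> y - x < \<delta> \<longrightarrow> \<bar>H y - H x\<bar> \<le> \<eta>' * (\<rho> y - \<rho> x)"
  proof (intro exI[of _ \<delta>] conjI allI impI)
   show "\<delta> > 0" using \<delta>1 \<delta>2 \<eta> by (simp add: \<delta>_def)
   fix x y assume x: "\<alpha> \<le> x" "x < y" "y \<le> \<beta>" "y - x < \<delta>"
   define G where "G = {x..<y}"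
   define l where "l = (x + y) / 2"
   define \<epsilon> where "\<epsilon> = (y - x) / 2"
   have \<epsilon>: "0 \<le> \<epsilon>" "\<epsilon> \<le> \<eta>\<^sup>2" using x by (auto simp: \<epsilon>_def \<delta>_def)
   have G: "G \<in> sets borel" "G \<subseteq> {l - \<epsilon>..l + \<epsilon>}" "G \<subseteq> {\<alpha>..\<beta>}"
    using x by (auto simp: G_def l_def \<epsilon>_def field_simps)
   have l: "\<alpha> \<le> l" "l \<le> \<beta>" using x by (auto simp: l_def)
   have dl: "dist t l < \<delta>1" "dist t l < \<delta>2" if "t \<in> G" for t
    using that x G(2) unfolding G_def l_def \<epsilon>_def \<delta>_def by (auto simp: dist_real_def abs_less_iff field_simps)
   have split: "(\<integral>t. indicator {\<alpha>..<y} t * sq p t \<partial>M s) - (\<integral>t. indicator {\<alpha>..<x} t * sq p t \<partial>M s) = (\<integral>t. indicator G t * sq p t \<partial>M s)"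
    if "p \<in> finseq" "s \<in> ell2" for p s
   proof -
    have "(\<integral>t. indicator {\<alpha>..<y} t * sq p t \<partial>M s) = (\<integral>t. indicator {\<alpha>..<x} t * sq p t + indicator G t * sq p t \<partial>M s)"
     using x by (intro Bochner_Integration.integral_cong) (auto simp: G_def indicator_def)
    also have "\<dots> = (\<integral>t. indicator {\<alpha>..<x} t * sq p t \<partial>M s) + (\<integral>t. indicator G t * sq p t \<partial>M s)"
     by (intro Bochner_Integration.integral_add integrable_sq_ivl[of _ _ _ \<alpha> \<beta>] that) (use x G in auto)
    finally show ?thesis by simp
   qed
   have msplit: "measure (M s) {\<alpha>..<y} - measure (M s) {\<alpha>..<x} = measure (M s) G" if s: "s \<in> ell2" for s
   proof -
    interpret finite_measure "M s" by (rule finite_M[OF s])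
    have "{\<alpha>..<y} = {\<alpha>..<x} \<union> G" using x by (auto simp: G_def)
    then show ?thesis using finite_measure_Union[of "{\<alpha>..<x}" G] by (auto simp: G_def)
   qed
   have approx: "\<bar>(\<integral>t. indicator G t * sq p t \<partial>M s) - sq p l * measure (M s) G\<bar> \<le> \<eta> * measure (M s) G"
    if p: "p \<in> finseq" "\<And>t. t \<in> G \<Longrightarrow> dist (sq p t) (sq p l) < \<eta>" and s: "s \<in> ell2" for p s
   proof -
    interpret finite_measure "M s" by (rule finite_M[OF s])
    have i: "integrable (M s) (\<lambda>t. indicator G t * sq p t)" by (rule integrable_sq_ivl[OF p(1) s G(1,3)])
    have j: "integrable (M s) (indicator G :: real \<Rightarrow> real)" using G(1) by (simp add: emeasure_M s)
    have "(\<integral>t. indicator G t * sq p t \<partial>M s) - sq p l * measure (M s) G = (\<integral>t. indicator G t * sq p t - sq p l * indicator G t \<partial>M s)"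
     using i j G(1) by (simp add: Bochner_Integration.integral_diff)
    also have "\<bar>\<dots>\<bar> \<le> (\<integral>t. \<eta> * indicator G t \<partial>M s)"
    proof (rule integral_abs_bound[THEN order_trans], rule integral_mono)
     show "integrable (M s) (\<lambda>t. \<bar>indicator G t * sq p t - sq p l * indicator G t\<bar>)" using i j by (intro integrable_abs Bochner_Integration.integrable_diff) auto
     show "integrable (M s) (\<lambda>t. \<eta> * indicator G t)" using j by auto
     show "\<bar>indicator G t * sq p t - sq p l * indicator G t\<bar> \<le> \<eta> * indicator G t" for t
      using p(2)[of t] by (auto simp: indicator_def dist_real_def less_imp_le)
    qed
    also have "\<dots> = \<eta> * measure (M s) G" using G(1) by simp
    finally show ?thesis .
   qed
   have a1: "\<bar>(\<integral>t. indicator G t * sq v t \<partial>M u) - sq v l * measure (M u) G\<bar> \<le> \<eta> * measure (M u) G"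
    by (rule approx[OF v _ ue]) (use \<delta>2(2) dl(2) G(3) l in auto)
   have a2: "\<bar>(\<integral>t. indicator G t * sq u t \<partial>M v) - sq u l * measure (M v) G\<bar> \<le> \<eta> * measure (M v) G"
    by (rule approx[OF u _ ve]) (use \<delta>1(2) dl(1) G(3) l in auto)
   define nu where "nu = ell2_norm (E G u)"
   define nv where "nv = ell2_norm (E G v)"
   have mu: "measure (M u) G = nu^2" "measure (M v) G = nv^2" using G(1) ue ve by (simp_all add: measure_M nu_def nv_def)
   have nn: "0 \<le> nu" "0 \<le> nv" by (simp_all add: nu_def nv_def)
   \<comment> \<open>A difference of squares: the two vectors differ by at most
     \<open>C * \<epsilon>\<close> in norm, and the sum of their norms is at most
     \<open>K * (nu + nv)\<close>.\<close>
   have a3: "\<bar>sq v l * nu^2 - sq u l * nv^2\<bar> \<le> C * \<epsilon> * (K * (nu + nv))"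
   proof -
    define p where "p = (\<lambda>j. FF v (of_real l) * E G u j)"
    define s where "s = (\<lambda>j. FF u (of_real l) * E G v j)"
    have ps: "p \<in> ell2" "s \<in> ell2" unfolding p_def s_def by (intro ell2_cmult E_ell2 G ue ve)+
    have n: "ell2_norm p = cmod (FF v (of_real l)) * nu" "ell2_norm s = cmod (FF u (of_real l)) * nv"
     unfolding p_def s_def nu_def nv_def by (rule ell2_norm_cmult)+
    have "ell2_norm p \<le> ell2_norm (\<lambda>k. p k - s k) + ell2_norm s" "ell2_norm s \<le> ell2_norm (\<lambda>k. p k - s k) + ell2_norm p"
     using ell2_norm_triangle[of "\<lambda>k. p k - s k" s] ell2_norm_triangle[of "\<lambda>k. s k - p k" p] ps
     by (auto simp: ell2_diff ell2_norm_minus[of s p])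
    then have "\<bar>ell2_norm p - ell2_norm s\<bar> \<le> ell2_norm (\<lambda>k. p k - s k)" by linarith
    also have "\<dots> \<le> C * \<epsilon>" using C(2)[OF R[OF l] \<epsilon>(1) G(1,2)] by (simp add: YF_def p_def s_def)
    finally have d: "\<bar>ell2_norm p - ell2_norm s\<bar> \<le> C * \<epsilon>" .
    have "cmod (FF v (of_real l)) \<le> K" "cmod (FF u (of_real l)) \<le> K" using K[OF l] unfolding K_def by linarith+
    then have sum: "ell2_norm p + ell2_norm s \<le> K * (nu + nv)"
     unfolding n distrib_left using nn by (intro add_mono mult_right_mono) auto
    have "sq v l * nu^2 - sq u l * nv^2 = (ell2_norm p - ell2_norm s) * (ell2_norm p + ell2_norm s)"
     unfolding n sq_def by (simp add: power2_eq_square algebra_simps)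
    then have "\<bar>sq v l * nu^2 - sq u l * nv^2\<bar> = \<bar>ell2_norm p - ell2_norm s\<bar> * (ell2_norm p + ell2_norm s)"
     by (simp add: abs_mult)
    also have "\<dots> \<le> C * \<epsilon> * (K * (nu + nv))" using C \<epsilon> by (intro mult_mono d sum) auto
    finally show ?thesis .
   qed
   \<comment> \<open>The norms \<open>nu\<close>, \<open>nv\<close> occur to the first power, while
     the masses are their squares; the inequality between arithmetic and geometric means restores
     squares at the price of the length.\<close>
   have amgm: "\<epsilon> * t \<le> \<eta> * \<epsilon> + \<eta> * t^2" for t
   proof -
    have "\<epsilon> * t * (2 * \<eta>) \<le> \<epsilon>\<^sup>2 + (\<eta> * t)^2" using sum_squares_bound[of \<epsilon> "\<eta> * t"] by (simp add: mult_ac)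
    also have "\<epsilon>\<^sup>2 \<le> \<epsilon> * \<eta>\<^sup>2" unfolding power2_eq_square[of \<epsilon>] using \<epsilon> by (intro mult_left_mono) auto
    finally have "(\<epsilon> * t * 2) * \<eta> \<le> (\<eta> * \<epsilon> + \<eta> * t^2) * \<eta>" by (simp add: power2_eq_square algebra_simps)
    then have "\<epsilon> * t * 2 \<le> \<eta> * \<epsilon> + \<eta> * t^2" using \<eta> by (rule mult_right_le_imp_le)
    moreover have "0 \<le> \<eta> * \<epsilon> + \<eta> * t^2" using \<eta> \<epsilon> by (intro add_nonneg_nonneg mult_nonneg_nonneg) auto
    ultimately show ?thesis by linarith
   qed
   have "\<epsilon> * (nu + nv) \<le> \<eta> * ((y - x) + nu^2 + nv^2)"
   proof -
    have "y - x = 2 * \<epsilon>" by (simp add: \<epsilon>_def)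
    then show ?thesis using amgm[of nu] amgm[of nv] by (simp add: algebra_simps)
   qed
   then have "(C * K) * (\<epsilon> * (nu + nv)) \<le> (C * K) * (\<eta> * ((y - x) + nu^2 + nv^2))"
    using CK by (rule mult_left_mono)
   then have "\<bar>sq v l * nu^2 - sq u l * nv^2\<bar> \<le> (C * K) * (\<eta> * ((y - x) + nu^2 + nv^2))"
    using a3 by (simp add: mult_ac)
   moreover have "\<eta> * nu^2 + \<eta> * nv^2 \<le> \<eta> * ((y - x) + nu^2 + nv^2)"
    using \<eta> x by (simp add: distrib_left)
   moreover have "H y - H x = (\<integral>t. indicator G t * sq v t \<partial>M u) - (\<integral>t. indicator G t * sq u t \<partial>M v)"
    using split[OF v ue] split[OF u ve] by (simp add: H_def)
   ultimately have "\<bar>H y - H x\<bar> \<le> \<eta> * ((y - x) + nu^2 + nv^2) + (C * K) * (\<eta> * ((y - x) + nu^2 + nv^2))"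
    using a1 a2 unfolding mu by linarith
   also have "\<dots> = ((1 + C * K) * \<eta>) * ((y - x) + nu^2 + nv^2)" by (simp add: algebra_simps)
   also have "(1 + C * K) * \<eta> = \<eta>'" using CK by (simp add: \<eta>_def)
   also have "(y - x) + nu^2 + nv^2 = \<rho> y - \<rho> x" using msplit[OF ue] msplit[OF ve] by (simp add: \<rho>_def mu)
   finally show "\<bar>H y - H x\<bar> \<le> \<eta>' * (\<rho> y - \<rho> x)" .
  qed
 qed (rule xy)
 then show ?thesis by (simp add: H_def)
qed

text \<open>It follows that dividing the scalar measure of \<open>u\<close> by \<open>sq u\<close>
  gives the same result for all \<open>u\<close>, away from zeros of the transform.\<close>

lemma sq_measure_eq:
 assumes u: "u \<in> finseq" and v: "v \<in> finseq"
 shows "density (M u) (\<lambda>t. ennreal (sq v t)) = density (M v) (\<lambda>t. ennreal (sq u t))"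
proof (rule measure_eqI_half_open)
 fix x y :: real assume xy: "x < y"
 have em: "emeasure (density (M s) (\<lambda>t. ennreal (sq p t))) {x..<y} = ennreal (\<integral>t. indicator {x..<y} t * sq p t \<partial>M s)"
  if s: "s \<in> finseq" and p: "p \<in> finseq" for s p
 proof -
  have "emeasure (density (M s) (\<lambda>t. ennreal (sq p t))) {x..<y} = (\<integral>\<^sup>+ t. ennreal (sq p t) * indicator {x..<y} t \<partial>M s)"
   by (rule emeasure_density) (use p in auto)
  also have "\<dots> = (\<integral>\<^sup>+ t. ennreal (indicator {x..<y} t * sq p t) \<partial>M s)"
   by (intro nn_integral_cong) (auto simp: indicator_def)
  also have "\<dots> = ennreal (\<integral>t. indicator {x..<y} t * sq p t \<partial>M s)"
   by (intro nn_integral_eq_integral integrable_sq_ivl[of _ _ _ x y]) (use s p finseq_ell2 in auto)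
  finally show ?thesis .
 qed
 show "emeasure (density (M u) (\<lambda>t. ennreal (sq v t))) {x..<y} = emeasure (density (M v) (\<lambda>t. ennreal (sq u t))) {x..<y}"
  unfolding em[OF u v] em[OF v u] sq_measure_ivl[OF u v xy] ..
 show "emeasure (density (M u) (\<lambda>t. ennreal (sq v t))) {x..<y} \<noteq> \<infinity>" unfolding em[OF u v] by simp
qed simp_all

text \<open>\<open>Phi 0\<close> and \<open>Phi 1\<close> are real on the real line and have no common zero, so the transform of \<open>g0\<close>
 has no real zero.\<close>

definition g0 :: zseq where "g0 = (\<lambda>j. 1 * e 0 j + \<i> * e 1 j)"

lemma g0_finseq [simp]: "g0 \<in> finseq" unfolding g0_def by (intro finseq_lin basis_vec_finseq)

lemma sq_g0: "0 < sq g0 t"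
proof -
 obtain x y where xy: "Phi 0 (of_real t) = of_real x" "Phi 1 (of_real t) = of_real y" using Phi_real by metis
 then have "x \<noteq> 0 \<or> y \<noteq> 0" using Phi_0_1_nonzero[of "of_real t"] by auto
 moreover have "FF g0 (of_real t) = of_real x + \<i> * of_real y" unfolding g0_def by (subst FF_lin) (auto simp: xy)
 ultimately have "FF g0 (of_real t) \<noteq> 0" by (auto simp: complex_eq_iff)
 then show ?thesis by (simp add: sq_def)
qed

text \<open>The common quotient, computed from the one vector whose transform has no real zeros. It
  is finite on bounded sets, but its total mass is not controlled.\<close>

definition \<sigma> :: "real measure" where
 "\<sigma> = density (M g0) (\<lambda>t. ennreal (1 / sq g0 t))"

lemma sets_\<sigma> [simp, measurable_cong]: "sets \<sigma> = sets borel"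
 and space_\<sigma> [simp]: "space \<sigma> = UNIV" by (simp_all add: \<sigma>_def)

theorem M_eq_density:
 assumes u: "u \<in> finseq"
 shows "M u = density \<sigma> (\<lambda>t. ennreal (sq u t))"
proof -
 have m: "(\<lambda>t. ennreal (sq x t)) \<in> borel_measurable (M y)" "(\<lambda>t. ennreal (1 / sq g0 t)) \<in> borel_measurable (M y)" if "x \<in> finseq" for x y
  using that by measurable
 have "density \<sigma> (\<lambda>t. ennreal (sq u t)) = density (M g0) (\<lambda>t. ennreal (1 / sq g0 t) * ennreal (sq u t))"
  unfolding \<sigma>_def by (rule density_density_eq) (use m u in auto)
 also have "\<dots> = density (M g0) (\<lambda>t. ennreal (sq u t) * ennreal (1 / sq g0 t))" by (simp add: mult.commute)
 also have "\<dots> = density (density (M g0) (\<lambda>t. ennreal (sq u t))) (\<lambda>t. ennreal (1 / sq g0 t))"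
  by (rule density_density_eq[symmetric]) (use m u in auto)
 also have "density (M g0) (\<lambda>t. ennreal (sq u t)) = density (M u) (\<lambda>t. ennreal (sq g0 t))"
  by (rule sq_measure_eq) (use u in auto)
 also have "density (density (M u) (\<lambda>t. ennreal (sq g0 t))) (\<lambda>t. ennreal (1 / sq g0 t)) = density (M u) (\<lambda>t. ennreal (sq g0 t) * ennreal (1 / sq g0 t))"
  by (rule density_density_eq) (use m[of g0] in auto)
 also have "\<dots> = density (M u) (\<lambda>t. 1)"
 proof -
  have "ennreal (sq g0 t) * ennreal (1 / sq g0 t) = 1" for t using sq_g0[of t] by (subst ennreal_mult[symmetric]) auto
  then show ?thesis by simp
 qed
 also have "\<dots> = M u" by (rule density_1)
 finally show ?thesis by simp
qed

lemma emeasure_\<sigma>_bounded: "G \<in> sets borel \<Longrightarrow> G \<subseteq> {x..y} \<Longrightarrow> emeasure \<sigma> G < \<infinity>"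
proof -
 assume G: "G \<in> sets borel" "G \<subseteq> {x..y}"
 have "continuous_on {x..y} (\<lambda>t. 1 / sq g0 t)"
  using sq_g0 by (intro continuous_intros continuous_sq g0_finseq) (auto simp: less_imp_neq[THEN not_sym])
 then have "bounded ((\<lambda>t. 1 / sq g0 t) ` {x..y})" by (intro compact_imp_bounded compact_continuous_image) auto
 then obtain K where K: "\<And>t. t \<in> {x..y} \<Longrightarrow> 1 / sq g0 t \<le> K"
  unfolding bounded_iff by (metis abs_le_D1 imageI real_norm_def)
 have "emeasure \<sigma> G = (\<integral>\<^sup>+ t. ennreal (1 / sq g0 t) * indicator G t \<partial>M g0)"
  unfolding \<sigma>_def by (rule emeasure_density) (use G in auto)
 also have "\<dots> \<le> (\<integral>\<^sup>+ t. ennreal K \<partial>M g0)"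
  by (intro nn_integral_mono) (use K G in \<open>auto simp: indicator_def intro!: ennreal_leI\<close>)
 also have "\<dots> = ennreal K * emeasure (M g0) UNIV" by simp
 also have "\<dots> < \<infinity>" by (simp add: emeasure_M finseq_ell2 ennreal_mult_less_top)
 finally show ?thesis .
qed

lemma nn_integral_sq:
 assumes "u \<in> finseq" "G \<in> sets borel"
 shows "(\<integral>\<^sup>+ t. ennreal (sq u t) * indicator G t \<partial>\<sigma>) = ennreal ((ell2_norm (E G u))^2)"
 using emeasure_M[OF assms(2) finseq_ell2[OF assms(1)]]
 by (subst (asm) M_eq_density[OF assms(1)], subst (asm) emeasure_density) (use assms in auto)

end

section \<open>The spectrum outside \<open>(-1, 1)\<close>\<close>

lemma ell2_tendsto_minus_inf:
 assumes "v \<in> ell2" shows "(\<lambda>n. v (- int n)) \<longlonglongrightarrow> 0"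
proof -
 have "(\<lambda>k. (cmod (v k))^2) summable_on range (\<lambda>n::nat. - int n)"
  using assms by (auto simp: ell2_def intro: summable_on_subset_banach)
 then have "((\<lambda>k. (cmod (v k))^2) \<circ> (\<lambda>n. - int n)) summable_on (UNIV :: nat set)"
  by (subst (asm) summable_on_reindex) (auto simp: inj_on_def)
 then have "summable (\<lambda>n. (cmod (v (- int n)))^2)" by (simp add: o_def summable_on_imp_summable)
 then have "(\<lambda>n. (cmod (v (- int n)))^2) \<longlonglongrightarrow> 0" by (rule summable_LIMSEQ_zero)
 then have "(\<lambda>n. sqrt ((cmod (v (- int n)))^2)) \<longlonglongrightarrow> sqrt 0" by (intro tendsto_intros)
 then show ?thesis by (simp add: tendsto_norm_zero_iff)
qed

context jacobi_spectral
begin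

text \<open>The root of \<open>mu y = t\<close> outside the unit disc; the sign of \<open>t\<close>
  selects it.\<close>

definition yy :: "real \<Rightarrow> real" where
 "yy t = t + sgn t * sqrt (t^2 - 1)"

lemma yy:
 assumes "1 < \<bar>t\<bar>" shows "mu (yy t) = t" "1 < \<bar>yy t\<bar>"
proof -
 define s where "s = sqrt (t^2 - 1)"
 have t2: "1 < t^2" using power_strict_mono[OF assms, of 2] by simp
 then have s: "s^2 = t^2 - 1" "0 < s" by (auto simp: s_def)
 have sg: "sgn t * sgn t = 1" using assms by (auto simp: sgn_if)
 have prod: "(t + sgn t * s) * (t - sgn t * s) = 1"
 proof -
  have "(t + sgn t * s) * (t - sgn t * s) = t^2 - (sgn t * sgn t) * s^2" by (simp add: algebra_simps power2_eq_square)
  then show ?thesis using s sg by simp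
 qed
 then have "inverse (yy t) = t - sgn t * s" unfolding yy_def s_def[symmetric] by (rule inverse_unique)
 then show "mu (yy t) = t" by (simp add: mu_def yy_def s_def)
 show "1 < \<bar>yy t\<bar>" unfolding yy_def s_def[symmetric] using s(2) assms by (auto simp: sgn_if abs_if split: if_splits)
qed

lemma continuous_yy: "X \<subseteq> {t. 1 < \<bar>t\<bar>} \<Longrightarrow> continuous_on X yy"
 unfolding yy_def by (intro continuous_intros continuous_on_sgn) auto

lemma sq_basis: "sq (e k) t = (cmod (Phi k (of_real t)))^2" by (simp add: sq_def)

lemma nn_integral_sq_basis_le:
 assumes "G \<in> sets borel" shows "(\<integral>\<^sup>+ t. ennreal (sq (e k) t) * indicator G t \<partial>\<sigma>) \<le> 1"
proof -
 have "(ell2_norm (E G (e k)))^2 \<le> 1^2" using norm_E_le[OF assms, of "e k"] by (intro power_mono) auto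
 then show ?thesis using assms by (simp add: nn_integral_sq)
qed

text \<open>\<open>D\<close> is the Wronskian at every index far enough to the left. There
  \<open>Psi\<close> is of order \<rho>^(-n), so the integral of
  \<open>\<bar>D\<bar>\<^sup>2\<close> is at most a constant times \<rho>^(-2n), because the
  functions \<open>sq (e k)\<close> have integral at most 1.\<close>

lemma D_zero_ivl:
 assumes ivl: "{x0..y0} \<subseteq> {t. 1 < \<bar>t\<bar>}"
 shows "AE t in \<sigma>. t \<in> {x0..y0} \<longrightarrow> D (of_real (yy t)) = 0"
proof (cases "x0 \<le> y0")
 case False
 then show ?thesis by simp
next
 case True
 define Ys where "Ys = (\<lambda>t. complex_of_real (yy t)) ` {x0..y0}"
 have cy: "continuous_on {x0..y0} (\<lambda>t. complex_of_real (yy t))" by (intro continuous_intros continuous_yy ivl)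
 have Yc: "compact Ys" unfolding Ys_def by (intro compact_continuous_image cy) auto
 have Y1: "1 < norm y" if "y \<in> Ys" for y using that ivl yy(2) by (auto simp: Ys_def)
 have YS: "Ys \<subseteq> S" using Y1 S_I less_imp_le by blast
 obtain C where C: "C > 0" "\<And>y k. y \<in> Ys \<Longrightarrow> k \<le> K0 \<Longrightarrow> norm (Psi k y) \<le> C * norm y powi k"
  using Psi_bound[OF Yc YS] by blast
 obtain A0 where A0: "A0 > 0" "\<And>k. k \<le> 0 \<Longrightarrow> a k \<le> A0" using a_bound_neg by blast
 have "Ys \<noteq> {}" using True by (auto simp: Ys_def)
 then obtain ym where ym: "ym \<in> Ys" "\<And>y. y \<in> Ys \<Longrightarrow> norm ym \<le> norm y"
  using continuous_attains_inf[OF Yc, of norm] continuous_on_norm_id by blast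
 \<comment> \<open>The smallest modulus of \<open>y\<close> over the compact interval exceeds 1 and
   gives a uniform rate of decay.\<close>
 define \<rho> where "\<rho> = norm ym"
 have \<rho>: "1 < \<rho>" using Y1[OF ym(1)] by (simp add: \<rho>_def)
 have P: "norm (Psi (- int n) y) \<le> C / \<rho> ^ n" if "y \<in> Ys" "- int n \<le> K0" for y n
 proof -
  have "norm (Psi (- int n) y) \<le> C * norm y powi (- int n)" by (rule C(2)[OF that])
  also have "norm y powi (- int n) = 1 / norm y ^ n" by (simp add: power_int_minus field_simps)
  also have "\<dots> \<le> 1 / \<rho> ^ n" using \<rho> ym(2)[OF that(1)] by (intro divide_left_mono power_mono mult_pos_pos zero_less_power) (auto simp: \<rho>_def)
  finally show ?thesis using C(1) by simp
 qed
 define dd where "dd t = (cmod (D (of_real (yy t))))^2 * indicator {x0..y0} t" for t :: real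
 have meas: "dd \<in> borel_measurable borel"
 proof -
  have "continuous_on {x0..y0} (\<lambda>t. D (complex_of_real (yy t)))"
   by (rule continuous_on_compose2[OF holomorphic_on_imp_continuous_on[OF holomorphic_D] cy])
    (use YS in \<open>auto simp: Ys_def\<close>)
  then have "continuous_on {x0..y0} (\<lambda>t. (cmod (D (of_real (yy t))))^2)" by (intro continuous_intros)
  from borel_measurable_continuous_on_indicator[OF _ this]
  show ?thesis unfolding dd_def by (simp add: mult.commute)
 qed
 have bound: "dd t \<le> 2 * (A0 * C)^2 / (\<rho> ^ n)^2 * ((sq (e (- int n)) t + sq (e (- int (Suc n))) t) * indicator {x0..y0} t)"
  if n: "nat (- K0) \<le> n" for n t
 proof (cases "t \<in> {x0..y0}")
  case True
  define y where "y = complex_of_real (yy t)"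
  have y: "y \<in> Ys" "mu y = of_real t" using True ivl yy(1) by (auto simp: Ys_def y_def mu_of_real)
  let ?m = "- int (Suc n)"
  have m: "?m + 1 \<le> K0" "?m + 1 = - int n" using n by auto
  have Dw: "D y = wr ?m (\<lambda>k. Phi k (of_real t)) (\<lambda>k. Psi k y)" using wr_Phi_Psi[of y ?m] y YS m by auto
  define p1 where "p1 = norm (Phi (- int n) (of_real t))"
  define p2 where "p2 = norm (Phi ?m (of_real t))"
  have b1: "norm (Psi ?m y) \<le> C / \<rho> ^ n"
  proof -
   have "C / \<rho> ^ Suc n \<le> C / \<rho> ^ n" using \<rho> C(1) by (intro divide_left_mono) (auto simp: mult_le_cancel_right1)
   then show ?thesis using P[OF y(1), of "Suc n"] m by simp
  qed
  have b2: "norm (Psi (- int n) y) \<le> C / \<rho> ^ n" using P[OF y(1)] m by simp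
  have "norm (D y) \<le> a ?m * (p1 * norm (Psi ?m y) + p2 * norm (Psi (- int n) y))"
   unfolding Dw wr_def m(2) norm_mult[of "of_real _"] p1_def p2_def using a_pos[of ?m]
   by (intro mult_mono) (auto intro!: order_trans[OF norm_triangle_ineq4] simp: norm_mult)
  also have "\<dots> \<le> A0 * (p1 * (C / \<rho> ^ n) + p2 * (C / \<rho> ^ n))"
   using A0(2)[of ?m] A0(1) b1 b2 by (intro mult_mono add_mono mult_left_mono) (auto simp: p1_def p2_def)
  also have "\<dots> = A0 * C / \<rho> ^ n * (p1 + p2)" by (simp add: algebra_simps add_divide_distrib)
  finally have "(norm (D y))^2 \<le> (A0 * C / \<rho> ^ n * (p1 + p2))^2" by (intro power_mono) auto
  also have "\<dots> = (A0 * C)^2 / (\<rho> ^ n)^2 * (p1 + p2)^2" by (simp add: power_mult_distrib power_divide)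
  also have "\<dots> \<le> (A0 * C)^2 / (\<rho> ^ n)^2 * (2 * (p1^2 + p2^2))"
   using sum_squares_bound[of p1 p2] by (intro mult_left_mono) (auto simp: power2_sum)
  also have "\<dots> = 2 * (A0 * C)^2 / (\<rho> ^ n)^2 * (p1^2 + p2^2)" by simp
  finally show ?thesis using True unfolding dd_def y_def p1_def p2_def sq_basis by simp
 next
  case False
  then show ?thesis by (simp add: dd_def)
 qed
 have le: "(\<integral>\<^sup>+ t. ennreal (dd t) \<partial>\<sigma>) \<le> ennreal (4 * (A0 * C)^2 * (1 / \<rho>\<^sup>2) ^ n)" if n: "nat (- K0) \<le> n" for n
 proof -
  define c0 where "c0 = 2 * (A0 * C)^2 / (\<rho> ^ n)^2"
  have c0: "0 \<le> c0" by (simp add: c0_def)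
  have "(\<integral>\<^sup>+ t. ennreal (dd t) \<partial>\<sigma>) \<le> (\<integral>\<^sup>+ t. ennreal c0 * (ennreal (sq (e (- int n)) t) * indicator {x0..y0} t + ennreal (sq (e (- int (Suc n))) t) * indicator {x0..y0} t) \<partial>\<sigma>)"
  proof (rule nn_integral_mono)
   fix t
   have "ennreal (dd t) \<le> ennreal (c0 * ((sq (e (- int n)) t + sq (e (- int (Suc n))) t) * indicator {x0..y0} t))"
    unfolding c0_def by (intro ennreal_leI bound n)
   also have "\<dots> = ennreal c0 * (ennreal (sq (e (- int n)) t) * indicator {x0..y0} t + ennreal (sq (e (- int (Suc n))) t) * indicator {x0..y0} t)"
    using c0 by (auto simp: indicator_def ennreal_mult ennreal_plus)
   finally show "ennreal (dd t) \<le> ennreal c0 * (ennreal (sq (e (- int n)) t) * indicator {x0..y0} t + ennreal (sq (e (- int (Suc n))) t) * indicator {x0..y0} t)" .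
  qed
  also have "\<dots> = ennreal c0 * ((\<integral>\<^sup>+ t. ennreal (sq (e (- int n)) t) * indicator {x0..y0} t \<partial>\<sigma>) + (\<integral>\<^sup>+ t. ennreal (sq (e (- int (Suc n))) t) * indicator {x0..y0} t \<partial>\<sigma>))"
   by (subst nn_integral_cmult, measurable, subst nn_integral_add) auto
  also have "\<dots> \<le> ennreal c0 * (1 + 1)" by (intro mult_left_mono add_mono nn_integral_sq_basis_le) auto
  also have "\<dots> = ennreal (c0 * 2)" using c0 by (simp add: ennreal_mult)
  also have "c0 * 2 = 4 * (A0 * C)^2 * (1 / \<rho>\<^sup>2) ^ n"
   by (simp add: c0_def power_one_over flip: power_mult) (simp add: mult.commute)
  finally show ?thesis .
 qed
 have "(\<lambda>n. ennreal (4 * (A0 * C)^2 * (1 / \<rho>\<^sup>2) ^ n)) \<longlonglongrightarrow> ennreal (4 * (A0 * C)^2 * 0)"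
 proof (intro tendsto_ennrealI tendsto_mult tendsto_const LIMSEQ_power_zero)
  have r2: "1 < \<rho>\<^sup>2" using \<rho> by (simp add: one_less_power)
  then have "0 < \<rho>\<^sup>2" by linarith
  then show "norm (1 / \<rho>\<^sup>2) < 1" using r2 by simp
 qed
 then have "(\<integral>\<^sup>+ t. ennreal (dd t) \<partial>\<sigma>) \<le> ennreal (4 * (A0 * C)^2 * 0)"
  by (rule LIMSEQ_le_const) (use le in blast)
 then have "(\<integral>\<^sup>+ t. ennreal (dd t) \<partial>\<sigma>) = 0" by simp
 then have "AE t in \<sigma>. ennreal (dd t) = 0" by (subst (asm) nn_integral_0_iff_AE) (use meas in auto)
 then show ?thesis by (rule AE_mp) (auto intro!: AE_I2 simp: dd_def indicator_def)
qed

definition yp :: "int \<Rightarrow> real" where "yp p = q powi p / (d * r)"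

lemma AE_outside: "AE t in \<sigma>. 1 < \<bar>t\<bar> \<longrightarrow> (\<exists>p. 1 < \<bar>yp p\<bar> \<and> t = mu (yp p))"
proof -
 \<comment> \<open>Countably many compact intervals, staying away from the edges, exhaust the outer
   region.\<close>
 have "AE t in \<sigma>. t \<in> {1 + 1 / real (Suc n)..real n} \<longrightarrow> D (of_real (yy t)) = 0" for n
 proof (rule D_zero_ivl, rule)
  fix t assume "t \<in> {1 + 1 / real (Suc n)..real n}"
  then have "1 + 1 / real (Suc n) \<le> t" by simp
  moreover have "0 < 1 / real (Suc n)" by simp
  ultimately have "1 < t" by linarith
  then show "t \<in> {t. 1 < \<bar>t\<bar>}" by auto
 qed
 moreover have "AE t in \<sigma>. t \<in> {- real n..- (1 + 1 / real (Suc n))} \<longrightarrow> D (of_real (yy t)) = 0" for n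
 proof (rule D_zero_ivl, rule)
  fix t assume "t \<in> {- real n..- (1 + 1 / real (Suc n))}"
  then have "t \<le> - (1 + 1 / real (Suc n))" by simp
  moreover have "0 < 1 / real (Suc n)" by simp
  ultimately have "t < - 1" by linarith
  then show "t \<in> {t. 1 < \<bar>t\<bar>}" by auto
 qed
 ultimately have "AE t in \<sigma>. \<forall>n. (t \<in> {1 + 1 / real (Suc n)..real n} \<longrightarrow> D (of_real (yy t)) = 0) \<and>
   (t \<in> {- real n..- (1 + 1 / real (Suc n))} \<longrightarrow> D (of_real (yy t)) = 0)" by (simp add: AE_all_countable)
 then show ?thesis
 proof (rule AE_mp, intro AE_I2 impI)
  fix t assume H: "\<forall>n. (t \<in> {1 + 1 / real (Suc n)..real n} \<longrightarrow> D (of_real (yy t)) = 0) \<and>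
   (t \<in> {- real n..- (1 + 1 / real (Suc n))} \<longrightarrow> D (of_real (yy t)) = 0)" and t: "1 < \<bar>t\<bar>"
  obtain n1 where n1: "\<bar>t\<bar> \<le> real n1" using real_arch_simple by blast
  obtain n2 where n2: "inverse (real (Suc n2)) < \<bar>t\<bar> - 1" using reals_Archimedean[of "\<bar>t\<bar> - 1"] t by auto
  define n where "n = max n1 n2"
  have "1 / real (Suc n) \<le> 1 / real (Suc n2)" by (intro divide_left_mono) (auto simp: n_def)
  then have "1 + 1 / real (Suc n) \<le> \<bar>t\<bar>" "\<bar>t\<bar> \<le> real n" using n1 n2 by (auto simp: n_def inverse_eq_divide)
  then have "t \<in> {1 + 1 / real (Suc n)..real n} \<or> t \<in> {- real n..- (1 + 1 / real (Suc n))}" by (cases "0 \<le> t") auto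
  then have D0: "D (of_real (yy t)) = 0" using H by blast
  have "1 < norm (complex_of_real (yy t))" using yy(2)[OF t] by simp
  from D_zero_iff[OF this] D0 obtain p where "complex_of_real (yy t) = of_real (q powi p / (d * r))" by blast
  then have "yy t = yp p" unfolding yp_def of_real_eq_iff .
  then show "\<exists>p. 1 < \<bar>yp p\<bar> \<and> t = mu (yp p)" using yy[OF t] by metis
 qed
qed

section \<open>Eigenvectors and the edges of the spectrum\<close>

lemma eigenvector_E:
 assumes "u \<in> ell2"
 shows "J (E {t} u) = (\<lambda>k. of_real t * E {t} u k)"
proof -
 have x: "E {t} u \<in> ell2" using assms by simp
 have tb': "{t} \<in> sets borel" "{t} \<subseteq> {- \<bar>t\<bar>..\<bar>t\<bar>}" by auto
 have Jx: "J (E {t} u) \<in> ell2" using Dom_ell2(2)[OF Dom_E_bounded[OF tb' assms]] .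
 have tb: "{t} \<in> sets borel" "{t} \<subseteq> {t - 0..t + 0}" by auto
 note J_near_scalar[OF tb x E_idem[OF tb(1) assms]]
 then have "ell2_norm (\<lambda>k. J (E {t} u) k - of_real t * E {t} u k) = 0"
  using ell2_norm_nonneg[of "\<lambda>k. J (E {t} u) k - of_real t * E {t} u k"] by simp
 then have "(\<lambda>k. J (E {t} u) k - of_real t * E {t} u k) = (\<lambda>k. 0)"
  by (rule ell2_norm_eq_0[rotated]) (intro ell2_diff ell2_cmult x Jx)
 then show ?thesis by (metis eq_iff_diff_eq_0)
qed

lemma solution_zero:
 assumes sol: "J v = (\<lambda>k. x * v k)" and z: "v m = 0" "v (m + 1) = 0"
 shows "v k = 0"
proof -
 have eqn: "of_real (a k) * v (k + 1) + of_real (b k) * v k + of_real (a (k - 1)) * v (k - 1) = x * v k" for k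
  using fun_cong[OF sol, of k] by (simp add: jac_def)
 have ak: "a k \<noteq> 0" for k using a_pos[of k] by simp
 have up: "v i = 0 \<and> v (i + 1) = 0" if "m \<le> i" for i using that
 proof (induction i rule: int_ge_induct)
  case (step i)
  then show ?case using eqn[of "i + 1"] ak by simp
 qed (use z in simp)
 have dn: "v i = 0 \<and> v (i + 1) = 0" if "i \<le> m" for i using that
 proof (induction i rule: int_le_induct)
  case (step i)
  then show ?case using eqn[of i] ak by simp
 qed (use z in simp)
 show ?thesis using up[of k] dn[of k] by linarith
qed

text \<open>An exact eigenvector has no residual, so \<open>wr_tail\<close> makes its Wronskian with
  \<open>Phi\<close> zero; this fixes the ratio at the indices 0 and 1, and the recurrence does the
  rest.\<close>

lemma eigenvector_proportional:
 assumes v: "v \<in> ell2" and sol: "J v = (\<lambda>k. of_real l * v k)"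
 obtains \<kappa> where "v = (\<lambda>k. \<kappa> * Phi k (of_real l))"
proof -
 let ?P = "\<lambda>k. Phi k (of_real l)"
 have Jv: "J v \<in> ell2" unfolding sol using v by (rule ell2_cmult)
 have "wr 0 v ?P = 0" using wr_tail[OF v Jv, of 0 l] by (simp add: sol)
 then have w0: "v 1 * ?P 0 = v 0 * ?P 1" using a_pos[of 0] by (simp add: wr_def)
 define \<kappa> where "\<kappa> = (if ?P 0 \<noteq> 0 then v 0 / ?P 0 else v 1 / ?P 1)"
 have \<kappa>: "v 0 = \<kappa> * ?P 0" "v 1 = \<kappa> * ?P 1"
  using w0 Phi_0_1_nonzero[of "of_real l"] by (auto simp: \<kappa>_def field_simps)
 define x where "x = (\<lambda>k. 1 * v k + (- \<kappa>) * ?P k)"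
 have JP: "J ?P = (\<lambda>k. of_real l * ?P k)" using J_Phi by auto
 have "J x = (\<lambda>k. of_real l * x k)" unfolding x_def jac_lin JP sol by (auto simp: algebra_simps)
 then have "x k = 0" for k by (rule solution_zero[where m = 0]) (use \<kappa> in \<open>simp_all add: x_def\<close>)
 then have "v k = \<kappa> * ?P k" for k by (simp add: x_def)
 then show ?thesis using that by blast
qed

text \<open>At the edges of the continuous spectrum the Jost solution \<open>Psi\<close> is bounded but does not decay,
 which excludes square-summable solutions.\<close>

lemma no_eigenvector_edge:
 assumes l: "\<bar>l\<bar> = 1" and v: "v \<in> ell2" and sol: "J v = (\<lambda>k. of_real l * v k)"
 shows "v = (\<lambda>k. 0)"
proof -
 define y where "y = complex_of_real l"
 \<comment> \<open>At an edge \<open>y\<close> is its own inverse, so \<open>wr_limit\<close>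
   applies with both rates equal to \<open>y\<close> and the limit carries the factor
   \<open>y - y\<close>.\<close>
 have y: "norm y = 1" "y * y = 1" using l by (auto simp: y_def abs_if simp flip: of_real_mult split: if_splits)
 have yS: "y \<in> S" using y S_I by simp
 have my: "mu y = of_real l"
 proof -
  have "inverse y = y" using y(2) by (rule inverse_unique)
  then show ?thesis by (simp add: mu_def) (simp add: y_def)
 qed
 have solv: "solves (mu y) v k" for k using fun_cong[OF sol, of k] by (simp add: solves_def jac_def my)
 let ?P = "\<lambda>k. Psi k y"
 have const: "wr m v ?P = wr (K0 - 1) v ?P" if "m \<le> K0 - 1" for m
  by (rule wr_const[OF solv _ that]) (use Psi_recurrence[OF yS] in auto)
 have "(\<lambda>n. wr (- int (Suc n)) v ?P) \<longlonglongrightarrow> 0 * 1 * (y - y) / 2"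
 proof (rule wr_limit)
  show "(\<lambda>n. v (- int n) * y ^ n) \<longlonglongrightarrow> 0"
   by (rule tendsto_norm_zero_cancel) (use tendsto_norm_zero[OF ell2_tendsto_minus_inf[OF v]] y in \<open>simp add: norm_mult norm_power\<close>)
  show "(\<lambda>n. Psi (- int n) y * y ^ n) \<longlonglongrightarrow> 1" by (rule Psi_lim[OF yS])
 qed (use y in simp)
 moreover have "\<forall>\<^sub>F n in sequentially. wr (- int (Suc n)) v ?P = wr (K0 - 1) v ?P"
  using eventually_ge_at_top[of "nat (- K0)"] by eventually_elim (intro const, simp)
 ultimately have "(\<lambda>n::nat. wr (K0 - 1) v ?P) \<longlonglongrightarrow> 0" by (subst (asm) tendsto_cong) auto
 then have w0: "wr m v ?P = 0" if "m \<le> K0 - 1" for m using const[OF that] by (simp add: LIMSEQ_const_iff)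
 have "(\<lambda>n. norm (Psi (- int n) y * y ^ n)) \<longlonglongrightarrow> norm (1::complex)" by (intro tendsto_norm Psi_lim yS)
 then have nP: "(\<lambda>n. norm (Psi (- int n) y)) \<longlonglongrightarrow> 1" using y by (simp add: norm_mult norm_power)
 then have "\<forall>\<^sub>F n in sequentially. 1 / 2 < norm (Psi (- int n) y)" by (rule order_tendstoD) simp
 then obtain N1 where N1: "\<And>n. n \<ge> N1 \<Longrightarrow> 1 / 2 < norm (Psi (- int n) y)" by (auto simp: eventually_sequentially)
 define n0 where "n0 = max N1 (nat (1 - K0))"
 have P0: "Psi (- int n) y \<noteq> 0" if "n \<ge> n0" for n using N1[of n] that by (auto simp: n0_def)
 define \<kappa> where "\<kappa> = v (- int n0) / Psi (- int n0) y"
 \<comment> \<open>A vanishing Wronskian makes \<open>v\<close> proportional to \<open>Psi\<close>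
   step by step, as long as \<open>Psi\<close> does not vanish; since \<open>Psi\<close> has modulus
   near 1 and \<open>v\<close> tends to 0, the factor must be 0.\<close>
 have vP: "v (- int n) = \<kappa> * Psi (- int n) y" if "n \<ge> n0" for n using that
 proof (induction n rule: dec_induct)
  case base
  then show ?case using P0[of n0] by (simp add: \<kappa>_def)
 next
  case (step n)
  have "- int (Suc n) \<le> K0 - 1" using step by (auto simp: n0_def)
  from w0[OF this] have "v (- int n) * Psi (- int (Suc n)) y = v (- int (Suc n)) * Psi (- int n) y"
   using a_pos[of "- int (Suc n)"] by (simp add: wr_def)
  then have "v (- int (Suc n)) * Psi (- int n) y = v (- int n) * Psi (- int (Suc n)) y" ..
  also have "v (- int n) = \<kappa> * Psi (- int n) y" using step by blast
  finally have "v (- int (Suc n)) * Psi (- int n) y = (\<kappa> * Psi (- int (Suc n)) y) * Psi (- int n) y" by (simp only: mult_ac)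
  moreover have "Psi (- int n) y \<noteq> 0" using P0[of n] step by simp
  ultimately show ?case using mult_right_cancel by blast
 qed
 have "\<kappa> = 0"
 proof -
  have "(\<lambda>n. norm \<kappa> * norm (Psi (- int n) y)) \<longlonglongrightarrow> norm \<kappa> * 1" by (intro tendsto_intros nP)
  moreover have "\<forall>\<^sub>F n in sequentially. norm \<kappa> * norm (Psi (- int n) y) = norm (v (- int n))"
   using eventually_ge_at_top[of n0] by eventually_elim (simp add: vP norm_mult)
  ultimately have "(\<lambda>n. norm (v (- int n))) \<longlonglongrightarrow> norm \<kappa> * 1" by (simp add: tendsto_cong)
  from LIMSEQ_unique[OF this tendsto_norm_zero[OF ell2_tendsto_minus_inf[OF v]]] show ?thesis by simp
 qed
 then have "v (- int (Suc n0)) = 0" "v (- int (Suc n0) + 1) = 0" using vP[of "Suc n0"] vP[of n0] by auto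
 then have "v k = 0" for k by (rule solution_zero[OF sol])
 then show ?thesis by blast
qed

lemma emeasure_\<sigma>_singleton:
 assumes "u \<in> finseq" shows "ennreal (sq u t) * emeasure \<sigma> {t} = ennreal ((ell2_norm (E {t} u))^2)"
proof -
 have "(\<integral>\<^sup>+ s. ennreal (sq u s) * indicator {t} s \<partial>\<sigma>) = (\<integral>\<^sup>+ s. ennreal (sq u t) * indicator {t} s \<partial>\<sigma>)"
  by (intro nn_integral_cong) (auto simp: indicator_def)
 also have "\<dots> = ennreal (sq u t) * emeasure \<sigma> {t}" by (subst nn_integral_cmult_indicator) auto
 finally show ?thesis using nn_integral_sq[OF assms, of "{t}"] by simp
qed

lemma \<sigma>_edge: "\<bar>t\<bar> = 1 \<Longrightarrow> emeasure \<sigma> {t} = 0"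
proof -
 assume t: "\<bar>t\<bar> = 1"
 have "E {t} g0 = (\<lambda>k. 0)" by (rule no_eigenvector_edge[OF t _ eigenvector_E]) (auto simp: finseq_ell2)
 then have "ennreal (sq g0 t) * emeasure \<sigma> {t} = 0" using emeasure_\<sigma>_singleton[of g0 t] by simp
 then show ?thesis using sq_g0[of t] by simp
qed

end

section \<open>The derivative of the Wronskian and the residue\<close>

lemma continuous_on_suminf:
 fixes f :: "nat \<Rightarrow> 'a::topological_space \<Rightarrow> 'b::banach"
 assumes "\<And>n. continuous_on X (f n)" "\<And>n x. x \<in> X \<Longrightarrow> norm (f n x) \<le> M n" "summable M"
 shows "continuous_on X (\<lambda>x. \<Sum>n. f n x)"
proof (rule uniform_limit_theorem)
 show "uniform_limit X (\<lambda>n x. \<Sum>i<n. f i x) (\<lambda>x. \<Sum>n. f n x) sequentially"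
  by (rule Weierstrass_m_test) (use assms in auto)
qed (auto intro!: always_eventually continuous_on_sum assms)

lemma has_sum_int_split:
 fixes g :: "int \<Rightarrow> 'a::banach"
 assumes "summable (\<lambda>n. norm (g (m - int n)))" "summable (\<lambda>n. norm (g (m + 1 + int n)))"
 shows "(g has_sum ((\<Sum>n. g (m - int n)) + (\<Sum>n. g (m + 1 + int n)))) UNIV"
proof -
 have "((g \<circ> (\<lambda>n. m - int n)) has_sum (\<Sum>n. g (m - int n))) UNIV"
  unfolding o_def by (rule norm_summable_imp_has_sum[OF assms(1) summable_sums[OF summable_norm_cancel[OF assms(1)]]])
 then have 1: "(g has_sum (\<Sum>n. g (m - int n))) (range (\<lambda>n. m - int n))" by (subst has_sum_reindex) (auto simp: inj_on_def)
 have "((g \<circ> (\<lambda>n. m + 1 + int n)) has_sum (\<Sum>n. g (m + 1 + int n))) UNIV"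
  unfolding o_def by (rule norm_summable_imp_has_sum[OF assms(2) summable_sums[OF summable_norm_cancel[OF assms(2)]]])
 then have 2: "(g has_sum (\<Sum>n. g (m + 1 + int n))) (range (\<lambda>n. m + 1 + int n))"
  by (subst has_sum_reindex) (auto simp: inj_on_def)
 have "range (\<lambda>n. m - int n) \<union> range (\<lambda>n. m + 1 + int n) = UNIV"
 proof (intro equalityI subsetI)
  fix k :: int
  show "k \<in> range (\<lambda>n. m - int n) \<union> range (\<lambda>n. m + 1 + int n)"
  proof (cases "k \<le> m")
   case True
   then have "k = m - int (nat (m - k))" by simp
   then show ?thesis by blast
  next
   case False
   then have "k = m + 1 + int (nat (k - m - 1))" by simp
   then show ?thesis by blast
  qed
 qed simp
 moreover have "range (\<lambda>n. m - int n) \<inter> range (\<lambda>n. m + 1 + int n) = {}" by auto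
 ultimately show ?thesis using has_sum_Un_disjoint[OF 1 2] by simp
qed

context jacobi_fun
begin

lemma Phi_bound_from: "\<exists>C>0. \<forall>x k. norm x \<le> R \<longrightarrow> m \<le> k \<longrightarrow> norm (Phi k x) \<le> C * q powi k"
proof (cases "0 \<le> m")
 case True
 then show ?thesis using Phi_bound[of R] by (meson order_trans)
next
 case False
 then have "m \<le> 0" by simp
 then show ?thesis
 proof (induction m rule: int_le_induct)
  case base
  then show ?case by (rule Phi_bound)
 next
  case (step i)
  obtain C where C: "C > 0" "\<And>x k. norm x \<le> R \<Longrightarrow> i \<le> k \<Longrightarrow> norm (Phi k x) \<le> C * q powi k"
   using step by blast
  have "compact (Phi (i - 1) ` cball 0 R)" by (intro compact_continuous_image continuous_Phi continuous_intros compact_cball)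
  from compact_imp_bounded[OF this] obtain C' where "\<forall>z\<in>Phi (i - 1) ` cball 0 R. norm z \<le> C'"
   unfolding bounded_iff by blast
  then have C': "norm (Phi (i - 1) x) \<le> C'" if "norm x \<le> R" for x using that by simp
  have qi: "0 < q powi (i - 1)" using q01 by simp
  have "norm (Phi k x) \<le> (C + \<bar>C'\<bar> / q powi (i - 1)) * q powi k" if x: "norm x \<le> R" and k: "i - 1 \<le> k" for x k
  proof (cases "k = i - 1")
   case True
   have "norm (Phi k x) \<le> \<bar>C'\<bar>" using C'[OF x] True by simp
   also have "\<dots> = \<bar>C'\<bar> / q powi (i - 1) * q powi k" using qi True by simp
   also have "\<dots> \<le> (C + \<bar>C'\<bar> / q powi (i - 1)) * q powi k" using C(1) q01 by (intro mult_right_mono) auto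
   finally show ?thesis .
  next
   case False
   then have "norm (Phi k x) \<le> C * q powi k" using C(2)[OF x] k by simp
   also have "\<dots> \<le> (C + \<bar>C'\<bar> / q powi (i - 1)) * q powi k" using qi q01 by (intro mult_right_mono) auto
   finally show ?thesis .
  qed
  moreover have "0 < C + \<bar>C'\<bar> / q powi (i - 1)" using C(1) qi by (intro add_pos_nonneg) auto
  ultimately show ?case by blast
 qed
qed

text \<open>The boundary term at +infinity vanishes: the coefficient grows like
  \<open>q powi (- k)\<close>, but the two solutions decay like \<open>q powi k\<close>
  each.\<close>

lemma wr_Phi_Phi_sums:
 "(\<lambda>n. (x - t) * (Phi (m + 1 + int n) x * Phi (m + 1 + int n) t)) sums - wr m (\<lambda>k. Phi k x) (\<lambda>k. Phi k t)"
proof -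
 let ?W = "\<lambda>n. wr (m + int n) (\<lambda>k. Phi k x) (\<lambda>k. Phi k t)"
 obtain C where C: "C > 0" "\<And>z k. norm z \<le> max (norm x) (norm t) \<Longrightarrow> m \<le> k \<Longrightarrow> norm (Phi k z) \<le> C * q powi k"
  using Phi_bound_from[of "max (norm x) (norm t)" m] by blast
 obtain A0 where A0: "A0 > 0" "\<And>k. k \<ge> 0 \<Longrightarrow> a k \<le> A0 * q powi (- k)" using a_bound by blast
 have "?W \<longlonglongrightarrow> 0"
 proof (rule Lim_null_comparison)
  have le: "norm (?W n) \<le> 2 * A0 * C^2 * q powi (m + 1) * q ^ n" if n: "nat (- m) \<le> n" for n
  proof -
   let ?k = "m + int n"
   have k: "0 \<le> ?k" using n by simp
   have P: "norm (Phi i z) \<le> C * q powi i" if "i \<ge> ?k" "z = x \<or> z = t" for i z using that by (intro C(2)) auto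
   have "norm (?W n) \<le> a ?k * (C * q powi (?k + 1) * (C * q powi ?k) + C * q powi ?k * (C * q powi (?k + 1)))"
    unfolding wr_def norm_mult[of "of_real _"] using a_pos[of ?k] C(1) q01
    by (intro mult_mono order_trans[OF norm_triangle_ineq4] add_mono) (auto simp: norm_mult intro!: mult_mono P)
   also have "\<dots> \<le> (A0 * q powi (- ?k)) * (C * q powi (?k + 1) * (C * q powi ?k) + C * q powi ?k * (C * q powi (?k + 1)))"
    using A0(2)[OF k] C(1) q01 by (intro mult_right_mono) auto
   also have "\<dots> = 2 * A0 * C^2 * (q powi (- ?k) * q powi ?k) * q powi (?k + 1)" by (simp add: power2_eq_square)
   also have "q powi (- ?k) * q powi ?k = 1" using q01 by (simp flip: power_int_add)
   also have "q powi (?k + 1) = q powi (m + 1) * q ^ n" using q01 by (simp add: power_int_add)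
   finally show ?thesis by simp
  qed
  show "\<forall>\<^sub>F n in sequentially. norm (?W n) \<le> 2 * A0 * C^2 * q powi (m + 1) * q ^ n"
   using eventually_ge_at_top[of "nat (- m)"] by eventually_elim (rule le)
  show "(\<lambda>n. 2 * A0 * C^2 * q powi (m + 1) * q ^ n) \<longlonglongrightarrow> 0"
   by (rule tendsto_mult_right_zero[OF qpow_lim])
 qed
 from telescope_sums[OF this] have "(\<lambda>n. ?W (Suc n) - ?W n) sums (0 - ?W 0)" .
 moreover have "?W (Suc n) - ?W n = (x - t) * (Phi (m + 1 + int n) x * Phi (m + 1 + int n) t)" for n
  using wr_step[OF solves_Phi solves_Phi, of "m + 1 + int n" x t] by (simp add: add_ac)
 ultimately show ?thesis by simp
qed

text \<open>The counterpart towards -infinity. There \<open>Psi\<close> decays because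
  \<open>norm y > 1\<close>, and the hypothesis on \<open>t\<close> makes the other factor tend to
  0.\<close>

lemma wr_Psi_Phi_sums:
 assumes y: "1 < norm y" and m: "m + 1 \<le> K0" and t: "(\<lambda>n. Phi (- int n) t) \<longlonglongrightarrow> 0"
 shows "(\<lambda>n. (mu y - t) * (Psi (m - int n) y * Phi (m - int n) t)) sums wr m (\<lambda>k. Psi k y) (\<lambda>k. Phi k t)"
proof -
 let ?W = "\<lambda>n. wr (m - int n) (\<lambda>k. Psi k y) (\<lambda>k. Phi k t)"
 have yS: "y \<in> S" using y S_I by simp
 have "(\<lambda>n. wr (- int (Suc n)) (\<lambda>k. Psi k y) (\<lambda>k. Phi k t)) \<longlonglongrightarrow> 1 * 0 * (y - inverse y) / 2"
 proof (rule wr_limit)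
  show "(\<lambda>n. Psi (- int n) y * y ^ n) \<longlonglongrightarrow> 1" by (rule Psi_lim[OF yS])
  show "(\<lambda>n. Phi (- int n) t * inverse y ^ n) \<longlonglongrightarrow> 0"
  proof (rule Lim_null_comparison)
   show "(\<lambda>n. norm (Phi (- int n) t)) \<longlonglongrightarrow> 0" using t by (rule tendsto_norm_zero)
   have "norm (inverse y ^ n) \<le> 1" for n unfolding norm_power norm_inverse using y by (intro power_le_one) (auto simp: divide_simps inverse_eq_divide)
   then show "\<forall>\<^sub>F n in sequentially. norm (Phi (- int n) t * inverse y ^ n) \<le> norm (Phi (- int n) t)"
    by (auto simp: norm_mult intro!: mult_left_le always_eventually)
  qed
  have "y \<noteq> 0" using y by auto
  then show "y * inverse y = 1" by simp
 qed
 then have W0: "(\<lambda>n. wr (- int (Suc n)) (\<lambda>k. Psi k y) (\<lambda>k. Phi k t)) \<longlonglongrightarrow> 0" by simp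
 have "?W \<longlonglongrightarrow> 0"
 proof -
  define s where "s = nat (- m - 1)"
  have s: "m = - int (Suc s)" using m K0(1) unfolding s_def by simp
  have "m - int n = - int (Suc (n + s))" for n by (simp add: s)
  then show ?thesis using LIMSEQ_ignore_initial_segment[OF W0, of s] by (simp only:)
 qed
 from telescope_sums'[OF this] have "(\<lambda>n. ?W n - ?W (Suc n)) sums (?W 0 - 0)" .
 moreover have "?W n - ?W (Suc n) = (mu y - t) * (Psi (m - int n) y * Phi (m - int n) t)" for n
  using wr_step[OF Psi_recurrence[OF yS] solves_Phi, of "m - int n" t] m by (simp add: algebra_simps)
 ultimately show ?thesis by simp
qed

lemma outside_disc:
 assumes "1 < norm y" shows "y \<noteq> 0" "y \<in> S" "y^2 \<noteq> 1"
proof -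
 show "y \<noteq> 0" "y \<in> S" using assms S_I by auto
 have "y \<noteq> 1" "y \<noteq> - 1" using assms by auto
 then show "y^2 \<noteq> 1" by (simp add: power2_eq_1_iff)
qed

lemma cc_D:
 assumes "y \<in> S - {1, -1}" shows "inverse y - y \<noteq> 0" "cc y = D y * 2 / (inverse y - y)"
proof -
 have y: "y \<in> S" "y \<noteq> 0" "y^2 \<noteq> 1" using assms by (auto simp: S_def power2_eq_1_iff)
 then show nz: "inverse y - y \<noteq> 0" by (simp add: field_simps power2_eq_square)
 show "cc y = D y * 2 / (inverse y - y)" using D_cc[OF y(1,3)] nz by (simp add: field_simps)
qed

lemma holomorphic_cc: "cc holomorphic_on S - {1, -1}" and open_S': "open (S - {1, -1})"
proof -
 have "(\<lambda>y. D y * 2 / (inverse y - y)) holomorphic_on S - {1, -1}"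
  by (intro holomorphic_intros holomorphic_on_subset[OF holomorphic_D] cc_D) (auto simp: S_def)
 then show "cc holomorphic_on S - {1, -1}" by (rule holomorphic_transform) (simp add: cc_D)
 show "open (S - {1, -1})" using open_S by (intro open_Diff) auto
qed

text \<open>Since \<open>cc y0 = 0\<close>, the connection formula makes \<open>Phi\<close> a
  multiple of the decaying \<open>Psi\<close>, hence square-summable. Green's formula on the two
  half-lines, combined by \<open>wr_cyclic\<close>, factors \<open>D y\<close> as
  \<open>mu y - t\<close> times \<open>H y\<close>. Caratheodory's criterion then needs continuity
  of \<open>H\<close> only, and \<open>H y0\<close> is the negative squared norm divided by
  \<open>cc (inverse y0)\<close>.\<close>

lemma derivative_D:
 assumes y0: "1 < norm y0" "inverse y0 \<in> S" "cc y0 = 0" "cc (inverse y0) \<noteq> 0" and t: "mu y0 = complex_of_real t"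
 shows "(\<lambda>k. Phi k (of_real t)) \<in> ell2"
  and "(D has_field_derivative - (1 - inverse y0 * inverse y0) / 2 * of_real ((ell2_norm (\<lambda>k. Phi k (of_real t)))^2) / cc (inverse y0)) (at y0)"
proof -
 define \<beta> where "\<beta> = cc (inverse y0)"
 have \<beta>: "\<beta> \<noteq> 0" using y0 by (simp add: \<beta>_def)
 let ?P = "\<lambda>k. Phi k (complex_of_real t)"
 note y0n = outside_disc(1)[OF y0(1)] and y0S = outside_disc(2)[OF y0(1)] and y02 = outside_disc(3)[OF y0(1)]
 have P: "?P k = \<beta> * Psi k y0" if "k + 1 \<le> K0" for k using connection[OF y0S y0(2) y02 that] y0(3) by (simp add: t \<beta>_def)
 have "\<forall>\<^sub>F n in sequentially. Psi (- int n) y0 * y0 ^ n \<noteq> 0"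
  using tendsto_imp_eventually_ne[OF Psi_lim[OF y0S], of 0] by simp
 then have "\<forall>\<^sub>F n in sequentially. Psi (- int n) y0 * y0 ^ n \<noteq> 0 \<and> nat (1 - K0) \<le> n"
  using eventually_ge_at_top eventually_conj by blast
 then obtain n0 where n0: "Psi (- int n0) y0 * y0 ^ n0 \<noteq> 0" "nat (1 - K0) \<le> n0" by (auto simp: eventually_sequentially)
 \<comment> \<open>The half-lines meet at an index where \<open>Psi\<close>, hence
   \<open>Phi\<close>, does not vanish, since \<open>H\<close> divides by
   \<open>Phi m\<close>.\<close>
 define m where "m = - int n0"
 have m: "m + 1 \<le> K0" "Psi m y0 \<noteq> 0" using n0 by (auto simp: m_def)
 have Pm: "?P m \<noteq> 0" using P[OF m(1)] m(2) \<beta> by simp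
 \<comment> \<open>On the closed disc of this radius \<open>norm y\<close> stays at least
   \<open>\<rho> > 1\<close>, which gives uniform majorants for the two series.\<close>
 define \<delta> where "\<delta> = (norm y0 - 1) / 2"
 define \<rho> where "\<rho> = 1 + \<delta>"
 have \<delta>: "0 < \<delta>" "1 < \<rho>" using y0(1) by (auto simp: \<delta>_def \<rho>_def)
 let ?U = "cball y0 \<delta>"
 have U1: "\<rho> \<le> norm y" if "y \<in> ?U" for y
  using that norm_triangle_ineq2[of y0 y] by (simp add: \<rho>_def \<delta>_def dist_norm field_simps)
 have U: "y \<in> S" "y \<noteq> 0" "1 < norm y" if "y \<in> ?U" for y using U1[OF that] \<delta>(2) S_I[of y] by auto
 have US: "?U \<subseteq> S" using U(1) by blast
 have y0U: "y0 \<in> ?U" using \<delta> by simp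
 obtain C where C: "C > 0" "\<And>y k. y \<in> ?U \<Longrightarrow> k \<le> K0 \<Longrightarrow> norm (Psi k y) \<le> C * norm y powi k"
  using Psi_bound[OF compact_cball US] by blast
 have Pb: "norm (Psi (m - int n) y) \<le> C * (1 / \<rho>) ^ n" if "y \<in> ?U" for y n
 proof -
  have "norm (Psi (m - int n) y) \<le> C * norm y powi (m - int n)" by (rule C(2)[OF that]) (use m in simp)
  also have "m - int n = - int (n0 + n)" by (simp add: m_def)
  also have "norm y powi - int (n0 + n) = (1 / norm y) ^ (n0 + n)"
   unfolding power_int_minus power_int_of_nat by (simp add: power_one_over inverse_eq_divide)
  also have "(1 / norm y) ^ (n0 + n) \<le> (1 / norm y) ^ n" using U(2,3)[OF that] by (intro power_decreasing) (auto simp: divide_le_eq)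
  also have "(1 / norm y) ^ n \<le> (1 / \<rho>) ^ n"
   using U1[OF that] U(2)[OF that] \<delta>(2) by (intro power_mono divide_left_mono mult_pos_pos) auto
  finally show ?thesis using C(1) by (simp add: m_def)
 qed
 have mU: "continuous_on ?U (\<lambda>y. mu y :: complex)" by (intro holomorphic_on_imp_continuous_on holomorphic_mu) (use U in auto)
 have "bounded ((\<lambda>y. mu y :: complex) ` ?U)" by (intro compact_imp_bounded compact_continuous_image mU compact_cball)
 then obtain R where R: "\<And>y. y \<in> ?U \<Longrightarrow> norm (mu y) \<le> R" unfolding bounded_iff by blast
 obtain C2 where C2: "C2 > 0" "\<And>x k. norm x \<le> R \<Longrightarrow> m + 1 \<le> k \<Longrightarrow> norm (Phi k x) \<le> C2 * q powi k"
  using Phi_bound_from[of R "m + 1"] by blast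
 define C3 where "C3 = C2 * q powi (m + 1)"
 have Fb: "norm (Phi (m + 1 + int n) (mu y)) \<le> C3 * q ^ n" if "y \<in> ?U" for y n
  using C2(2)[OF R[OF that], of "m + 1 + int n"] q01 by (simp add: C3_def power_int_add mult_ac)
 have C3: "0 < C3" using C2(1) q01 by (simp add: C3_def)
 have b1: "norm (?P (m - int n)) \<le> norm \<beta> * C * (1 / \<rho>) ^ n" for n
  using mult_left_mono[OF Pb[OF y0U, of n], of "norm \<beta>"] m by (simp add: P norm_mult mult_ac)
 have b2: "norm (?P (m + 1 + int n)) \<le> C3 * q ^ n" for n using Fb[OF y0U, of n] by (simp add: t)
 have s1: "summable (\<lambda>n. C * (1 / \<rho>) ^ n * (norm \<beta> * C * (1 / \<rho>) ^ n))"
 proof -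
  have "(1 / \<rho>) * (1 / \<rho>) < 1" using \<delta>(2) mult_strict_mono[of "1 / \<rho>" 1 "1 / \<rho>" 1] by simp
  then have "summable (\<lambda>n. C * (norm \<beta> * C) * ((1 / \<rho>) * (1 / \<rho>)) ^ n)" using \<delta>(2) by (intro summable_mult summable_geometric) simp
  moreover have "C * (1 / \<rho>) ^ n * (norm \<beta> * C * (1 / \<rho>) ^ n) = C * (norm \<beta> * C) * ((1 / \<rho>) * (1 / \<rho>)) ^ n" for n
   unfolding power_mult_distrib by (simp only: mult_ac)
  ultimately show ?thesis by (simp only:)
 qed
 have s2: "summable (\<lambda>n. C3 * q ^ n * (C3 * q ^ n))"
 proof -
  have "q * q < 1" using q01 mult_strict_mono[of q 1 q 1] by simp
  then have "summable (\<lambda>n. C3 * C3 * (q * q) ^ n)" using q01 by (intro summable_mult summable_geometric) simp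
  moreover have "C3 * q ^ n * (C3 * q ^ n) = C3 * C3 * (q * q) ^ n" for n unfolding power_mult_distrib by (simp only: mult_ac)
  ultimately show ?thesis by (simp only:)
 qed
 define G1 where "G1 y = (\<Sum>n. Psi (m - int n) y * ?P (m - int n))" for y
 define G2 where "G2 y = (\<Sum>n. Phi (m + 1 + int n) (mu y) * ?P (m + 1 + int n))" for y
 have cG1: "continuous_on ?U G1" unfolding G1_def
 proof (rule continuous_on_suminf[OF _ _ s1])
  fix n show "continuous_on ?U (\<lambda>y. Psi (m - int n) y * ?P (m - int n))"
   by (intro continuous_intros holomorphic_on_imp_continuous_on holomorphic_on_subset[OF holomorphic_Psi US]) (use m in simp)
  fix y assume "y \<in> ?U"
  then show "norm (Psi (m - int n) y * ?P (m - int n)) \<le> C * (1 / \<rho>) ^ n * (norm \<beta> * C * (1 / \<rho>) ^ n)"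
   unfolding norm_mult using C(1) \<delta>(2) by (intro mult_mono Pb b1) auto
 qed
 have cG2: "continuous_on ?U G2" unfolding G2_def
 proof (rule continuous_on_suminf[OF _ _ s2])
  fix n show "continuous_on ?U (\<lambda>y. Phi (m + 1 + int n) (mu y) * ?P (m + 1 + int n))"
   by (intro continuous_intros continuous_Phi mU)
  fix y assume "y \<in> ?U"
  then show "norm (Phi (m + 1 + int n) (mu y) * ?P (m + 1 + int n)) \<le> C3 * q ^ n * (C3 * q ^ n)"
   unfolding norm_mult using C3 q01 by (intro mult_mono Fb b2) auto
 qed
 have sq1: "summable (\<lambda>n. norm (?P (m - int n) * ?P (m - int n)))"
  by (rule summable_comparison_test'[OF summable_mult[OF s1, of "norm \<beta>"], of 0])
   (use mult_mono[OF b1 b1] C(1) \<delta>(2) in \<open>simp add: norm_mult mult_ac\<close>)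
 have sq2: "summable (\<lambda>n. norm (?P (m + 1 + int n) * ?P (m + 1 + int n)))"
  by (rule summable_comparison_test'[OF s2, of 0]) (use mult_mono[OF b2 b2] C3 q01 in \<open>simp add: norm_mult\<close>)
 have PP: "?P k * ?P k = of_real ((cmod (?P k))^2)" for k
 proof -
  have "cnj (?P k) = ?P k" by (simp add: cnj_Phi)
  then show ?thesis unfolding complex_norm_square by simp
 qed
 have hs: "((\<lambda>k. ?P k * ?P k) has_sum ((\<Sum>n. ?P (m - int n) * ?P (m - int n)) + (\<Sum>n. ?P (m + 1 + int n) * ?P (m + 1 + int n)))) UNIV"
  by (rule has_sum_int_split[OF sq1 sq2])
 then have "(\<lambda>k. complex_of_real ((cmod (?P k))^2)) summable_on UNIV" unfolding PP by (rule has_sum_imp_summable)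
 then have "(\<lambda>k. (cmod (?P k))^2) summable_on UNIV" using summable_on_Re by fastforce
 then show ell2P: "?P \<in> ell2" by (simp add: ell2_def)
 have "ip ?P ?P = (\<Sum>\<^sub>\<infinity>k. ?P k * ?P k)" unfolding ip_def by (simp add: cnj_Phi)
 with hs have nrm: "of_real ((ell2_norm ?P)^2) = (\<Sum>n. ?P (m - int n) * ?P (m - int n)) + (\<Sum>n. ?P (m + 1 + int n) * ?P (m + 1 + int n))"
  by (simp add: ip_self[OF ell2P] infsumI)
 have Pzero: "(\<lambda>n. ?P (- int n)) \<longlonglongrightarrow> 0" by (rule ell2_tendsto_minus_inf[OF ell2P])
 define H where "H y = - (Phi m (mu y) * G1 y + Psi m y * G2 y) / ?P m" for y
 have DH: "D y = (mu y - of_real t) * H y" if "y \<in> ?U" for y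
 proof -
  have W1: "wr m (\<lambda>k. Psi k y) ?P = (mu y - of_real t) * G1 y"
  proof -
   have sm: "summable (\<lambda>n. Psi (m - int n) y * ?P (m - int n))"
    by (rule summable_comparison_test'[OF s1, of 0]) (unfold norm_mult, use C(1) \<delta>(2) in \<open>intro mult_mono Pb b1 that, auto\<close>)
   show ?thesis using sums_unique2[OF wr_Psi_Phi_sums[OF U(3)[OF that] m(1) Pzero] sums_mult[OF summable_sums[OF sm]]] by (simp add: G1_def)
  qed
  have W2: "wr m (\<lambda>k. Phi k (mu y)) ?P = - (mu y - of_real t) * G2 y"
  proof -
   have sm: "summable (\<lambda>n. Phi (m + 1 + int n) (mu y) * ?P (m + 1 + int n))"
    by (rule summable_comparison_test'[OF s2, of 0]) (unfold norm_mult, use C3 q01 in \<open>intro mult_mono Fb b2 that, auto\<close>)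
   have "(\<lambda>n. (mu y - of_real t) * (Phi (m + 1 + int n) (mu y) * ?P (m + 1 + int n))) sums ((mu y - of_real t) * G2 y)"
    unfolding G2_def by (rule sums_mult[OF summable_sums[OF sm]])
   from sums_unique2[OF wr_Phi_Phi_sums this] have "- wr m (\<lambda>k. Phi k (mu y)) ?P = (mu y - of_real t) * G2 y" .
   then show ?thesis by (simp add: algebra_simps minus_equation_iff[of "wr _ _ _"])
  qed
  have W3: "wr m (\<lambda>k. Phi k (mu y)) (\<lambda>k. Psi k y) = D y" using U(1)[OF that] m(1) by (rule wr_Phi_Psi)
  from wr_cyclic[of "\<lambda>k. Phi k (mu y)" m "\<lambda>k. Psi k y" ?P]
  have "?P m * D y = (mu y - of_real t) * (- (Phi m (mu y) * G1 y + Psi m y * G2 y))"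
   unfolding W1 W3 wr_swap[of m ?P] W2 by (simp add: algebra_simps eq_neg_iff_add_eq_0 add_eq_0_iff2)
  then show ?thesis using Pm by (simp add: H_def field_simps)
 qed
 have H0: "H y0 = - of_real ((ell2_norm ?P)^2) / \<beta>"
 proof -
  have "\<beta> * G1 y0 = (\<Sum>n. ?P (m - int n) * ?P (m - int n))"
  proof -
   have "summable (\<lambda>n. Psi (m - int n) y0 * ?P (m - int n))"
    by (rule summable_comparison_test'[OF s1, of 0]) (unfold norm_mult, use C(1) \<delta>(2) in \<open>intro mult_mono Pb b1 y0U, auto\<close>)
   from suminf_mult[OF this, of \<beta>] show ?thesis using m by (simp add: G1_def P mult.assoc)
  qed
  moreover have "G2 y0 = (\<Sum>n. ?P (m + 1 + int n) * ?P (m + 1 + int n))" by (simp add: G2_def t)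
  ultimately have nG: "of_real ((ell2_norm ?P)^2) = \<beta> * G1 y0 + G2 y0" using nrm by simp
  have "H y0 = - (\<beta> * Psi m y0 * G1 y0 + Psi m y0 * G2 y0) / (\<beta> * Psi m y0)" unfolding H_def t P[OF m(1)] ..
  also have "\<dots> = - (\<beta> * G1 y0 + G2 y0) / \<beta>" using \<beta> m(2) by (simp add: field_simps)
  finally show ?thesis unfolding nG .
 qed
 have "continuous_on ?U H"
  unfolding H_def by (intro continuous_intros cG1 cG2 continuous_Phi mU holomorphic_on_imp_continuous_on holomorphic_on_subset[OF holomorphic_Psi US] Pm) (use m Pm in auto)
 then have cH: "isCont H y0" by (rule continuous_on_interior) (use \<delta> in simp)
 have "((\<lambda>y. mu y - of_real t) has_field_derivative (1 - inverse y0 * inverse y0) / 2) (at y0)"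
  unfolding mu_def by (auto intro!: derivative_eq_intros simp: y0n)
 then obtain g where g: "\<And>z. (mu z - of_real t) - (mu y0 - of_real t) = g z * (z - y0)" "isCont g y0" "g y0 = (1 - inverse y0 * inverse y0) / 2"
  unfolding CARAT_DERIV by auto
 have "((\<lambda>y. (mu y - of_real t) * H y) has_field_derivative (1 - inverse y0 * inverse y0) / 2 * H y0) (at y0)"
  unfolding CARAT_DERIV by (rule exI[of _ "\<lambda>y. g y * H y"]) (use g cH in \<open>auto intro!: continuous_intros simp: t\<close>)
 then have "(D has_field_derivative (1 - inverse y0 * inverse y0) / 2 * H y0) (at y0)"
  by (rule has_field_derivative_transform_within_open[of _ _ _ "ball y0 \<delta>"]) (use \<delta> DH in auto)
 then show "(D has_field_derivative - (1 - inverse y0 * inverse y0) / 2 * of_real ((ell2_norm ?P)^2) / cc (inverse y0)) (at y0)"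
 proof -
  have "x / 2 * (- z / w) = - x / 2 * z / w" for x z w :: complex by simp
  with \<open>(D has_field_derivative _) (at y0)\<close> show ?thesis unfolding H0 \<beta>_def by (simp only:)
 qed
qed

text \<open>With \<beta> = \<open>cc (inverse y0)\<close> the derivative of \<open>cc\<close> at
  \<open>y0\<close> is the squared norm of \<open>Phi\<close> divided by \<beta> y0. The simple-pole
  formula divides 1 / (\<beta> y0) by it, and \<beta> y0 cancels.\<close>

lemma residue_cc:
 assumes y0: "1 < norm y0" "inverse y0 \<in> S" "cc y0 = 0" "cc (inverse y0) \<noteq> 0" and t: "mu y0 = complex_of_real t"
 shows "residue (\<lambda>z. 1 / (cc (inverse z) * cc z * z)) y0 = of_real (1 / (ell2_norm (\<lambda>k. Phi k (of_real t)))^2)"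
proof -
 define nrm where "nrm = complex_of_real ((ell2_norm (\<lambda>k. Phi k (of_real t)))^2)"
 define \<beta> where "\<beta> = cc (inverse y0)"
 have \<beta>: "\<beta> \<noteq> 0" using y0 by (simp add: \<beta>_def)
 have nrm0: "nrm \<noteq> 0"
 proof -
  obtain k where "Phi k (of_real t) \<noteq> 0" using Phi_eventually_nonzero by blast
  then have "(\<lambda>k. Phi k (of_real t)) \<noteq> (\<lambda>k. 0)" by metis
  then show ?thesis using ell2_norm_eq_0[OF derivative_D(1)[OF y0 t]] by (auto simp: nrm_def)
 qed
 note y0n = outside_disc(1)[OF y0(1)]
 define X where "X = S - {1, -1}"
 have X: "y \<noteq> 0" "inverse y - y \<noteq> 0" if "y \<in> X" for y using cc_D(1)[of y] that by (auto simp: X_def S_def)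
 note oX = open_S'[folded X_def] and ccX = cc_D(2)[folded X_def] and hX = holomorphic_cc[folded X_def]
 have inX: "y0 \<in> X" "inverse y0 \<in> X"
 proof -
  have y1: "y0 \<noteq> 1" "y0 \<noteq> - 1" using y0(1) by auto
  moreover have "inverse y0 \<noteq> 1" "inverse y0 \<noteq> - 1"
   using y1 by (metis inverse_1 inverse_inverse_eq, metis inverse_1 inverse_inverse_eq inverse_minus_eq)
  ultimately show "y0 \<in> X" "inverse y0 \<in> X" using y0(2) outside_disc(2)[OF y0(1)] by (auto simp: X_def)
 qed
 have oX': "open (X \<inter> inverse -` X)"
 proof -
  have "X \<inter> inverse -` X = (X - {0}) \<inter> inverse -` X" using X(1) by auto
  moreover have "open ((X - {0}) \<inter> inverse -` X)"
   by (rule continuous_open_preimage) (use oX in \<open>auto intro!: continuous_intros open_Diff\<close>)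
  ultimately show ?thesis by simp
 qed
 have "isCont (\<lambda>z. cc (inverse z)) y0"
 proof -
  have "isCont cc (inverse y0)" using hX oX inX holomorphic_on_imp_continuous_on continuous_on_eq_continuous_at by blast
  then show ?thesis by (rule isCont_o2[rotated]) (use y0n in \<open>auto intro!: continuous_intros\<close>)
 qed
 \<comment> \<open>The numerator of the residue formula has to be holomorphic near
   \<open>y0\<close>, so \<open>cc (inverse z)\<close> must be kept away from 0.\<close>
 then have "\<forall>\<^sub>F z in at y0. cc (inverse z) \<noteq> 0"
  using \<beta> by (intro tendsto_imp_eventually_ne) (auto simp: isCont_def \<beta>_def)
 then obtain \<delta>1 where \<delta>1: "\<delta>1 > 0" "\<forall>z\<in>UNIV. z \<noteq> y0 \<and> dist z y0 < \<delta>1 \<longrightarrow> cc (inverse z) \<noteq> 0"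
  unfolding eventually_at by blast
 have \<delta>1': "cc (inverse z) \<noteq> 0" if "dist y0 z < \<delta>1" for z
  using \<delta>1(2) \<beta> that by (cases "z = y0") (auto simp: \<beta>_def dist_commute)
 obtain \<delta>2 where \<delta>2: "\<delta>2 > 0" "ball y0 \<delta>2 \<subseteq> X \<inter> inverse -` X"
  using oX' inX open_contains_ball_eq[OF oX', of y0] by auto
 define B0 where "B0 = ball y0 (min \<delta>1 \<delta>2)"
 have B0: "y0 \<in> B0" "open B0" "connected B0" "B0 \<subseteq> X" "\<And>z. z \<in> B0 \<Longrightarrow> inverse z \<in> X" "\<And>z. z \<in> B0 \<Longrightarrow> cc (inverse z) \<noteq> 0"
  using \<delta>1(1) \<delta>1' \<delta>2 by (auto simp: B0_def subset_iff)
 have D0: "D y0 = 0" using ccX[OF inX(1)] X(2)[OF inX(1)] y0(3) by simp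
 have dI: "((\<lambda>y. D y * 2 / (inverse y - y)) has_field_derivative (- (1 - inverse y0 * inverse y0) / 2 * nrm / \<beta>) * 2 / (inverse y0 - y0)) (at y0)"
 proof -
  have d1: "((\<lambda>y. D y * 2) has_field_derivative (- (1 - inverse y0 * inverse y0) / 2 * nrm / \<beta>) * 2) (at y0)"
   unfolding nrm_def \<beta>_def by (rule DERIV_cmult_right[OF derivative_D(2)[OF y0 t]])
  have d2: "((\<lambda>y. inverse y - y) has_field_derivative - (inverse y0 * 1 * inverse y0) - 1) (at y0)"
   by (intro DERIV_diff DERIV_inverse' DERIV_ident y0n)
  from DERIV_divide[OF d1 d2 X(2)[OF inX(1)]] show ?thesis by (rule DERIV_cong) (simp add: D0 X(2)[OF inX(1)])
 qed
 have "(cc has_field_derivative (- (1 - inverse y0 * inverse y0) / 2 * nrm / \<beta>) * 2 / (inverse y0 - y0)) (at y0)"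
  by (rule has_field_derivative_transform_within_open[OF dI oX inX(1)]) (simp add: ccX)
 also have "(- (1 - inverse y0 * inverse y0) / 2 * nrm / \<beta>) * 2 / (inverse y0 - y0) = nrm / (\<beta> * y0)"
 proof -
  have "- (1 - inverse y0 * inverse y0) = (inverse y0 - y0) / y0" using y0n by (simp add: field_simps)
  then show ?thesis using X(2)[OF inX(1)] by simp
 qed
 finally have dcc: "(cc has_field_derivative nrm / (\<beta> * y0)) (at y0)" .
 have "residue (\<lambda>z. (1 / (cc (inverse z) * z)) / cc z) y0 = (1 / (cc (inverse y0) * y0)) / (nrm / (\<beta> * y0))"
 proof (rule residue_simple_pole_deriv[OF _ _ B0(2,3,1) dcc])
  show "(\<lambda>z. 1 / (cc (inverse z) * z)) holomorphic_on B0"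
  proof (intro holomorphic_intros)
   have "(cc \<circ> inverse) holomorphic_on B0"
    by (rule holomorphic_on_compose_gen[OF _ hX]) (use B0 X(1) in \<open>auto intro!: holomorphic_intros\<close>)
   then show "(\<lambda>z. cc (inverse z)) holomorphic_on B0" by (simp add: o_def)
  qed (use B0 X(1) in auto)
  show "cc holomorphic_on B0" using hX B0(4) by (rule holomorphic_on_subset)
 qed (use y0 y0n nrm0 \<beta> in auto)
 also have "\<dots> = 1 / nrm" using \<beta> y0n nrm0 by (simp add: \<beta>_def)
 finally show ?thesis by (simp add: nrm_def mult_ac)
qed

end

context jacobi_spectral
begin

text \<open>On the range of \<open>E\<close> over the interval \<open>J - l\<close> has norm at most
  \<epsilon>, but on the projection of \<open>v\<close> it acts as the larger scalar
  \<open>t - l\<close>.\<close>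

lemma E_eigenvector_ivl:
 assumes v: "v \<in> ell2" and sol: "J v = (\<lambda>k. of_real t * v k)" and less: "\<epsilon> < \<bar>l - t\<bar>"
 shows "E {l - \<epsilon>..l + \<epsilon>} v = (\<lambda>k. 0)"
proof -
 let ?G = "{l - \<epsilon>..l + \<epsilon>}"
 have Jv: "J v \<in> ell2" unfolding sol using v by (rule ell2_cmult)
 have G: "?G \<in> sets borel" "?G \<subseteq> {l - \<epsilon>..l + \<epsilon>}" by auto
 define x where "x = E ?G v"
 have x: "x \<in> ell2" "E ?G x = x" using v by (auto simp: x_def E_idem)
 have "J x = E ?G (J v)" unfolding x_def by (rule J_E) (use v Jv in auto)
 also have "\<dots> = E ?G (\<lambda>k. of_real t * v k + 0 * v k)" by (simp add: sol)
 also have "\<dots> = (\<lambda>k. of_real t * x k)" by (subst E_lin[OF G(1) v v]) (simp add: x_def)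
 finally have Jx: "J x = (\<lambda>k. of_real t * x k)" .
 have eq: "(\<lambda>k. J x k - of_real l * x k) = (\<lambda>k. of_real (t - l) * x k)" by (simp add: Jx left_diff_distrib)
 have "ell2_norm (\<lambda>k. J x k - of_real l * x k) \<le> \<epsilon> * ell2_norm x" by (rule J_near_scalar[OF G x])
 then have "\<bar>t - l\<bar> * ell2_norm x \<le> \<epsilon> * ell2_norm x" by (simp only: eq ell2_norm_cmult norm_of_real)
 then have "ell2_norm x = 0" using less ell2_norm_nonneg[of x] by (simp add: mult_le_cancel_right abs_minus_commute)
 then show ?thesis unfolding x_def[symmetric] by (rule ell2_norm_eq_0[OF x(1)])
qed

lemma E_eigenvector:
 assumes v: "v \<in> ell2" and sol: "J v = (\<lambda>k. of_real t * v k)"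
 shows "E {t} v = v"
proof -
 have null: "{l - \<epsilon>..l + \<epsilon>} \<in> null_sets (M v)" if "\<epsilon> < \<bar>l - t\<bar>" for l \<epsilon>
  using E_eigenvector_ivl[OF v sol that] v by (auto simp: null_sets_def emeasure_M)
 \<comment> \<open>Rational intervals avoiding \<open>t\<close> form a countable cover of its
   complement by null sets.\<close>
 define I where "I = {(l, \<epsilon>). l \<in> \<rat> \<and> \<epsilon> \<in> \<rat> \<and> \<epsilon> < \<bar>l - t\<bar>}"
 have "I \<subseteq> \<rat> \<times> \<rat>" by (auto simp: I_def)
 then have cI: "countable I" by (rule countable_subset) (intro countable_SIGMA countable_rat)
 have "(\<Union>(l, \<epsilon>)\<in>I. {l - \<epsilon>..l + \<epsilon>}) \<in> null_sets (M v)"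
  by (rule null_sets_UN'[OF cI]) (auto simp: I_def intro!: null)
 moreover have "- {t} \<subseteq> (\<Union>(l, \<epsilon>)\<in>I. {l - \<epsilon>..l + \<epsilon>})"
 proof
  fix s assume "s \<in> - {t}"
  then have st: "0 < \<bar>s - t\<bar>" by simp
  then obtain \<epsilon> where \<epsilon>: "\<epsilon> \<in> \<rat>" "0 < \<epsilon>" "\<epsilon> < \<bar>s - t\<bar> / 2" using Rats_dense_in_real[of 0 "\<bar>s - t\<bar> / 2"] by auto
  then obtain l where l: "l \<in> \<rat>" "s - \<epsilon> < l" "l < s + \<epsilon>" using Rats_dense_in_real[of "s - \<epsilon>" "s + \<epsilon>"] by auto
  have "\<bar>s - t\<bar> \<le> \<bar>s - l\<bar> + \<bar>l - t\<bar>" "\<bar>s - l\<bar> < \<epsilon>" using l by (auto simp: abs_less_iff)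
  then have "\<epsilon> < \<bar>l - t\<bar>" using \<epsilon>(3) by simp
  then show "s \<in> (\<Union>(l, \<epsilon>)\<in>I. {l - \<epsilon>..l + \<epsilon>})" using l \<epsilon> by (intro UN_I[of "(l, \<epsilon>)"]) (auto simp: I_def)
 qed
 ultimately have "emeasure (M v) (- {t}) = 0" by (intro emeasure_eq_0[of _ "M v" "- {t}"]) auto
 then have "ell2_norm (E (- {t}) v) = 0" using v by (simp add: emeasure_M)
 then have "E (- {t}) v = (\<lambda>k. 0)" using v by (intro ell2_norm_eq_0) auto
 then show ?thesis using E_Compl[of "{t}" v] v by (auto simp: fun_eq_iff)
qed

text \<open>The range of \<open>E {t}\<close> is spanned by \<open>Phi\<close>. Pairing
  \<open>E {t} (e k)\<close> with \<open>Phi\<close> in two ways determines the coefficient as the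
  conjugate of \<open>Phi k\<close> over the squared norm; \<open>k\<close> is any index with
  \<open>Phi k\<close> nonzero.\<close>

lemma emeasure_\<sigma>_eigenvalue:
 assumes v: "(\<lambda>k. Phi k (of_real t)) \<in> ell2"
 shows "emeasure \<sigma> {t} = ennreal (1 / (ell2_norm (\<lambda>k. Phi k (of_real t)))^2)"
proof -
 let ?P = "\<lambda>k. Phi k (of_real t)"
 obtain k where k: "?P k \<noteq> 0" using Phi_0_1_nonzero by blast
 have JP: "J ?P = (\<lambda>k. of_real t * ?P k)" using J_Phi by auto
 obtain \<kappa> where \<kappa>: "E {t} (e k) = (\<lambda>j. \<kappa> * ?P j)"
  using eigenvector_proportional[of "E {t} (e k)" t] eigenvector_E[of "e k" t] by (auto simp: finseq_ell2)
 define nrm where "nrm = (ell2_norm ?P)^2"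
 have ek: "e k \<in> ell2" by (simp add: finseq_ell2)
 have "\<kappa> * of_real nrm = ip (E {t} (e k)) ?P" unfolding \<kappa> nrm_def by (subst ip_cmult_left) (auto simp: v ip_self)
 also have "\<dots> = ip (e k) (E {t} ?P)" using v ek by (intro E_sym) auto
 also have "E {t} ?P = ?P" by (rule E_eigenvector[OF v JP])
 also have "ip (e k) ?P = cnj (?P k)" by (rule ip_basis_left)
 finally have 1: "\<kappa> * of_real nrm = cnj (?P k)" .
 have "of_real ((ell2_norm (E {t} (e k)))^2) = ip (E {t} (e k)) (e k)" using ek by (simp add: Re_ip_E)
 also have "\<dots> = \<kappa> * ?P k" by (simp add: ip_basis_right \<kappa>)
 finally have "of_real ((ell2_norm (E {t} (e k)))^2) * complex_of_real nrm = \<kappa> * of_real nrm * ?P k" by simp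
 also have "\<dots> = of_real ((cmod (?P k))^2)" unfolding 1 complex_norm_square by simp
 finally have 2: "(ell2_norm (E {t} (e k)))^2 * nrm = sq (e k) t" unfolding of_real_mult[symmetric] of_real_eq_iff sq_basis .
 have sk: "0 < sq (e k) t" using k by (simp add: sq_basis)
 then have n0: "nrm \<noteq> 0" "0 \<le> nrm" using 2 by (auto simp: nrm_def)
 have "ennreal (sq (e k) t) * emeasure \<sigma> {t} = ennreal (sq (e k) t) * ennreal (1 / nrm)"
 proof -
  have "(ell2_norm (E {t} (e k)))^2 = sq (e k) t * (1 / nrm)" using 2 n0 by (simp add: field_simps)
  then show ?thesis using n0 sk by (simp add: emeasure_\<sigma>_singleton flip: ennreal_mult)
 qed
 then show ?thesis unfolding nrm_def[symmetric] using sk by (subst (asm) ennreal_mult_cancel_left) auto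
qed

end

section \<open>The spectrum inside \<open>(-1, 1)\<close>\<close>

text \<open>The entry \<open>(0, j)\<close> of the \<open>i\<close>-th power of the free Jacobi operator, the limit of the translates of
 \<open>L\<close> towards \<open>-\<infinity>\<close>.\<close>

definition cosmom :: "nat \<Rightarrow> int \<Rightarrow> real" where
 "cosmom i j = integral {0..pi} (\<lambda>\<theta>. cos \<theta> ^ i * cos (of_int j * \<theta>)) / pi"

lemma cosmom_integrable: "(\<lambda>\<theta>. cos \<theta> ^ i * cos (of_int j * \<theta>)) integrable_on {0..pi}"
 by (intro integrable_continuous_interval continuous_intros)

lemma cosmom_0: "cosmom 0 j = (if j = 0 then 1 else 0)"
proof (cases "j = 0")
 case False
 have "((\<lambda>\<theta>. cos (of_int j * \<theta>)) has_integral (sin (of_int j * pi) / of_int j - sin (of_int j * 0) / of_int j)) {0..pi}"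
  using False by (intro fundamental_theorem_of_calculus)
   (auto intro!: derivative_eq_intros simp flip: has_real_derivative_iff_has_vector_derivative)
 moreover have "sin (of_int j * pi) = 0" by (metis mult.commute sin_int_times_real sin_zero_iff_int2)
 ultimately have "integral {0..pi} (\<lambda>\<theta>. cos (of_int j * \<theta>)) = 0" by (simp add: integral_unique)
 then show ?thesis using False by (simp add: cosmom_def)
qed (simp add: cosmom_def)

lemma cosmom_Suc: "cosmom (Suc i) j = (cosmom i (j - 1) + cosmom i (j + 1)) / 2"
proof -
 have "cos \<theta> ^ Suc i * cos (of_int j * \<theta>) = (cos \<theta> ^ i * cos (of_int (j - 1) * \<theta>) + cos \<theta> ^ i * cos (of_int (j + 1) * \<theta>)) / 2" for \<theta> :: real
 proof -
  have "cos (of_int (j - 1) * \<theta>) + cos (of_int (j + 1) * \<theta>) = 2 * cos (of_int j * \<theta>) * cos \<theta>"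
   by (simp add: left_diff_distrib distrib_right cos_diff cos_add)
  then show ?thesis by (simp add: mult_ac flip: distrib_left)
 qed
 then have "integral {0..pi} (\<lambda>\<theta>. cos \<theta> ^ Suc i * cos (of_int j * \<theta>)) =
   integral {0..pi} (\<lambda>\<theta>. (cos \<theta> ^ i * cos (of_int (j - 1) * \<theta>) + cos \<theta> ^ i * cos (of_int (j + 1) * \<theta>)) / 2)"
  by (simp only:)
 also have "\<dots> = (integral {0..pi} (\<lambda>\<theta>. cos \<theta> ^ i * cos (of_int (j - 1) * \<theta>)) + integral {0..pi} (\<lambda>\<theta>. cos \<theta> ^ i * cos (of_int (j + 1) * \<theta>))) / 2"
  unfolding integral_divide integral_add[OF cosmom_integrable cosmom_integrable] ..
 finally show ?thesis by (simp add: cosmom_def add_divide_distrib)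
qed

lemma abs_cosmom_le: "\<bar>cosmom i j\<bar> \<le> 1"
proof -
 have "norm (integral {0..pi} (\<lambda>\<theta>. cos \<theta> ^ i * cos (of_int j * \<theta>))) \<le> 1 * (pi - 0)"
 proof (rule integral_bound)
  have "\<bar>cos \<theta>\<bar> ^ i * \<bar>cos (of_int j * \<theta>)\<bar> \<le> 1" for \<theta> :: real
   by (intro mult_le_one power_le_one) auto
  then show "norm (cos \<theta> ^ i * cos (of_int j * \<theta>)) \<le> 1" for \<theta> :: real by (simp add: abs_mult power_abs)
 qed (auto intro!: continuous_intros)
 then show ?thesis by (simp add: cosmom_def)
qed

text \<open>The origin of the weight \<open>(sin \<theta>)^2\<close>: it is
  \<open>1 - (cos \<theta>)^2\<close> read in moments.\<close>

lemma cosmom_sin_sq: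
 "2 * cosmom i 0 - 2 * cosmom (i + 2) 0 = 2 / pi * integral {0..pi} (\<lambda>\<theta>. cos \<theta> ^ i * (sin \<theta>)^2)"
proof -
 have "cos \<theta> ^ i * (sin \<theta>)^2 = cos \<theta> ^ i * cos (of_int 0 * \<theta>) - cos \<theta> ^ (i + 2) * cos (of_int 0 * \<theta>)" for \<theta> :: real
  unfolding power_add sin_squared_eq right_diff_distrib by simp
 then have "integral {0..pi} (\<lambda>\<theta>. cos \<theta> ^ i * (sin \<theta>)^2) = integral {0..pi} (\<lambda>\<theta>. cos \<theta> ^ i * cos (of_int 0 * \<theta>) - cos \<theta> ^ (i + 2) * cos (of_int 0 * \<theta>))"
  by (simp only:)
 also have "\<dots> = pi * cosmom i 0 - pi * cosmom (i + 2) 0"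
  unfolding cosmom_def by (subst integral_diff[OF cosmom_integrable cosmom_integrable]) simp
 finally show ?thesis by (simp add: field_simps)
qed

lemma tendsto_int_shift:
 fixes g :: "int \<Rightarrow> 'a::topological_space"
 assumes "(\<lambda>n. g (- int n)) \<longlonglongrightarrow> l" shows "(\<lambda>n. g (- int n + j)) \<longlonglongrightarrow> l"
proof (cases "0 \<le> j")
 case True
 have "(\<lambda>n. g (- int (n + nat j) + j)) \<longlonglongrightarrow> l" using assms True by simp
 then show ?thesis by (rule LIMSEQ_offset)
next
 case False
 then have "- int n + j = - int (n + nat (- j))" for n by simp
 then show ?thesis using LIMSEQ_ignore_initial_segment[OF assms, of "nat (- j)"] by simp
qed

section \<open>Moments of the measure and their limits\<close>

context jacobi_spectral
begin

lemma jac_pow_finseq: "u \<in> finseq \<Longrightarrow> (J ^^ i) u \<in> finseq" by (induction i) (auto intro: jac_finseq)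

lemma jac_pow_lin: "(J ^^ i) (\<lambda>k. \<alpha> * u k + \<beta> * v k) = (\<lambda>k. \<alpha> * (J ^^ i) u k + \<beta> * (J ^^ i) v k)"
 by (induction i) (simp_all add: jac_lin)

lemma ip_jac_pow: "u \<in> finseq \<Longrightarrow> v \<in> finseq \<Longrightarrow> ip ((J ^^ i) u) v = ip u ((J ^^ i) v)"
proof (induction i arbitrary: v)
 case (Suc i)
 have "ip ((J ^^ Suc i) u) v = ip ((J ^^ i) u) (J v)"
  using ip_jac[of "(J ^^ i) u" v] Suc.prems by (simp add: jac_pow_finseq finseq_ell2 jac_finseq)
 then show ?case using Suc by (simp add: jac_finseq funpow_swap1)
qed simp

lemma FF_jac_pow: "u \<in> finseq \<Longrightarrow> FF ((J ^^ i) u) x = x ^ i * FF u x"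
 by (induction i) (simp_all add: FF_jac jac_pow_finseq mult.assoc)

lemma sq_jac_pow: "u \<in> finseq \<Longrightarrow> sq ((J ^^ i) u) t = t ^ (2 * i) * sq u t"
 by (simp only: sq_def FF_jac_pow norm_mult norm_power norm_of_real power_mult_distrib power_even_eq power_abs[symmetric] power2_abs abs_power2)

lemma integral_M:
 assumes u: "u \<in> finseq" and h: "h \<in> borel_measurable borel" and i: "integrable (M u) h"
 shows "integrable \<sigma> (\<lambda>t. sq u t * h t)" "(\<integral>t. sq u t * h t \<partial>\<sigma>) = (\<integral>t. h t \<partial>M u)"
proof -
 have m: "h \<in> borel_measurable \<sigma>" "sq u \<in> borel_measurable \<sigma>" using u h by measurable
 show "integrable \<sigma> (\<lambda>t. sq u t * h t)"
  using i unfolding M_eq_density[OF u] by (subst (asm) integrable_density) (use m in auto)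
 show "(\<integral>t. sq u t * h t \<partial>\<sigma>) = (\<integral>t. h t \<partial>M u)"
  unfolding M_eq_density[OF u] by (subst integral_density) (use m in auto)
qed

text \<open>Half of the powers are moved onto the vector: with \<open>v = (J ^^ j) u\<close> the
  integrand is \<open>sq v t\<close> or \<open>t * sq v t\<close>, so the total mass and the first
  moment of scalar measures suffice.\<close>

lemma moment:
 assumes u: "u \<in> finseq"
 shows "integrable \<sigma> (\<lambda>t. t ^ i * sq u t)" "(\<integral>t. t ^ i * sq u t \<partial>\<sigma>) = Re (ip ((J ^^ i) u) u)"
proof -
 define j where "j = i div 2"
 define v where "v = (J ^^ j) u"
 have v: "v \<in> finseq" using u by (simp add: v_def jac_pow_finseq)
 interpret finite_measure "M v" by (intro finite_M finseq_ell2 v)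
 have "integrable \<sigma> (\<lambda>t. t ^ i * sq u t) \<and> (\<integral>t. t ^ i * sq u t \<partial>\<sigma>) = Re (ip ((J ^^ i) u) u)"
 proof (cases "even i")
  case True
  then have i: "i = j + j" by (auto simp: j_def)
  have s: "t ^ i * sq u t = sq v t * 1" for t by (simp add: v_def sq_jac_pow[OF u] i mult_2)
  have "ip ((J ^^ i) u) u = ip v v" unfolding i funpow_add o_def v_def by (rule ip_jac_pow[OF jac_pow_finseq[OF u] u])
  then show ?thesis unfolding s using integral_M[OF v, of "\<lambda>_. 1"] measure_M_UNIV[OF finseq_ell2[OF v]]
   by (simp add: ell2_norm_sq finseq_ell2 v)
 next
  case False
  then have i: "i = Suc (j + j)" by (auto simp: j_def elim: oddE)
  have s: "t ^ i * sq u t = sq v t * t" for t by (simp add: v_def sq_jac_pow[OF u] i mult_2)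
  have "ip ((J ^^ i) u) u = ip ((J ^^ j) (J v)) u" unfolding i v_def by (simp add: funpow_add funpow_swap1)
  also have "\<dots> = ip (J v) v" unfolding v_def by (rule ip_jac_pow) (use u in \<open>auto intro: jac_finseq jac_pow_finseq\<close>)
  also have "\<dots> = of_real (\<integral>t. t \<partial>M v)" by (rule quad[OF finseq_Dom[OF v]])
  finally have ipM: "ip ((J ^^ i) u) u = of_real (\<integral>t. t \<partial>M v)" .
  have "(\<lambda>t. t) \<in> borel_measurable (borel :: real measure)" by simp
  note I = integral_M[OF v this integrable_M_id[OF finseq_Dom[OF v]]]
  show ?thesis unfolding s ipM Re_complex_of_real I(2) by (intro conjI I(1) refl)
 qed
 then show "integrable \<sigma> (\<lambda>t. t ^ i * sq u t)" "(\<integral>t. t ^ i * sq u t \<partial>\<sigma>) = Re (ip ((J ^^ i) u) u)" by auto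
qed

text \<open>Far to the left \<open>a\<close> tends to \<open>1 / 2\<close> and \<open>b\<close> to
  0, so the entries obey the recursion \<open>cosmom_Suc\<close> in the limit.\<close>

lemma jac_pow_lim: "(\<lambda>n. (J ^^ i) (e (- int n)) (- int n + j)) \<longlonglongrightarrow> of_real (cosmom i j)"
proof (induction i arbitrary: j)
 case 0
 have "(\<lambda>n. (J ^^ 0) (e (- int n)) (- int n + j)) = (\<lambda>n. of_real (cosmom 0 j))" by (auto simp: basis_vec_def cosmom_0)
 then show ?case by simp
next
 case (Suc i)
 have "(J ^^ Suc i) (e (- int n)) (- int n + j) =
   of_real (a (- int n + j)) * (J ^^ i) (e (- int n)) (- int n + (j + 1)) + of_real (b (- int n + j)) * (J ^^ i) (e (- int n)) (- int n + j)
   + of_real (a (- int n + (j - 1))) * (J ^^ i) (e (- int n)) (- int n + (j - 1))" for n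
 proof -
  have e: "- int n + j + 1 = - int n + (j + 1)" "- int n + j - 1 = - int n + (j - 1)" by simp_all
  show ?thesis unfolding funpow.simps o_def jac_def[of _ _ "(J ^^ i) (e (- int n))"] e ..
 qed
 moreover have "(\<lambda>n. of_real (a (- int n + j)) * (J ^^ i) (e (- int n)) (- int n + (j + 1)) + of_real (b (- int n + j)) * (J ^^ i) (e (- int n)) (- int n + j)
   + of_real (a (- int n + (j - 1))) * (J ^^ i) (e (- int n)) (- int n + (j - 1))) \<longlonglongrightarrow>
   of_real (1 / 2) * of_real (cosmom i (j + 1)) + of_real 0 * of_real (cosmom i j) + of_real (1 / 2) * of_real (cosmom i (j - 1))"
  by (intro tendsto_add tendsto_mult tendsto_of_real Suc tendsto_int_shift[OF a_lim] tendsto_int_shift[OF b_lim])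
 ultimately show ?case by (simp add: cosmom_Suc add_divide_distrib add.commute)
qed

text \<open>The quadratic form of \<open>quad_lim\<close> at a real point, written as a combination of densities \<open>sq u\<close> so
 that its moments are matrix entries of powers of \<open>J\<close>; see \<open>qd_eq\<close>.  For \<open>\<bar>t\<bar> > 1\<close> it may be negative,
 and \<open>tv\<close> dominates it there.\<close>

definition zv :: "nat \<Rightarrow> zseq" where
 "zv n = (\<lambda>j. 1 * J (e (- int n)) j + (-1) * e (- int (Suc n)) j)"

definition qd :: "nat \<Rightarrow> real \<Rightarrow> real" where
 "qd n t = sq (e (- int n)) t - sq (J (e (- int n))) t + sq (zv n) t"

definition tv :: "nat \<Rightarrow> real \<Rightarrow> real" where
 "tv n t = sq (e (- int n)) t + sq (J (e (- int n))) t + sq (zv n) t"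

lemma zv_finseq: "zv n \<in> finseq" unfolding zv_def by (intro finseq_lin jac_finseq basis_vec_finseq)

lemma abs_qd_le: "\<bar>qd n t\<bar> \<le> tv n t"
 using sq_nonneg[of "e (- int n)" t] sq_nonneg[of "J (e (- int n))" t] sq_nonneg[of "zv n" t] unfolding qd_def tv_def by linarith

text \<open>Completing the square in the second variable gives x^2 + y^2 - 2 t x y = x^2 - (t x)^2 +
  (t x - y)^2, and each square is the transform of a finite sequence.\<close>

lemma qd_eq:
 "of_real (qd n t) = (Phi (- int n) (of_real t))^2 + (Phi (- int (Suc n)) (of_real t))^2
   - 2 * of_real t * Phi (- int n) (of_real t) * Phi (- int (Suc n)) (of_real t)"
proof -
 obtain x y where xy: "Phi (- int n) (of_real t) = of_real x" "Phi (- int (Suc n)) (of_real t) = of_real y" using Phi_real by metis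
 have "FF (zv n) (of_real t) = of_real (t * x - y)"
  unfolding zv_def using xy(2) by (subst FF_lin) (auto simp: FF_jac xy(1) intro: jac_finseq)
 then have z: "sq (zv n) t = (t * x - y)^2" unfolding sq_def by (simp only: norm_of_real power2_abs)
 have "qd n t = x^2 - (t * x)^2 + (t * x - y)^2"
  unfolding qd_def z by (simp add: sq_def FF_jac xy norm_mult power_mult_distrib)
 then have "qd n t = x^2 + y^2 - 2 * t * x * y" by (simp add: power2_eq_square algebra_simps)
 then show ?thesis unfolding xy by simp
qed

lemma moment_limits:
 "(\<lambda>n. \<integral>t. t ^ i * sq (e (- int n)) t \<partial>\<sigma>) \<longlonglongrightarrow> cosmom i 0" (is ?A)
 "(\<lambda>n. \<integral>t. t ^ i * sq (J (e (- int n))) t \<partial>\<sigma>) \<longlonglongrightarrow> cosmom (i + 2) 0" (is ?B)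
 "(\<lambda>n. \<integral>t. t ^ i * sq (zv n) t \<partial>\<sigma>) \<longlonglongrightarrow> cosmom i 0 - cosmom (i + 2) 0" (is ?C)
proof -
 have L: "(\<lambda>n. Re ((J ^^ i) (e (- int n)) (- int n + j))) \<longlonglongrightarrow> cosmom i j" for i j
  using tendsto_Re[OF jac_pow_lim[of i j]] by simp
 have L': "(\<lambda>n. Re ((J ^^ i) (e (- int (Suc n))) (- int n + j))) \<longlonglongrightarrow> cosmom i (j + 1)" for i j
  using LIMSEQ_Suc[OF L[of i "j + 1"]] by (simp add: algebra_simps)
 have ef: "e k \<in> finseq" "J (e k) \<in> finseq" for k by (auto intro: jac_finseq)
 have ipJ: "ip u (J (e k)) = J u k" if "u \<in> finseq" for u k
  using ip_jac[OF that, of "e k"] ef by (simp add: finseq_ell2 ip_basis_right)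
 have pf: "(J ^^ i) (e k) \<in> finseq" for i k by (intro jac_pow_finseq ef)
 have Jp: "J ((J ^^ i) u) = (J ^^ (i + 1)) u" "(J ^^ i) (J u) = (J ^^ (i + 1)) u" for i u by (simp_all add: funpow_swap1)
 show ?A using L[of i 0] ef by (simp add: moment ip_basis_right)
 have "Re (ip ((J ^^ i) (J (e k))) (J (e k))) = Re ((J ^^ (i + 2)) (e k) k)" for k unfolding Jp ipJ[OF pf] by (simp add: numeral_2_eq_2)
 then show ?B using L[of "i + 2" 0] ef by (simp add: moment)
 have eq: "Re (ip ((J ^^ i) (zv n)) (zv n)) =
   Re ((J ^^ (i + 2)) (e (- int n)) (- int n + 0)) - Re ((J ^^ (i + 1)) (e (- int n)) (- int n + (-1)))
   - Re ((J ^^ (i + 1)) (e (- int (Suc n))) (- int n + 0)) + Re ((J ^^ i) (e (- int (Suc n))) (- int n + (-1)))" for n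
 proof -
  let ?k = "- int n" and ?k' = "- int (Suc n)"
  have "(J ^^ i) (zv n) = (\<lambda>j. 1 * (J ^^ (i + 1)) (e ?k) j + (-1) * (J ^^ i) (e ?k') j)" unfolding zv_def jac_pow_lin Jp ..
  then have 1: "ip ((J ^^ i) (zv n)) (zv n) = ip ((J ^^ (i + 1)) (e ?k)) (zv n) - ip ((J ^^ i) (e ?k')) (zv n)"
   by (simp only:) (subst ip_lin_left, auto intro!: finseq_ell2 pf zv_finseq jac_finseq)
  have 2: "ip u (zv n) = J u ?k - u ?k'" if "u \<in> finseq" for u
   unfolding zv_def using that ef by (subst ip_lin_right) (auto intro!: finseq_ell2 simp: ipJ ip_basis_right)
  have e: "?k + (-1) = ?k'" "?k + 0 = ?k" by simp_all
  show ?thesis unfolding 1 2[OF pf] e by simp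
 qed
 have lim: "(\<lambda>n. Re ((J ^^ (i + 2)) (e (- int n)) (- int n + 0)) - Re ((J ^^ (i + 1)) (e (- int n)) (- int n + (-1)))
   - Re ((J ^^ (i + 1)) (e (- int (Suc n))) (- int n + 0)) + Re ((J ^^ i) (e (- int (Suc n))) (- int n + (-1))))
   \<longlonglongrightarrow> cosmom (i + 2) 0 - cosmom (i + 1) (-1) - cosmom (i + 1) (0 + 1) + cosmom i (-1 + 1)"
  by (intro tendsto_intros L L')
 \<comment> \<open>The two middle terms are the neighbours of index 0; by \<open>cosmom_Suc\<close>
   they add up to \<open>2 * cosmom (i + 2) 0\<close>.\<close>
 have val: "cosmom (i + 2) 0 - cosmom (i + 1) (-1) - cosmom (i + 1) (0 + 1) + cosmom i (-1 + 1) = cosmom i 0 - cosmom (i + 2) 0"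
  using cosmom_Suc[of "i + 1" 0] by simp
 show ?C unfolding moment(2)[OF zv_finseq] eq using lim unfolding val .
qed

lemma integrable_qd: "integrable \<sigma> (\<lambda>t. t ^ i * qd n t)" "integrable \<sigma> (\<lambda>t. t ^ i * tv n t)"
 unfolding qd_def tv_def ring_distribs right_diff_distrib
 by (intro Bochner_Integration.integrable_add Bochner_Integration.integrable_diff moment zv_finseq jac_finseq basis_vec_finseq)+

lemma qd_moment_lim: "(\<lambda>n. \<integral>t. t ^ i * qd n t \<partial>\<sigma>) \<longlonglongrightarrow> 2 / pi * integral {0..pi} (\<lambda>\<theta>. cos \<theta> ^ i * (sin \<theta>)^2)"
proof -
 have eq: "(\<integral>t. t ^ i * qd n t \<partial>\<sigma>) = (\<integral>t. t ^ i * sq (e (- int n)) t \<partial>\<sigma>) - (\<integral>t. t ^ i * sq (J (e (- int n))) t \<partial>\<sigma>) + (\<integral>t. t ^ i * sq (zv n) t \<partial>\<sigma>)" for n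
  unfolding qd_def ring_distribs right_diff_distrib
  by (simp add: Bochner_Integration.integral_add Bochner_Integration.integral_diff moment(1) zv_finseq jac_finseq)
 have "2 * x - 2 * y = x - y + (x - y)" for x y :: real by simp
 then show ?thesis unfolding eq cosmom_sin_sq[symmetric]
  using tendsto_add[OF tendsto_diff[OF moment_limits(1)[of i] moment_limits(2)[of i]] moment_limits(3)[of i]] by (simp only:)
qed

lemma tv_moment_lim: "(\<lambda>n. \<integral>t. t ^ i * tv n t \<partial>\<sigma>) \<longlonglongrightarrow> 2 * cosmom i 0"
proof -
 have "(\<integral>t. t ^ i * tv n t \<partial>\<sigma>) = (\<integral>t. t ^ i * sq (e (- int n)) t \<partial>\<sigma>) + (\<integral>t. t ^ i * sq (J (e (- int n))) t \<partial>\<sigma>) + (\<integral>t. t ^ i * sq (zv n) t \<partial>\<sigma>)" for n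
  unfolding tv_def ring_distribs by (simp add: Bochner_Integration.integral_add moment(1) zv_finseq jac_finseq)
 then show ?thesis using tendsto_add[OF tendsto_add[OF moment_limits(1)[of i] moment_limits(2)[of i]] moment_limits(3)[of i]] by simp
qed

lemma integrable_bounded_support:
 fixes h :: "real \<Rightarrow> real"
 assumes "h \<in> borel_measurable borel" "\<And>t. \<bar>h t\<bar> \<le> K" "\<And>t. x < \<bar>t\<bar> \<Longrightarrow> h t = 0"
 shows "integrable \<sigma> h"
proof (rule Bochner_Integration.integrable_bound[where f = "\<lambda>t. K * indicator {- x..x} t"])
 have "emeasure \<sigma> {- x..x} < \<infinity>" by (rule emeasure_\<sigma>_bounded[of _ "- x" x]) auto
 then show "integrable \<sigma> (\<lambda>t. K * indicator {- x..x} t)" by (intro integrable_mult_right integrable_real_indicator) auto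
 show "AE t in \<sigma>. norm (h t) \<le> norm (K * indicator {- x..x} t)"
 proof (rule AE_I2)
  fix t show "norm (h t) \<le> norm (K * indicator {- x..x} t)"
   using assms(2)[of t] assms(3)[of t] by (cases "\<bar>t\<bar> \<le> x") (auto simp: indicator_def abs_le_iff)
 qed
qed (use assms in \<open>simp add: measurable_cong_sets[OF sets_\<sigma> refl]\<close>)

text \<open>The coefficients of \<open>L\<close> are unbounded, so polynomial approximation on a
  compact interval does not suffice. Outside it the polynomial is dominated by \<epsilon> times a
  high even power, whose integral against \<open>tv n\<close> has a bounded limit.\<close>

lemma qd_integral_lim:
 assumes \<phi>: "continuous_on UNIV \<phi>" and supp: "\<And>t. 1 < \<bar>t\<bar> \<Longrightarrow> \<phi> t = 0"
 shows "(\<lambda>n. \<integral>t. \<phi> t * qd n t \<partial>\<sigma>) \<longlonglongrightarrow> 2 / pi * integral {0..pi} (\<lambda>\<theta>. \<phi> (cos \<theta>) * (sin \<theta>)^2)"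
proof (rule LIMSEQ_I)
 fix \<epsilon>0 :: real assume "0 < \<epsilon>0"
 \<comment> \<open>The shares are \<open>5 * \<epsilon>\<close> for replacing \<open>\<phi>\<close>
   by \<open>p\<close> under \<open>\<sigma>\<close>, \<open>\<epsilon>\<close> for the moments of
   \<open>p\<close>, and \<open>4 * \<epsilon>\<close> for returning to \<open>\<phi>\<close> in the
   limit.\<close>
 define \<epsilon> where "\<epsilon> = \<epsilon>0 / 10"
 have \<epsilon>: "0 < \<epsilon>" using \<open>0 < \<epsilon>0\<close> by (simp add: \<epsilon>_def)
 define \<Lambda> where "\<Lambda> h = 2 / pi * integral {0..pi} (\<lambda>\<theta>. h (cos \<theta>) * (sin \<theta>)^2)" for h :: "real \<Rightarrow> real"
 have "compact {-2..2::real}" "continuous_on {-2..2} \<phi>" using \<phi> by (auto intro: continuous_on_subset)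
 from Stone_Weierstrass_real_polynomial_function[OF this \<epsilon>] obtain p
  where "real_polynomial_function p" and p: "\<And>t. t \<in> {-2..2} \<Longrightarrow> \<bar>\<phi> t - p t\<bar> < \<epsilon>" by blast
 then obtain co m where pe: "p = (\<lambda>t. \<Sum>i\<le>m. co i * t ^ i)" unfolding real_polynomial_function_iff_sum by blast
 have cp: "continuous_on X p" for X unfolding pe by (intro continuous_intros)
 define K where "K = (\<Sum>i\<le>m. \<bar>co i\<bar>)"
 have K: "0 \<le> K" by (simp add: K_def sum_nonneg)
 \<comment> \<open>Approximating on \<open>{-2..2}\<close> leaves \<open>\<bar>t\<bar> > 2\<close>
   outside, where \<open>t^2 > 4\<close>; so \<open>j\<close> further squares absorb the constant
   \<open>K / \<epsilon>\<close>.\<close>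
 obtain j where j: "K / \<epsilon> < 4 ^ j" using real_arch_pow[of 4 "K / \<epsilon>"] by auto
 define l where "l = m + j"
 have near: "\<bar>\<phi> t - p t\<bar> \<le> \<epsilon> * (1 + t ^ (2 * l))" for t
 proof (cases "\<bar>t\<bar> \<le> 2")
  case True
  then have "t \<in> {-2..2}" by auto
  then have "\<bar>\<phi> t - p t\<bar> \<le> \<epsilon> * 1" using p[of t] by linarith
  also have "\<dots> \<le> \<epsilon> * (1 + t ^ (2 * l))" using \<epsilon> by (intro mult_left_mono) (auto simp: power_mult)
  finally show ?thesis .
 next
  case False
  then have t: "2 < \<bar>t\<bar>" by simp
  have "\<bar>\<phi> t - p t\<bar> = \<bar>p t\<bar>" using supp[of t] t by simp
  also have "\<dots> \<le> (\<Sum>i\<le>m. \<bar>co i\<bar> * \<bar>t\<bar> ^ (2 * m))"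
   unfolding pe using t by (intro order_trans[OF sum_abs] sum_mono) (auto simp: abs_mult power_abs intro!: mult_left_mono power_increasing)
  also have "\<dots> = K * \<bar>t\<bar> ^ (2 * m)" by (simp add: K_def sum_distrib_right)
  also have "\<dots> \<le> (\<epsilon> * 4 ^ j) * \<bar>t\<bar> ^ (2 * m)" using j \<epsilon> by (intro mult_right_mono) (auto simp: field_simps)
  also have "\<dots> \<le> (\<epsilon> * (\<bar>t\<bar>\<^sup>2) ^ j) * \<bar>t\<bar> ^ (2 * m)"
   using t \<epsilon> power_mono[of 2 "\<bar>t\<bar>" 2] by (intro mult_right_mono mult_left_mono power_mono) auto
  also have "\<dots> = \<epsilon> * \<bar>t\<bar> ^ (2 * l)" by (simp add: l_def power_add power_mult distrib_left)
  also have "\<bar>t\<bar> ^ (2 * l) = t ^ (2 * l)" by (simp add: power_mult)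
  also have "\<epsilon> * t ^ (2 * l) \<le> \<epsilon> * (1 + t ^ (2 * l))" using \<epsilon> by simp
  finally show ?thesis .
 qed
 have ip: "integrable \<sigma> (\<lambda>t. p t * qd n t)" for n
  unfolding pe sum_distrib_right mult.assoc by (intro Bochner_Integration.integrable_sum integrable_mult_right integrable_qd)
 have iq: "integrable \<sigma> (\<lambda>t. \<epsilon> * (1 + t ^ (2 * l)) * tv n t)" for n
 proof -
  have "(\<lambda>t. \<epsilon> * (1 + t ^ (2 * l)) * tv n t) = (\<lambda>t. \<epsilon> * (t ^ 0 * tv n t) + \<epsilon> * (t ^ (2 * l) * tv n t))"
   by (simp add: algebra_simps)
  then show ?thesis using integrable_qd(2)[of 0 n] integrable_qd(2)[of "2 * l" n] by simp
 qed
 have cqd: "continuous_on UNIV (qd n)" for n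
  unfolding qd_def by (intro continuous_intros continuous_sq basis_vec_finseq jac_finseq zv_finseq)
 have dom: "norm ((\<phi> t - p t) * qd n t) \<le> \<epsilon> * (1 + t ^ (2 * l)) * tv n t" for n t
  using near[of t] abs_qd_le[of n t] unfolding real_norm_def abs_mult by (intro mult_mono) (auto intro: order_trans[OF abs_ge_zero])
 have idf: "integrable \<sigma> (\<lambda>t. (\<phi> t - p t) * qd n t)" for n
 proof (rule Bochner_Integration.integrable_bound[OF iq[of n]])
  have "(\<lambda>t. (\<phi> t - p t) * qd n t) \<in> borel_measurable borel"
   by (intro borel_measurable_continuous_onI continuous_intros \<phi> cp cqd)
  then show "(\<lambda>t. (\<phi> t - p t) * qd n t) \<in> borel_measurable \<sigma>" by simp
  show "AE t in \<sigma>. norm ((\<phi> t - p t) * qd n t) \<le> norm (\<epsilon> * (1 + t ^ (2 * l)) * tv n t)"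
   using order_trans[OF dom abs_ge_self] by (intro AE_I2) simp
 qed
 have e1: "(\<integral>t. \<phi> t * qd n t \<partial>\<sigma>) = (\<integral>t. p t * qd n t \<partial>\<sigma>) + (\<integral>t. (\<phi> t - p t) * qd n t \<partial>\<sigma>)" for n
  by (subst Bochner_Integration.integral_add[OF ip idf, symmetric]) (simp add: algebra_simps)
 have e2: "\<bar>\<integral>t. (\<phi> t - p t) * qd n t \<partial>\<sigma>\<bar> \<le> \<epsilon> * ((\<integral>t. t ^ 0 * tv n t \<partial>\<sigma>) + (\<integral>t. t ^ (2 * l) * tv n t \<partial>\<sigma>))" for n
 proof -
  have "norm (\<integral>t. (\<phi> t - p t) * qd n t \<partial>\<sigma>) \<le> (\<integral>t. \<epsilon> * (1 + t ^ (2 * l)) * tv n t \<partial>\<sigma>)"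
   by (rule Bochner_Integration.integral_norm_bound_integral[OF idf iq dom])
  also have "\<dots> = (\<integral>t. \<epsilon> * (t ^ 0 * tv n t + t ^ (2 * l) * tv n t) \<partial>\<sigma>)" by (simp add: algebra_simps)
  also have "\<dots> = \<epsilon> * ((\<integral>t. t ^ 0 * tv n t \<partial>\<sigma>) + (\<integral>t. t ^ (2 * l) * tv n t \<partial>\<sigma>))"
   by (subst integral_mult_right_zero, subst Bochner_Integration.integral_add) (rule integrable_qd refl)+
  finally show ?thesis by simp
 qed
 have pl: "(\<lambda>n. \<integral>t. p t * qd n t \<partial>\<sigma>) \<longlonglongrightarrow> \<Lambda> p"
 proof -
  have "(\<integral>t. p t * qd n t \<partial>\<sigma>) = (\<Sum>i\<le>m. co i * (\<integral>t. t ^ i * qd n t \<partial>\<sigma>))" for n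
   unfolding pe sum_distrib_right mult.assoc by (subst Bochner_Integration.integral_sum) (auto intro: integrable_qd)
  moreover have "\<Lambda> p = (\<Sum>i\<le>m. co i * (2 / pi * integral {0..pi} (\<lambda>\<theta>. cos \<theta> ^ i * (sin \<theta>)^2)))"
  proof -
   have "integral {0..pi} (\<lambda>\<theta>. \<Sum>i\<le>m. co i * (cos \<theta> ^ i * (sin \<theta>)^2)) = (\<Sum>i\<le>m. integral {0..pi} (\<lambda>\<theta>. co i * (cos \<theta> ^ i * (sin \<theta>)^2)))"
    by (intro integral_sum integrable_continuous_interval continuous_intros) auto
   then show ?thesis unfolding \<Lambda>_def pe sum_distrib_right mult.assoc by (simp add: sum_distrib_left mult_ac)
  qed
  ultimately show ?thesis by (simp only:) (intro tendsto_intros qd_moment_lim)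
 qed
 have e3: "\<bar>\<Lambda> \<phi> - \<Lambda> p\<bar> \<le> 4 * \<epsilon>"
 proof -
  have i: "(\<lambda>\<theta>. \<phi> (cos \<theta>) * (sin \<theta>)^2) integrable_on {0..pi}" "(\<lambda>\<theta>. p (cos \<theta>) * (sin \<theta>)^2) integrable_on {0..pi}"
   by (intro integrable_continuous_interval continuous_intros continuous_on_compose2[OF \<phi>] continuous_on_compose2[OF cp[of UNIV]], auto)+
  have "norm (integral {0..pi} (\<lambda>\<theta>. \<phi> (cos \<theta>) * (sin \<theta>)^2 - p (cos \<theta>) * (sin \<theta>)^2)) \<le> 2 * \<epsilon> * (pi - 0)"
  proof (rule integral_bound)
   show "continuous_on {0..pi} (\<lambda>\<theta>. \<phi> (cos \<theta>) * (sin \<theta>)^2 - p (cos \<theta>) * (sin \<theta>)^2)"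
    by (intro continuous_intros continuous_on_compose2[OF \<phi>] continuous_on_compose2[OF cp[of UNIV]]) auto
   fix \<theta> :: real
   have "cos \<theta> \<in> {-2..2}" using cos_ge_minus_one[of \<theta>] cos_le_one[of \<theta>] by (auto simp del: cos_ge_minus_one cos_le_one)
   then have "\<bar>\<phi> (cos \<theta>) - p (cos \<theta>)\<bar> \<le> 2 * \<epsilon>" using p[of "cos \<theta>"] \<epsilon> by linarith
   moreover have "(sin \<theta>)^2 \<le> 1" by (simp add: abs_square_le_1)
   ultimately have "\<bar>\<phi> (cos \<theta>) - p (cos \<theta>)\<bar> * (sin \<theta>)^2 \<le> (2 * \<epsilon>) * 1" using \<epsilon> by (intro mult_mono) auto
   then show "norm (\<phi> (cos \<theta>) * (sin \<theta>)^2 - p (cos \<theta>) * (sin \<theta>)^2) \<le> 2 * \<epsilon>"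
    by (simp add: abs_mult flip: left_diff_distrib)
  qed simp
  then have "2 / pi * \<bar>integral {0..pi} (\<lambda>\<theta>. \<phi> (cos \<theta>) * (sin \<theta>)^2) - integral {0..pi} (\<lambda>\<theta>. p (cos \<theta>) * (sin \<theta>)^2)\<bar> \<le> 2 / pi * (2 * \<epsilon> * pi)"
   unfolding integral_diff[OF i] by (intro mult_left_mono) auto
  then show ?thesis unfolding \<Lambda>_def right_diff_distrib[symmetric] abs_mult by simp
 qed
 have c2: "2 * cosmom 0 0 + 2 * cosmom (2 * l) 0 < 5" using abs_cosmom_le[of 0 0] abs_cosmom_le[of "2 * l" 0] by linarith
 have "(\<lambda>n. (\<integral>t. t ^ 0 * tv n t \<partial>\<sigma>) + (\<integral>t. t ^ (2 * l) * tv n t \<partial>\<sigma>)) \<longlonglongrightarrow> 2 * cosmom 0 0 + 2 * cosmom (2 * l) 0"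
  by (intro tendsto_add tv_moment_lim)
 then have "\<forall>\<^sub>F n in sequentially. (\<integral>t. t ^ 0 * tv n t \<partial>\<sigma>) + (\<integral>t. t ^ (2 * l) * tv n t \<partial>\<sigma>) < 5"
  using c2 by (rule order_tendstoD)
 moreover have "\<forall>\<^sub>F n in sequentially. dist (\<integral>t. p t * qd n t \<partial>\<sigma>) (\<Lambda> p) < \<epsilon>" using pl \<epsilon> by (rule tendstoD)
 ultimately have "\<forall>\<^sub>F n in sequentially. norm ((\<integral>t. \<phi> t * qd n t \<partial>\<sigma>) - \<Lambda> \<phi>) < \<epsilon>0"
 proof eventually_elim
  case (elim n)
  have "\<bar>\<integral>t. (\<phi> t - p t) * qd n t \<partial>\<sigma>\<bar> \<le> \<epsilon> * 5"
   using e2[of n] mult_left_mono[of _ 5 \<epsilon>] elim(1) \<epsilon> by (meson less_imp_le order_trans)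
  then show ?case using elim(2) e3 \<epsilon> unfolding e1 dist_real_def real_norm_def \<epsilon>_def by linarith
 qed
 then show "\<exists>n0. \<forall>n\<ge>n0. norm ((\<integral>t. \<phi> t * qd n t \<partial>\<sigma>) - 2 / pi * integral {0..pi} (\<lambda>\<theta>. \<phi> (cos \<theta>) * (sin \<theta>)^2)) < \<epsilon>0"
  by (simp add: eventually_sequentially \<Lambda>_def)
qed

end

section \<open>Behaviour on the unit circle and the continuous density\<close>

context jacobi_fun
begin

lemma cnj_Q: "cnj (Q x) = Q (cnj x)"
proof -
 have "(\<lambda>n. cnj (qpoch x (of_real q) n)) \<longlonglongrightarrow> cnj (Q x)" by (intro tendsto_cnj qpoch_LIMSEQ)
 moreover have "cnj (qpoch x (of_real q) n) = qpoch (cnj x) (of_real q) n" for n by (simp add: qpoch_def)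
 ultimately have "(\<lambda>n. qpoch (cnj x) (of_real q) n) \<longlonglongrightarrow> cnj (Q x)" by (simp only:)
 then show ?thesis using qpoch_LIMSEQ by (rule LIMSEQ_unique)
qed

lemma cnj_cc: "cnj (cc y) = cc (cnj y)" by (simp add: c_fun_def qpochs_inf_def cnj_Q power_int_minus)

definition circ :: "complex set" where "circ = {y. norm y = 1 \<and> y^2 \<noteq> 1}"

lemma circ:
 assumes "y \<in> circ"
 shows "y \<in> S" "inverse y \<in> S" "y^2 \<noteq> 1" "norm y = 1" "inverse y = cnj y" "inverse y - y \<noteq> 0" "mu y = of_real (Re y)"
  "inverse y \<in> circ" "y \<noteq> 0"
proof -
 have y: "norm y = 1" "y^2 \<noteq> 1" using assms by (auto simp: circ_def)
 then show y0: "y \<noteq> 0" by auto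
 have "y * cnj y = 1" using y(1) by (simp add: complex_norm_square[symmetric])
 then show i: "inverse y = cnj y" by (rule inverse_unique)
 show "y \<in> S" "inverse y \<in> S" using y S_I by (auto simp: norm_inverse)
 show "y^2 \<noteq> 1" "norm y = 1" by fact+
 show "inverse y - y \<noteq> 0" using y y0 by (simp add: field_simps power2_eq_square)
 show "mu y = of_real (Re y)" by (simp add: mu_def i complex_add_cnj)
 show "inverse y \<in> circ" using y by (simp add: circ_def norm_inverse power_inverse)
qed

lemma continuous_cc: "continuous_on circ cc"
proof (rule continuous_on_subset[OF holomorphic_on_imp_continuous_on[OF holomorphic_cc]])
 show "circ \<subseteq> S - {1, -1}" using circ(1) by (auto simp: circ_def)
qed

text \<open>On a closed arc away from 1 and -1 the connection coefficients are bounded and the Jost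
  solutions have modulus of order 1. This is the domination needed for the limit of
  \<open>qd\<close>.\<close>

lemma Phi_bound_arc:
 assumes s: "s < 1"
 shows "\<exists>C\<ge>0. \<forall>y. norm y = 1 \<longrightarrow> \<bar>Re y\<bar> \<le> s \<longrightarrow> (\<forall>k\<le>K0 - 1. norm (Phi k (mu y)) \<le> C)"
proof -
 define Ys where "Ys = sphere (0::complex) 1 \<inter> {y. \<bar>Re y\<bar> \<le> s}"
 have "closed {y. \<bar>Re y\<bar> \<le> s}" by (intro closed_Collect_le continuous_intros)
 then have Yc: "compact Ys" unfolding Ys_def by (intro compact_Int_closed compact_sphere)
 have Yci: "y \<in> circ" if "y \<in> Ys" for y using that s by (auto simp: Ys_def circ_def power2_eq_1_iff)
 have Yi: "inverse y \<in> Ys" if "y \<in> Ys" for y using that circ(5)[OF Yci[OF that]] by (simp add: Ys_def)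
 have YS: "Ys \<subseteq> S" using Yci circ(1) by blast
 obtain C where C: "C > 0" "\<And>y k. y \<in> Ys \<Longrightarrow> k \<le> K0 \<Longrightarrow> norm (Psi k y) \<le> C * norm y powi k"
  using Psi_bound[OF Yc YS] by blast
 have "bounded (cc ` Ys)" using Yci by (intro compact_imp_bounded compact_continuous_image Yc continuous_on_subset[OF continuous_cc]) auto
 then obtain C' where C': "\<And>y. y \<in> Ys \<Longrightarrow> norm (cc y) \<le> C'" unfolding bounded_iff by blast
 have "norm (Phi k (mu y)) \<le> 2 * \<bar>C'\<bar> * C" if y: "y \<in> Ys" and k: "k \<le> K0 - 1" for y k
 proof -
  note cy = circ[OF Yci[OF y]]
  have k1: "k + 1 \<le> K0" using k by simp
  have "norm (Phi k (mu y)) \<le> norm (cc (inverse y)) * norm (Psi k y) + norm (cc y) * norm (Psi k (inverse y))"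
   unfolding connection[OF cy(1,2,3) k1] by (rule order_trans[OF norm_triangle_ineq]) (simp add: norm_mult)
  also have "\<dots> \<le> \<bar>C'\<bar> * C + \<bar>C'\<bar> * C"
   using C(2)[OF y, of k] C(2)[OF Yi[OF y], of k] k cy(4) C'[OF y] C'[OF Yi[OF y]] C(1)
   by (intro add_mono mult_mono) (auto simp: norm_inverse)
  finally show ?thesis by (simp add: mult_ac)
 qed
 then show ?thesis using C(1) by (intro exI[of _ "2 * \<bar>C'\<bar> * C"]) (auto simp: Ys_def)
qed

definition yc :: "real \<Rightarrow> complex" where "yc t = Complex t (sqrt (1 - t^2))"

lemma yc:
 assumes "\<bar>t\<bar> < 1" shows "yc t \<in> circ" "mu (yc t) = of_real t" "Re (yc t) = t"
proof -
 have t: "t^2 < 1" using assms by (simp add: abs_square_less_1)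
 show Re: "Re (yc t) = t" by (simp add: yc_def)
 have "norm (yc t) = 1" using t by (simp add: yc_def cmod_def)
 moreover have "yc t \<noteq> 1" "yc t \<noteq> - 1" using assms Re by (metis abs_1 abs_minus_cancel less_irrefl one_complex.sel(1) uminus_complex.sel(1))+
 ultimately show c: "yc t \<in> circ" by (simp add: circ_def power2_eq_1_iff)
 show "mu (yc t) = of_real t" using circ(7)[OF c] Re by simp
qed

lemma yc_cos: "0 \<le> \<theta> \<Longrightarrow> \<theta> \<le> pi \<Longrightarrow> yc (cos \<theta>) = cis \<theta>"
 using sin_ge_zero[of \<theta>] by (simp add: yc_def complex_eq_iff flip: sin_squared_eq)

text \<open>The limit from \<open>quad_lim\<close> at a point of the upper half circle, where
  \<open>y - inverse y = 2 * \<i> * sqrt (1 - t^2)\<close> and \<open>cc (inverse y)\<close> is the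
  conjugate of \<open>cc y\<close>.\<close>

definition Wt :: "real \<Rightarrow> real" where "Wt t = 4 * (1 - t^2) * (cmod (cc (yc t)))^2"

lemma continuous_Wt: "continuous_on {-1<..<1} Wt"
proof -
 have "continuous_on {-1<..<1} yc" unfolding yc_def Complex_eq by (intro continuous_intros)
 then have "continuous_on {-1<..<1} (\<lambda>t. cc (yc t))" by (rule continuous_on_compose2[OF continuous_cc]) (auto intro!: yc)
 then show ?thesis unfolding Wt_def by (intro continuous_intros)
qed

end

context jacobi_spectral
begin

text \<open>On the circle \<open>inverse y\<close> is the conjugate of \<open>y\<close>, so a zero
  of \<open>cc\<close> would make both connection coefficients vanish, and with them
  \<open>Phi\<close> far to the left, hence everywhere.\<close>

lemma cc_circ_nonzero:
 assumes "y \<in> circ" shows "cc y \<noteq> 0"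
proof
 note y = circ[OF assms]
 assume "cc y = 0"
 moreover from this have "cc (inverse y) = 0" unfolding y(5) by (simp flip: cnj_cc)
 ultimately have z: "Phi k (mu y) = 0" if "k + 1 \<le> K0" for k using connection[OF y(1,2,3) that] by simp
 have "J (\<lambda>k. Phi k (mu y)) = (\<lambda>k. mu y * Phi k (mu y))" using J_Phi by auto
 then have "Phi k (mu y) = 0" for k by (rule solution_zero[where m = "K0 - 2"]) (use z in auto)
 then show False using Phi_0_1_nonzero by blast
qed

lemma Wt_pos: "\<bar>t\<bar> < 1 \<Longrightarrow> 0 < Wt t"
 unfolding Wt_def using cc_circ_nonzero[OF yc(1)] by (auto intro!: mult_pos_pos simp: abs_square_less_1)

lemma qd_lim:
 assumes "\<bar>t\<bar> < 1" shows "(\<lambda>n. qd n t) \<longlonglongrightarrow> Wt t"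
proof -
 note y = circ[OF yc(1)[OF assms]] and mt = yc(2)[OF assms]
 have "(\<lambda>n. complex_of_real (qd n t)) \<longlonglongrightarrow> - cc (yc t) * cc (inverse (yc t)) * (yc t - inverse (yc t))^2"
  using quad_lim[OF y(4,3)] unfolding qd_eq mt .
 also have "- cc (yc t) * cc (inverse (yc t)) * (yc t - inverse (yc t))^2 = of_real (Wt t)"
 proof -
  have 1: "cc (yc t) * cc (inverse (yc t)) = of_real ((cmod (cc (yc t)))^2)" unfolding y(5) cnj_cc[symmetric] complex_norm_square ..
  have 2: "yc t - inverse (yc t) = 2 * \<i> * of_real (sqrt (1 - t^2))" unfolding y(5) complex_diff_cnj by (simp add: yc_def)
  have 3: "(2 * \<i> * of_real (sqrt (1 - t^2)))^2 = complex_of_real (- 4 * (1 - t^2))"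
  proof -
   have "(complex_of_real (sqrt (1 - t^2)))^2 = of_real (1 - t^2)"
    using assms unfolding of_real_power[symmetric] by (simp add: abs_square_le_1)
   then show ?thesis by (simp add: power_mult_distrib)
  qed
  show ?thesis unfolding mult_minus_left 1 2 3 Wt_def by (simp add: algebra_simps)
 qed
 finally show ?thesis by (simp only: tendsto_of_real_iff)
qed

lemma qd_bound:
 assumes "s < 1" shows "\<exists>C. \<forall>n t. nat (1 - K0) \<le> n \<longrightarrow> \<bar>t\<bar> \<le> s \<longrightarrow> \<bar>qd n t\<bar> \<le> C"
proof -
 obtain C where C: "C \<ge> 0" "\<And>y k. norm y = 1 \<Longrightarrow> \<bar>Re y\<bar> \<le> s \<Longrightarrow> k \<le> K0 - 1 \<Longrightarrow> norm (Phi k (mu y)) \<le> C"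
  using Phi_bound_arc[OF assms] by blast
 have "\<bar>qd n t\<bar> \<le> 4 * C^2" if n: "nat (1 - K0) \<le> n" and t: "\<bar>t\<bar> \<le> s" for n t
 proof -
  have t1: "\<bar>t\<bar> < 1" using t assms by linarith
  define x where "x = Phi (- int n) (of_real t)"
  define y where "y = Phi (- int (Suc n)) (of_real t)"
  have b: "norm x \<le> C" "norm y \<le> C" using C(2)[of "yc t"] circ(4)[OF yc(1)[OF t1]] yc(2,3)[OF t1] n t by (auto simp: x_def y_def)
  have "\<bar>qd n t\<bar> = norm (complex_of_real (qd n t))" by simp
  also have "\<dots> = norm (x^2 + y^2 - 2 * of_real t * x * y)" unfolding qd_eq x_def y_def ..
  also have "\<dots> \<le> (norm x)^2 + (norm y)^2 + 2 * \<bar>t\<bar> * norm x * norm y"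
   by (intro order_trans[OF norm_triangle_ineq4] add_mono order_trans[OF norm_triangle_ineq]) (auto simp: norm_power norm_mult)
  also have "\<dots> \<le> C^2 + C^2 + 2 * 1 * C * C" using b t1 C(1) by (intro add_mono power_mono mult_mono) auto
  finally show ?thesis by (simp add: power2_eq_square)
 qed
 then show ?thesis by blast
qed

text \<open>The quotient of \<open>2 / pi * (sin \<theta>)^2\<close> by
  \<open>Wt (cos \<theta>)\<close>, set to 0 outside the open interval.\<close>

definition \<kappa> :: "real \<Rightarrow> real" where
 "\<kappa> \<theta> = indicator {0<..<pi} \<theta> / (2 * pi * (cmod (cc (cis \<theta>)))^2)"

lemma cis_circ: "\<theta> \<in> {0<..<pi} \<Longrightarrow> cis \<theta> \<in> circ"
proof -
 assume "\<theta> \<in> {0<..<pi}"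
 then have "0 < sin \<theta>" by (simp add: sin_gt_zero)
 then have "cis \<theta> \<noteq> 1" "cis \<theta> \<noteq> -1" by (auto simp: complex_eq_iff)
 then show ?thesis by (simp add: circ_def power2_eq_1_iff)
qed

lemma \<kappa>_nonneg [simp]: "0 \<le> \<kappa> \<theta>" by (simp add: \<kappa>_def)

lemma measurable_\<kappa> [measurable]: "\<kappa> \<in> borel_measurable borel"
proof -
 have "continuous_on {0<..<pi} (\<lambda>\<theta>. cc (cis \<theta>))"
  by (rule continuous_on_compose2[OF continuous_cc]) (auto intro!: continuous_intros cis_circ)
 then have "continuous_on {0<..<pi} (\<lambda>\<theta>. 1 / (2 * pi * (cmod (cc (cis \<theta>)))^2))"
  using cc_circ_nonzero cis_circ by (intro continuous_intros) auto
 from borel_measurable_continuous_on_indicator[OF _ this]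
 show ?thesis by (simp add: \<kappa>_def[abs_def])
qed

text \<open>Testing the weak limit of \<open>qd n\<close> against \<open>\<psi> / Wt\<close> gives
  the stated density on one side; on the other side dominated convergence lets \<open>qd n\<close>
  tend to \<open>Wt\<close>, which cancels.\<close>

lemma integral_\<sigma>_inner:
 assumes \<psi>: "continuous_on UNIV \<psi>" and s: "0 < s" "s < 1" and supp: "\<And>t. s < \<bar>t\<bar> \<Longrightarrow> \<psi> t = 0" and nn: "\<And>t. 0 \<le> \<psi> t"
 shows "(\<integral>\<^sup>+ t. ennreal (\<psi> t) \<partial>\<sigma>) = (\<integral>\<^sup>+ \<theta>. ennreal (\<psi> (cos \<theta>) * \<kappa> \<theta>) \<partial>lborel)"
proof -
 define \<phi> where "\<phi> t = \<psi> t / Wt t" for t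
 have \<phi>0: "\<phi> t = 0" if "s < \<bar>t\<bar>" for t using supp[OF that] by (simp add: \<phi>_def)
 have c\<phi>: "continuous_on UNIV \<phi>"
 proof -
  have "Wt t \<noteq> 0" if "t \<in> {-1<..<1}" for t using Wt_pos[of t] that by (auto simp: abs_less_iff)
  then have "continuous_on {-1<..<1} \<phi>"
   unfolding \<phi>_def by (intro continuous_intros continuous_Wt continuous_on_subset[OF \<psi>]) auto
  moreover have "continuous_on {t. s < \<bar>t\<bar>} \<phi>"
   by (rule continuous_on_eq[OF continuous_on_const[of _ 0]]) (simp add: \<phi>0)
  moreover have "open {t::real. s < \<bar>t\<bar>}" by (intro open_Collect_less continuous_intros)
  ultimately have "continuous_on ({-1<..<1} \<union> {t. s < \<bar>t\<bar>}) \<phi>" by (intro continuous_on_open_Un) auto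
  also have "{-1<..<1} \<union> {t. s < \<bar>t\<bar>} = UNIV" using s by auto
  finally show ?thesis .
 qed
 have bd: "\<exists>K. \<forall>t. \<bar>h t\<bar> \<le> K" if h: "continuous_on UNIV h" "\<And>t. s < \<bar>t\<bar> \<Longrightarrow> h t = 0" for h :: "real \<Rightarrow> real"
 proof -
  have "bounded (h ` {-s..s})" by (intro compact_imp_bounded compact_continuous_image continuous_on_subset[OF h(1)]) auto
  then obtain K where "\<And>t. t \<in> {-s..s} \<Longrightarrow> \<bar>h t\<bar> \<le> K" unfolding bounded_iff real_norm_def by blast
  then have "\<bar>h t\<bar> \<le> \<bar>K\<bar>" for t using h(2)[of t] by (cases "t \<in> {-s..s}") (force simp: abs_le_iff)+
  then show ?thesis by blast
 qed
 obtain K\<phi> where K\<phi>: "\<And>t. \<bar>\<phi> t\<bar> \<le> K\<phi>" using bd[OF c\<phi> \<phi>0] by blast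
 obtain K\<psi> where K\<psi>: "\<And>t. \<bar>\<psi> t\<bar> \<le> K\<psi>" using bd[OF \<psi> supp] by blast
 have m: "h \<in> borel_measurable \<sigma>" if "continuous_on UNIV h" for h :: "real \<Rightarrow> real"
  using borel_measurable_continuous_onI[OF that] by simp
 have i\<psi>: "integrable \<sigma> \<psi>" by (rule integrable_bounded_support[OF borel_measurable_continuous_onI[OF \<psi>] K\<psi> supp])
 obtain C where C: "\<And>n t. nat (1 - K0) \<le> n \<Longrightarrow> \<bar>t\<bar> \<le> s \<Longrightarrow> \<bar>qd n t\<bar> \<le> C" using qd_bound[OF s(2)] by blast
 define n1 where "n1 = nat (1 - K0)"
 have "(\<lambda>n. \<integral>t. \<phi> t * qd (n + n1) t \<partial>\<sigma>) \<longlonglongrightarrow> (\<integral>t. \<psi> t \<partial>\<sigma>)"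
 proof (rule integral_dominated_convergence[where w = "\<lambda>t. K\<phi> * \<bar>C\<bar> * indicator {-s..s} t"])
  show "\<psi> \<in> borel_measurable \<sigma>" by (rule m[OF \<psi>])
  show "(\<lambda>t. \<phi> t * qd (n + n1) t) \<in> borel_measurable \<sigma>" for n
   by (intro m continuous_intros c\<phi>) (unfold qd_def, intro continuous_intros continuous_sq basis_vec_finseq jac_finseq zv_finseq)
  show "integrable \<sigma> (\<lambda>t. K\<phi> * \<bar>C\<bar> * indicator {-s..s} t)"
   by (rule integrable_bounded_support[where x = s and K = "\<bar>K\<phi> * \<bar>C\<bar>\<bar>"]) (auto simp: indicator_def abs_le_iff)
  show "AE t in \<sigma>. (\<lambda>n. \<phi> t * qd (n + n1) t) \<longlonglongrightarrow> \<psi> t"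
  proof (rule AE_I2)
   fix t show "(\<lambda>n. \<phi> t * qd (n + n1) t) \<longlonglongrightarrow> \<psi> t"
   proof (cases "\<bar>t\<bar> < 1")
    case True
    have "(\<lambda>n. \<phi> t * qd (n + n1) t) \<longlonglongrightarrow> \<phi> t * Wt t"
     by (intro tendsto_intros LIMSEQ_ignore_initial_segment qd_lim True)
    then show ?thesis using Wt_pos[OF True] by (simp add: \<phi>_def)
   next
    case False
    then show ?thesis using supp[of t] \<phi>0[of t] s by simp
   qed
  qed
  show "AE t in \<sigma>. norm (\<phi> t * qd (n + n1) t) \<le> K\<phi> * \<bar>C\<bar> * indicator {-s..s} t" for n
  proof (rule AE_I2)
   fix t show "norm (\<phi> t * qd (n + n1) t) \<le> K\<phi> * \<bar>C\<bar> * indicator {-s..s} t"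
   proof (cases "\<bar>t\<bar> \<le> s")
    case True
    have "\<bar>\<phi> t\<bar> * \<bar>qd (n + n1) t\<bar> \<le> K\<phi> * \<bar>C\<bar>"
     using K\<phi>[of t] C[of "n + n1" t] True by (intro mult_mono) (auto simp: n1_def intro: order_trans[OF _ abs_ge_self] order_trans[OF abs_ge_zero])
    then show ?thesis using True by (auto simp: indicator_def abs_mult abs_le_iff)
   next
    case False
    then show ?thesis using \<phi>0[of t] by (auto simp: indicator_def)
   qed
  qed
 qed
 moreover have "(\<lambda>n. \<integral>t. \<phi> t * qd (n + n1) t \<partial>\<sigma>) \<longlonglongrightarrow> 2 / pi * integral {0..pi} (\<lambda>\<theta>. \<phi> (cos \<theta>) * (sin \<theta>)^2)"
  by (rule LIMSEQ_ignore_initial_segment[OF qd_integral_lim[OF c\<phi>]]) (use \<phi>0 s in auto)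
 ultimately have eq: "(\<integral>t. \<psi> t \<partial>\<sigma>) = 2 / pi * integral {0..pi} (\<lambda>\<theta>. \<phi> (cos \<theta>) * (sin \<theta>)^2)"
  by (rule LIMSEQ_unique)
 have pw: "2 / pi * (\<phi> (cos \<theta>) * (sin \<theta>)^2) * indicator {0..pi} \<theta> = \<psi> (cos \<theta>) * \<kappa> \<theta>" for \<theta>
 proof -
  consider "\<theta> \<in> {0<..<pi}" | "\<theta> = 0 \<or> \<theta> = pi" | "\<theta> \<notin> {0..pi}" by fastforce
  then show ?thesis
  proof cases
   case 1
   then have "0 < sin \<theta>" by (simp add: sin_gt_zero)
   moreover have "Wt (cos \<theta>) = 4 * (sin \<theta>)^2 * (cmod (cc (cis \<theta>)))^2"
    using 1 by (simp add: Wt_def yc_cos sin_squared_eq)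
   moreover have "cc (cis \<theta>) \<noteq> 0" using cc_circ_nonzero[OF cis_circ[OF 1]] .
   ultimately show ?thesis using 1 by (simp add: \<phi>_def \<kappa>_def field_simps)
  next
   case 2
   then show ?thesis using supp[of 1] supp[of "-1"] s by (auto simp: \<kappa>_def)
  qed (auto simp: \<kappa>_def indicator_def)
 qed
 have nn': "0 \<le> \<phi> (cos \<theta>)" for \<theta>
 proof (cases "\<bar>cos \<theta>\<bar> < 1")
  case True
  then show ?thesis unfolding \<phi>_def using nn Wt_pos by (simp add: less_imp_le)
 next
  case False
  then show ?thesis using \<phi>0[of "cos \<theta>"] s by simp
 qed
 have hi: "((\<lambda>\<theta>. 2 / pi * (\<phi> (cos \<theta>) * (sin \<theta>)^2)) has_integral (\<integral>t. \<psi> t \<partial>\<sigma>)) {0..pi}"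
  unfolding eq by (intro has_integral_mult_right integrable_integral integrable_continuous_interval continuous_intros continuous_on_compose2[OF c\<phi>]) auto
 have "(\<integral>\<^sup>+ \<theta>. ennreal (\<psi> (cos \<theta>) * \<kappa> \<theta>) \<partial>lborel) = (\<integral>\<^sup>+ \<theta>. ennreal (2 / pi * (\<phi> (cos \<theta>) * (sin \<theta>)^2)) * indicator {0..pi} \<theta> \<partial>lborel)"
  by (intro nn_integral_cong) (auto simp flip: pw simp: indicator_def)
 also have "\<dots> = ennreal (\<integral>t. \<psi> t \<partial>\<sigma>)"
  by (rule nn_integral_has_integral_lebesgue'[OF _ hi]) (use nn' in \<open>auto intro!: mult_nonneg_nonneg divide_nonneg_pos\<close>)
 also have "\<dots> = (\<integral>\<^sup>+ t. ennreal (\<psi> t) \<partial>\<sigma>)"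
  by (rule nn_integral_eq_integral[symmetric]) (use i\<psi> nn in auto)
 finally show ?thesis by simp
qed

theorem \<sigma>_inner: "density \<sigma> (indicator {-1<..<1}) = distr (density lborel (\<lambda>\<theta>. ennreal (\<kappa> \<theta>))) borel cos"
proof (rule measure_eqI_lessThan)
 fix x :: real
 have em: "emeasure (density \<sigma> (indicator {-1<..<1})) {x<..} = (\<integral>\<^sup>+ t. indicator {-1<..<1} t * indicator {x<..} t \<partial>\<sigma>)"
  by (rule emeasure_density) auto
 also have "\<dots> = (\<integral>\<^sup>+ t. indicator {max x (-1)<..<1} t \<partial>\<sigma>)"
  by (intro nn_integral_cong) (auto simp: indicator_def)
 finally have em: "emeasure (density \<sigma> (indicator {-1<..<1})) {x<..} = (\<integral>\<^sup>+ t. indicator {max x (-1)<..<1} t \<partial>\<sigma>)" .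
 then have "emeasure (density \<sigma> (indicator {-1<..<1})) {x<..} = emeasure \<sigma> {max x (-1)<..<1}" by simp
 also have "\<dots> < \<infinity>" by (rule emeasure_\<sigma>_bounded[of _ "-1" 1]) auto
 finally show "emeasure (density \<sigma> (indicator {-1<..<1})) {x<..} < \<infinity>" .
 define \<alpha> where "\<alpha> = max x (-1)"
 \<comment> \<open>Positive exactly on the open interval. The cut-offs built from it are continuous,
   increase to its indicator, and vanish near its ends, as \<open>integral_\<sigma>_inner\<close>
   demands.\<close>
 define g where "g t = min (t - \<alpha>) (1 - t)" for t
 define \<psi> where "\<psi> n t = min 1 (max 0 (real n * g t - 1))" for n t
 have c: "continuous_on X (\<psi> n)" for X n unfolding \<psi>_def g_def by (intro continuous_intros)
 have inc: "\<psi> n t \<le> \<psi> (Suc n) t" for n t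
 proof (cases "0 \<le> g t")
  case True
  then have "real n * g t \<le> real (Suc n) * g t" by (intro mult_right_mono) auto
  then show ?thesis by (auto simp: \<psi>_def)
 next
  case False
  then have "real n * g t \<le> 0" by (simp add: mult_le_0_iff)
  then show ?thesis by (auto simp: \<psi>_def)
 qed
 have lim: "(\<lambda>n. \<psi> n t) \<longlonglongrightarrow> indicator {\<alpha><..<1} t" for t
 proof (cases "t \<in> {\<alpha><..<1}")
  case True
  then have g: "0 < g t" by (simp add: g_def)
  obtain n0 where n0: "2 < real n0 * g t" using reals_Archimedean3[OF g] by blast
  have "\<forall>\<^sub>F n in sequentially. \<psi> n t = 1" using eventually_ge_at_top[of n0]
  proof eventually_elim
   case (elim n)
   then have "real n0 * g t \<le> real n * g t" using g by (intro mult_right_mono) auto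
   then show ?case using n0 by (auto simp: \<psi>_def)
  qed
  then show ?thesis using True by (simp add: tendsto_eventually)
 next
  case False
  then have "g t \<le> 0" by (auto simp: g_def)
  then have "real n * g t \<le> 0" for n by (simp add: mult_le_0_iff)
  then have "real n * g t - 1 \<le> 0" for n by (meson diff_le_0_iff_le order_trans zero_le_one)
  then have "\<psi> n t = 0" for n by (auto simp: \<psi>_def max_absorb1)
  then show ?thesis using False by simp
 qed
 have eq: "(\<integral>\<^sup>+ t. ennreal (\<psi> n t) \<partial>\<sigma>) = (\<integral>\<^sup>+ \<theta>. ennreal (\<psi> n (cos \<theta>) * \<kappa> \<theta>) \<partial>lborel)" for n
 \<comment> \<open>Within \<open>1 / (n + 2)\<close> of an edge \<open>n * g t\<close> is at most 1,
   so the cut-off is 0; the offset 2 keeps \<open>s\<close> positive for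
   \<open>n = 0\<close>.\<close>
 proof (rule integral_\<sigma>_inner[where s = "1 - 1 / real (n + 2)"])
  fix t assume t: "1 - 1 / real (n + 2) < \<bar>t\<bar>"
  have "g t \<le> 1 / real (n + 2)" using t by (auto simp: g_def \<alpha>_def min_def max_def abs_if split: if_splits)
  then have "real n * g t \<le> real n * (1 / real (n + 2))" by (intro mult_left_mono) auto
  also have "\<dots> \<le> 1" by simp
  finally show "\<psi> n t = 0" by (auto simp: \<psi>_def)
 qed (use c in \<open>auto simp: \<psi>_def\<close>)
 have "(\<lambda>n. \<integral>\<^sup>+ t. ennreal (\<psi> n t) \<partial>\<sigma>) \<longlonglongrightarrow> (\<integral>\<^sup>+ t. ennreal (indicator {\<alpha><..<1} t) \<partial>\<sigma>)"
 proof (rule nn_integral_LIMSEQ)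
  show "incseq (\<lambda>n t. ennreal (\<psi> n t))" by (rule incseq_SucI) (auto simp: le_fun_def intro!: ennreal_leI inc)
  show "(\<lambda>t. ennreal (\<psi> n t)) \<in> borel_measurable \<sigma>" for n
   using borel_measurable_continuous_onI[OF c[of UNIV n]] by simp
  show "(\<lambda>n. ennreal (\<psi> n t)) \<longlonglongrightarrow> ennreal (indicator {\<alpha><..<1} t)" for t by (intro tendsto_ennrealI lim)
 qed
 moreover have "(\<lambda>n. \<integral>\<^sup>+ \<theta>. ennreal (\<psi> n (cos \<theta>) * \<kappa> \<theta>) \<partial>lborel) \<longlonglongrightarrow> (\<integral>\<^sup>+ \<theta>. ennreal (indicator {\<alpha><..<1} (cos \<theta>) * \<kappa> \<theta>) \<partial>lborel)"
 proof (rule nn_integral_LIMSEQ)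
  show "incseq (\<lambda>n \<theta>. ennreal (\<psi> n (cos \<theta>) * \<kappa> \<theta>))"
   by (rule incseq_SucI) (auto simp: le_fun_def intro!: ennreal_leI mult_right_mono inc)
  show "(\<lambda>\<theta>. ennreal (\<psi> n (cos \<theta>) * \<kappa> \<theta>)) \<in> borel_measurable lborel" for n
   using borel_measurable_continuous_onI[OF c[of UNIV n]] by measurable
  show "(\<lambda>n. ennreal (\<psi> n (cos \<theta>) * \<kappa> \<theta>)) \<longlonglongrightarrow> ennreal (indicator {\<alpha><..<1} (cos \<theta>) * \<kappa> \<theta>)" for \<theta>
   by (intro tendsto_ennrealI tendsto_mult lim tendsto_const)
 qed
 ultimately have "(\<integral>\<^sup>+ t. ennreal (indicator {\<alpha><..<1} t) \<partial>\<sigma>) = (\<integral>\<^sup>+ \<theta>. ennreal (indicator {\<alpha><..<1} (cos \<theta>) * \<kappa> \<theta>) \<partial>lborel)"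
  unfolding eq by (rule LIMSEQ_unique)
 also have "\<dots> = (\<integral>\<^sup>+ \<theta>. ennreal (\<kappa> \<theta>) * indicator {\<theta>. x < cos \<theta>} \<theta> \<partial>lborel)"
 proof (intro nn_integral_cong)
  fix \<theta>
  have "-1 < cos \<theta>" "cos \<theta> < 1" if "\<theta> \<in> {0<..<pi}"
  proof -
   have s: "0 < sin \<theta>" using that by (simp add: sin_gt_zero)
   then have "(cos \<theta>)^2 < 1" by (simp add: cos_squared_eq)
   then show "-1 < cos \<theta>" "cos \<theta> < 1" by (simp_all add: abs_square_less_1 abs_less_iff)
  qed
  then show "ennreal (indicator {\<alpha><..<1} (cos \<theta>) * \<kappa> \<theta>) = ennreal (\<kappa> \<theta>) * indicator {\<theta>. x < cos \<theta>} \<theta>"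
   by (cases "\<theta> \<in> {0<..<pi}") (auto simp: \<alpha>_def indicator_def \<kappa>_def)
 qed
 also have "\<dots> = emeasure (density lborel (\<lambda>\<theta>. ennreal (\<kappa> \<theta>))) {\<theta>. x < cos \<theta>}"
  by (rule emeasure_density[symmetric]) measurable
 also have "\<dots> = emeasure (distr (density lborel (\<lambda>\<theta>. ennreal (\<kappa> \<theta>))) borel cos) {x<..}"
  by (subst emeasure_distr) (auto simp: vimage_def)
 finally show "emeasure (density \<sigma> (indicator {-1<..<1})) {x<..} = emeasure (distr (density lborel (\<lambda>\<theta>. ennreal (\<kappa> \<theta>))) borel cos) {x<..}"
  unfolding em by (simp add: \<alpha>_def ennreal_indicator)
qed simp_all

end

section \<open>The spectral decomposition\<close>

lemma integrable_count_space_imp_summable: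
 fixes f :: "'a \<Rightarrow> real"
 assumes "integrable (count_space X) f"
 shows "f summable_on X" "infsum f X = integral\<^sup>L (count_space X) f"
proof -
 have "Infinite_Set_Sum.abs_summable_on f X" using assms by (simp add: Infinite_Set_Sum.abs_summable_on_def)
 moreover from this have "(\<lambda>x. norm (f x)) summable_on X" using abs_summable_equivalent[of f X] by simp
 ultimately show "f summable_on X" "infsum f X = integral\<^sup>L (count_space X) f"
  using abs_summable_summable infsetsum_infsum[of f X] unfolding infsetsum_def by (blast, simp)
qed

lemma complex_polarization:
 "z * cnj w = (1 / 4) * (1 * of_real ((cmod (z + 1 * w))^2)) + (1 / 4) * (-1 * of_real ((cmod (z + (-1) * w))^2))
   + (1 / 4) * (\<i> * of_real ((cmod (z + \<i> * w))^2)) + (1 / 4) * (- \<i> * of_real ((cmod (z + (- \<i>) * w))^2))"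
proof -
 have "4 * (z * cnj w) = 1 * of_real ((cmod (z + 1 * w))^2) + -1 * of_real ((cmod (z + (-1) * w))^2)
   + \<i> * of_real ((cmod (z + \<i> * w))^2) + - \<i> * of_real ((cmod (z + (- \<i>) * w))^2)"
  unfolding complex_norm_square by (simp add: algebra_simps)
 then have "(1 / 4) * (4 * (z * cnj w)) = (1 / 4) * (1 * of_real ((cmod (z + 1 * w))^2) + -1 * of_real ((cmod (z + (-1) * w))^2)
   + \<i> * of_real ((cmod (z + \<i> * w))^2) + - \<i> * of_real ((cmod (z + (- \<i>) * w))^2))" by (simp only:)
 moreover have "(1 / 4) * (4 * x) = x" for x :: complex by simp
 ultimately show ?thesis unfolding distrib_left by (simp only:)
qed

context jacobi_spectral
begin

definition P0 :: "int set" where "P0 = {p. 1 < \<bar>yp p\<bar>}"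

definition mass :: "int \<Rightarrow> real" where "mass p = 1 / (ell2_norm (\<lambda>k. Phi k (of_real (mu (yp p)))))^2"

lemma mass_nonneg [simp]: "0 \<le> mass p" by (simp add: mass_def)

text \<open>Equal values of \<open>mu\<close> leave equal or inverse arguments, and two numbers of
  modulus above 1 are not inverse to each other.\<close>

lemma inj_mu_yp: "inj_on (\<lambda>p. mu (yp p)) P0"
proof (rule inj_onI)
 fix p p' assume p: "p \<in> P0" "p' \<in> P0" and eq: "mu (yp p) = mu (yp p')"
 have "complex_of_real (yp p) \<noteq> 0" "complex_of_real (yp p') \<noteq> 0" using p by (auto simp: P0_def)
 from mu_eq_iff[OF this] eq have "complex_of_real (yp p) = of_real (yp p') \<or> complex_of_real (yp p) = inverse (of_real (yp p'))"
  by (simp add: mu_of_real)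
 then have "yp p = yp p' \<or> yp p = inverse (yp p')" by (simp flip: of_real_inverse)
 moreover have "yp p \<noteq> inverse (yp p')"
 proof
  assume "yp p = inverse (yp p')"
  then have "\<bar>yp p\<bar> * \<bar>yp p'\<bar> = 1" using p by (auto simp: P0_def simp flip: abs_mult)
  moreover have "1 * 1 < \<bar>yp p\<bar> * \<bar>yp p'\<bar>" using p by (intro mult_strict_mono) (auto simp: P0_def)
  ultimately show False by simp
 qed
 ultimately have "yp p = yp p'" by blast
 then have "q powi p = q powi p'" using d r by (simp add: yp_def)
 then show "p = p'" using q01 power_int_strict_decreasing[of p p' q] power_int_strict_decreasing[of p' p q]
  by (cases p p' rule: linorder_cases) auto
qed

lemma abs_mu_gt_1: "1 < \<bar>y\<bar> \<Longrightarrow> 1 < \<bar>mu y\<bar>" for y :: real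
proof -
 assume y: "1 < \<bar>y\<bar>"
 have "0 < (\<bar>y\<bar> - 1)^2" using y by simp
 then have "2 * \<bar>y\<bar> < \<bar>y\<bar> * \<bar>y\<bar> + 1" by (simp add: power2_eq_square algebra_simps)
 also have "\<bar>y\<bar> * \<bar>y\<bar> + 1 = \<bar>y * y + 1\<bar>" by (simp add: abs_mult_self_eq)
 finally have "1 < \<bar>y * y + 1\<bar> / (2 * \<bar>y\<bar>)" using y by simp
 also have "\<bar>y * y + 1\<bar> / (2 * \<bar>y\<bar>) = \<bar>mu y\<bar>"
  using y by (simp add: mu_def abs_divide[symmetric] abs_mult[symmetric] del: abs_mult) (simp add: field_simps abs_mult abs_divide)
 finally show ?thesis .
qed

text \<open>The assumption speaks of zeros of \<open>c\<close> as a meromorphic function, so the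
  zero of \<open>D\<close> must first be recognised as an isolated zero of \<open>c\<close>; then
  the residue and the atom are both the reciprocal squared norm of \<open>Phi\<close>.\<close>

lemma residue_mass:
 assumes nop: "\<And>y. y \<noteq> 0 \<Longrightarrow> isolated_zero cc y \<Longrightarrow> cc (inverse y) \<noteq> 0" and p: "p \<in> P0"
 shows "residue (\<lambda>z. 1 / (cc (inverse z) * cc z * z)) (of_real (yp p)) = of_real (mass p)"
  and "emeasure \<sigma> {mu (yp p)} = ennreal (mass p)"
proof -
 define y0 where "y0 = complex_of_real (yp p)"
 have y1: "1 < norm y0" using p by (simp add: y0_def P0_def)
 note y0 = outside_disc[OF y1]
 have D0: "D y0 = 0" using D_zero_iff[OF y1] by (auto simp: y0_def yp_def)
 have U: "y0 \<in> S - {1, -1}" using y0 by auto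
 have c0: "cc y0 = 0" using cc_D[OF U] D0 by simp
 have "isolated_zero cc y0"
 proof -
  have "D y \<noteq> 0" if "norm y > 1" "Im y \<noteq> 0" for y using D_zero_iff[OF that(1)] that(2) Im_complex_of_real by metis
  then have D2: "D (2 * \<i>) \<noteq> 0" by (simp add: norm_mult)
  have "2 * \<i> \<in> S" by (rule S_I) (simp add: norm_mult)
  \<comment> \<open>The point \<open>2 * \<i>\<close> shows that \<open>D\<close> is not identically
    zero on the connected set \<open>S\<close>.\<close>
  from isolated_zeros[OF holomorphic_D open_S connected_S y0(2) D0 this D2] obtain \<rho>
   where \<rho>: "0 < \<rho>" "\<And>z. z \<in> ball y0 \<rho> - {y0} \<Longrightarrow> D z \<noteq> 0" by blast
  have "isCont cc y0" using holomorphic_on_imp_continuous_on[OF holomorphic_cc] continuous_on_eq_continuous_at[OF open_S'] U by blast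
  then have "cc \<midarrow>y0\<rightarrow> 0" by (simp add: isCont_def c0)
  moreover have "\<forall>\<^sub>F z in at y0. cc z \<noteq> 0"
   using eventually_at_in_open[OF open_S' U] eventually_at_in_open[OF open_ball centre_in_ball[THEN iffD2, OF \<rho>(1)]]
  proof eventually_elim
   case (elim z)
   then show ?case using \<rho>(2)[of z] cc_D[of z] by simp
  qed
  ultimately show ?thesis by (simp add: isolated_zero_def)
 qed
 then have c1: "cc (inverse y0) \<noteq> 0" using nop y0(1) by blast
 \<comment> \<open>At nonzero points outside \<open>S\<close> the value of \<open>c_fun\<close> is 0
   by division by zero, which is excluded at \<open>inverse y0\<close>.\<close>
 have "inverse y0 \<in> S"
 proof (rule ccontr)
  assume "inverse y0 \<notin> S"
  then have "Q (of_real q / (inverse y0)^2) = 0" using y0 by (auto simp: S_def)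
  then have "N (inverse y0) = 0" by (simp add: N_def)
  then show False using c1 cc_N[of "inverse y0"] y0 by simp
 qed
 note hyp = y1 this c0 c1
 have t: "mu y0 = of_real (mu (yp p))" by (simp add: y0_def mu_of_real)
 show "residue (\<lambda>z. 1 / (cc (inverse z) * cc z * z)) (of_real (yp p)) = of_real (mass p)"
  using residue_cc[OF hyp t] by (simp add: y0_def mass_def)
 show "emeasure \<sigma> {mu (yp p)} = ennreal (mass p)"
  unfolding mass_def by (rule emeasure_\<sigma>_eigenvalue[OF derivative_D(1)[OF hyp t]])
qed

context
 assumes nop: "\<And>y. y \<noteq> 0 \<Longrightarrow> isolated_zero cc y \<Longrightarrow> cc (inverse y) \<noteq> 0"
begin

text \<open>The line is divided into the open interval, the two edge points of measure zero, and the
  outer region, where almost every point is one of the countably many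
  \<open>mu (yp p)\<close>.\<close>

lemma nn_integral_\<sigma>:
 assumes h: "h \<in> borel_measurable borel"
 shows "(\<integral>\<^sup>+ t. h t \<partial>\<sigma>) = (\<integral>\<^sup>+ \<theta>. ennreal (\<kappa> \<theta>) * h (cos \<theta>) \<partial>lborel) + (\<integral>\<^sup>+ p. h (mu (yp p)) * ennreal (mass p) \<partial>count_space P0)"
proof -
 have [measurable]: "h \<in> borel_measurable \<sigma>" using h by simp
 have cnt: "countable P0" by simp
 have edge: "AE t in \<sigma>. t \<noteq> 1" "AE t in \<sigma>. t \<noteq> -1"
  by (rule AE_I[where N = "{1}"]; simp add: \<sigma>_edge) (rule AE_I[where N = "{-1}"]; simp add: \<sigma>_edge)
 define T0 where "T0 = (\<lambda>p. mu (yp p)) ` P0"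
 have [measurable]: "T0 \<in> sets borel" unfolding T0_def by (rule sets.countable[OF _ countable_image[OF cnt]]) simp
 \<comment> \<open>By injectivity at most one index contributes at each point, so the sum of the
   point indicators is the indicator of \<open>T0\<close>.\<close>
 have pt: "(\<integral>\<^sup>+ p. h t * indicator {mu (yp p)} t \<partial>count_space P0) = h t * indicator T0 t" for t
 proof (cases "t \<in> T0")
  case False
  then have "(\<integral>\<^sup>+ p. h t * indicator {mu (yp p)} t \<partial>count_space P0) = (\<integral>\<^sup>+ p. 0 \<partial>count_space P0)"
   by (intro nn_integral_cong) (auto simp: T0_def indicator_def)
  then show ?thesis using False by simp
 next
  case True
  then obtain p where p: "p \<in> P0" "t = mu (yp p)" by (auto simp: T0_def)
  have "(\<integral>\<^sup>+ p. h t * indicator {mu (yp p)} t \<partial>count_space P0) = (\<integral>\<^sup>+ p'. h t * indicator {p} p' \<partial>count_space P0)"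
  proof (rule nn_integral_cong)
   fix p' assume "p' \<in> space (count_space P0)"
   then have "t = mu (yp p') \<longleftrightarrow> p' = p" using inj_onD[OF inj_mu_yp, of p p'] p by auto
   then show "h t * indicator {mu (yp p')} t = h t * indicator {p} p'" by (auto simp: indicator_def)
  qed
  also have "\<dots> = h t * emeasure (count_space P0) {p}" by (rule nn_integral_cmult_indicator) (use p in simp)
  finally show ?thesis using p True by simp
 qed
 have "(\<integral>\<^sup>+ t. h t \<partial>\<sigma>) = (\<integral>\<^sup>+ t. indicator {-1<..<1} t * h t + h t * indicator T0 t \<partial>\<sigma>)"
 proof (rule nn_integral_cong_AE)
  show "AE t in \<sigma>. h t = indicator {-1<..<1} t * h t + h t * indicator T0 t" using AE_outside edge
  proof eventually_elim
   case (elim t)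
   show ?case
   proof (cases "\<bar>t\<bar> < 1")
    case True
    then have "t \<notin> T0" using abs_mu_gt_1 by (fastforce simp: T0_def P0_def)
    then show ?thesis using True by (simp add: abs_less_iff)
   next
    case False
    then have "1 < \<bar>t\<bar>" using elim by auto
    then have "t \<in> T0" using elim(1) by (auto simp: P0_def T0_def)
    moreover have "t \<notin> {-1<..<1}" using False by auto
    ultimately show ?thesis by simp
   qed
  qed
 qed
 also have "\<dots> = (\<integral>\<^sup>+ t. indicator {-1<..<1} t * h t \<partial>\<sigma>) + (\<integral>\<^sup>+ t. h t * indicator T0 t \<partial>\<sigma>)"
  by (rule nn_integral_add) measurable
 also have "(\<integral>\<^sup>+ t. indicator {-1<..<1} t * h t \<partial>\<sigma>) = (\<integral>\<^sup>+ t. h t \<partial>density \<sigma> (indicator {-1<..<1}))"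
  by (rule nn_integral_density[symmetric]) measurable
 also have "\<dots> = (\<integral>\<^sup>+ \<theta>. h (cos \<theta>) \<partial>density lborel (\<lambda>\<theta>. ennreal (\<kappa> \<theta>)))"
  unfolding \<sigma>_inner by (rule nn_integral_distr) (use h in auto)
 also have "\<dots> = (\<integral>\<^sup>+ \<theta>. ennreal (\<kappa> \<theta>) * h (cos \<theta>) \<partial>lborel)"
  by (rule nn_integral_density) (use h in measurable)
 also have "(\<integral>\<^sup>+ t. h t * indicator T0 t \<partial>\<sigma>) = (\<integral>\<^sup>+ p. (\<integral>\<^sup>+ t. h t * indicator {mu (yp p)} t \<partial>\<sigma>) \<partial>count_space P0)"
  unfolding pt[symmetric] by (rule nn_integral_count_space_nn_integral) (use cnt in auto)
 also have "\<dots> = (\<integral>\<^sup>+ p. h (mu (yp p)) * ennreal (mass p) \<partial>count_space P0)"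
 proof (rule nn_integral_cong)
  fix p assume "p \<in> space (count_space P0)"
  then have p: "p \<in> P0" by simp
  have "(\<integral>\<^sup>+ t. h t * indicator {mu (yp p)} t \<partial>\<sigma>) = (\<integral>\<^sup>+ t. h (mu (yp p)) * indicator {mu (yp p)} t \<partial>\<sigma>)"
   by (intro nn_integral_cong) (auto simp: indicator_def)
  also have "\<dots> = h (mu (yp p)) * emeasure \<sigma> {mu (yp p)}" by (rule nn_integral_cmult_indicator) simp
  also have "emeasure \<sigma> {mu (yp p)} = ennreal (mass p)" by (rule residue_mass(2)[OF nop p])
  finally show "(\<integral>\<^sup>+ t. h t * indicator {mu (yp p)} t \<partial>\<sigma>) = h (mu (yp p)) * ennreal (mass p)" .
 qed
 finally show ?thesis .
qed

lemma norm_E_decomp: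
 assumes u: "u \<in> finseq" and G: "G \<in> sets borel"
 shows "integrable lborel (\<lambda>\<theta>. \<kappa> \<theta> * (sq u (cos \<theta>) * indicator G (cos \<theta>)))"
  and "(\<lambda>p. sq u (mu (yp p)) * indicator G (mu (yp p)) * mass p) summable_on P0"
  and "(ell2_norm (E G u))^2 = (\<integral>\<theta>. \<kappa> \<theta> * (sq u (cos \<theta>) * indicator G (cos \<theta>)) \<partial>lborel)
    + (\<Sum>\<^sub>\<infinity>p\<in>P0. sq u (mu (yp p)) * indicator G (mu (yp p)) * mass p)"
proof -
 define f1 where "f1 \<theta> = \<kappa> \<theta> * (sq u (cos \<theta>) * indicator G (cos \<theta>))" for \<theta>
 define f2 where "f2 p = sq u (mu (yp p)) * indicator G (mu (yp p)) * mass p" for p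
 have m: "(\<lambda>t. sq u t * indicator G t) \<in> borel_measurable borel" using u G by measurable
 have m1: "f1 \<in> borel_measurable lborel" unfolding f1_def using m by measurable
 have n1: "0 \<le> f1 \<theta>" and n2: "0 \<le> f2 p" for \<theta> p by (auto simp: f1_def f2_def intro!: mult_nonneg_nonneg)
 have "ennreal ((ell2_norm (E G u))^2) = (\<integral>\<^sup>+ t. ennreal (sq u t * indicator G t) \<partial>\<sigma>)"
  unfolding nn_integral_sq[OF u G, symmetric] by (intro nn_integral_cong) (auto simp: indicator_def)
 also have "\<dots> = (\<integral>\<^sup>+ \<theta>. ennreal (f1 \<theta>) \<partial>lborel) + (\<integral>\<^sup>+ p. ennreal (f2 p) \<partial>count_space P0)"
  by (subst nn_integral_\<sigma>) (use m in \<open>auto simp: f1_def f2_def ennreal_mult[symmetric]\<close>)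
 finally have eq: "ennreal ((ell2_norm (E G u))^2) = (\<integral>\<^sup>+ \<theta>. ennreal (f1 \<theta>) \<partial>lborel) + (\<integral>\<^sup>+ p. ennreal (f2 p) \<partial>count_space P0)" .
 then have "(\<integral>\<^sup>+ \<theta>. ennreal (f1 \<theta>) \<partial>lborel) + (\<integral>\<^sup>+ p. ennreal (f2 p) \<partial>count_space P0) < \<infinity>"
  by (metis ennreal_less_top infinity_ennreal_def)
 then have fin: "(\<integral>\<^sup>+ \<theta>. ennreal (f1 \<theta>) \<partial>lborel) < \<infinity>" "(\<integral>\<^sup>+ p. ennreal (f2 p) \<partial>count_space P0) < \<infinity>"
  by (auto simp: ennreal_add_less_top)
 have i1: "integrable lborel f1" by (rule integrableI_nonneg[OF m1]) (use n1 fin in auto)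
 have i2: "integrable (count_space P0) f2" by (rule integrableI_nonneg) (use n2 fin in auto)
 note s2 = integrable_count_space_imp_summable[OF i2]
 have "ennreal ((ell2_norm (E G u))^2) = ennreal (integral\<^sup>L lborel f1) + ennreal (integral\<^sup>L (count_space P0) f2)"
  unfolding eq using n1 n2 by (simp add: nn_integral_eq_integral[OF i1] nn_integral_eq_integral[OF i2])
 also have "\<dots> = ennreal (integral\<^sup>L lborel f1 + infsum f2 P0)"
  unfolding s2(2) using n1 n2 by (intro ennreal_plus[symmetric] Bochner_Integration.integral_nonneg) auto
 finally have "(ell2_norm (E G u))^2 = integral\<^sup>L lborel f1 + infsum f2 P0"
  by (rule ennreal_inj[THEN iffD1, rotated -1]) (auto intro!: add_nonneg_nonneg Bochner_Integration.integral_nonneg infsum_nonneg n1 n2)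
 with i1 s2(1) show "integrable lborel (\<lambda>\<theta>. \<kappa> \<theta> * (sq u (cos \<theta>) * indicator G (cos \<theta>)))"
  "(\<lambda>p. sq u (mu (yp p)) * indicator G (mu (yp p)) * mass p) summable_on P0"
  "(ell2_norm (E G u))^2 = (\<integral>\<theta>. \<kappa> \<theta> * (sq u (cos \<theta>) * indicator G (cos \<theta>)) \<partial>lborel)
    + (\<Sum>\<^sub>\<infinity>p\<in>P0. sq u (mu (yp p)) * indicator G (mu (yp p)) * mass p)"
  by (simp_all add: f1_def[abs_def] f2_def[abs_def])
qed

text \<open>Polarisation: the quadratic decomposition is applied to \<open>u + \<alpha> * v\<close>
  with \<alpha> = 1, -1, \<i>, -\<i>. Integrability and summability pass through the same linear
  combination.\<close>

lemma ip_E_decomp: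
 assumes u: "u \<in> finseq" and v: "v \<in> finseq" and G: "G \<in> sets borel"
 defines "g1 \<equiv> \<lambda>\<theta>. of_real (\<kappa> \<theta> * indicator G (cos \<theta>)) * (FF u (of_real (cos \<theta>)) * cnj (FF v (of_real (cos \<theta>))))"
  and "g2 \<equiv> \<lambda>p. of_real (indicator G (mu (yp p)) * mass p) * (FF u (of_real (mu (yp p))) * cnj (FF v (of_real (mu (yp p)))))"
 shows "integrable lborel g1" "g2 summable_on P0" "ip (E G u) v = integral\<^sup>L lborel g1 + infsum g2 P0"
proof -
 define x where "x \<alpha> = (\<lambda>k. 1 * u k + \<alpha> * v k)" for \<alpha>
 have x: "x \<alpha> \<in> finseq" for \<alpha> unfolding x_def by (rule finseq_lin[OF u v])
 have FFx: "FF (x \<alpha>) t = FF u t + \<alpha> * FF v t" for \<alpha> t using FF_lin[OF u v, of 1 \<alpha> t] by (simp add: x_def)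
 define k1 where "k1 \<alpha> \<theta> = \<kappa> \<theta> * (sq (x \<alpha>) (cos \<theta>) * indicator G (cos \<theta>))" for \<alpha> \<theta>
 define k2 where "k2 \<alpha> p = sq (x \<alpha>) (mu (yp p)) * indicator G (mu (yp p)) * mass p" for \<alpha> p
 note dec = norm_E_decomp[OF x G, folded k1_def k2_def]
 define I where "I \<alpha> = complex_of_real (\<integral>\<theta>. k1 \<alpha> \<theta> \<partial>lborel)" for \<alpha>
 define H where "H \<alpha> = complex_of_real (\<Sum>\<^sub>\<infinity>p\<in>P0. k2 \<alpha> p)" for \<alpha>
 let ?pol = "\<lambda>F. (1 / 4) * (1 * F 1) + (1 / 4) * (-1 * F (-1)) + (1 / 4) * (\<i> * F \<i>) + (1 / 4) * (- \<i> * F (- \<i>)) :: complex"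
 have pol: "z * cnj y = ?pol (\<lambda>\<alpha>. of_real ((cmod (z + \<alpha> * y))^2))" for z y by (rule complex_polarization)
 have g1: "g1 = (\<lambda>\<theta>. ?pol (\<lambda>\<alpha>. of_real (k1 \<alpha> \<theta>)))"
  unfolding g1_def pol k1_def sq_def FFx by (auto simp: algebra_simps)
 have g2: "g2 = (\<lambda>p. ?pol (\<lambda>\<alpha>. of_real (k2 \<alpha> p)))"
  unfolding g2_def pol k2_def sq_def FFx by (auto simp: algebra_simps)
 have b1: "has_bochner_integral lborel (\<lambda>\<theta>. complex_of_real (k1 \<alpha> \<theta>)) (I \<alpha>)" for \<alpha>
  unfolding I_def using dec(1)[of \<alpha>] by (intro has_bochner_integral_of_real has_bochner_integral_integrable) (simp add: k1_def[abs_def])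
 have b2: "((\<lambda>p. complex_of_real (k2 \<alpha> p)) has_sum H \<alpha>) P0" for \<alpha>
  unfolding H_def using dec(2)[of \<alpha>] by (intro has_sum_of_real has_sum_infsum) (simp add: k2_def[abs_def])
 have B1: "has_bochner_integral lborel g1 (?pol I)" unfolding g1 by (intro has_bochner_integral_add has_bochner_integral_mult_right b1)
 have B2: "(g2 has_sum ?pol H) P0" unfolding g2 by (intro has_sum_add has_sum_cmult_right b2)
 have IH: "ip (E G (x \<alpha>)) (x \<alpha>) = I \<alpha> + H \<alpha>" for \<alpha>
  unfolding Re_ip_E[OF G finseq_ell2[OF x]] dec(3) I_def H_def by simp
 have ux: "u \<in> ell2" "v \<in> ell2" "E G u \<in> ell2" "E G v \<in> ell2" using u v G by (auto simp: finseq_ell2)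
 have "ip (E G (x \<alpha>)) (x \<alpha>) = ip (E G u) u + cnj \<alpha> * ip (E G u) v + \<alpha> * ip (E G v) u + \<alpha> * cnj \<alpha> * ip (E G v) v" for \<alpha>
 proof -
  have Ex: "E G (x \<alpha>) = (\<lambda>k. 1 * E G u k + \<alpha> * E G v k)" unfolding x_def by (rule E_lin[OF G ux(1,2)])
  have "ip (E G (x \<alpha>)) (x \<alpha>) = 1 * ip (E G u) (x \<alpha>) + \<alpha> * ip (E G v) (x \<alpha>)"
   unfolding Ex by (rule ip_lin_left[OF ux(3,4) finseq_ell2[OF x]])
  moreover have "ip z (x \<alpha>) = cnj 1 * ip z u + cnj \<alpha> * ip z v" if "z \<in> ell2" for z
   unfolding x_def by (rule ip_lin_right[OF ux(1,2) that])
  ultimately show ?thesis using ux by (simp add: algebra_simps)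
 qed
 then have "ip (E G u) v = ?pol (\<lambda>\<alpha>. ip (E G (x \<alpha>)) (x \<alpha>))" by (simp add: field_simps)
 also have "\<dots> = ?pol I + ?pol H" unfolding IH by (simp add: algebra_simps)
 finally have eq: "ip (E G u) v = ?pol I + ?pol H" .
 show "integrable lborel g1" "g2 summable_on P0" "ip (E G u) v = integral\<^sup>L lborel g1 + infsum g2 P0"
  using B1 B2 eq by (auto simp: has_bochner_integral_iff has_sum_imp_summable infsumI)
qed

end

end

theorem theorem5p8:
  fixes q r c d :: real
  assumes "0 < q" and "q < 1" and "r < 0" and "0 < c" and "c \<le> q\<^sup>2"
    and "d \<noteq> 0" and "\<bar>d\<bar> < 1" and "\<bar>c / d\<bar> < 1"
    and simple_zeros:
      "\<And>y. y \<noteq> 0 \<Longrightarrow> isolated_zero (c_fun q r c d) y \<Longrightarrow> zorder (c_fun q r c d) y = 1"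
    and no_opposite_zeros:
      "\<And>y. y \<noteq> 0 \<Longrightarrow> isolated_zero (c_fun q r c d) y \<Longrightarrow> c_fun q r c d (inverse y) \<noteq> 0"
  shows "essentially_self_adjoint (L_graph q r c d) \<and>
    (\<forall>E. is_spectral_measure E (op_closure (L_graph q r c d)) \<longrightarrow>
      (\<forall>A\<in>sets borel. \<forall>u\<in>finseq. \<forall>v\<in>finseq.
        (let F = F_transform q r c d;
             cc = c_fun q r c d;
             S = {\<theta>. 0 \<le> \<theta> \<and> \<theta> \<le> pi \<and> cos \<theta> \<in> A};
             g = (\<lambda>\<theta>. F u (of_real (cos \<theta>)) * cnj (F v (of_real (cos \<theta>)))
                        / of_real ((cmod (cc (exp (\<i> * of_real \<theta>))))\<^sup>2));
             y = (\<lambda>p. q powi p / (d * r));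
             P = {p::int. \<bar>y p\<bar> > 1 \<and> mu (y p) \<in> A};
             h = (\<lambda>p. residue (\<lambda>z. 1 / (cc (inverse z) * cc z * z)) (of_real (y p))
                        * F u (of_real (mu (y p))) * cnj (F v (of_real (mu (y p)))))
         in set_integrable lborel S g \<and> h summable_on P \<and>
            ip (E A u) v = 1 / (2 * of_real pi) * (LINT \<theta>:S|lborel. g \<theta>) + (\<Sum>\<^sub>\<infinity>p\<in>P. h p))))"
proof (intro conjI allI impI ballI)
 interpret jacobi_fun q r c d using assms by unfold_locales auto
 show "essentially_self_adjoint (L_graph q r c d)" unfolding essentially_self_adjoint_def by (rule self_adjoint_closure_L)
 fix E and A :: "real set" and u v assume E: "is_spectral_measure E (op_closure (L_graph q r c d))"
  and A: "A \<in> sets borel" and u: "u \<in> finseq" and v: "v \<in> finseq"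
 interpret jacobi_spectral q r c d E using E by unfold_locales
 define G where "G = {\<theta>. 0 \<le> \<theta> \<and> \<theta> \<le> pi \<and> cos \<theta> \<in> A}"
 define g where "g = (\<lambda>\<theta>. FF u (of_real (cos \<theta>)) * cnj (FF v (of_real (cos \<theta>)))
            / of_real ((cmod (cc (exp (\<i> * of_real \<theta>))))^2))"
 define PA where "PA = {p::int. \<bar>q powi p / (d * r)\<bar> > 1 \<and> mu (q powi p / (d * r)) \<in> A}"
 define h where "h = (\<lambda>p. residue (\<lambda>z. 1 / (cc (inverse z) * cc z * z)) (of_real (q powi p / (d * r)))
            * FF u (of_real (mu (q powi p / (d * r)))) * cnj (FF v (of_real (mu (q powi p / (d * r))))))"
 define g1 where "g1 = (\<lambda>\<theta>. of_real (\<kappa> \<theta> * indicator A (cos \<theta>)) * (FF u (of_real (cos \<theta>)) * cnj (FF v (of_real (cos \<theta>)))))"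
 define g2 where "g2 = (\<lambda>p. of_real (indicator A (mu (yp p)) * mass p) * (FF u (of_real (mu (yp p))) * cnj (FF v (of_real (mu (yp p))))))"
 note dec = ip_E_decomp[OF no_opposite_zeros u v A, folded g1_def g2_def]
 have gg: "indicator G \<theta> *\<^sub>R g \<theta> = 2 * of_real pi * g1 \<theta>" for \<theta>
 proof -
  \<comment> \<open>At the end points \<open>\<theta> = 0\<close> and \<open>\<theta> = pi\<close>
    the value of \<open>c_fun\<close> is 0 by division by zero, so \<open>g\<close> is 0 there for
    the same reason, in agreement with \<open>\<kappa>\<close>.\<close>
  have cc1: "cc 1 = 0" "cc (-1) = 0" using qpoch_inf_eq_0_iff[of 1] by (auto simp: c_fun_def qpochs_inf_def intro!: exI[of _ "0::nat"])
  consider "\<theta> \<in> {0<..<pi}" | "\<theta> = 0 \<or> \<theta> = pi" | "\<theta> \<notin> {0..pi}" by fastforce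
  then show ?thesis
  proof cases
   case 1
   then show ?thesis by (auto simp: G_def g_def g1_def \<kappa>_def indicator_def cis_conv_exp[symmetric])
  next
   case 2
   then have "cc (cis \<theta>) = 0" using cc1 by auto
   then show ?thesis by (simp add: g_def g1_def \<kappa>_def cis_conv_exp[symmetric])
  next
   case 3
   then show ?thesis by (auto simp: G_def g1_def \<kappa>_def indicator_def)
  qed
 qed
 have "set_integrable lborel G g" unfolding set_integrable_def gg by (intro integrable_mult_right dec(1))
 moreover have lint: "1 / (2 * of_real pi) * (LINT \<theta>:G|lborel. g \<theta>) = integral\<^sup>L lborel g1"
  unfolding set_lebesgue_integral_def gg by simp
 have hg: "h p = g2 p" if "p \<in> PA" for p
  using that residue_mass(1)[OF no_opposite_zeros, of p] by (simp add: h_def g2_def PA_def P0_def yp_def mult_ac)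
 have PAP: "PA \<subseteq> P0" "\<And>p. p \<in> P0 - PA \<Longrightarrow> g2 p = 0" by (auto simp: PA_def P0_def yp_def g2_def)
 \<comment> \<open>The decomposition sums over all eigenvalues with the indicator of
   \<open>A\<close> in the term; the claim restricts the index set instead.\<close>
 have "h summable_on PA \<longleftrightarrow> g2 summable_on P0" by (rule summable_on_cong_neutral) (use hg PAP in auto)
 moreover have "infsum h PA = infsum g2 P0" by (rule infsum_cong_neutral) (use hg PAP in auto)
 ultimately show "let F = F_transform q r c d;
       cc = c_fun q r c d;
       S = {\<theta>. 0 \<le> \<theta> \<and> \<theta> \<le> pi \<and> cos \<theta> \<in> A};
       g = (\<lambda>\<theta>. F u (of_real (cos \<theta>)) * cnj (F v (of_real (cos \<theta>)))
            / of_real ((cmod (cc (exp (\<i> * of_real \<theta>))))^2));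
       y = (\<lambda>p. q powi p / (d * r));
       P = {p::int. \<bar>y p\<bar> > 1 \<and> mu (y p) \<in> A};
       h = (\<lambda>p. residue (\<lambda>z. 1 / (cc (inverse z) * cc z * z)) (of_real (y p))
            * F u (of_real (mu (y p))) * cnj (F v (of_real (mu (y p)))))
     in set_integrable lborel S g \<and> h summable_on P \<and>
      ip (E A u) v = 1 / (2 * of_real pi) * (LINT \<theta>:S|lborel. g \<theta>) + (\<Sum>\<^sub>\<infinity>p\<in>P. h p)"
  using dec(2,3) lint unfolding Let_def G_def[symmetric] g_def[symmetric] PA_def[symmetric] h_def[symmetric] by simp
qed

end
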